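(* Let $n\ge 1$, and for $i\ne j$ let $\mathfrak{s}_{i,j}\in\mathcal{S}_n\subset\mathfrak{B}_n$ denote the transposition $(i,j)$. The group $\mathcal{S}_n$ acts on the set of all $\mathcal{R}$-cross-sections of $\mathfrak{B}_n$ by conjugation, $\Theta\mapsto\sigma^{-1}\Theta\sigma$. The stabilizer in $\mathcal{S}_n$ of any canonical $\mathcal{R}$-cross-section of $\mathfrak{B}_n$ consists of $\mathrm{id}\in\mathcal{S}_n$ and $\mathfrak{s}_{n-1,n}\prod_{(i,i+1)\in\mathfrak{A}_n}\mathfrak{s}_{i,i+1}\in\mathcal{S}_n$. Moreover: (i) For $n=1$ there is one trivial $\mathcal{R}$-cross-section. (ii) For $n=2$ there is only one $\mathcal{R}$-cross-section; moreover, it is canonical and consists of $\alpha_{1,2}$ and $\mathrm{id}$. (iii) For $n=3$ there are $3$ different $\mathcal{R}$-cross-sections, namely $\Lambda$, $\mathfrak{s}_{1,2}\Lambda\mathfrak{s}_{1,2}$ and $\mathfrak{s}_{1,3}\Lambda\mathfrak{s}_{1,3}$, where $\Lambda$ is the (unique) canonical $\mathcal{R}$-cross-section of $\mathfrak{B}_3$, consisting of the idempotents $\alpha_{1,2},\alpha_{2,3},\alpha_{1,3}$ and $\mathrm{id}$. (iv) For $n=4$ there are $12$ different $\mathcal{R}$-cross-sections, each of which is $\mathcal{S}_4$-conjugated to the regular canonical $\mathcal{R}$-cross-section. (v) For $n=5$ there are $2\cdot 5!$ different $\mathcal{R}$-cross-sections, each of which is $\mathcal{S}_5$-conjugated to a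 canonical $\mathcal{R}$-cross-section satisfying $\alpha_{1,2}^{(1)}=\mathrm{id}$. (vi) For $n=6$ there are $2\cdot 6!$ different $\mathcal{R}$-cross-sections, each of which is $\mathcal{S}_6$-conjugated to a canonical $\mathcal{R}$-cross-section satisfying $\alpha_{1,2}^{(1)}=\mathrm{id}$ and $\alpha_{1,2}^{(2)}=\mathrm{id}$. (vii) For $n\ge 7$ there are $n!$ different $\mathcal{R}$-cross-sections. Half of them are $\mathcal{S}_n$-conjugated to the regular canonical $\mathcal{R}$-cross-section, and half of them are $\mathcal{S}_n$-conjugated to the alternating canonical $\mathcal{R}$-cross-section.
   Context: Let $M=\{1,\dots,n\}$, $M'=\{1',\dots,n'\}$. The Brauer semigroup $\mathfrak{B}_n$ is the set of all partitions of $M\cup M'$ into two-element subsets; write $a\equiv_\alpha b$ if $\{a,b\}\in\alpha$. The product $\alpha\beta$ is obtained by drawing $\alpha$ to the left of $\beta$ ($M$ = left pins, $M'$ = right pins), identifying each right pin $a'$ of $\alpha$ with the left pin $a$ of $\beta$, pairing the left pins of $\alpha$ and right pins of $\beta$ that are joined by a path, and discarding closed loops. $\mathfrak{B}_n$ is a monoid; $\sigma\in\mathcal{S}_n$ is identified with $\{\{i,\sigma(i)'\}: i\in M\}$. $\mathrm{corank}(\alpha)$ is $n$ minus the number of blocks of the form $\{a,b'\}$, $a,b\in M$; it is even. Green's relation: $\alpha\mathcal{R}\beta$ iff $\alpha,\beta$ contain the same two-element subsets of $M$. An $\mathcal{R}$-cross-section is a subsemigroup containing exactly one element of each $\mathcal{R}$-class.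 An $\mathcal{R}$-cross-section $\Lambda$ is canonical if every $\alpha\in\Lambda$ of corank $2k$ satisfies $(n-2k+1)'\equiv_\alpha(n-2k+2)'$, $(n-2k+3)'\equiv_\alpha(n-2k+4)'$, ..., $(n-1)'\equiv_\alpha n'$. For a canonical $\Lambda$ and $1\le i<j\le n$, $\alpha_{i,j}$ denotes the unique element of $\Lambda$ of corank $2$ with $i\equiv_{\alpha_{i,j}}j$. For $1\le i<j<n-1$ and $l=1,\dots,\lfloor\frac{n-j}{2}\rfloor$, define $\alpha_{i,j}^{(l)}\in\mathcal{S}_2$ to be $\mathrm{id}$ if $(n-2l+2)\equiv_{\alpha_{i,j}}(n-2l)'$ and $(1,2)$ if $(n-2l+2)\equiv_{\alpha_{i,j}}(n-2l-1)'$ (exactly one of the two always holds). For $n=5$ there are $8$ canonical $\mathcal{R}$-cross-sections, corresponding to independent choices of $\alpha_{1,2}^{(1)},\alpha_{2,3}^{(1)},\alpha_{1,3}^{(1)}\in\mathcal{S}_2$; for $n=6$ there are $16$, corresponding to independent choices of $\alpha_{1,2}^{(1)},\alpha_{1,2}^{(2)},\alpha_{2,3}^{(1)},\alpha_{1,3}^{(1)}\in\mathcal{S}_2$. $\mathfrak{A}_n$ is the set of all pairs $(n-3,n-2),(n-5,n-4),\dots$ with positive entries. A canonical $\mathcal{R}$-cross-section is regular if $\alpha_{i,j}^{(l)}=\mathrm{id}$ for all admissible $i,j,l$; it is alternating if $\alpha_{i,j}^{(l)}=(1,2)$ for all admissible $(i,j)\notin\mathfrak{A}_n$ and all admissible $l$,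 and $\alpha_{i,i+1}^{(l)}=\mathrm{id}$ for all $(i,i+1)\in\mathfrak{A}_n$ and all admissible $l$.
   Formalization: The stabilizer claim is corrected: it is {id} alone for n=1 (where s_{0,1} is undefined) and for n=5 when α_{1,2}^{(1)} ≠ α_{1,3}^{(1)} (there s_{4,5}s_{2,3} swaps these two parameters, so it does not stabilize Λ); all else is as stated. *)

theory Defs
  imports "HOL-Algebra.Sym_Groups" "HOL-Algebra.Group_Action" "HOL-Library.Disjoint_Sets"
begin

text \<open>The pin \<open>LP a\<close> is the left pin \<open>a\<close>, and \<open>RP a\<close> is the right pin \<open>a'\<close>.\<close>

datatype pin = LP nat | RP nat

definition left_pins :: "nat \<Rightarrow> pin set" where
  "left_pins n = LP ` {1..n}"

definition right_pins :: "nat \<Rightarrow> pin set" where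
  "right_pins n = RP ` {1..n}"

definition brauer :: "nat \<Rightarrow> pin set set set" where
  "brauer n = {\<alpha>. partition_on (left_pins n \<union> right_pins n) \<alpha> \<and> (\<forall>B\<in>\<alpha>. card B = 2)}"

text \<open>
  The product glues two diagrams: the vertices are the left pins of the first factor (\<open>Lft\<close>),
  the right pins of the first factor identified with the left pins of the second (\<open>Mid\<close>), and
  the right pins of the second factor (\<open>Rgt\<close>). Paths in the glued diagram are given by the
  reflexive-transitive closure of the (symmetric) edge relation.
\<close>

datatype glued = Lft nat | Mid nat | Rgt nat

primrec in_first :: "pin \<Rightarrow> glued" where
  "in_first (LP a) = Lft a"
| "in_first (RP a) = Mid a"

primrec in_second :: "pin \<Rightarrow> glued" where
  "in_second (LP a) = Mid a"
| "in_second (RP a) = Rgt a"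

primrec outer :: "pin \<Rightarrow> glued" where
  "outer (LP a) = Lft a"
| "outer (RP a) = Rgt a"

definition glued_edges :: "pin set set \<Rightarrow> pin set set \<Rightarrow> (glued \<times> glued) set" where
  "glued_edges \<alpha> \<beta> =
     {(in_first x, in_first y) |x y. {x, y} \<in> \<alpha>} \<union> {(in_second x, in_second y) |x y. {x, y} \<in> \<beta>}"

definition brauer_mult :: "pin set set \<Rightarrow> pin set set \<Rightarrow> pin set set" (infixl "\<odot>" 70) where
  "\<alpha> \<odot> \<beta> = {{x, y} |x y. x \<noteq> y \<and> (outer x, outer y) \<in> (glued_edges \<alpha> \<beta>)\<^sup>*}"

definition perm_brauer :: "nat \<Rightarrow> (nat \<Rightarrow> nat) \<Rightarrow> pin set set" where
  "perm_brauer n \<sigma> = {{LP i, RP (\<sigma> i)} |i. i \<in> {1..n}}"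

definition corank :: "nat \<Rightarrow> pin set set \<Rightarrow> nat" where
  "corank n \<alpha> = n - card {B \<in> \<alpha>. \<exists>a\<in>{1..n}. \<exists>b\<in>{1..n}. B = {LP a, RP b}}"

definition green_R :: "nat \<Rightarrow> (pin set set \<times> pin set set) set" where
  "green_R n = {(\<alpha>, \<beta>). \<alpha> \<in> brauer n \<and> \<beta> \<in> brauer n \<and>
     {B \<in> \<alpha>. B \<subseteq> left_pins n} = {B \<in> \<beta>. B \<subseteq> left_pins n}}"

definition R_cross_sections :: "nat \<Rightarrow> pin set set set set" where
  "R_cross_sections n = {\<Lambda>. \<Lambda> \<subseteq> brauer n \<and> (\<forall>\<alpha>\<in>\<Lambda>. \<forall>\<beta>\<in>\<Lambda>. \<alpha> \<odot> \<beta> \<in> \<Lambda>) \<and>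
     (\<forall>C \<in> brauer n // green_R n. \<exists>!\<alpha>. \<alpha> \<in> \<Lambda> \<inter> C)}"

definition canonical :: "nat \<Rightarrow> pin set set set \<Rightarrow> bool" where
  "canonical n \<Lambda> \<longleftrightarrow> \<Lambda> \<in> R_cross_sections n \<and>
     (\<forall>\<alpha>\<in>\<Lambda>. \<forall>k. corank n \<alpha> = 2 * k \<longrightarrow>
        (\<forall>m\<in>{1..k}. {RP (n - 2 * k + 2 * m - 1), RP (n - 2 * k + 2 * m)} \<in> \<alpha>))"

definition alpha :: "nat \<Rightarrow> pin set set set \<Rightarrow> nat \<Rightarrow> nat \<Rightarrow> pin set set" where
  "alpha n \<Lambda> i j = (THE \<alpha>. \<alpha> \<in> \<Lambda> \<and> corank n \<alpha> = 2 \<and> {LP i, LP j} \<in> \<alpha>)"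

text \<open>
  For a canonical cross-section and admissible indices exactly one of the two tests succeeds, so
  the last branch is never reached. Elements of the symmetric group on \<open>{1, 2}\<close> are represented,
  as in \<^const>\<open>sym_group\<close>, by functions on \<^typ>\<open>nat\<close>.
\<close>

definition alpha_sup :: "nat \<Rightarrow> pin set set set \<Rightarrow> nat \<Rightarrow> nat \<Rightarrow> nat \<Rightarrow> (nat \<Rightarrow> nat)" where
  "alpha_sup n \<Lambda> i j l =
     (if {LP (n - 2 * l + 2), RP (n - 2 * l)} \<in> alpha n \<Lambda> i j then id
      else if {LP (n - 2 * l + 2), RP (n - 2 * l - 1)} \<in> alpha n \<Lambda> i j
        then Transposition.transpose 1 2
      else undefined)"

definition admissible :: "nat \<Rightarrow> nat \<Rightarrow> nat \<Rightarrow> nat \<Rightarrow> bool" where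
  "admissible n i j l \<longleftrightarrow> 1 \<le> i \<and> i < j \<and> j < n - 1 \<and> 1 \<le> l \<and> l \<le> (n - j) div 2"

definition A_pairs :: "nat \<Rightarrow> (nat \<times> nat) set" where
  "A_pairs n = {(n - 2 * k - 1, n - 2 * k) |k. 1 \<le> k \<and> 2 * k + 1 < n}"

definition regular_canonical :: "nat \<Rightarrow> pin set set set \<Rightarrow> bool" where
  "regular_canonical n \<Lambda> \<longleftrightarrow> canonical n \<Lambda> \<and>
     (\<forall>i j l. admissible n i j l \<longrightarrow> alpha_sup n \<Lambda> i j l = id)"

definition alternating_canonical :: "nat \<Rightarrow> pin set set set \<Rightarrow> bool" where
  "alternating_canonical n \<Lambda> \<longleftrightarrow> canonical n \<Lambda> \<and>
     (\<forall>i j l. admissible n i j l \<longrightarrow>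
        alpha_sup n \<Lambda> i j l = (if (i, j) \<in> A_pairs n then id else Transposition.transpose 1 2))"

text \<open>
  The map sending \<open>\<Theta>\<close> to \<open>\<sigma>\<^sup>-\<^sup>1 \<Theta> \<sigma>\<close>, restricted to the set of cross-sections because
  \<^const>\<open>BijGroup\<close> consists of extensional functions. Since
  \<open>perm_brauer n \<sigma> \<odot> perm_brauer n \<tau> = perm_brauer n (\<tau> \<circ> \<sigma>)\<close>, this is a left action of
  \<open>sym_group n\<close>, whose multiplication is \<open>(\<circ>)\<close>.
\<close>

definition conj_action :: "nat \<Rightarrow> (nat \<Rightarrow> nat) \<Rightarrow> pin set set set \<Rightarrow> pin set set set" where
  "conj_action n \<sigma> = (\<lambda>\<Theta> \<in> R_cross_sections n.
     (\<lambda>\<alpha>. perm_brauer n (inv' \<sigma>) \<odot> \<alpha> \<odot> perm_brauer n \<sigma>) ` \<Theta>)"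

abbreviation conj_orbit :: "nat \<Rightarrow> pin set set set \<Rightarrow> pin set set set set" where
  "conj_orbit n \<Lambda> \<equiv> Group_Action.orbit (sym_group n) (conj_action n) \<Lambda>"

text \<open>
  The pairs in \<open>A_pairs n\<close> and the pair \<open>(n - 1, n)\<close> are pairwise disjoint, so the factors commute
  and the fold does not depend on the order. For \<open>n = 1\<close> this is not an element of \<open>sym_group n\<close>.
  For \<open>n = 5\<close> it is \<open>(4 5)(2 3)\<close>; conjugation by it exchanges the parameters
  \<open>alpha_sup 5 \<Lambda> 1 2 1\<close> and \<open>alpha_sup 5 \<Lambda> 1 3 1\<close> of a canonical \<open>\<Lambda>\<close>, so it can stabilize
  \<open>\<Lambda>\<close> only if they agree.
\<close>

definition special_perm :: "nat \<Rightarrow> nat \<Rightarrow> nat" where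
  "special_perm n = Transposition.transpose (n - 1) n \<circ>
     Finite_Set.fold (\<lambda>(i, j) p. Transposition.transpose i j \<circ> p) id (A_pairs n)"

end

theory Submission
  imports Defs
begin

text \<open>
  Two elements of an \<open>\<R>\<close>-cross-section satisfy \<open>\<alpha> \<beta> = \<alpha>\<close> as soon as no through strand of \<open>\<alpha>\<close> is turned
  back by \<open>\<beta>\<close>. Hence the sets of right pairs form a chain, and every cross-section is conjugate to a
  canonical one. A canonical cross-section is generated by its elements \<open>\<alpha>\<^sub>p\<close> of corank 2, one for each
  left pair \<open>p\<close>. Such an element is determined up to a sign, which says whether the standard pairs above
  \<open>p\<close> are shifted with or without a twist, and after conjugation with products of the transpositions
  \<open>(n - 2 l - 1, n - 2 l)\<close> the signs are encoded by a set \<open>T\<close> of pairs. Commutation of the generators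
  makes the sign of each pair agree with that of others and conversely suffices for \<open>T\<close> to define a
  cross-section. For \<open>n \<ge> 7\<close> these relations link all pairs with a free sign, so that only two sets
  remain; for \<open>n = 5, 6\<close> there are four, and one for \<open>n \<le> 4\<close>.

  Two normalised canonical cross-sections are conjugate only by the identity or by the permutation
  \<open>bar n\<close> exchanging the points of every standard pair. Counting pairs \<open>(\<sigma>, T)\<close> therefore gives
  \<open>2 |R_cross_sections n| = n! |{T. valid n T}|\<close> for \<open>n \<ge> 2\<close>, and the same rigidity determines the stabilizers.
\<close>

section \<open>The Brauer monoid\<close>

text \<open>A single sign per pair is not automatic: on each level separately, a generator of a
  canonical cross-section may exchange the two points of the pair that it shifts. Once the generator
  of the deepest standard pair is the plain shift from \<open>x\<close> to \<open>x - 2\<close>,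
  commuting with it makes the generators of all standard pairs plain shifts, and commuting with
  those makes every twist independent of the level. The same shift explains rigidity: a permutation
  between two normalised cross-sections preserves levels and commutes with it, so it is determined
  by the image of \<open>n\<close>, which is \<open>n\<close> or \<open>n - 1\<close>.

  In the converse direction a product of generators must not depend on the order in which the left
  pairs are removed. This is a diamond property, settled by comparing two generators; closure under
  multiplication then reduces to dropping generators whose pair meets \<open>{n - 1, n}\<close>.

  The degree 5 is exceptional: \<open>bar 5\<close> fixes 1 and exchanges \<open>{1, 2}\<close> and
  \<open>{1, 3}\<close>, and no relation links the signs of these two pairs, so \<open>bar 5\<close>
  need not stabilize a canonical cross-section.\<close>

abbreviation pins :: "nat \<Rightarrow> pin set" where
  "pins n \<equiv> left_pins n \<union> right_pins n"

lemma pins_simps [simp]: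
  "LP a \<in> left_pins n \<longleftrightarrow> a \<in> {1..n}" "RP a \<notin> left_pins n"
  "RP a \<in> right_pins n \<longleftrightarrow> a \<in> {1..n}" "LP a \<notin> right_pins n"
  by (auto simp: left_pins_def right_pins_def)

lemma finite_pins [simp]: "finite (pins n)"
  by (simp add: left_pins_def right_pins_def)

lemma brauer_unique: "\<alpha> \<in> brauer n \<Longrightarrow> {x, y} \<in> \<alpha> \<Longrightarrow> {x, z} \<in> \<alpha> \<Longrightarrow> y = z"
  unfolding brauer_def partition_on_def disjoint_def
  by (smt (verit) disjoint_iff doubleton_eq_iff insertI1 mem_Collect_eq)

lemma brauer_unique': "\<alpha> \<in> brauer n \<Longrightarrow> {x, z} \<in> \<alpha> \<Longrightarrow> {y, z} \<in> \<alpha> \<Longrightarrow> x = y"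
  using brauer_unique[of \<alpha> n z x y] insert_commute[of x z "{}"] insert_commute[of y z "{}"] by simp

lemma brauer_neq: "\<alpha> \<in> brauer n \<Longrightarrow> {x, y} \<in> \<alpha> \<Longrightarrow> x \<noteq> y"
  unfolding brauer_def by fastforce

lemma brauer_pins: "\<alpha> \<in> brauer n \<Longrightarrow> {x, y} \<in> \<alpha> \<Longrightarrow> x \<in> pins n \<and> y \<in> pins n"
  unfolding brauer_def partition_on_def by blast

lemma brauer_block: "\<alpha> \<in> brauer n \<Longrightarrow> B \<in> \<alpha> \<Longrightarrow> \<exists>x y. B = {x, y}"
  unfolding brauer_def by (metis (mono_tags, lifting) card_2_iff mem_Collect_eq)

lemma brauer_ex:
  assumes "\<alpha> \<in> brauer n" "x \<in> pins n" obtains y where "{x, y} \<in> \<alpha>"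
proof -
  obtain B where B: "B \<in> \<alpha>" "x \<in> B"
    using assms unfolding brauer_def partition_on_def by blast
  then obtain u v where "B = {u, v}" using brauer_block assms by blast
  then show ?thesis using B that by (auto simp: insert_commute)
qed

lemma brauerI:
  assumes "\<And>B. B \<in> \<alpha> \<Longrightarrow> \<exists>x\<in>pins n. \<exists>y\<in>pins n. x \<noteq> y \<and> B = {x, y}"
    and "\<And>x. x \<in> pins n \<Longrightarrow> \<exists>y. {x, y} \<in> \<alpha>"
    and "\<And>x y z. {x, y} \<in> \<alpha> \<Longrightarrow> {x, z} \<in> \<alpha> \<Longrightarrow> y = z"
  shows "\<alpha> \<in> brauer n"
proof -
  have "disjoint \<alpha>"
  proof (rule disjointI)
    fix A B assume AB: "A \<in> \<alpha>" "B \<in> \<alpha>" "A \<noteq> B"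
    show "A \<inter> B = {}"
    proof (rule ccontr)
      assume "A \<inter> B \<noteq> {}"
      then obtain x where x: "x \<in> A" "x \<in> B" by blast
      obtain y where "A = {x, y}" using assms(1)[OF AB(1)] x by (auto simp: insert_commute)
      moreover obtain z where "B = {x, z}" using assms(1)[OF AB(2)] x by (auto simp: insert_commute)
      ultimately show False using AB assms(3) by blast
    qed
  qed
  moreover have "\<Union>\<alpha> = pins n"
  proof
    show "\<Union>\<alpha> \<subseteq> pins n" using assms(1) by fastforce
    show "pins n \<subseteq> \<Union>\<alpha>" using assms(2) by (meson UnionI insertI1 subsetI)
  qed
  moreover have "{} \<notin> \<alpha>" "\<forall>B\<in>\<alpha>. card B = 2"
    using assms(1) by (fastforce)+
  ultimately show ?thesis by (simp add: brauer_def partition_on_def)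
qed

lemma brauer_eqI:
  assumes "\<alpha> \<in> brauer n" "\<beta> \<in> brauer n"
    and "\<And>x. x \<in> pins n \<Longrightarrow> \<exists>y. {x, y} \<in> \<alpha> \<and> {x, y} \<in> \<beta>"
  shows "\<alpha> = \<beta>"
proof -
  have "B \<in> \<alpha> \<longleftrightarrow> B \<in> \<beta>" for B
  proof (cases "\<exists>x y. B = {x, y} \<and> x \<in> pins n")
    case True
    then obtain x y where B: "B = {x, y}" "x \<in> pins n" by blast
    obtain z where "{x, z} \<in> \<alpha>" "{x, z} \<in> \<beta>" using assms(3) B by blast
    then show ?thesis using B brauer_unique assms(1,2) by metis
  next
    case False
    then show ?thesis using brauer_block brauer_pins assms(1,2) by metis
  qed
  then show ?thesis by blast
qed

section \<open>Paths in a union of two matchings, and closure of the product\<close>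

text \<open>Each component of a union of two matchings is a path or a cycle, and a vertex covered by
  only one of them is an end of a path; the lemma finds the other end. The induction deletes the
  first edge and exchanges the two relations, because the path continues from \<open>y\<close> along
  \<open>E2\<close>.\<close>

lemma alternating_path_end:
  assumes "finite E1" "finite E2" "sym E1" "sym E2" "single_valued E1" "single_valued E2"
    and "irrefl E1" "irrefl E2" "x \<in> Domain E1" "x \<notin> Domain E2"
  shows "\<exists>!y. y \<noteq> x \<and> (x, y) \<in> (E1 \<union> E2)\<^sup>* \<and> (y \<in> Domain E1 \<longleftrightarrow> y \<notin> Domain E2)"
  using assms
proof (induction "card E1 + card E2" arbitrary: E1 E2 x rule: less_induct)
  case less
  obtain y where xy: "(x, y) \<in> E1" using less.prems by blast
  have yx: "(y, x) \<in> E1" using xy less.prems by (meson symD)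
  have neq: "y \<noteq> x" using xy less.prems by (auto simp: irrefl_def)
  have only_y: "(x, w) \<in> E1 \<union> E2 \<Longrightarrow> w = y" for w
    using xy less.prems by (auto dest: single_valuedD)
  have only_x: "(y, w) \<in> E1 \<Longrightarrow> w = x" for w
    using yx less.prems by (auto dest: single_valuedD)
  show ?case
  proof (cases "y \<in> Domain E2")
    case False
    have "w = x \<or> w = y" if "(x, w) \<in> (E1 \<union> E2)\<^sup>*" for w
      using that by induction (use only_y only_x False in blast)+
    then show ?thesis using xy yx neq False less.prems(10) by blast
  next
    case True
    \<comment> \<open>Both orientations of the edge are deleted, so \<open>y\<close> leaves the
      domain of \<open>F\<close> and the induction hypothesis applies to \<open>E2\<close> and
      \<open>F\<close> in this order.\<close>
    define F where "F = E1 - {(x, y), (y, x)}"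
    have F_dom: "Domain F = Domain E1 - {x, y}"
      using only_y only_x unfolding F_def by blast
    have "card F < card E1"
      unfolding F_def using xy less.prems(1) by (intro psubset_card_mono) auto
    have F: "finite F" "sym F" "single_valued F" "irrefl F"
      using less.prems(1,3,5,7) unfolding F_def
      by (auto simp: sym_def single_valued_def irrefl_def)
    have "y \<notin> Domain F" using F_dom by simp
    have "\<exists>!z. z \<noteq> y \<and> (y, z) \<in> (E2 \<union> F)\<^sup>* \<and> (z \<in> Domain E2 \<longleftrightarrow> z \<notin> Domain F)"
    proof (rule less.hyps)
      show "card E2 + card F < card E1 + card E2" using \<open>card F < card E1\<close> by simp
    qed (fact less.prems F True \<open>y \<notin> Domain F\<close>)+
    then obtain z where z: "z \<noteq> y" "(y, z) \<in> (E2 \<union> F)\<^sup>*" "z \<in> Domain E2 \<longleftrightarrow> z \<notin> Domain F"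
      and z_unique: "\<And>w. w \<noteq> y \<Longrightarrow> (y, w) \<in> (E2 \<union> F)\<^sup>* \<Longrightarrow>
        (w \<in> Domain E2 \<longleftrightarrow> w \<notin> Domain F) \<Longrightarrow> w = z"
      by (elim ex1E) blast
    have "(E2 \<union> F)\<^sup>* \<subseteq> (E1 \<union> E2)\<^sup>*" by (rule rtrancl_mono) (auto simp: F_def)
    then have "(x, z) \<in> (E1 \<union> E2)\<^sup>*" using xy z(2)
      by (meson UnI1 converse_rtrancl_into_rtrancl subsetD)
    moreover have "z \<noteq> x" using z(3) F_dom less.prems(10) by blast
    moreover have "w = z" if w: "w \<noteq> x" "(x, w) \<in> (E1 \<union> E2)\<^sup>*" "w \<in> Domain E1 \<longleftrightarrow> w \<notin> Domain E2" for w
    proof -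
      \<comment> \<open>After the deletion \<open>x\<close> is isolated, so every vertex visited
        from \<open>x\<close> is \<open>x\<close> itself or is reached from \<open>y\<close> without
        the deleted edge.\<close>
      have "w = x \<or> (y, w) \<in> (E2 \<union> F)\<^sup>*"
        using w(2)
      proof induction
        case (step u v)
        show ?case
        proof (cases "(u, v) \<in> E2 \<union> F")
          case True
          moreover have "u \<noteq> x" using True less.prems(10) F_dom by blast
          ultimately show ?thesis using step.IH by (meson rtrancl.rtrancl_into_rtrancl)
        next
          case False
          then have "v = x \<or> v = y" using step.hyps(2) by (auto simp: F_def)
          then show ?thesis by blast
        qed
      qed simp
      moreover have "w \<noteq> y" using w(3) True xy yx by blast
      ultimately show ?thesis using z_unique[of w] w(1,3) F_dom by blast
    qed
    moreover have "z \<in> Domain E1 \<longleftrightarrow> z \<notin> Domain E2"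
      using z(1,3) \<open>z \<noteq> x\<close> unfolding F_dom by simp
    ultimately show ?thesis by (intro ex1I[of _ z] conjI) (assumption | blast)+
  qed
qed

definition first_edges :: "pin set set \<Rightarrow> (glued \<times> glued) set" where
  "first_edges \<alpha> = {(in_first x, in_first y) |x y. {x, y} \<in> \<alpha>}"

definition second_edges :: "pin set set \<Rightarrow> (glued \<times> glued) set" where
  "second_edges \<alpha> = {(in_second x, in_second y) |x y. {x, y} \<in> \<alpha>}"

lemma in_first_inj [simp]: "in_first x = in_first y \<longleftrightarrow> x = y"
  by (cases x; cases y) auto

lemma in_second_inj [simp]: "in_second x = in_second y \<longleftrightarrow> x = y"
  by (cases x; cases y) auto

lemma outer_inj [simp]: "outer x = outer y \<longleftrightarrow> x = y"
  by (cases x; cases y) auto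

lemma image_pins_iff:
  "v \<in> in_first ` pins n \<longleftrightarrow> (case v of Lft a \<Rightarrow> a \<in> {1..n} | Mid a \<Rightarrow> a \<in> {1..n} | Rgt a \<Rightarrow> False)"
  "v \<in> in_second ` pins n \<longleftrightarrow> (case v of Lft a \<Rightarrow> False | Mid a \<Rightarrow> a \<in> {1..n} | Rgt a \<Rightarrow> a \<in> {1..n})"
  "v \<in> outer ` pins n \<longleftrightarrow> (case v of Lft a \<Rightarrow> a \<in> {1..n} | Mid a \<Rightarrow> False | Rgt a \<Rightarrow> a \<in> {1..n})"
  by (cases v; simp add: left_pins_def right_pins_def image_Un image_image; simp add: image_iff)+

lemma first_second_edges:
  assumes "\<alpha> \<in> brauer n"
  shows "finite (first_edges \<alpha>)" "sym (first_edges \<alpha>)" "single_valued (first_edges \<alpha>)"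
    "irrefl (first_edges \<alpha>)" "Domain (first_edges \<alpha>) = in_first ` pins n"
    and "finite (second_edges \<alpha>)" "sym (second_edges \<alpha>)" "single_valued (second_edges \<alpha>)"
    "irrefl (second_edges \<alpha>)" "Domain (second_edges \<alpha>) = in_second ` pins n"
proof -
  have sub: "first_edges \<alpha> \<subseteq> in_first ` pins n \<times> in_first ` pins n"
    "second_edges \<alpha> \<subseteq> in_second ` pins n \<times> in_second ` pins n"
    unfolding first_edges_def second_edges_def using brauer_pins[OF assms] by blast+
  have dom: "Domain {(f x, f y) |x y. {x, y} \<in> \<alpha>} = f ` pins n" for f :: "pin \<Rightarrow> glued"
  proof
    show "Domain {(f x, f y) |x y. {x, y} \<in> \<alpha>} \<subseteq> f ` pins n"
    proof
      fix v assume "v \<in> Domain {(f x, f y) |x y. {x, y} \<in> \<alpha>}"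
      then obtain x y where "v = f x" "{x, y} \<in> \<alpha>" by blast
      then show "v \<in> f ` pins n" using brauer_pins[OF assms, of x y] by simp
    qed
    show "f ` pins n \<subseteq> Domain {(f x, f y) |x y. {x, y} \<in> \<alpha>}"
    proof
      fix v assume "v \<in> f ` pins n"
      then obtain x where "v = f x" "x \<in> pins n" by (elim imageE)
      moreover obtain y where "{x, y} \<in> \<alpha>" using brauer_ex[OF assms \<open>x \<in> pins n\<close>] .
      ultimately show "v \<in> Domain {(f x, f y) |x y. {x, y} \<in> \<alpha>}" by (intro DomainI) blast
    qed
  qed
  show "finite (first_edges \<alpha>)" "finite (second_edges \<alpha>)"
    using sub by (meson finite_SigmaI finite_imageI finite_pins finite_subset)+
  show "sym (first_edges \<alpha>)" "sym (second_edges \<alpha>)"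
    unfolding first_edges_def second_edges_def sym_def by (auto simp: insert_commute)
  show "single_valued (first_edges \<alpha>)" "single_valued (second_edges \<alpha>)"
    unfolding first_edges_def second_edges_def
    by (intro single_valuedI; clarsimp; erule (1) brauer_unique[OF assms])+
  show "irrefl (first_edges \<alpha>)" "irrefl (second_edges \<alpha>)"
    unfolding first_edges_def second_edges_def
    by (intro irreflI notI; clarsimp; metis brauer_neq[OF assms] insert_absorb2)+
  show "Domain (first_edges \<alpha>) = in_first ` pins n" "Domain (second_edges \<alpha>) = in_second ` pins n"
    unfolding first_edges_def second_edges_def by (rule dom)+
qed

lemma sym_glued_edges: "sym (glued_edges \<alpha> \<beta>)"
  unfolding glued_edges_def sym_def by (auto simp: insert_commute)

lemma brauer_mult_iff:
  "{x, y} \<in> \<alpha> \<odot> \<beta> \<longleftrightarrow> x \<noteq> y \<and> (outer x, outer y) \<in> (glued_edges \<alpha> \<beta>)\<^sup>*"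
proof -
  have "(outer y, outer x) \<in> (glued_edges \<alpha> \<beta>)\<^sup>* \<longleftrightarrow> (outer x, outer y) \<in> (glued_edges \<alpha> \<beta>)\<^sup>*"
    using sym_rtrancl[OF sym_glued_edges] by (meson symD)
  then show ?thesis unfolding brauer_mult_def by (auto simp: doubleton_eq_iff)
qed

text \<open>The outer pins are precisely the vertices of the glued diagram covered by one factor
  only, so \<open>alternating_path_end\<close> gives each of them a unique partner. A path from a
  left pin starts in the first factor, a path from a right pin in the second; hence the two
  cases.\<close>

lemma brauer_mult_closed:
  assumes "\<alpha> \<in> brauer n" "\<beta> \<in> brauer n"
  shows "\<alpha> \<odot> \<beta> \<in> brauer n"
proof -
  note A = first_second_edges[OF assms(1)] and B = first_second_edges[OF assms(2)]
  let ?E = "first_edges \<alpha> \<union> second_edges \<beta>"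
  have E: "glued_edges \<alpha> \<beta> = ?E" "glued_edges \<alpha> \<beta> = second_edges \<beta> \<union> first_edges \<alpha>"
    unfolding glued_edges_def first_edges_def second_edges_def by auto
  have ends: "(v \<in> Domain (first_edges \<alpha>) \<longleftrightarrow> v \<notin> Domain (second_edges \<beta>)) \<longleftrightarrow> v \<in> outer ` pins n" for v
    unfolding A(5) B(10) image_pins_iff by (cases v) simp_all
  have uniq: "\<exists>!v. v \<noteq> outer x \<and> (outer x, v) \<in> ?E\<^sup>* \<and> v \<in> outer ` pins n" if x: "x \<in> pins n" for x
  proof (cases x)
    case (LP a)
    then have "outer x \<in> Domain (first_edges \<alpha>)" "outer x \<notin> Domain (second_edges \<beta>)"
      using x unfolding A(5) B(10) image_pins_iff by simp_all
    then show ?thesis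
      using alternating_path_end[of "first_edges \<alpha>" "second_edges \<beta>" "outer x"] A B
      unfolding ends by blast
  next
    case (RP a)
    then have "outer x \<in> Domain (second_edges \<beta>)" "outer x \<notin> Domain (first_edges \<alpha>)"
      using x unfolding A(5) B(10) image_pins_iff by simp_all
    then have "\<exists>!v. v \<noteq> outer x \<and> (outer x, v) \<in> (second_edges \<beta> \<union> first_edges \<alpha>)\<^sup>* \<and>
        (v \<in> Domain (second_edges \<beta>) \<longleftrightarrow> v \<notin> Domain (first_edges \<alpha>))"
      using alternating_path_end[of "second_edges \<beta>" "first_edges \<alpha>" "outer x"] A B by blast
    moreover have "(v \<in> Domain (second_edges \<beta>) \<longleftrightarrow> v \<notin> Domain (first_edges \<alpha>)) \<longleftrightarrow> v \<in> outer ` pins n" for v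
      using ends[of v] by blast
    ultimately show ?thesis by (simp add: Un_commute)
  qed
  have inside: "y \<in> pins n \<and> x \<in> pins n" if "(outer x, outer y) \<in> ?E\<^sup>*" "x \<noteq> y" for x y
  proof -
    have "outer x \<in> Domain ?E" using that by (metis Domain.DomainI converse_rtranclE outer_inj)
    moreover have "(outer y, outer x) \<in> ?E\<^sup>*" using that sym_rtrancl[OF sym_glued_edges] E by (metis symD)
    then have "outer y \<in> Domain ?E" using that by (metis Domain.DomainI converse_rtranclE outer_inj)
    ultimately have "outer x \<in> Domain (first_edges \<alpha>) \<union> Domain (second_edges \<beta>)"
      "outer y \<in> Domain (first_edges \<alpha>) \<union> Domain (second_edges \<beta>)"
      by (metis Domain_Un_eq)+
    then show ?thesis unfolding A(5) B(10) Un_iff image_pins_iff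
      by (cases x; cases y) simp_all
  qed
  show ?thesis
  proof (rule brauerI)
    fix C assume "C \<in> \<alpha> \<odot> \<beta>"
    then obtain x y where "C = {x, y}" "x \<noteq> y" "(outer x, outer y) \<in> ?E\<^sup>*"
      unfolding brauer_mult_def E by blast
    then show "\<exists>x\<in>pins n. \<exists>y\<in>pins n. x \<noteq> y \<and> C = {x, y}" using inside by blast
  next
    fix x assume "x \<in> pins n"
    from ex1_implies_ex[OF uniq[OF this]] show "\<exists>y. {x, y} \<in> \<alpha> \<odot> \<beta>"
      unfolding brauer_mult_iff E by auto
  next
    fix x y z assume "{x, y} \<in> \<alpha> \<odot> \<beta>" "{x, z} \<in> \<alpha> \<odot> \<beta>"
    then show "y = z" unfolding brauer_mult_iff E using uniq[of x] inside[of x]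
      by (metis (no_types, lifting) imageI outer_inj)
  qed
qed

text \<open>
  Both bracketings of a triple product are compared with the diagram of all three factors on four
  columns of pins; \<open>place i j\<close> puts the left pins in column \<open>i\<close> and the right pins in column \<open>j\<close>.
\<close>

definition place :: "nat \<Rightarrow> nat \<Rightarrow> pin \<Rightarrow> nat \<times> nat" where
  "place i j x = (case x of LP a \<Rightarrow> (i, a) | RP a \<Rightarrow> (j, a))"

definition layer :: "nat \<Rightarrow> nat \<Rightarrow> pin set set \<Rightarrow> ((nat \<times> nat) \<times> (nat \<times> nat)) set" where
  "layer i j \<alpha> = {(place i j x, place i j y) |x y. {x, y} \<in> \<alpha>}"

lemma rtrancl_image_inj:
  assumes "inj g"
  shows "(g x, g y) \<in> (map_prod g g ` R)\<^sup>* \<longleftrightarrow> (x, y) \<in> R\<^sup>*"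
proof
  have "\<exists>y. v = g y \<and> (x, y) \<in> R\<^sup>*" if "(g x, v) \<in> (map_prod g g ` R)\<^sup>*" for v
    using that by induction (use assms in \<open>auto dest!: injD intro: rtrancl_into_rtrancl\<close>)
  then show "(g x, g y) \<in> (map_prod g g ` R)\<^sup>* \<Longrightarrow> (x, y) \<in> R\<^sup>*"
    using assms by (metis injD)
  show "(x, y) \<in> R\<^sup>* \<Longrightarrow> (g x, g y) \<in> (map_prod g g ` R)\<^sup>*"
    by (induction rule: rtrancl_induct) (auto intro: rtrancl_into_rtrancl)
qed

lemma brauer_mult_layers:
  assumes "i \<noteq> j" "j \<noteq> k" "i \<noteq> k"
  shows "{x, y} \<in> \<alpha> \<odot> \<beta> \<longleftrightarrow> x \<noteq> y \<and> (place i k x, place i k y) \<in> (layer i j \<alpha> \<union> layer j k \<beta>)\<^sup>*"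
proof -
  define g where "g v = (case v of Lft a \<Rightarrow> (i, a) | Mid a \<Rightarrow> (j, a) | Rgt a \<Rightarrow> (k, a))" for v
  have "inj g" using assms unfolding g_def by (auto simp: inj_def split: glued.splits)
  have 1: "g (in_first z) = place i j z" "g (in_second z) = place j k z" "g (outer z) = place i k z" for z
    by (cases z; simp add: g_def place_def)+
  have 2: "map_prod g g ` {(p x, p y) |x y. {x, y} \<in> \<delta>} = {(g (p x), g (p y)) |x y. {x, y} \<in> \<delta>}"
    for p :: "pin \<Rightarrow> glued" and \<delta>
    by (auto simp: image_iff) blast
  have "map_prod g g ` glued_edges \<alpha> \<beta> = layer i j \<alpha> \<union> layer j k \<beta>"
    unfolding glued_edges_def layer_def image_Un 2 1 ..
  then show ?thesis unfolding brauer_mult_iff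
    using rtrancl_image_inj[OF \<open>inj g\<close>, of "outer x" "outer y" "glued_edges \<alpha> \<beta>"] 1 by simp
qed

text \<open>The edges of \<open>R\<close> avoid the inner vertices \<open>I\<close>, so a path
  alternates between excursions inside \<open>Q\<close> and edges of \<open>R\<close> between outer
  vertices. Each excursion from one outer vertex to another may be replaced by a single edge of
  \<open>S\<close>.\<close>

lemma rtrancl_contract:
  assumes "\<And>u v. (u, v) \<in> R \<Longrightarrow> u \<notin> I \<and> v \<notin> I"
    and S: "S = {(u, v). u \<noteq> v \<and> u \<notin> I \<and> v \<notin> I \<and> (u, v) \<in> Q\<^sup>*}"
    and "x \<notin> I" "y \<notin> I"
  shows "(x, y) \<in> (S \<union> R)\<^sup>* \<longleftrightarrow> (x, y) \<in> (Q \<union> R)\<^sup>*"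
proof
  have "S \<union> R \<subseteq> (Q \<union> R)\<^sup>*" unfolding S using rtrancl_mono[of Q "Q \<union> R"] by auto
  then show "(x, y) \<in> (S \<union> R)\<^sup>* \<Longrightarrow> (x, y) \<in> (Q \<union> R)\<^sup>*"
    using rtrancl_subset_rtrancl by blast
  \<comment> \<open>The invariant splits the path at an outer vertex \<open>w\<close>: up to
    \<open>w\<close> it is already contracted, after \<open>w\<close> it runs in
    \<open>Q\<close>.\<close>
  have "\<exists>w. w \<notin> I \<and> (x, w) \<in> (S \<union> R)\<^sup>* \<and> (w, z) \<in> Q\<^sup>*" if "(x, z) \<in> (Q \<union> R)\<^sup>*" for z
    using that
  proof induction
    case base show ?case using assms(3) by blast
  next
    case (step u v)
    then obtain w where w: "w \<notin> I" "(x, w) \<in> (S \<union> R)\<^sup>*" "(w, u) \<in> Q\<^sup>*" by blast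
    show ?case
    proof (cases "(u, v) \<in> R")
      case True
      then have "(w, u) \<in> (S \<union> R)\<^sup>*" using w assms(1)[OF True] unfolding S
        by (cases "w = u") auto
      then show ?thesis using True w assms(1)[OF True]
        by (meson UnI2 rtrancl.rtrancl_into_rtrancl rtrancl_refl rtrancl_trans)
    next
      case False
      then show ?thesis using w step.hyps(2) by (meson UnE rtrancl.rtrancl_into_rtrancl)
    qed
  qed
  then show "(x, y) \<in> (Q \<union> R)\<^sup>* \<Longrightarrow> (x, y) \<in> (S \<union> R)\<^sup>*"
  proof -
    assume "(x, y) \<in> (Q \<union> R)\<^sup>*"
    then obtain w where w: "w \<notin> I" "(x, w) \<in> (S \<union> R)\<^sup>*" "(w, y) \<in> Q\<^sup>*"
      using \<open>\<And>z. (x, z) \<in> (Q \<union> R)\<^sup>* \<Longrightarrow> _\<close> by blast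
    then have "(w, y) \<in> (S \<union> R)\<^sup>*" using assms(4) unfolding S by (cases "w = y") auto
    then show ?thesis using w(2) by (rule rtrancl_trans[rotated])
  qed
qed

lemma fst_place: "fst (place i j x) \<in> {i, j}"
  by (cases x) (simp_all add: place_def)

lemma layer_fst: "(u, v) \<in> layer i j \<alpha> \<Longrightarrow> fst u \<in> {i, j} \<and> fst v \<in> {i, j}"
  unfolding layer_def using fst_place by blast

lemma place_surj: "fst u \<in> {i, k} \<Longrightarrow> \<exists>z. place i k z = u"
proof -
  assume "fst u \<in> {i, k}"
  then have "place i k (LP (snd u)) = u \<or> place i k (RP (snd u)) = u"
    by (auto simp: place_def prod_eq_iff)
  then show ?thesis by blast
qed

lemma place_inj: "i \<noteq> k \<Longrightarrow> place i k x = place i k y \<longleftrightarrow> x = y"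
  by (cases x; cases y; auto simp: place_def)

text \<open>The product is the contraction of the middle column, here in the form required of
  \<open>S\<close> in \<open>rtrancl_contract\<close>.\<close>

lemma layer_mult:
  assumes "i \<noteq> j" "j \<noteq> k" "i \<noteq> k"
  shows "layer i k (\<alpha> \<odot> \<beta>) = {(u, v). u \<noteq> v \<and> u \<notin> {w. fst w = j} \<and> v \<notin> {w. fst w = j} \<and>
    (u, v) \<in> (layer i j \<alpha> \<union> layer j k \<beta>)\<^sup>*}" (is "?L = ?R")
proof -
  let ?Q = "layer i j \<alpha> \<union> layer j k \<beta>"
  have "(u, v) \<in> ?L \<longleftrightarrow> (u, v) \<in> ?R" for u v
  proof
    assume "(u, v) \<in> ?L"
    then obtain x y where xy: "u = place i k x" "v = place i k y" "{x, y} \<in> \<alpha> \<odot> \<beta>"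
      unfolding layer_def by blast
    show "(u, v) \<in> ?R"
      using xy(3) fst_place[of i k x] fst_place[of i k y] assms
      unfolding xy(1,2) mem_Collect_eq brauer_mult_layers[OF assms] by (auto simp: place_inj)
  next
    assume uv: "(u, v) \<in> ?R"
    then have path: "u \<noteq> v" "(u, v) \<in> ?Q\<^sup>*" by blast+
    obtain w where "(u, w) \<in> ?Q" using path by (blast elim: converse_rtranclE)
    moreover obtain w' where "(w', v) \<in> ?Q" using path by (blast elim: rtranclE)
    ultimately have "fst u \<in> {i, j, k}" "fst v \<in> {i, j, k}" by (auto dest!: layer_fst)
    then obtain x y where "place i k x = u" "place i k y = v"
      using place_surj[of u i k] place_surj[of v i k] uv by blast
    then show "(u, v) \<in> ?L" using uv unfolding layer_def mem_Collect_eq brauer_mult_layers[OF assms] by auto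
  qed
  then show ?thesis by auto
qed

text \<open>Contracting column 1 gives one bracketing and contracting column 2 the other; neither
  changes the connectivity between the columns 0 and 3 of the full diagram.\<close>

lemma brauer_mult_assoc: "(\<alpha> \<odot> \<beta>) \<odot> \<gamma> = \<alpha> \<odot> (\<beta> \<odot> \<gamma>)"
proof -
  have fst_ends: "fst (place 0 3 x) \<noteq> 1" "fst (place 0 3 x) \<noteq> 2" for x
    using fst_place[of 0 3 x] by auto
  have "(place 0 3 x, place 0 3 y) \<in> (layer 0 2 (\<alpha> \<odot> \<beta>) \<union> layer 2 3 \<gamma>)\<^sup>* \<longleftrightarrow>
      (place 0 3 x, place 0 3 y) \<in> ((layer 0 1 \<alpha> \<union> layer 1 2 \<beta>) \<union> layer 2 3 \<gamma>)\<^sup>*" for x y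
    by (rule rtrancl_contract[where I = "{w. fst w = 1}", OF _ layer_mult])
      (use fst_ends in \<open>auto dest: layer_fst\<close>)
  moreover have "(place 0 3 x, place 0 3 y) \<in> (layer 1 3 (\<beta> \<odot> \<gamma>) \<union> layer 0 1 \<alpha>)\<^sup>* \<longleftrightarrow>
      (place 0 3 x, place 0 3 y) \<in> ((layer 1 2 \<beta> \<union> layer 2 3 \<gamma>) \<union> layer 0 1 \<alpha>)\<^sup>*" for x y
    by (rule rtrancl_contract[where I = "{w. fst w = 2}", OF _ layer_mult])
      (use fst_ends in \<open>auto dest: layer_fst\<close>)
  ultimately have eq: "{x, y} \<in> (\<alpha> \<odot> \<beta>) \<odot> \<gamma> \<longleftrightarrow> {x, y} \<in> \<alpha> \<odot> (\<beta> \<odot> \<gamma>)" for x y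
    using brauer_mult_layers[of 0 2 3 x y "\<alpha> \<odot> \<beta>" \<gamma>] brauer_mult_layers[of 0 1 3 x y \<alpha> "\<beta> \<odot> \<gamma>"]
    by (simp add: Un_commute Un_left_commute)
  have block: "\<exists>x y. B = {x, y}" if "B \<in> \<delta> \<odot> \<epsilon>" for B \<delta> \<epsilon>
    using that unfolding brauer_mult_def by blast
  show ?thesis
  proof (rule Set.set_eqI)
    fix B show "B \<in> (\<alpha> \<odot> \<beta>) \<odot> \<gamma> \<longleftrightarrow> B \<in> \<alpha> \<odot> (\<beta> \<odot> \<gamma>)"
    proof (cases "\<exists>x y. B = {x, y}")
      case True then show ?thesis using eq by auto
    next
      case False then show ?thesis using block by blast
    qed
  qed
qed

section \<open>Short paths in a product\<close>

lemma glued_step: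
  "{x, y} \<in> \<alpha> \<Longrightarrow> (in_first x, v) \<in> (glued_edges \<alpha> \<beta>)\<^sup>* \<Longrightarrow> (in_first y, v) \<in> (glued_edges \<alpha> \<beta>)\<^sup>*"
  "{x, y} \<in> \<beta> \<Longrightarrow> (in_second x, v) \<in> (glued_edges \<alpha> \<beta>)\<^sup>* \<Longrightarrow> (in_second y, v) \<in> (glued_edges \<alpha> \<beta>)\<^sup>*"
  by (rule converse_rtrancl_into_rtrancl; fastforce simp: glued_edges_def insert_commute)+

text \<open>Products are computed by exhibiting a path for each pin; since partners are unique in a
  diagram, these one-sided rules determine the product.\<close>

lemma mult_LL: "{LP x, LP y} \<in> \<alpha> \<Longrightarrow> x \<noteq> y \<Longrightarrow> {LP x, LP y} \<in> \<alpha> \<odot> \<beta>"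
  using glued_step(1)[of "LP y" "LP x" \<alpha> "Lft y" \<beta>] by (simp add: brauer_mult_iff insert_commute)

lemma mult_RR: "{RP x, RP y} \<in> \<beta> \<Longrightarrow> x \<noteq> y \<Longrightarrow> {RP x, RP y} \<in> \<alpha> \<odot> \<beta>"
  using glued_step(2)[of "RP y" "RP x" \<beta> "Rgt y" \<alpha>] by (simp add: brauer_mult_iff insert_commute)

lemma mult_LR: "{LP x, RP m} \<in> \<alpha> \<Longrightarrow> {LP m, RP y} \<in> \<beta> \<Longrightarrow> {LP x, RP y} \<in> \<alpha> \<odot> \<beta>"
  using glued_step(1)[of "RP m" "LP x" \<alpha> "Rgt y" \<beta>] glued_step(2)[of "RP y" "LP m" \<beta> "Rgt y" \<alpha>]
  by (simp add: brauer_mult_iff insert_commute)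

lemma mult_LLR:
  "{LP x, RP m} \<in> \<alpha> \<Longrightarrow> {LP m, LP m'} \<in> \<beta> \<Longrightarrow> {LP y, RP m'} \<in> \<alpha> \<Longrightarrow> x \<noteq> y \<Longrightarrow> {LP x, LP y} \<in> \<alpha> \<odot> \<beta>"
  using glued_step(1)[of "RP m" "LP x" \<alpha> "Lft y" \<beta>] glued_step(2)[of "LP m'" "LP m" \<beta> "Lft y" \<alpha>]
    glued_step(1)[of "LP y" "RP m'" \<alpha> "Lft y" \<beta>]
  by (simp add: brauer_mult_iff insert_commute)

lemma mult_LRLR:
  "{LP x, RP m} \<in> \<alpha> \<Longrightarrow> {LP m, LP m'} \<in> \<beta> \<Longrightarrow> {RP m', RP m''} \<in> \<alpha> \<Longrightarrow> {LP m'', RP y} \<in> \<beta> \<Longrightarrow>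
    {LP x, RP y} \<in> \<alpha> \<odot> \<beta>"
  using glued_step(1)[of "RP m" "LP x" \<alpha> "Rgt y" \<beta>] glued_step(2)[of "LP m'" "LP m" \<beta> "Rgt y" \<alpha>]
    glued_step(1)[of "RP m''" "RP m'" \<alpha> "Rgt y" \<beta>] glued_step(2)[of "RP y" "LP m''" \<beta> "Rgt y" \<alpha>]
  by (simp add: brauer_mult_iff insert_commute)

lemma mult_RRL:
  "{LP m, RP x} \<in> \<beta> \<Longrightarrow> {RP m, RP m'} \<in> \<alpha> \<Longrightarrow> {LP m', RP y} \<in> \<beta> \<Longrightarrow> x \<noteq> y \<Longrightarrow> {RP x, RP y} \<in> \<alpha> \<odot> \<beta>"
  using glued_step(2)[of "LP m" "RP x" \<beta> "Rgt y" \<alpha>] glued_step(1)[of "RP m'" "RP m" \<alpha> "Rgt y" \<beta>]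
    glued_step(2)[of "RP y" "LP m'" \<beta> "Rgt y" \<alpha>]
  by (simp add: brauer_mult_iff insert_commute)

section \<open>Left pairs, right pairs and conjugation\<close>

text \<open>Pairs of numbers rather than of pins, so that right pairs of one element can be compared
  with left pairs of another and permutations act on both alike.\<close>

definition lft :: "pin set set \<Rightarrow> nat set set" where
  "lft \<alpha> = {p. LP ` p \<in> \<alpha>}"

definition rgt :: "pin set set \<Rightarrow> nat set set" where
  "rgt \<alpha> = {p. RP ` p \<in> \<alpha>}"

definition matching :: "nat \<Rightarrow> nat set set \<Rightarrow> bool" where
  "matching n L \<longleftrightarrow> (\<forall>p\<in>L. card p = 2 \<and> p \<subseteq> {1..n}) \<and> disjoint L"

lemma pair_lft: "{i, j} \<in> lft \<alpha> \<longleftrightarrow> {LP i, LP j} \<in> \<alpha>"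
  by (simp add: lft_def)

lemma pair_rgt: "{i, j} \<in> rgt \<alpha> \<longleftrightarrow> {RP i, RP j} \<in> \<alpha>"
  by (simp add: rgt_def)

lemma inj_LP: "inj LP" and inj_RP: "inj RP"
  by (simp_all add: inj_def)

lemma matching_aux:
  assumes "\<alpha> \<in> brauer n" "inj f" "\<And>a. f a \<in> pins n \<Longrightarrow> a \<in> {1..n}"
  shows "matching n {p. f ` p \<in> \<alpha>}"
proof -
  have "card p = 2" "p \<subseteq> {1..n}" if "f ` p \<in> \<alpha>" for p
  proof -
    have "card (f ` p) = 2" using assms(1) that by (simp add: brauer_def)
    then show "card p = 2" using card_image[OF inj_on_subset[OF assms(2)], of p] by simp
    have "f ` p \<subseteq> pins n" using assms(1) that unfolding brauer_def partition_on_def by blast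
    then show "p \<subseteq> {1..n}" using assms(3) by blast
  qed
  moreover have "disjoint {p. f ` p \<in> \<alpha>}"
  proof (rule disjointI)
    fix p q assume pq: "p \<in> {p. f ` p \<in> \<alpha>}" "q \<in> {p. f ` p \<in> \<alpha>}" "p \<noteq> q"
    then have "f ` p \<noteq> f ` q" using assms(2) by (simp add: inj_image_eq_iff)
    moreover have "disjoint \<alpha>" using assms(1) by (simp add: brauer_def partition_on_def)
    ultimately have "f ` p \<inter> f ` q = {}" using pq by (auto dest: disjointD)
    then show "p \<inter> q = {}" by blast
  qed
  ultimately show ?thesis unfolding matching_def by blast
qed

lemma matching_lft: "\<alpha> \<in> brauer n \<Longrightarrow> matching n (lft \<alpha>)"
  unfolding lft_def by (rule matching_aux[OF _ inj_LP]) auto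

lemma matching_rgt: "\<alpha> \<in> brauer n \<Longrightarrow> matching n (rgt \<alpha>)"
  unfolding rgt_def by (rule matching_aux[OF _ inj_RP]) auto

lemma matching_subset: "matching n L \<Longrightarrow> K \<subseteq> L \<Longrightarrow> matching n K"
  unfolding matching_def by (meson pairwise_subset subsetD)

lemma matching_pair:
  assumes "matching n L" "p \<in> L"
  obtains a b where "p = {a, b}" "a \<noteq> b" "a \<in> {1..n}" "b \<in> {1..n}"
  using assms unfolding matching_def by (metis card_2_iff insert_subset)

lemma matching_disjoint: "matching n L \<Longrightarrow> p \<in> L \<Longrightarrow> q \<in> L \<Longrightarrow> p \<noteq> q \<Longrightarrow> p \<inter> q = {}"
  unfolding matching_def by (meson disjointD)

lemma matching_subset_Pow: "matching n L \<Longrightarrow> L \<subseteq> Pow {1..n}"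
  unfolding matching_def by blast

lemma finite_matching: "matching n L \<Longrightarrow> finite L"
  using matching_subset_Pow by (meson finite_Pow_iff finite_atLeastAtMost finite_subset)

lemma Union_matching: "matching n L \<Longrightarrow> \<Union>L \<subseteq> {1..n}"
  unfolding matching_def by blast

lemma card_Union_matching:
  assumes "matching n L" shows "card (\<Union>L) = 2 * card L"
proof -
  have "card (\<Union>L) = sum card L"
    using assms unfolding matching_def by (intro card_Union_disjoint) (auto intro: finite_subset)
  also have "\<dots> = 2 * card L"
    using assms unfolding matching_def by simp
  finally show ?thesis .
qed

lemma card_Compl_matching: "matching n L \<Longrightarrow> card ({1..n} - \<Union>L) = n - 2 * card L"
  using finite_subset[OF Union_matching, of n L] Union_matching[of n L]
    card_Diff_subset[of "\<Union>L" "{1..n}"] by (simp add: card_Union_matching)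

lemma matching_singleton: "matching n {p} \<longleftrightarrow> card p = 2 \<and> p \<subseteq> {1..n}"
  unfolding matching_def by simp

lemma matching_empty [simp]: "matching n {}"
  unfolding matching_def by simp

lemma matching_insert:
  "matching n L \<Longrightarrow> card p = 2 \<Longrightarrow> p \<subseteq> {1..n} \<Longrightarrow> p \<inter> \<Union>L = {} \<Longrightarrow> matching n (insert p L)"
  unfolding matching_def by (auto simp: pairwise_insert disjnt_def)

lemma left_partner:
  assumes "\<alpha> \<in> brauer n" "x \<in> {1..n}"
  shows "x \<in> \<Union>(lft \<alpha>) \<longleftrightarrow> (\<exists>y. {LP x, LP y} \<in> \<alpha>)" "x \<notin> \<Union>(lft \<alpha>) \<longleftrightarrow> (\<exists>y. {LP x, RP y} \<in> \<alpha>)"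
proof -
  show L: "x \<in> \<Union>(lft \<alpha>) \<longleftrightarrow> (\<exists>y. {LP x, LP y} \<in> \<alpha>)"
  proof
    assume "x \<in> \<Union>(lft \<alpha>)"
    then obtain p where p: "p \<in> lft \<alpha>" "x \<in> p" by blast
    then obtain a b where "p = {a, b}" using matching_pair[OF matching_lft[OF assms(1)]] by blast
    then show "\<exists>y. {LP x, LP y} \<in> \<alpha>" using p pair_lft by (metis doubleton_eq_iff insertE singletonD)
  qed (metis UnionI insertI1 pair_lft)
  obtain y where "{LP x, y} \<in> \<alpha>" using brauer_ex[OF assms(1), of "LP x"] assms(2) by auto
  then show "x \<notin> \<Union>(lft \<alpha>) \<longleftrightarrow> (\<exists>y. {LP x, RP y} \<in> \<alpha>)"
    unfolding L using brauer_unique[OF assms(1), of "LP x"] by (metis pin.distinct(1) pin.exhaust)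
qed

lemma right_partner:
  assumes "\<alpha> \<in> brauer n" "x \<in> {1..n}"
  shows "x \<notin> \<Union>(rgt \<alpha>) \<longleftrightarrow> (\<exists>y. {LP y, RP x} \<in> \<alpha>)"
proof -
  obtain y where y: "{RP x, y} \<in> \<alpha>" using brauer_ex[OF assms(1), of "RP x"] assms(2) by auto
  have "x \<in> \<Union>(rgt \<alpha>) \<longleftrightarrow> (\<exists>y. {RP x, RP y} \<in> \<alpha>)"
  proof
    assume "x \<in> \<Union>(rgt \<alpha>)"
    then obtain p where p: "p \<in> rgt \<alpha>" "x \<in> p" by blast
    then obtain a b where "p = {a, b}" using matching_pair[OF matching_rgt[OF assms(1)]] by blast
    then show "\<exists>y. {RP x, RP y} \<in> \<alpha>" using p pair_rgt by (metis doubleton_eq_iff insertE singletonD)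
  qed (metis UnionI insertI1 pair_rgt)
  then show ?thesis using y brauer_unique[OF assms(1), of "RP x"]
    by (metis insert_commute pin.distinct(1) pin.exhaust)
qed

section \<open>Through strands, corank and R-classes\<close>

text \<open>A through strand is determined by either of its ends. The left ends are the points
  outside the left pairs, the right ends those outside the right pairs; the two counts together give
  \<open>card_rgt_eq\<close>.\<close>

lemma card_through:
  assumes "\<alpha> \<in> brauer n"
  shows "card {B \<in> \<alpha>. \<exists>a\<in>{1..n}. \<exists>b\<in>{1..n}. B = {LP a, RP b}} = n - 2 * card (lft \<alpha>)"
    "card {B \<in> \<alpha>. \<exists>a\<in>{1..n}. \<exists>b\<in>{1..n}. B = {LP a, RP b}} = n - 2 * card (rgt \<alpha>)"
proof -
  let ?T = "{B \<in> \<alpha>. \<exists>a\<in>{1..n}. \<exists>b\<in>{1..n}. B = {LP a, RP b}}"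
  define g where "g B = (THE a. LP a \<in> B)" for B
  define h where "h B = (THE b. RP b \<in> B)" for B
  have gh: "g {LP a, RP b} = a" "h {LP a, RP b} = b" for a b
    unfolding g_def h_def by (rule the_equality; simp)+
  have "bij_betw g ?T ({1..n} - \<Union>(lft \<alpha>))"
  proof (rule bij_betw_imageI)
    show "inj_on g ?T"
    proof (rule inj_onI)
      fix B C assume "B \<in> ?T" "C \<in> ?T" "g B = g C"
      then obtain a b c d where "B = {LP a, RP b}" "C = {LP c, RP d}" "B \<in> \<alpha>" "C \<in> \<alpha>" by blast
      moreover have "a = c" using calculation gh(1) \<open>g B = g C\<close> by simp
      ultimately show "B = C" using brauer_unique[OF assms, of "LP a" "RP b" "RP d"] by simp
    qed
    show "g ` ?T = {1..n} - \<Union>(lft \<alpha>)"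
    proof
      show "g ` ?T \<subseteq> {1..n} - \<Union>(lft \<alpha>)"
      proof
        fix x assume "x \<in> g ` ?T"
        then obtain b where "x \<in> {1..n}" "{LP x, RP b} \<in> \<alpha>" using gh(1) by fastforce
        then show "x \<in> {1..n} - \<Union>(lft \<alpha>)" using left_partner(2)[OF assms, of x] by blast
      qed
      show "{1..n} - \<Union>(lft \<alpha>) \<subseteq> g ` ?T"
      proof
        fix x assume x: "x \<in> {1..n} - \<Union>(lft \<alpha>)"
        then obtain y where y: "{LP x, RP y} \<in> \<alpha>" using left_partner(2)[OF assms, of x] by auto
        then have "y \<in> {1..n}" using brauer_pins[OF assms y] by simp
        then have "{LP x, RP y} \<in> ?T" using x y by blast
        then show "x \<in> g ` ?T" by (rule rev_image_eqI) (simp add: gh)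
      qed
    qed
  qed
  then have "card ?T = card ({1..n} - \<Union>(lft \<alpha>))" by (rule bij_betw_same_card)
  then show "card ?T = n - 2 * card (lft \<alpha>)"
    using card_Compl_matching[OF matching_lft[OF assms]] by simp
  have "bij_betw h ?T ({1..n} - \<Union>(rgt \<alpha>))"
  proof (rule bij_betw_imageI)
    show "inj_on h ?T"
    proof (rule inj_onI)
      fix B C assume "B \<in> ?T" "C \<in> ?T" "h B = h C"
      then obtain a b c d where "B = {LP a, RP b}" "C = {LP c, RP d}" "B \<in> \<alpha>" "C \<in> \<alpha>" by blast
      moreover have "b = d" using calculation gh(2) \<open>h B = h C\<close> by simp
      ultimately show "B = C" using brauer_unique'[OF assms, of "LP a" "RP b" "LP c"] by simp
    qed
    show "h ` ?T = {1..n} - \<Union>(rgt \<alpha>)"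
    proof
      show "h ` ?T \<subseteq> {1..n} - \<Union>(rgt \<alpha>)"
      proof
        fix x assume "x \<in> h ` ?T"
        then obtain a where "x \<in> {1..n}" "{LP a, RP x} \<in> \<alpha>" using gh(2) by fastforce
        then show "x \<in> {1..n} - \<Union>(rgt \<alpha>)" using right_partner[OF assms, of x] by blast
      qed
      show "{1..n} - \<Union>(rgt \<alpha>) \<subseteq> h ` ?T"
      proof
        fix x assume x: "x \<in> {1..n} - \<Union>(rgt \<alpha>)"
        then obtain y where y: "{LP y, RP x} \<in> \<alpha>" using right_partner[OF assms, of x] by auto
        then have "y \<in> {1..n}" using brauer_pins[OF assms y] by simp
        then have "{LP y, RP x} \<in> ?T" using x y by blast
        then show "x \<in> h ` ?T" by (rule rev_image_eqI) (simp add: gh)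
      qed
    qed
  qed
  then have "card ?T = card ({1..n} - \<Union>(rgt \<alpha>))" by (rule bij_betw_same_card)
  then show "card ?T = n - 2 * card (rgt \<alpha>)"
    using card_Compl_matching[OF matching_rgt[OF assms]] by simp
qed

lemma card_matching_le: "matching n L \<Longrightarrow> 2 * card L \<le> n"
  using card_mono[OF _ Union_matching, of n L] card_Union_matching[of n L] by simp

lemma corank_eq: "\<alpha> \<in> brauer n \<Longrightarrow> corank n \<alpha> = 2 * card (lft \<alpha>)"
  using card_matching_le[OF matching_lft, of \<alpha> n] card_through(1)[of \<alpha> n] unfolding corank_def by simp

lemma card_rgt_eq: "\<alpha> \<in> brauer n \<Longrightarrow> card (rgt \<alpha>) = card (lft \<alpha>)"
  using card_matching_le[OF matching_lft, of \<alpha> n] card_matching_le[OF matching_rgt, of \<alpha> n]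
    card_through[of \<alpha> n] by simp

lemma green_R_iff: "(\<alpha>, \<beta>) \<in> green_R n \<longleftrightarrow> \<alpha> \<in> brauer n \<and> \<beta> \<in> brauer n \<and> lft \<alpha> = lft \<beta>"
proof -
  have L: "{B \<in> \<delta>. B \<subseteq> left_pins n} = (`) LP ` lft \<delta>" if "\<delta> \<in> brauer n" for \<delta>
  proof -
    have "B \<in> (`) LP ` lft \<delta>" if "B \<in> \<delta>" "B \<subseteq> left_pins n" for B
      using that unfolding lft_def left_pins_def by (auto simp: subset_image_iff)
    moreover have "LP ` p \<subseteq> left_pins n" if "p \<in> lft \<delta>" for p
      using matching_subset_Pow[OF matching_lft[OF \<open>\<delta> \<in> brauer n\<close>]] that
      unfolding left_pins_def by blast
    ultimately show ?thesis unfolding lft_def by blast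
  qed
  have "inj ((`) LP)" using inj_image_eq_iff[OF inj_LP] by (meson injI)
  then have "(`) LP ` lft \<alpha> = (`) LP ` lft \<beta> \<longleftrightarrow> lft \<alpha> = lft \<beta>" by (rule inj_image_eq_iff)
  then show ?thesis unfolding green_R_def mem_Collect_eq prod.case
    using L[of \<alpha>] L[of \<beta>] by metis
qed

text \<open>A symmetric diagram witnessing that every matching occurs as the left pairs of some
  element.\<close>

definition mirror :: "nat \<Rightarrow> nat set set \<Rightarrow> pin set set" where
  "mirror n L = {LP ` p |p. p \<in> L} \<union> {RP ` p |p. p \<in> L} \<union> {{LP x, RP x} |x. x \<in> {1..n} - \<Union>L}"

lemma mirror_brauer:
  assumes "matching n L" shows "mirror n L \<in> brauer n" "lft (mirror n L) = L"
proof -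
  have pairs: "\<exists>a b. p = {a, b} \<and> a \<noteq> b \<and> a \<in> {1..n} \<and> b \<in> {1..n}" if "p \<in> L" for p
    using matching_pair[OF assms that] by metis
  have LL: "{LP a, LP b} \<in> mirror n L \<longleftrightarrow> {a, b} \<in> L"
    and RR: "{RP a, RP b} \<in> mirror n L \<longleftrightarrow> {a, b} \<in> L" for a b
  proof -
    have *: "f a = f b \<longleftrightarrow> a = b" if "f = LP \<or> f = RP" for f a b using that by auto
    have "{LP a, LP b} = LP ` p \<longleftrightarrow> p = {a, b}" "{RP a, RP b} = RP ` p \<longleftrightarrow> p = {a, b}"
      "{LP a, LP b} \<noteq> RP ` p" "{RP a, RP b} \<noteq> LP ` p" for p
      using inj_image_eq_iff[OF inj_LP, of "{a, b}" p] inj_image_eq_iff[OF inj_RP, of "{a, b}" p]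
      by auto
    then show "{LP a, LP b} \<in> mirror n L \<longleftrightarrow> {a, b} \<in> L" "{RP a, RP b} \<in> mirror n L \<longleftrightarrow> {a, b} \<in> L"
      unfolding mirror_def by (auto simp: doubleton_eq_iff)
  qed
  have LR: "{LP a, RP b} \<in> mirror n L \<longleftrightarrow> a = b \<and> a \<in> {1..n} - \<Union>L" for a b
  proof -
    have "{LP a, RP b} \<noteq> LP ` p" "{LP a, RP b} \<noteq> RP ` p" for p by auto
    then show ?thesis unfolding mirror_def by (auto simp: doubleton_eq_iff)
  qed
  have uniq: "a = b" if "{c, a} \<in> L" "{c, b} \<in> L" for a b c
    using matching_disjoint[OF assms that] by (metis disjoint_iff doubleton_eq_iff insertI1)
  show "mirror n L \<in> brauer n"
  proof (rule brauerI)
    fix B assume "B \<in> mirror n L"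
    then consider p where "p \<in> L" "B = LP ` p" | p where "p \<in> L" "B = RP ` p"
      | x where "x \<in> {1..n}" "B = {LP x, RP x}" unfolding mirror_def by blast
    then show "\<exists>x\<in>pins n. \<exists>y\<in>pins n. x \<noteq> y \<and> B = {x, y}"
    proof cases
      case 1 then obtain a b where "p = {a, b}" "a \<noteq> b" "a \<in> {1..n}" "b \<in> {1..n}" using pairs by metis
      then show ?thesis using 1 by (intro bexI[of _ "LP a"] bexI[of _ "LP b"]) auto
    next
      case 2 then obtain a b where "p = {a, b}" "a \<noteq> b" "a \<in> {1..n}" "b \<in> {1..n}" using pairs by metis
      then show ?thesis using 2 by (intro bexI[of _ "RP a"] bexI[of _ "RP b"]) auto
    next
      case 3 then show ?thesis by (intro bexI[of _ "LP x"] bexI[of _ "RP x"]) auto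
    qed
  next
    fix x assume x: "x \<in> pins n"
    have ex: "\<exists>b. {a, b} \<in> L" if a: "a \<in> \<Union>L" for a
    proof -
      obtain p where "p \<in> L" "a \<in> p" using a by blast
      with pairs[of p] show ?thesis by (auto simp: insert_commute)
    qed
    show "\<exists>y. {x, y} \<in> mirror n L"
    proof (cases x)
      case (LP a)
      then show ?thesis using x ex[of a] LL LR[of a a] by (cases "a \<in> \<Union>L") auto
    next
      case (RP a)
      then show ?thesis using x ex[of a] RR LR[of a a]
        by (cases "a \<in> \<Union>L") (auto simp: insert_commute)
    qed
  next
    fix x y z assume xyz: "{x, y} \<in> mirror n L" "{x, z} \<in> mirror n L"
    have mem: "c \<in> \<Union>L" if "{c, a} \<in> L" for a c using that by blast
    have RL: "{RP b, LP a} \<in> mirror n L \<longleftrightarrow> a = b \<and> a \<in> {1..n} - \<Union>L" for a b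
      using LR[of a b] by (simp add: insert_commute)
    show "y = z"
    proof (cases x)
      case (LP a)
      show ?thesis using xyz unfolding LP
        by (cases y; cases z) (use uniq[of a] mem[of a] in \<open>auto simp only: LL LR DiffE\<close>)
    next
      case (RP a)
      show ?thesis using xyz unfolding RP
        by (cases y; cases z) (use uniq[of a] mem[of a] in \<open>auto simp only: RR RL DiffE\<close>)
    qed
  qed
  show "lft (mirror n L) = L"
  proof (rule Set.set_eqI)
    fix p show "p \<in> lft (mirror n L) \<longleftrightarrow> p \<in> L"
    proof
      assume "p \<in> lft (mirror n L)"
      moreover obtain a b where "p = {a, b}"
        using matching_pair[OF matching_lft[OF \<open>mirror n L \<in> brauer n\<close>] calculation] by blast
      ultimately show "p \<in> L" using LL pair_lft by simp
    next
      assume "p \<in> L"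
      then show "p \<in> lft (mirror n L)" using LL pairs[of p] pair_lft by auto
    qed
  qed
qed

text \<open>An R-class is determined by its left pairs and every matching occurs through
  \<open>mirror\<close>, so quotient classes can be replaced by matchings.\<close>

lemma R_cross_sections_iff:
  "\<Lambda> \<in> R_cross_sections n \<longleftrightarrow> \<Lambda> \<subseteq> brauer n \<and> (\<forall>\<alpha>\<in>\<Lambda>. \<forall>\<beta>\<in>\<Lambda>. \<alpha> \<odot> \<beta> \<in> \<Lambda>) \<and>
     (\<forall>L. matching n L \<longrightarrow> (\<exists>!\<alpha>. \<alpha> \<in> \<Lambda> \<and> lft \<alpha> = L))"
proof -
  have cls: "green_R n `` {\<alpha>} = {\<beta> \<in> brauer n. lft \<beta> = lft \<alpha>}" if "\<alpha> \<in> brauer n" for \<alpha>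
    using that by (auto simp: green_R_iff)
  have "C \<in> brauer n // green_R n \<longleftrightarrow> (\<exists>L. matching n L \<and> C = {\<beta> \<in> brauer n. lft \<beta> = L})" for C
  proof
    assume "C \<in> brauer n // green_R n"
    then show "\<exists>L. matching n L \<and> C = {\<beta> \<in> brauer n. lft \<beta> = L}"
      by (elim quotientE) (auto simp: cls intro: matching_lft)
  next
    assume "\<exists>L. matching n L \<and> C = {\<beta> \<in> brauer n. lft \<beta> = L}"
    then obtain L where L: "matching n L" "C = {\<beta> \<in> brauer n. lft \<beta> = L}" by blast
    then have "C = green_R n `` {mirror n L}" using mirror_brauer[OF L(1)] cls by simp
    then show "C \<in> brauer n // green_R n" using mirror_brauer[OF L(1)] by (simp add: quotientI)
  qed
  then have "(\<forall>C \<in> brauer n // green_R n. P C) \<longleftrightarrow>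
      (\<forall>L. matching n L \<longrightarrow> P {\<beta> \<in> brauer n. lft \<beta> = L})" for P
    unfolding Ball_def by auto
  from this[of "\<lambda>C. \<exists>!\<alpha>. \<alpha> \<in> \<Lambda> \<inter> C"]
  have "(\<forall>C \<in> brauer n // green_R n. \<exists>!\<alpha>. \<alpha> \<in> \<Lambda> \<inter> C) \<longleftrightarrow>
      (\<forall>L. matching n L \<longrightarrow> (\<exists>!\<alpha>. \<alpha> \<in> \<Lambda> \<inter> {\<beta> \<in> brauer n. lft \<beta> = L}))" .
  moreover have "\<Lambda> \<inter> {\<beta> \<in> brauer n. lft \<beta> = L} = {\<alpha>. \<alpha> \<in> \<Lambda> \<and> lft \<alpha> = L}" if "\<Lambda> \<subseteq> brauer n" for L
    using that by blast
  ultimately have eq: "(\<forall>C \<in> brauer n // green_R n. \<exists>!\<alpha>. \<alpha> \<in> \<Lambda> \<inter> C) \<longleftrightarrow>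
      (\<forall>L. matching n L \<longrightarrow> (\<exists>!\<alpha>. \<alpha> \<in> \<Lambda> \<and> lft \<alpha> = L))" if "\<Lambda> \<subseteq> brauer n"
    using that by simp
  show ?thesis
  proof (cases "\<Lambda> \<subseteq> brauer n")
    case True show ?thesis unfolding R_cross_sections_def mem_Collect_eq eq[OF True] ..
  next
    case False then show ?thesis unfolding R_cross_sections_def by simp
  qed
qed

lemma cross_section_brauer: "\<Lambda> \<in> R_cross_sections n \<Longrightarrow> \<alpha> \<in> \<Lambda> \<Longrightarrow> \<alpha> \<in> brauer n"
  unfolding R_cross_sections_iff by (elim conjE) (erule (1) subsetD)

lemma cross_section_mult: "\<Lambda> \<in> R_cross_sections n \<Longrightarrow> \<alpha> \<in> \<Lambda> \<Longrightarrow> \<beta> \<in> \<Lambda> \<Longrightarrow> \<alpha> \<odot> \<beta> \<in> \<Lambda>"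
  unfolding R_cross_sections_iff by (elim conjE) simp

lemma cross_section_ex1:
  "\<Lambda> \<in> R_cross_sections n \<Longrightarrow> matching n L \<Longrightarrow> \<exists>!\<alpha>. \<alpha> \<in> \<Lambda> \<and> lft \<alpha> = L"
  unfolding R_cross_sections_iff by (elim conjE) simp

lemma cross_section_unique:
  assumes "\<Lambda> \<in> R_cross_sections n" "\<alpha> \<in> \<Lambda>" "\<beta> \<in> \<Lambda>" "lft \<alpha> = lft \<beta>"
  shows "\<alpha> = \<beta>"
  using cross_section_ex1[OF assms(1) matching_lft[OF cross_section_brauer[OF assms(1,3)]]] assms(2-4)
  by (elim ex1E) metis

lemma cross_section_ex:
  assumes "\<Lambda> \<in> R_cross_sections n" "matching n L"
  obtains \<alpha> where "\<alpha> \<in> \<Lambda>" "lft \<alpha> = L" "\<alpha> \<in> brauer n"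
  using cross_section_ex1[OF assms] cross_section_brauer[OF assms(1)] by (elim ex1E) metis

lemma cross_sectionI:
  assumes "\<And>\<alpha>. \<alpha> \<in> \<Lambda> \<Longrightarrow> \<alpha> \<in> brauer n"
    and "\<And>\<alpha> \<beta>. \<alpha> \<in> \<Lambda> \<Longrightarrow> \<beta> \<in> \<Lambda> \<Longrightarrow> \<alpha> \<odot> \<beta> \<in> \<Lambda>"
    and "\<And>L. matching n L \<Longrightarrow> \<exists>\<alpha>. \<alpha> \<in> \<Lambda> \<and> lft \<alpha> = L"
    and "\<And>\<alpha> \<beta>. \<alpha> \<in> \<Lambda> \<Longrightarrow> \<beta> \<in> \<Lambda> \<Longrightarrow> lft \<alpha> = lft \<beta> \<Longrightarrow> \<alpha> = \<beta>"
  shows "\<Lambda> \<in> R_cross_sections n"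
  unfolding R_cross_sections_iff
proof (intro conjI ballI allI impI subsetI)
  fix L assume "matching n L"
  then obtain \<alpha> where a: "\<alpha> \<in> \<Lambda> \<and> lft \<alpha> = L" using assms(3) by blast
  then show "\<exists>!\<alpha>. \<alpha> \<in> \<Lambda> \<and> lft \<alpha> = L" by (rule ex1I) (use a assms(4) in simp)
qed (fact assms(1,2))+

section \<open>Permutations and conjugation\<close>

lemma perm_brauer_iff: "{LP i, RP j} \<in> perm_brauer n \<sigma> \<longleftrightarrow> i \<in> {1..n} \<and> j = \<sigma> i"
  unfolding perm_brauer_def by (auto simp: doubleton_eq_iff)

lemma perm_brauer_in_brauer:
  assumes "\<sigma> permutes {1..n}" shows "perm_brauer n \<sigma> \<in> brauer n"
proof (rule brauerI)
  fix B assume "B \<in> perm_brauer n \<sigma>"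
  then obtain i where "i \<in> {1..n}" "B = {LP i, RP (\<sigma> i)}" unfolding perm_brauer_def by blast
  then show "\<exists>x\<in>pins n. \<exists>y\<in>pins n. x \<noteq> y \<and> B = {x, y}"
    using permutes_in_image[OF assms, of i] by (intro bexI[of _ "LP i"] bexI[of _ "RP (\<sigma> i)"]) simp_all
next
  fix x assume x: "x \<in> pins n"
  show "\<exists>y. {x, y} \<in> perm_brauer n \<sigma>"
  proof (cases x)
    case (LP a) then show ?thesis using x perm_brauer_iff[of a "\<sigma> a"] by auto
  next
    case (RP a)
    then have "a \<in> \<sigma> ` {1..n}" using x permutes_image[OF assms] by simp
    then obtain b where "b \<in> {1..n}" "\<sigma> b = a" by (elim imageE) simp
    then have "{RP a, LP b} \<in> perm_brauer n \<sigma>"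
      using perm_brauer_iff[of b a n \<sigma>] by (simp add: insert_commute)
    then show ?thesis using RP by blast
  qed
next
  fix x y z assume "{x, y} \<in> perm_brauer n \<sigma>" "{x, z} \<in> perm_brauer n \<sigma>"
  then obtain i j where "{x, y} = {LP i, RP (\<sigma> i)}" "{x, z} = {LP j, RP (\<sigma> j)}"
    unfolding perm_brauer_def by blast
  then show "y = z" using inj_eq[OF permutes_inj[OF assms]] by (auto simp: doubleton_eq_iff)
qed

primrec relabel :: "(nat \<Rightarrow> nat) \<Rightarrow> pin \<Rightarrow> pin" where
  "relabel \<sigma> (LP a) = LP (\<sigma> a)"
| "relabel \<sigma> (RP a) = RP (\<sigma> a)"

definition conj_elem :: "nat \<Rightarrow> (nat \<Rightarrow> nat) \<Rightarrow> pin set set \<Rightarrow> pin set set" where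
  "conj_elem n \<sigma> \<alpha> = perm_brauer n (inv' \<sigma>) \<odot> \<alpha> \<odot> perm_brauer n \<sigma>"

context
  fixes n :: nat and \<sigma> :: "nat \<Rightarrow> nat"
  assumes \<sigma>: "\<sigma> permutes {1..n}"
begin

lemma relabel_pins: "relabel \<sigma> x \<in> pins n \<longleftrightarrow> x \<in> pins n"
  by (cases x) (simp_all only: relabel.simps pins_simps Un_iff permutes_in_image[OF \<sigma>])

lemma relabel_inj: "relabel \<sigma> x = relabel \<sigma> y \<longleftrightarrow> x = y"
  by (cases x; cases y) (simp_all add: inj_eq[OF permutes_inj[OF \<sigma>]])

lemma conj_elem_brauer:
  assumes "\<alpha> \<in> brauer n" shows "conj_elem n \<sigma> \<alpha> \<in> brauer n"
  unfolding conj_elem_def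
  by (intro brauer_mult_closed perm_brauer_in_brauer permutes_inv \<sigma> assms)

text \<open>Conjugation renames the pins on both sides. Only one implication is computed from paths;
  the converse holds because \<open>x\<close> has some partner in \<open>\<alpha>\<close> and
  partners in the conjugate are unique.\<close>

lemma conj_elem_iff:
  assumes "\<alpha> \<in> brauer n"
  shows "{relabel \<sigma> x, relabel \<sigma> y} \<in> conj_elem n \<sigma> \<alpha> \<longleftrightarrow> {x, y} \<in> \<alpha>"
proof -
  have inv: "{LP (\<sigma> a), RP a} \<in> perm_brauer n (inv' \<sigma>)" and dir: "{LP a, RP (\<sigma> a)} \<in> perm_brauer n \<sigma>"
    if "a \<in> {1..n}" for a
    using that by (simp_all only: perm_brauer_iff permutes_in_image[OF \<sigma>] permutes_inverses[OF \<sigma>])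
  have LR: "{LP (\<sigma> a), RP (\<sigma> b)} \<in> conj_elem n \<sigma> \<alpha>" if "{LP a, RP b} \<in> \<alpha>" for a b
    using mult_LR[OF mult_LR[OF inv that] dir] brauer_pins[OF assms that] unfolding conj_elem_def by simp
  have imp: "{relabel \<sigma> x, relabel \<sigma> y} \<in> conj_elem n \<sigma> \<alpha>" if xy: "{x, y} \<in> \<alpha>" for x y
  proof (cases x; cases y)
    fix a b assume [simp]: "x = LP a" "y = LP b"
    have "a \<in> {1..n}" "b \<in> {1..n}" "a \<noteq> b"
      using brauer_pins[OF assms xy] brauer_neq[OF assms xy] by auto
    then have "\<sigma> a \<noteq> \<sigma> b" by (simp add: inj_eq[OF permutes_inj[OF \<sigma>]])
    have "{LP a, LP b} \<in> \<alpha>" using xy by simp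
    from mult_LLR[OF inv[OF \<open>a \<in> _\<close>] this inv[OF \<open>b \<in> _\<close>] \<open>\<sigma> a \<noteq> \<sigma> b\<close>]
    show ?thesis unfolding conj_elem_def using mult_LL[OF _ \<open>\<sigma> a \<noteq> \<sigma> b\<close>] by simp
  next
    fix a b assume "x = LP a" "y = RP b"
    then show ?thesis using LR xy by simp
  next
    fix a b assume "x = RP a" "y = LP b"
    then show ?thesis using LR[of b a] xy by (simp add: insert_commute)
  next
    fix a b assume [simp]: "x = RP a" "y = RP b"
    have "a \<in> {1..n}" "b \<in> {1..n}" "a \<noteq> b"
      using brauer_pins[OF assms xy] brauer_neq[OF assms xy] by auto
    then have "\<sigma> a \<noteq> \<sigma> b" by (simp add: inj_eq[OF permutes_inj[OF \<sigma>]])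
    have "{RP a, RP b} \<in> \<alpha>" using xy by simp
    then have "{RP a, RP b} \<in> perm_brauer n (inv' \<sigma>) \<odot> \<alpha>" using mult_RR \<open>a \<noteq> b\<close> by simp
    from mult_RRL[OF dir[OF \<open>a \<in> _\<close>] this dir[OF \<open>b \<in> _\<close>] \<open>\<sigma> a \<noteq> \<sigma> b\<close>]
    show ?thesis unfolding conj_elem_def by simp
  qed
  show ?thesis
  proof
    assume xy: "{relabel \<sigma> x, relabel \<sigma> y} \<in> conj_elem n \<sigma> \<alpha>"
    have "x \<in> pins n" using brauer_pins[OF conj_elem_brauer[OF assms] xy] relabel_pins by simp
    then obtain z where z: "{x, z} \<in> \<alpha>" using brauer_ex[OF assms] by blast
    have "relabel \<sigma> z = relabel \<sigma> y"
      using brauer_unique[OF conj_elem_brauer[OF assms] imp[OF z] xy] .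
    then show "{x, y} \<in> \<alpha>" using z relabel_inj by simp
  qed (rule imp)
qed

lemma conj_elem_lft:
  assumes "\<alpha> \<in> brauer n" shows "lft (conj_elem n \<sigma> \<alpha>) = (`) \<sigma> ` lft \<alpha>"
    "rgt (conj_elem n \<sigma> \<alpha>) = (`) \<sigma> ` rgt \<alpha>"
proof -
  let ?\<beta> = "conj_elem n \<sigma> \<alpha>"
  have L: "{\<sigma> a, \<sigma> b} \<in> lft ?\<beta> \<longleftrightarrow> {a, b} \<in> lft \<alpha>" "{\<sigma> a, \<sigma> b} \<in> rgt ?\<beta> \<longleftrightarrow> {a, b} \<in> rgt \<alpha>" for a b
    using conj_elem_iff[OF assms, of "LP a" "LP b"] conj_elem_iff[OF assms, of "RP a" "RP b"]
    by (simp_all add: pair_lft pair_rgt)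
  have S: "\<exists>a. \<sigma> a = c" for c using permutes_surj[OF \<sigma>] by (metis surjD)
  show "lft ?\<beta> = (`) \<sigma> ` lft \<alpha>"
  proof
    show "lft ?\<beta> \<subseteq> (`) \<sigma> ` lft \<alpha>"
    proof
      fix p assume p: "p \<in> lft ?\<beta>"
      obtain c d where "p = {c, d}" "c \<noteq> d" "c \<in> {1..n}" "d \<in> {1..n}"
        using matching_pair[OF matching_lft[OF conj_elem_brauer[OF assms]] p] .
      moreover obtain a b where "\<sigma> a = c" "\<sigma> b = d" using S by metis
      ultimately have "{a, b} \<in> lft \<alpha>" "p = \<sigma> ` {a, b}" using p L by auto
      then show "p \<in> (`) \<sigma> ` lft \<alpha>" by blast
    qed
    show "(`) \<sigma> ` lft \<alpha> \<subseteq> lft ?\<beta>"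
    proof
      fix q assume "q \<in> (`) \<sigma> ` lft \<alpha>"
      then obtain p where p: "p \<in> lft \<alpha>" "q = \<sigma> ` p" by blast
      moreover obtain a b where "p = {a, b}" "a \<noteq> b" "a \<in> {1..n}" "b \<in> {1..n}"
        using matching_pair[OF matching_lft[OF assms] p(1)] .
      ultimately show "q \<in> lft ?\<beta>" using L(1)[of a b] by simp
    qed
  qed
  show "rgt ?\<beta> = (`) \<sigma> ` rgt \<alpha>"
  proof
    show "rgt ?\<beta> \<subseteq> (`) \<sigma> ` rgt \<alpha>"
    proof
      fix p assume p: "p \<in> rgt ?\<beta>"
      obtain c d where "p = {c, d}" "c \<noteq> d" "c \<in> {1..n}" "d \<in> {1..n}"
        using matching_pair[OF matching_rgt[OF conj_elem_brauer[OF assms]] p] .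
      moreover obtain a b where "\<sigma> a = c" "\<sigma> b = d" using S by metis
      ultimately have "{a, b} \<in> rgt \<alpha>" "p = \<sigma> ` {a, b}" using p L by auto
      then show "p \<in> (`) \<sigma> ` rgt \<alpha>" by blast
    qed
    show "(`) \<sigma> ` rgt \<alpha> \<subseteq> rgt ?\<beta>"
    proof
      fix q assume "q \<in> (`) \<sigma> ` rgt \<alpha>"
      then obtain p where p: "p \<in> rgt \<alpha>" "q = \<sigma> ` p" by blast
      moreover obtain a b where "p = {a, b}" "a \<noteq> b" "a \<in> {1..n}" "b \<in> {1..n}"
        using matching_pair[OF matching_rgt[OF assms] p(1)] .
      ultimately show "q \<in> rgt ?\<beta>" using L(2)[of a b] by simp
    qed
  qed
qed

end

lemma perm_id_mult:
  assumes "\<alpha> \<in> brauer n" shows "perm_brauer n id \<odot> \<alpha> = \<alpha>" "\<alpha> \<odot> perm_brauer n id = \<alpha>"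
proof -
  have I: "perm_brauer n id \<in> brauer n" by (intro perm_brauer_in_brauer permutes_id)
  have id: "{LP a, RP a} \<in> perm_brauer n id" if "a \<in> {1..n}" for a using that by (simp add: perm_brauer_iff)
  show "perm_brauer n id \<odot> \<alpha> = \<alpha>" "\<alpha> \<odot> perm_brauer n id = \<alpha>"
  proof -
    have *: "{x, y} \<in> perm_brauer n id \<odot> \<alpha> \<and> {x, y} \<in> \<alpha> \<odot> perm_brauer n id" if xy: "{x, y} \<in> \<alpha>" for x y
    proof (cases x; cases y)
      fix a b assume [simp]: "x = LP a" "y = LP b"
      have ab: "a \<in> {1..n}" "b \<in> {1..n}" "a \<noteq> b"
        using brauer_pins[OF assms xy] brauer_neq[OF assms xy] by auto
      show ?thesis using mult_LLR[OF id[OF ab(1)] _ id[OF ab(2)] ab(3)] mult_LL[OF _ ab(3)] xy by simp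
    next
      fix a b assume [simp]: "x = LP a" "y = RP b"
      have ab: "a \<in> {1..n}" "b \<in> {1..n}" using brauer_pins[OF assms xy] by auto
      show ?thesis using mult_LR[OF id[OF ab(1)]] mult_LR[OF _ id[OF ab(2)]] xy by simp
    next
      fix a b assume [simp]: "x = RP a" "y = LP b"
      have ab: "a \<in> {1..n}" "b \<in> {1..n}" using brauer_pins[OF assms xy] by auto
      show ?thesis using mult_LR[OF id[OF ab(2)]] mult_LR[OF _ id[OF ab(1)]] xy by (simp add: insert_commute)
    next
      fix a b assume [simp]: "x = RP a" "y = RP b"
      have ab: "a \<in> {1..n}" "b \<in> {1..n}" "a \<noteq> b"
        using brauer_pins[OF assms xy] brauer_neq[OF assms xy] by auto
      show ?thesis using mult_RRL[OF id[OF ab(1)] _ id[OF ab(2)] ab(3)] mult_RR[OF _ ab(3)] xy by simp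
    qed
    show "perm_brauer n id \<odot> \<alpha> = \<alpha>"
      by (rule brauer_eqI[OF brauer_mult_closed[OF I assms] assms]) (use brauer_ex[OF assms] * in metis)
    show "\<alpha> \<odot> perm_brauer n id = \<alpha>"
      by (rule brauer_eqI[OF brauer_mult_closed[OF assms I] assms]) (use brauer_ex[OF assms] * in metis)
  qed
qed

lemma perm_mult:
  assumes "\<sigma> permutes {1..n}" "\<tau> permutes {1..n}"
  shows "perm_brauer n \<sigma> \<odot> perm_brauer n \<tau> = perm_brauer n (\<tau> \<circ> \<sigma>)"
proof (rule brauer_eqI)
  show "perm_brauer n \<sigma> \<odot> perm_brauer n \<tau> \<in> brauer n"
    by (intro brauer_mult_closed perm_brauer_in_brauer assms)
  show P: "perm_brauer n (\<tau> \<circ> \<sigma>) \<in> brauer n"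
    by (intro perm_brauer_in_brauer permutes_compose assms)
  have LR: "{LP a, RP (\<tau> (\<sigma> a))} \<in> perm_brauer n \<sigma> \<odot> perm_brauer n \<tau>" if "a \<in> {1..n}" for a
    using that permutes_in_image[OF assms(1), of a] by (intro mult_LR) (auto simp: perm_brauer_iff)
  fix x assume "x \<in> pins n"
  then obtain y where y: "{x, y} \<in> perm_brauer n (\<tau> \<circ> \<sigma>)" using brauer_ex[OF P] by blast
  then obtain a where "a \<in> {1..n}" "{x, y} = {LP a, RP (\<tau> (\<sigma> a))}" unfolding perm_brauer_def by auto
  then show "\<exists>y. {x, y} \<in> perm_brauer n \<sigma> \<odot> perm_brauer n \<tau> \<and> {x, y} \<in> perm_brauer n (\<tau> \<circ> \<sigma>)"
    using y LR by metis
qed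

lemma conj_elem_id: "\<alpha> \<in> brauer n \<Longrightarrow> conj_elem n id \<alpha> = \<alpha>"
  unfolding conj_elem_def by (simp add: perm_id_mult inv_id)

lemma conj_elem_comp:
  assumes "\<sigma> permutes {1..n}" "\<tau> permutes {1..n}"
  shows "conj_elem n \<sigma> (conj_elem n \<tau> \<alpha>) = conj_elem n (\<sigma> \<circ> \<tau>) \<alpha>"
proof -
  have "inv' (\<sigma> \<circ> \<tau>) = inv' \<tau> \<circ> inv' \<sigma>"
    using o_inv_distrib permutes_bij assms by blast
  then show ?thesis
    unfolding conj_elem_def
    by (simp add: perm_mult[OF assms(2,1), symmetric] perm_mult[OF permutes_inv permutes_inv, OF assms, symmetric]
      brauer_mult_assoc)
qed

lemma conj_elem_mult:
  assumes "\<sigma> permutes {1..n}" "\<beta> \<in> brauer n"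
  shows "conj_elem n \<sigma> (\<alpha> \<odot> \<beta>) = conj_elem n \<sigma> \<alpha> \<odot> conj_elem n \<sigma> \<beta>"
proof -
  have "perm_brauer n \<sigma> \<odot> (perm_brauer n (inv' \<sigma>) \<odot> \<gamma>) = \<gamma>" if "\<gamma> \<in> brauer n" for \<gamma>
    using that by (simp add: brauer_mult_assoc[symmetric] perm_mult[OF assms(1) permutes_inv[OF assms(1)]]
      permutes_inv_o[OF assms(1)] perm_id_mult)
  moreover have "\<beta> \<odot> perm_brauer n \<sigma> \<in> brauer n"
    by (intro brauer_mult_closed assms perm_brauer_in_brauer)
  ultimately show ?thesis unfolding conj_elem_def by (simp add: brauer_mult_assoc)
qed

lemma conj_elem_inv:
  assumes "\<sigma> permutes {1..n}" "\<alpha> \<in> brauer n"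
  shows "conj_elem n \<sigma> (conj_elem n (inv' \<sigma>) \<alpha>) = \<alpha>" "conj_elem n (inv' \<sigma>) (conj_elem n \<sigma> \<alpha>) = \<alpha>"
  using assms permutes_inv_o[OF assms(1)]
  by (simp_all add: conj_elem_comp permutes_inv conj_elem_id)

lemma conj_elem_cross_section:
  assumes "\<sigma> permutes {1..n}" "\<Theta> \<in> R_cross_sections n"
  shows "conj_elem n \<sigma> ` \<Theta> \<in> R_cross_sections n"
proof -
  note B = cross_section_brauer[OF assms(2)] and iv = permutes_inv[OF assms(1)]
  have inj: "inj ((`) \<sigma>)" by (simp add: inj_def inj_image_eq_iff[OF permutes_inj[OF assms(1)]])
  show ?thesis
  proof (rule cross_sectionI)
    fix \<alpha> assume "\<alpha> \<in> conj_elem n \<sigma> ` \<Theta>"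
    then show "\<alpha> \<in> brauer n" by (elim imageE) (simp add: conj_elem_brauer[OF assms(1)] B)
  next
    fix \<alpha> \<beta> assume "\<alpha> \<in> conj_elem n \<sigma> ` \<Theta>" "\<beta> \<in> conj_elem n \<sigma> ` \<Theta>"
    then obtain \<gamma> \<delta> where gd: "\<gamma> \<in> \<Theta>" "\<delta> \<in> \<Theta>" "\<alpha> = conj_elem n \<sigma> \<gamma>" "\<beta> = conj_elem n \<sigma> \<delta>"
      by (elim imageE)
    then have "\<alpha> \<odot> \<beta> = conj_elem n \<sigma> (\<gamma> \<odot> \<delta>)" by (simp add: conj_elem_mult[OF assms(1)] B)
    then show "\<alpha> \<odot> \<beta> \<in> conj_elem n \<sigma> ` \<Theta>" using cross_section_mult[OF assms(2) gd(1,2)] by simp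
  next
    fix L assume L: "matching n L"
    note m = mirror_brauer[OF L]
    \<comment> \<open>Any diagram with left pairs \<open>L\<close> would serve; conjugating it back
      names the R-class from which the element of \<open>\<Theta>\<close> has to be taken.\<close>
    obtain \<alpha> where a: "\<alpha> \<in> \<Theta>" "lft \<alpha> = lft (conj_elem n (inv' \<sigma>) (mirror n L))"
      using cross_section_ex[OF assms(2) matching_lft[OF conj_elem_brauer[OF iv m(1)]]] .
    have "lft (conj_elem n \<sigma> \<alpha>) = L"
      using conj_elem_lft(1)[OF assms(1) conj_elem_brauer[OF iv m(1)]] conj_elem_inv(1)[OF assms(1) m(1)]
      by (simp add: conj_elem_lft[OF assms(1) B[OF a(1)]] a(2) m(2))
    then show "\<exists>\<alpha>. \<alpha> \<in> conj_elem n \<sigma> ` \<Theta> \<and> lft \<alpha> = L" using a(1) by blast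
  next
    fix \<alpha> \<beta> assume ab: "\<alpha> \<in> conj_elem n \<sigma> ` \<Theta>" "\<beta> \<in> conj_elem n \<sigma> ` \<Theta>" "lft \<alpha> = lft \<beta>"
    then obtain \<gamma> \<delta> where gd: "\<gamma> \<in> \<Theta>" "\<delta> \<in> \<Theta>" "\<alpha> = conj_elem n \<sigma> \<gamma>" "\<beta> = conj_elem n \<sigma> \<delta>"
      by (elim imageE)
    then have "(`) \<sigma> ` lft \<gamma> = (`) \<sigma> ` lft \<delta>" using ab(3) by (simp add: conj_elem_lft[OF assms(1)] B)
    then have "lft \<gamma> = lft \<delta>" using inj by (simp add: inj_image_eq_iff)
    then show "\<alpha> = \<beta>" using cross_section_unique[OF assms(2) gd(1,2)] gd by simp
  qed
qed

section \<open>The conjugation action on cross-sections\<close>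

lemma conj_action_eq:
  "\<Theta> \<in> R_cross_sections n \<Longrightarrow> conj_action n \<sigma> \<Theta> = conj_elem n \<sigma> ` \<Theta>"
  unfolding conj_action_def conj_elem_def by simp

lemma carrier_sym_group: "\<sigma> \<in> carrier (sym_group n) \<longleftrightarrow> \<sigma> permutes {1..n}"
  by (simp add: sym_group_def)

lemma conj_action_comp:
  assumes "\<sigma> permutes {1..n}" "\<tau> permutes {1..n}" "\<Theta> \<in> R_cross_sections n"
  shows "conj_action n \<sigma> (conj_action n \<tau> \<Theta>) = conj_action n (\<sigma> \<circ> \<tau>) \<Theta>"
  using assms by (simp add: conj_action_eq conj_elem_cross_section image_image conj_elem_comp)

lemma conj_action_id: "\<Theta> \<in> R_cross_sections n \<Longrightarrow> conj_action n id \<Theta> = \<Theta>"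
proof -
  assume T: "\<Theta> \<in> R_cross_sections n"
  then have "\<And>\<alpha>. \<alpha> \<in> \<Theta> \<Longrightarrow> conj_elem n id \<alpha> = \<alpha>" using conj_elem_id cross_section_brauer by metis
  then show ?thesis unfolding conj_action_eq[OF T] by simp
qed

lemma conj_action_closed:
  "\<sigma> permutes {1..n} \<Longrightarrow> \<Theta> \<in> R_cross_sections n \<Longrightarrow> conj_action n \<sigma> \<Theta> \<in> R_cross_sections n"
  by (simp add: conj_action_eq conj_elem_cross_section)

lemma conj_group_action: "group_action (sym_group n) (R_cross_sections n) (conj_action n)"
proof -
  have bij: "conj_action n \<sigma> \<in> carrier (BijGroup (R_cross_sections n))" if s: "\<sigma> permutes {1..n}" for \<sigma>
  proof -
    note iv = permutes_inv[OF s]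
    have "bij_betw (conj_action n \<sigma>) (R_cross_sections n) (R_cross_sections n)"
      by (rule bij_betw_byWitness[of _ "conj_action n (inv' \<sigma>)"])
        (use permutes_inv_o[OF s] s iv in \<open>auto simp: conj_action_comp conj_action_id conj_action_closed\<close>)
    then show ?thesis by (simp add: BijGroup_def Bij_def conj_action_def)
  qed
  have "conj_action n (\<sigma> \<circ> \<tau>) = compose (R_cross_sections n) (conj_action n \<sigma>) (conj_action n \<tau>)"
    if "\<sigma> permutes {1..n}" "\<tau> permutes {1..n}" for \<sigma> \<tau>
  proof (rule extensionalityI[of _ "R_cross_sections n"])
    show "conj_action n (\<sigma> \<circ> \<tau>) \<in> extensional (R_cross_sections n)" by (simp add: conj_action_def)
    show "compose (R_cross_sections n) (conj_action n \<sigma>) (conj_action n \<tau>) \<in> extensional (R_cross_sections n)"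
      by (rule compose_extensional)
    fix \<Theta> assume "\<Theta> \<in> R_cross_sections n"
    then show "conj_action n (\<sigma> \<circ> \<tau>) \<Theta> = compose (R_cross_sections n) (conj_action n \<sigma>) (conj_action n \<tau>) \<Theta>"
      using that by (simp add: compose_def conj_action_comp)
  qed
  then have "conj_action n \<in> hom (sym_group n) (BijGroup (R_cross_sections n))"
    using bij by (intro homI) (auto simp: sym_group_def BijGroup_def)
  then show ?thesis
    unfolding group_action_def group_hom_def group_hom_axioms_def
    using sym_group_is_group group_BijGroup by blast
qed

section \<open>Signed shifts of the standard pairs\<close>

text \<open>Level 0 consists of \<open>n - 1\<close> and \<open>n\<close>. For odd \<open>n\<close>
  the point 1 belongs to no standard pair and is alone on the level \<open>n div 2\<close>, deeper
  than all standard pairs.\<close>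

definition lev :: "nat \<Rightarrow> nat \<Rightarrow> nat" where
  "lev n x = (n - x) div 2"

text \<open>The identity outside \<open>{1..n}\<close>, so that it is a permutation in the sense of
  \<open>permutes\<close>; for odd \<open>n\<close> it also fixes the unpaired point 1.\<close>

definition bar :: "nat \<Rightarrow> nat \<Rightarrow> nat" where
  "bar n x = (if x \<notin> {1..n} \<or> x = 1 \<and> odd n then x else if even (n - x) then x - 1 else x + 1)"

definition std :: "nat \<Rightarrow> nat \<Rightarrow> nat set" where
  "std n l = {n - Suc (2 * l), n - 2 * l}"

lemma bar_upper: "Suc (2 * k) < n \<Longrightarrow> bar n (n - 2 * k) = n - Suc (2 * k)"
  and bar_lower: "Suc (2 * k) < n \<Longrightarrow> bar n (n - Suc (2 * k)) = n - 2 * k"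
  and lev_upper: "Suc (2 * k) < n \<Longrightarrow> lev n (n - 2 * k) = k"
  and lev_lower: "Suc (2 * k) < n \<Longrightarrow> lev n (n - Suc (2 * k)) = k"
proof -
  assume k: "Suc (2 * k) < n"
  then have "n - Suc (2 * k) = 1 \<Longrightarrow> even n" by presburger
  then show "bar n (n - 2 * k) = n - Suc (2 * k)" "bar n (n - Suc (2 * k)) = n - 2 * k"
    "lev n (n - 2 * k) = k" "lev n (n - Suc (2 * k)) = k"
    using k by (auto simp: bar_def lev_def)
qed

lemma bar_cases:
  assumes "x \<in> {1..n}"
  obtains (single) "odd n" "x = 1" "bar n x = x" "lev n x = n div 2"
  | (upper) k where "x = n - 2 * k" "Suc (2 * k) < n" "bar n x = n - Suc (2 * k)" "lev n x = k"
  | (lower) k where "x = n - Suc (2 * k)" "Suc (2 * k) < n" "bar n x = n - 2 * k" "lev n x = k"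
proof (cases "x = 1 \<and> odd n")
  case True
  then show ?thesis using single by (auto simp: bar_def lev_def elim!: oddE)
next
  case False
  show ?thesis
  proof (cases "even (n - x)")
    case True
    then obtain k where k: "n - x = 2 * k" by (elim evenE)
    then have "x = n - 2 * k" using assms by auto
    moreover have "Suc (2 * k) < n"
    proof (rule ccontr)
      assume "\<not> Suc (2 * k) < n"
      then have "n = 2 * k + 1 \<and> x = 1" using k assms calculation by auto
      then show False using False by simp
    qed
    ultimately show ?thesis using upper[of k] bar_upper[of k n] lev_upper[of k n] by simp
  next
    case odd: False
    then obtain k where k: "n - x = 2 * k + 1" by (elim oddE)
    then have "x = n - Suc (2 * k)" "Suc (2 * k) < n" using assms by auto
    then show ?thesis using lower[of k] bar_lower[of k n] lev_lower[of k n] by simp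
  qed
qed

lemma bar_in [simp]: "bar n x \<in> {1..n} \<longleftrightarrow> x \<in> {1..n}"
proof (cases "x \<in> {1..n}")
  case True then show ?thesis by (cases rule: bar_cases) auto
next
  case False then show ?thesis unfolding bar_def by simp
qed

lemma bar_in' [simp]: "bar n x \<in> {Suc 0..n} \<longleftrightarrow> x \<in> {Suc 0..n}"
  using bar_in[of n x] by simp

lemma bar_bar [simp]: "bar n (bar n x) = x"
proof (cases "x \<in> {1..n}")
  case True then show ?thesis by (cases rule: bar_cases) (auto simp: bar_upper bar_lower)
next
  case False then show ?thesis by (simp add: bar_def)
qed

lemma bar_eq_iff: "bar n x = bar n y \<longleftrightarrow> x = y"
  by (metis bar_bar)

lemma lev_bar [simp]: "lev n (bar n x) = lev n x"
proof (cases "x \<in> {1..n}")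
  case True then show ?thesis by (cases rule: bar_cases) (auto simp: lev_upper lev_lower)
next
  case False then show ?thesis by (simp add: bar_def)
qed

lemma bar_neq: "x \<in> {1..n} \<Longrightarrow> lev n x < n div 2 \<Longrightarrow> bar n x \<noteq> x"
  by (cases rule: bar_cases) auto

lemma lev_eq: "x \<in> {1..n} \<Longrightarrow> y \<in> {1..n} \<Longrightarrow> lev n x = lev n y \<Longrightarrow> y = x \<or> y = bar n x"
  by (cases rule: bar_cases[of x n]; simp; cases rule: bar_cases[of y n]; auto)

lemma lev_le: "x \<in> {1..n} \<Longrightarrow> lev n x \<le> n div 2"
  unfolding lev_def by auto

lemma lev_eq_half:
  assumes "x \<in> {1..n}" "lev n x = n div 2" shows "bar n x = x"
  using assms(1)
proof (cases rule: bar_cases)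
  case (upper k) then show ?thesis using assms(2) by presburger
next
  case (lower k) then show ?thesis using assms(2) by presburger
qed

lemma lev_less_half:
  assumes "x \<in> {1..n}" "y \<in> {1..n}" "x \<noteq> y" "lev n y \<le> lev n x"
  shows "lev n y < n div 2"
proof (rule ccontr)
  assume "\<not> lev n y < n div 2"
  then have "lev n y = n div 2" "lev n x = lev n y" using lev_le[OF assms(1)] lev_le[OF assms(2)] assms(4) by auto
  then show False using lev_eq_half[OF assms(2)] lev_eq[OF assms(2,1)] assms(3) by simp
qed

lemma lev_less_imp: "lev n x > lev n y \<Longrightarrow> x < y"
  unfolding lev_def by (meson diff_le_mono2 div_le_mono leD linorder_le_less_linear)

lemma lev_pos_iff: "x \<in> {1..n} \<Longrightarrow> 0 < lev n x \<longleftrightarrow> x \<le> n - 2"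
  unfolding lev_def by auto

text \<open>The bound says that another standard pair lies below the one of \<open>x\<close>;
  subtracting 2 leads to it and commutes with \<open>bar n\<close>. The inequalities at the end keep
  the truncated subtraction of 2 injective.\<close>

lemma shift_aux:
  assumes "x \<in> {1..n}" "Suc (lev n x) < n div 2"
  shows "x - 2 \<in> {1..n} \<and> lev n (x - 2) = Suc (lev n x) \<and> bar n (x - 2) = bar n x - 2 \<and>
    3 \<le> x \<and> 3 \<le> bar n x"
  using assms(1)
proof (cases rule: bar_cases)
  case single
  then show "x - 2 \<in> {1..n} \<and> lev n (x - 2) = Suc (lev n x) \<and> bar n (x - 2) = bar n x - 2 \<and>
    3 \<le> x \<and> 3 \<le> bar n x" using assms(2) by auto
next
  case (upper k)
  have "Suc k < n div 2" using assms(2) upper by simp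
  then have "Suc (2 * Suc k) < n" by presburger
  moreover have "x - 2 = n - 2 * Suc k" "bar n x - 2 = n - Suc (2 * Suc k)" using upper by auto
  ultimately show "x - 2 \<in> {1..n} \<and> lev n (x - 2) = Suc (lev n x) \<and> bar n (x - 2) = bar n x - 2 \<and>
    3 \<le> x \<and> 3 \<le> bar n x" using upper bar_upper[of "Suc k" n] lev_upper[of "Suc k" n] by auto
next
  case (lower k)
  have "Suc k < n div 2" using assms(2) lower by simp
  then have "Suc (2 * Suc k) < n" by presburger
  moreover have "x - 2 = n - Suc (2 * Suc k)" "bar n x - 2 = n - 2 * Suc k" using lower by auto
  ultimately show "x - 2 \<in> {1..n} \<and> lev n (x - 2) = Suc (lev n x) \<and> bar n (x - 2) = bar n x - 2 \<and>
    3 \<le> x \<and> 3 \<le> bar n x" using lower bar_lower[of "Suc k" n] lev_lower[of "Suc k" n] by auto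
qed

lemmas shift = shift_aux[THEN conjunct1] shift_aux[THEN conjunct2, THEN conjunct1]
  shift_aux[THEN conjunct2, THEN conjunct2, THEN conjunct1]
  shift_aux[THEN conjunct2, THEN conjunct2, THEN conjunct2, THEN conjunct1]
  shift_aux[THEN conjunct2, THEN conjunct2, THEN conjunct2, THEN conjunct2]

lemma std_eq: "l < n div 2 \<Longrightarrow> x \<in> std n l \<longleftrightarrow> x \<in> {1..n} \<and> lev n x = l"
proof
  assume l: "l < n div 2"
  then have l': "Suc (2 * l) < n" by presburger
  show "x \<in> std n l \<Longrightarrow> x \<in> {1..n} \<and> lev n x = l"
    using l' lev_upper[OF l'] lev_lower[OF l'] by (auto simp: std_def)
  assume "x \<in> {1..n} \<and> lev n x = l"
  then have "x \<in> {1..n}" "lev n x = l" by auto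
  then show "x \<in> std n l" using l by (cases rule: bar_cases) (auto simp: std_def)
qed

lemma std_bar: "x \<in> {1..n} \<Longrightarrow> lev n x < n div 2 \<Longrightarrow> {x, bar n x} = std n (lev n x)"
  by (cases rule: bar_cases) (auto simp: std_def)

text \<open>
  The level of a point counts the standard pairs \<open>{n - 1, n}\<close>, \<open>{n - 3, n - 2}\<close>, \<dots> from the top,
  and the two points of a standard pair are exchanged by \<open>bar n\<close>. In a normalised canonical
  cross-section the element whose only left pair is \<open>p\<close> sends \<open>x\<close> to \<open>phi n T p x\<close>: standard pairs of
  level smaller than the levels of both points of \<open>p\<close> move down by one pair, twisted if \<open>p \<in> T\<close>.
  Pairs are written \<open>{a, b}\<close> with the deeper point \<open>a\<close> first; \<open>Max p\<close> is then a point of the smaller level.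
\<close>

definition phi :: "nat \<Rightarrow> nat set set \<Rightarrow> nat set \<Rightarrow> nat \<Rightarrow> nat" where
  "phi n T p x = (if lev n x < lev n (Max p) then (if p \<in> T then bar n (x - 2) else x - 2)
     else if x = bar n (Max p) then Min p else x)"

definition deep_pair :: "nat \<Rightarrow> nat \<Rightarrow> nat \<Rightarrow> bool" where
  "deep_pair n a b \<longleftrightarrow> a \<in> {1..n} \<and> b \<in> {1..n} \<and> a \<noteq> b \<and> lev n b \<le> lev n a"

lemma deep_pair_ex:
  assumes "card p = 2" "p \<subseteq> {1..n}"
  obtains a b where "p = {a, b}" "deep_pair n a b"
proof -
  obtain x y where "p = {x, y}" "x \<noteq> y" using assms(1) by (meson card_2_iff)
  then show ?thesis using that[of x y] that[of y x] assms(2)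
    by (cases "lev n y \<le> lev n x") (auto simp: deep_pair_def insert_commute)
qed

lemma deep_pair_half: "deep_pair n a b \<Longrightarrow> lev n b < n div 2"
  unfolding deep_pair_def using lev_less_half by blast

lemma deep_pair_cases:
  assumes "deep_pair n a b" obtains "a = bar n b" | "lev n b < lev n a"
  using assms lev_eq[of b n a] unfolding deep_pair_def by fastforce

text \<open>\<open>Max\<close> and \<open>Min\<close> make \<open>phi\<close> depend on the set
  only. Deeper points are smaller numbers, so \<open>Max\<close> is \<open>b\<close> unless
  \<open>a = bar n b\<close>; in that case both points have the same level and the partner branch is
  never met outside the pair.\<close>

lemma phi_eq:
  assumes "deep_pair n a b" "x \<notin> {a, b}"
  shows "phi n T {a, b} x = (if lev n x < lev n b then (if {a, b} \<in> T then bar n (x - 2) else x - 2)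
     else if x = bar n b then a else x)"
  using assms(1)
proof (cases rule: deep_pair_cases)
  case 1
  show ?thesis
  proof (cases "a < b")
    case True then show ?thesis using 1 assms(2) unfolding phi_def by (simp add: max_def min_def)
  next
    case False
    then have "Max {a, b} = a" "Min {a, b} = b" by (auto simp: max_def min_def)
    then show ?thesis using 1 assms(2) unfolding phi_def by auto
  qed
next
  case 2
  then have "a < b" by (rule lev_less_imp)
  then have "Max {a, b} = b" "Min {a, b} = a" by (auto simp: max_def min_def)
  then show ?thesis unfolding phi_def by simp
qed

lemma phi_above:
  assumes "deep_pair n a b" "x \<in> {1..n}" "lev n x < lev n b"
  shows "phi n T {a, b} x = (if {a, b} \<in> T then bar n (x - 2) else x - 2)"
    "lev n (phi n T {a, b} x) = Suc (lev n x)" "phi n T {a, b} x \<in> {1..n}"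
    "phi n T {a, b} (bar n x) = bar n (phi n T {a, b} x)"
proof -
  have "Suc (lev n x) < n div 2" using deep_pair_half[OF assms(1)] assms(3) by simp
  note s = shift[OF assms(2) this]
  have "x \<notin> {a, b}" "bar n x \<notin> {a, b}" using assms(1,3) lev_bar[of n x] unfolding deep_pair_def by fastforce+
  note p = phi_eq[OF assms(1) this(1)] phi_eq[OF assms(1) this(2)]
  show "phi n T {a, b} x = (if {a, b} \<in> T then bar n (x - 2) else x - 2)"
    using p assms(3) by simp
  then show "lev n (phi n T {a, b} x) = Suc (lev n x)" "phi n T {a, b} x \<in> {1..n}"
    using s(1,2) by (simp_all del: atLeastAtMost_iff)
  show "phi n T {a, b} (bar n x) = bar n (phi n T {a, b} x)"
    unfolding p using assms(3) by (simp add: s(3)[symmetric])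
qed

lemma phi_below:
  assumes "deep_pair n a b" "x \<notin> {a, b}" "lev n b < lev n x"
  shows "phi n T {a, b} x = x"
  using phi_eq[OF assms(1,2)] assms(3) by auto

lemma phi_partner:
  assumes "deep_pair n a b" "bar n b \<noteq> a"
  shows "phi n T {a, b} (bar n b) = a"
proof -
  have "bar n b \<noteq> b" using bar_neq deep_pair_half[OF assms(1)] assms(1) unfolding deep_pair_def by blast
  then show ?thesis using phi_eq[OF assms(1), of "bar n b"] assms(2) by simp
qed

lemma phi_cases:
  assumes "deep_pair n a b" "x \<in> {1..n}" "x \<notin> {a, b}"
  obtains (above) "lev n x < lev n b" | (partner) "x = bar n b" "lev n b < lev n a" "phi n T {a, b} x = a"
  | (below) "lev n b < lev n x" "phi n T {a, b} x = x"
proof -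
  have b: "b \<in> {1..n}" using assms(1) unfolding deep_pair_def by simp
  consider "lev n x < lev n b" | "lev n x = lev n b" | "lev n b < lev n x" by linarith
  then show ?thesis
  proof cases
    case 2
    then have "x = bar n b" using lev_eq[OF b assms(2)] assms(3) by auto
    moreover have "lev n b < lev n a" using assms(1)
      by (cases rule: deep_pair_cases) (use calculation assms(3) in auto)
    ultimately show ?thesis using partner phi_partner[OF assms(1)] assms(3) by auto
  qed (use above below phi_below[OF assms(1,3)] in auto)
qed

text \<open>Points of level less than \<open>lev n b\<close> land on levels at most
  \<open>lev n b\<close>, all others on larger levels. Collisions are thus possible only within one
  kind, where the map is a shift, or the identity apart from \<open>bar n b\<close>.\<close>

lemma phi_inj:
  assumes "deep_pair n a b" "x \<in> {1..n}" "x \<notin> {a, b}" "y \<in> {1..n}" "y \<notin> {a, b}"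
    and eq: "phi n T {a, b} x = phi n T {a, b} y"
  shows "x = y"
proof -
  have above: "u = v" if "lev n u < lev n b" "lev n v < lev n b" "u \<in> {1..n}" "v \<in> {1..n}"
    "phi n T {a, b} u = phi n T {a, b} v" for u v
  proof -
    have "Suc (lev n u) < n div 2" "Suc (lev n v) < n div 2"
      using deep_pair_half[OF assms(1)] that by auto
    note s = shift(4)[OF that(3) this(1)] shift(4)[OF that(4) this(2)]
    have "u - 2 = v - 2"
      using phi_above(1)[OF assms(1) that(3,1), where T = T] phi_above(1)[OF assms(1) that(4,2), where T = T] that(5)
      by (auto simp: bar_eq_iff split: if_splits)
    then show ?thesis using s by simp
  qed
  have low: "lev n (phi n T {a, b} u) \<le> lev n b" if "lev n u < lev n b" "u \<in> {1..n}" for u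
    using phi_above(2)[OF assms(1) that(2,1), where T = T] that by simp
  have deep: "lev n b < lev n (phi n T {a, b} u) \<and>
      (u = bar n b \<and> phi n T {a, b} u = a \<or> phi n T {a, b} u = u)"
    if "\<not> lev n u < lev n b" "u \<in> {1..n}" "u \<notin> {a, b}" for u
    by (cases rule: phi_cases[OF assms(1) that(2,3), where T = T]) (use that(1) in simp_all)
  show ?thesis
  proof (cases "lev n x < lev n b")
    case x: True
    have "lev n y < lev n b"
      by (rule ccontr) (use deep[OF _ assms(4,5)] low[OF x assms(2)] eq in simp)
    then show ?thesis using above[OF x _ assms(2,4) eq] by simp
  next
    case x: False
    have y: "\<not> lev n y < lev n b"
      using deep[OF x assms(2,3)] low[OF _ assms(4)] eq by force
    show ?thesis using deep[OF x assms(2,3)] deep[OF y assms(4,5)] eq assms(3,5) by auto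
  qed
qed

lemma phi_range:
  assumes "deep_pair n a b" "x \<in> {1..n}" "x \<notin> {a, b}"
  shows "phi n T {a, b} x \<in> {1..n - 2}"
proof -
  have "phi n T {a, b} x \<in> {1..n} \<and> 0 < lev n (phi n T {a, b} x)"
    proof (cases rule: phi_cases[OF assms, where T = T])
    case 1 then show ?thesis using phi_above[OF assms(1,2), where T = T] by simp
  next
    case 2 then show ?thesis using assms(1) unfolding deep_pair_def by simp
  next
    case 3 then show ?thesis using assms(2) by simp
  qed
  then show ?thesis using lev_pos_iff[of "phi n T {a, b} x" n] by auto
qed

text \<open>Injectivity and a count of \<open>n - 2\<close> points on both sides. The two missing
  values form the right pair of \<open>gen\<close>.\<close>

lemma phi_image:
  assumes "deep_pair n a b" shows "phi n T {a, b} ` ({1..n} - {a, b}) = {1..n - 2}"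
proof (rule card_subset_eq)
  show "phi n T {a, b} ` ({1..n} - {a, b}) \<subseteq> {1..n - 2}" using phi_range[OF assms] by blast
  have "inj_on (phi n T {a, b}) ({1..n} - {a, b})"
  proof (rule inj_onI)
    fix x y assume xy: "x \<in> {1..n} - {a, b}" "y \<in> {1..n} - {a, b}"
      "phi n T {a, b} x = phi n T {a, b} y"
    show "x = y" by (rule phi_inj[OF assms _ _ _ _ xy(3)]) (use xy(1,2) in simp_all)
  qed
  then have "card (phi n T {a, b} ` ({1..n} - {a, b})) = card ({1..n} - {a, b})"
    by (rule card_image)
  also have "\<dots> = n - 2"
    using assms card_Diff_subset[of "{a, b}" "{1..n}"] unfolding deep_pair_def by simp
  finally show "card (phi n T {a, b} ` ({1..n} - {a, b})) = card {1..n - 2}" by simp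
qed simp

section \<open>Sign sets and the commutation of signed shifts\<close>

text \<open>These are the pairs whose sign can be chosen: if \<open>lev n b = 0\<close>, no standard
  pair lies above \<open>{a, b}\<close>, and a pair with both points on one level is a standard
  pair, whose generator the normalisation untwists.\<close>

definition mixed :: "nat \<Rightarrow> nat set set" where
  "mixed n = {{a, b} |a b. a \<in> {1..n} \<and> b \<in> {1..n} \<and> lev n b < lev n a \<and> 0 < lev n b}"

text \<open>
  The two closure conditions say precisely that \<open>\<alpha>\<^sub>p \<alpha>\<^sub>q' = \<alpha>\<^sub>q \<alpha>\<^sub>p'\<close> for disjoint \<open>p\<close>, \<open>q\<close>, where
  \<open>q'\<close> and \<open>p'\<close> are the images of \<open>q\<close> under \<open>\<alpha>\<^sub>p\<close> and of \<open>p\<close> under \<open>\<alpha>\<^sub>q\<close>. Pairs outside \<open>mixed n\<close>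
  carry no free sign once the cross-section is normalised.
\<close>

definition valid :: "nat \<Rightarrow> nat set set \<Rightarrow> bool" where
  "valid n T \<longleftrightarrow> T \<subseteq> mixed n \<and>
     (\<forall>a b c. {a, b} \<in> mixed n \<and> {c, bar n b} \<in> mixed n \<and> lev n b < lev n a \<and> lev n b < lev n c \<and> a \<noteq> c \<longrightarrow>
       ({a, b} \<in> T \<longleftrightarrow> {c, bar n b} \<in> T)) \<and>
     (\<forall>a b c d. deep_pair n a b \<and> {c, d} \<in> mixed n \<and> lev n d < lev n c \<and> lev n d < lev n b \<and>
       {a, b} \<inter> {c, d} = {} \<longrightarrow> ({phi n T {a, b} c, phi n T {a, b} d} \<in> T \<longleftrightarrow> {c, d} \<in> T))"

lemma pair_mixed:
  "{a, b} \<in> mixed n \<longleftrightarrow> a \<in> {1..n} \<and> b \<in> {1..n} \<and> lev n a \<noteq> lev n b \<and> 0 < lev n a \<and> 0 < lev n b"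
proof
  assume "{a, b} \<in> mixed n"
  then show "a \<in> {1..n} \<and> b \<in> {1..n} \<and> lev n a \<noteq> lev n b \<and> 0 < lev n a \<and> 0 < lev n b"
    unfolding mixed_def by (auto simp: doubleton_eq_iff)
next
  assume r: "a \<in> {1..n} \<and> b \<in> {1..n} \<and> lev n a \<noteq> lev n b \<and> 0 < lev n a \<and> 0 < lev n b"
  then consider "lev n b < lev n a" | "lev n a < lev n b" by linarith
  then show "{a, b} \<in> mixed n"
  proof cases
    case 2
    then have "{b, a} \<in> mixed n" unfolding mixed_def using r by blast
    then show ?thesis by (simp add: insert_commute)
  qed (unfold mixed_def, use r in blast)
qed

text \<open>Extends the second closure condition to standard pairs \<open>{c, d}\<close>: such a
  pair and its image both lie outside \<open>mixed n\<close>, hence outside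
  \<open>T\<close>.\<close>

lemma valid_sign:
  assumes "valid n T" "deep_pair n a b" "deep_pair n c d" "lev n d < lev n b" "{a, b} \<inter> {c, d} = {}" "0 < lev n d"
  shows "{phi n T {a, b} c, phi n T {a, b} d} \<in> T \<longleftrightarrow> {c, d} \<in> T"
  using assms(3)
proof (cases rule: deep_pair_cases)
  case 1
  have d: "d \<in> {1..n}" using assms(3) unfolding deep_pair_def by simp
  have "lev n (phi n T {a, b} c) = lev n (phi n T {a, b} d)"
    using phi_above(4)[OF assms(2) d assms(4), where T = T] 1 by simp
  then have "{phi n T {a, b} c, phi n T {a, b} d} \<notin> mixed n" "{c, d} \<notin> mixed n"
    using 1 by (auto simp only: pair_mixed lev_bar)
  then show ?thesis using assms(1) unfolding valid_def by blast
next
  case 2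
  then have "{c, d} \<in> mixed n" using assms(3,6) unfolding pair_mixed deep_pair_def by simp
  then show ?thesis using assms(1,2,4,5) 2 unfolding valid_def by blast
qed

text \<open>If the levels of \<open>b\<close> and \<open>d\<close> agree, then
  \<open>d = bar n b\<close> and both second factors belong to the pair \<open>{a, c}\<close>; what
  remains is equality of two signs, the first closure condition. If \<open>d\<close> lies on a
  smaller level, the map of \<open>{c, d}\<close> fixes \<open>a\<close> and \<open>b\<close>, and
  the sign of \<open>{c, d}\<close> must agree with that of its image, the second condition.\<close>

lemma phi_commute_aux:
  assumes T: "valid n T" and p: "deep_pair n a b" and q: "deep_pair n c d"
    and disj: "{a, b} \<inter> {c, d} = {}" and le: "lev n d \<le> lev n b"
    and x: "x \<in> {1..n}" "x \<notin> {a, b}" "x \<notin> {c, d}"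
  shows "phi n T (phi n T {a, b} ` {c, d}) (phi n T {a, b} x) = phi n T (phi n T {c, d} ` {a, b}) (phi n T {c, d} x)"
proof (cases "lev n d = lev n b")
  case True
  have in_n: "a \<in> {1..n}" "b \<in> {1..n}" "c \<in> {1..n}" "d \<in> {1..n}" using p q unfolding deep_pair_def by auto
  have db: "d = bar n b" using lev_eq[OF in_n(2,4)] True disj by auto
  have lev_a: "lev n b < lev n a" using p by (cases rule: deep_pair_cases) (use db disj in auto)
  have lev_c: "lev n b < lev n c" using q by (cases rule: deep_pair_cases) (use db disj in auto)
  have "phi n T {a, b} c = c" using phi_below[OF p _ lev_c] disj by simp
  moreover have "phi n T {a, b} d = a" using phi_partner[OF p] db disj by auto
  moreover have "phi n T {c, d} a = a" using phi_below[OF q] lev_a True disj by simp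
  moreover have "phi n T {c, d} b = c" using phi_partner[OF q] db disj by auto
  moreover have "phi n T {a, b} x = phi n T {c, d} x"
  proof (cases "lev n x < lev n b")
    case less: True
    then have "{a, b} \<in> mixed n" "{c, bar n b} \<in> mixed n"
      unfolding pair_mixed using in_n lev_a lev_c by (simp_all del: atLeastAtMost_iff)
    then have "{a, b} \<in> T \<longleftrightarrow> {c, d} \<in> T" using T lev_a lev_c disj unfolding valid_def db by blast
    then show ?thesis using phi_above(1)[OF p x(1)] phi_above(1)[OF q x(1)] less True by simp
  next
    case False
    have "lev n b < lev n x" using False lev_eq[OF in_n(2) x(1)] x db by force
    then show ?thesis using phi_below[OF p x(2)] phi_below[OF q x(3)] True by simp
  qed
  ultimately show ?thesis by (simp add: insert_commute)
next
  case False
  then have less: "lev n d < lev n b" using le by simp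
  have in_n: "a \<in> {1..n}" "b \<in> {1..n}" "c \<in> {1..n}" "d \<in> {1..n}" using p q unfolding deep_pair_def by auto
  let ?c = "phi n T {a, b} c" and ?d = "phi n T {a, b} d" and ?y = "phi n T {a, b} x"
  have cd: "c \<notin> {a, b}" "d \<notin> {a, b}" "c \<noteq> d" using disj q unfolding deep_pair_def by auto
  have d': "lev n ?d = Suc (lev n d)" "?d \<in> {1..n}" using phi_above[OF p in_n(4) less] by auto
  \<comment> \<open>Only points on the level of \<open>d\<close> can reach the level of the image of
    \<open>d\<close>, so the image of \<open>{c, d}\<close> is again written with its deeper point
    first.\<close>
  have lev_phi: "lev n ?d < lev n (phi n T {a, b} u) \<or> lev n u = lev n d \<and> lev n (phi n T {a, b} u) = lev n ?d"
    if "u \<in> {1..n}" "u \<notin> {a, b}" "lev n d \<le> lev n u" for u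
    proof (cases rule: phi_cases[OF p that(1,2), where T = T])
    case 1 then show ?thesis using phi_above(2)[OF p that(1) 1, where T = T] d' that(3) by auto
  next
    case 2 then show ?thesis using d' less by auto
  next
    case 3 then show ?thesis using d' less by auto
  qed
  have range: "phi n T {a, b} u \<in> {1..n}" if "u \<in> {1..n}" "u \<notin> {a, b}" for u
    using phi_range[OF p that, where T = T] by auto
  have q': "deep_pair n ?c ?d"
    using lev_phi[OF in_n(3) cd(1)] range[OF in_n(3) cd(1)] d' q phi_inj[OF p in_n(3) cd(1) in_n(4) cd(2), where T = T] cd(3)
    unfolding deep_pair_def by auto
  have y': "?y \<notin> {?c, ?d}"
    using phi_inj[OF p x(1,2) in_n(3) cd(1), where T = T] phi_inj[OF p x(1,2) in_n(4) cd(2), where T = T] x(3) by auto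
  have "phi n T {c, d} a = a" using phi_below[OF q, where T = T] less p disj unfolding deep_pair_def by auto
  moreover have "phi n T {c, d} b = b" using phi_below[OF q, where T = T] less disj by auto
  moreover have "phi n T {?c, ?d} ?y = phi n T {a, b} (phi n T {c, d} x)"
    proof (cases rule: phi_cases[OF q x(1,3), where T = T])
    case 1
    let ?z = "phi n T {c, d} x"
    have xb: "lev n x < lev n b" using 1 less by simp
    have z: "lev n ?z = Suc (lev n x)" "?z \<in> {1..n}" using phi_above[OF q x(1) 1] by auto
    have zb: "lev n ?z < lev n b" using z(1) 1 less by simp
    have y: "lev n ?y = Suc (lev n x)" "?y \<in> {1..n}" using phi_above[OF p x(1) xb] by auto
    have yd: "lev n ?y < lev n ?d" using y(1) d'(1) 1 by simp
    have sgn: "{?c, ?d} \<in> T \<longleftrightarrow> {c, d} \<in> T"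
      using valid_sign[OF T p q less disj] 1 by simp
    have "Suc (lev n x) < n div 2" "Suc (lev n ?y) < n div 2" "Suc (lev n ?z) < n div 2"
      using deep_pair_half[OF p] deep_pair_half[OF q'] zb yd xb by auto
    note s = shift[OF x(1) this(1)] shift[OF y(2) this(2)] shift[OF z(2) this(3)]
    \<comment> \<open>Twisting before the second shift is the same as twisting after it, so the
      twists of the two factors may be taken in either order.\<close>
    have bx: "bar n (x - 2) - 2 = bar n (x - 2 - 2)"
    proof -
      have "Suc (lev n (x - 2)) < n div 2" using s(2) \<open>Suc (lev n ?y) < n div 2\<close> y(1) by simp
      then show ?thesis using shift(3)[OF s(1)] by simp
    qed
    show ?thesis
      unfolding phi_above(1)[OF q' y(2) yd] phi_above(1)[OF p z(2) zb] sgn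
      unfolding phi_above(1)[OF p x(1) xb] phi_above(1)[OF q x(1) 1] using bx by simp
  next
    case 2
    have "?y = bar n ?d" using phi_above(4)[OF p in_n(4) less, where T = T] 2(1) by simp
    then show ?thesis using phi_partner[OF q', where T = T] y' 2(3) by auto
  next
    case 3
    have "lev n ?d < lev n ?y" using lev_phi[OF x(1,2)] 3(1) by auto
    then show ?thesis using phi_below[OF q' y'] 3(2) by simp
  qed
  ultimately show ?thesis by simp
qed

lemma phi_commute:
  assumes "valid n T" "deep_pair n a b" "deep_pair n c d" "{a, b} \<inter> {c, d} = {}"
    and "x \<in> {1..n}" "x \<notin> {a, b}" "x \<notin> {c, d}"
  shows "phi n T (phi n T {a, b} ` {c, d}) (phi n T {a, b} x) = phi n T (phi n T {c, d} ` {a, b}) (phi n T {c, d} x)"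
proof (cases "lev n d \<le> lev n b")
  case True then show ?thesis using phi_commute_aux assms by blast
next
  case False
  then show ?thesis using phi_commute_aux[OF assms(1,3,2) _ _ assms(5,7,6)] assms(4) by (simp add: Int_commute)
qed

section \<open>The cross-section of a valid set of signs\<close>

definition gen :: "nat \<Rightarrow> nat set set \<Rightarrow> nat set \<Rightarrow> pin set set" where
  "gen n T p = {LP ` p, {RP (n - 1), RP n}} \<union> {{LP x, RP (phi n T p x)} |x. x \<in> {1..n} - p}"

lemma deep_pair_ge: "deep_pair n a b \<Longrightarrow> 2 \<le> n"
  unfolding deep_pair_def by auto

lemma top_range: "(y :: nat) \<in> {1..n} \<Longrightarrow> y \<notin> {1..n - 2} \<Longrightarrow> y = n - 1 \<or> y = n"
  by auto

context
  fixes n :: nat and T :: "nat set set" and a b :: nat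
  assumes ab: "deep_pair n a b"
begin

lemma gen_LR: "{LP x, RP y} \<in> gen n T {a, b} \<longleftrightarrow> x \<in> {1..n} - {a, b} \<and> y = phi n T {a, b} x"
  unfolding gen_def by (auto simp: doubleton_eq_iff)

lemma gen_LL: "{LP x, LP y} \<in> gen n T {a, b} \<longleftrightarrow> {x, y} = {a, b}"
  unfolding gen_def by (auto simp: doubleton_eq_iff)

lemma gen_RR: "{RP x, RP y} \<in> gen n T {a, b} \<longleftrightarrow> {x, y} = {n - 1, n}"
  unfolding gen_def by (auto simp: doubleton_eq_iff)

lemma gen_block:
  assumes "B \<in> gen n T {a, b}"
  shows "B = {LP a, LP b} \<or> B = {RP (n - 1), RP n} \<or>
    (\<exists>x. x \<in> {1..n} - {a, b} \<and> B = {LP x, RP (phi n T {a, b} x)})"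
  using assms unfolding gen_def by auto

lemma gen_brauer: "gen n T {a, b} \<in> brauer n"
proof (rule brauerI)
  have ab': "a \<in> {1..n}" "b \<in> {1..n}" "a \<noteq> b" and n: "2 \<le> n"
    using ab deep_pair_ge[OF ab] unfolding deep_pair_def by auto
  have range: "phi n T {a, b} x \<in> {1..n - 2}" if "x \<in> {1..n} - {a, b}" for x
    using phi_range[OF ab] that by simp
  show "\<exists>x\<in>pins n. \<exists>y\<in>pins n. x \<noteq> y \<and> B = {x, y}" if B: "B \<in> gen n T {a, b}" for B
    using gen_block[OF B]
  proof (elim disjE exE conjE)
    assume "B = {LP a, LP b}"
    then show ?thesis using ab' by (intro bexI[of _ "LP a"] bexI[of _ "LP b"]) simp_all
  next
    assume "B = {RP (n - 1), RP n}"
    then show ?thesis using n by (intro bexI[of _ "RP (n - 1)"] bexI[of _ "RP n"]) auto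
  next
    fix x assume x: "x \<in> {1..n} - {a, b}" "B = {LP x, RP (phi n T {a, b} x)}"
    then show ?thesis using range[OF x(1)]
      by (intro bexI[of _ "LP x"] bexI[of _ "RP (phi n T {a, b} x)"]) auto
  qed
  show "\<exists>y. {x, y} \<in> gen n T {a, b}" if x: "x \<in> pins n" for x
  proof (cases x)
    case (LP u)
    show ?thesis
    proof (cases "u \<in> {a, b}")
      case True
      then have "{u, a} = {a, b} \<or> {u, b} = {a, b}" by auto
      then show ?thesis using gen_LL LP by metis
    next
      case False
      then have "u \<in> {1..n} - {a, b}" using x LP by simp
      then show ?thesis using gen_LR LP by metis
    qed
  next
    case (RP u)
    show ?thesis
    proof (cases "u \<in> {1..n - 2}")
      case True
      then obtain v where "v \<in> {1..n} - {a, b}" "u = phi n T {a, b} v"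
        using phi_image[OF ab, of T] by (metis imageE)
      then have "{LP v, RP u} \<in> gen n T {a, b}" using gen_LR by simp
      then show ?thesis using RP by (metis insert_commute)
    next
      case False
      then have "u = n - 1 \<or> u = n" using top_range[of u n] x RP by simp
      then have "{u, n} = {n - 1, n} \<or> {u, n - 1} = {n - 1, n}" by auto
      then show ?thesis using gen_RR RP by metis
    qed
  qed
  show "y = z" if yz: "{x, y} \<in> gen n T {a, b}" "{x, z} \<in> gen n T {a, b}" for x y z
  proof -
    have RL: "{RP v, LP u} \<in> gen n T {a, b} \<longleftrightarrow> u \<in> {1..n} - {a, b} \<and> v = phi n T {a, b} u" for u v
      using gen_LR[of u v] by (simp add: insert_commute)
    have top: "phi n T {a, b} u \<noteq> n - 1" "phi n T {a, b} u \<noteq> n" if "u \<in> {1..n} - {a, b}" for u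
      using range[OF that] n by auto
    have inj: "u = v" if "u \<in> {1..n} - {a, b}" "v \<in> {1..n} - {a, b}" "phi n T {a, b} u = phi n T {a, b} v" for u v
      by (rule phi_inj[OF ab _ _ _ _ that(3)]) (use that in simp_all)
    show ?thesis
    proof (cases x)
      case (LP u)
      show ?thesis using yz unfolding LP
        by (cases y; cases z) (auto simp only: gen_LL gen_LR doubleton_eq_iff)
    next
      case (RP u)
      show ?thesis using yz unfolding RP
      proof (cases y; cases z)
        fix v w assume "y = LP v" "z = LP w"
        then show ?thesis using yz unfolding RP using inj[of v w] RL by simp
      next
        fix v w assume "y = LP v" "z = RP w"
        then show ?thesis using yz unfolding RP using top[of v] RL gen_RR by (auto simp: doubleton_eq_iff)
      next
        fix v w assume "y = RP v" "z = LP w"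
        then show ?thesis using yz unfolding RP using top[of w] RL gen_RR by (auto simp: doubleton_eq_iff)
      next
        fix v w assume "y = RP v" "z = RP w"
        then show ?thesis using yz n unfolding RP by (auto simp: gen_RR doubleton_eq_iff)
      qed
    qed
  qed
qed

lemma gen_mult_pair: "{LP a, LP b} \<in> gen n T {a, b} \<odot> \<beta>"
  using ab gen_LL by (intro mult_LL) (auto simp: deep_pair_def)

lemma gen_mult_LL:
  assumes "{LP (phi n T {a, b} c), LP (phi n T {a, b} d)} \<in> \<beta>"
    "c \<in> {1..n} - {a, b}" "d \<in> {1..n} - {a, b}" "c \<noteq> d"
  shows "{LP c, LP d} \<in> gen n T {a, b} \<odot> \<beta>"
  by (rule mult_LLR[OF _ assms(1) _ assms(4)]) (use assms gen_LR in simp_all)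

lemma gen_mult_LR:
  assumes "{LP (phi n T {a, b} x), RP y} \<in> \<beta>" "x \<in> {1..n} - {a, b}"
  shows "{LP x, RP y} \<in> gen n T {a, b} \<odot> \<beta>"
  by (rule mult_LR[OF _ assms(1)]) (use assms gen_LR in simp_all)

lemma gen_mult_RR:
  assumes "{LP (n - 1), RP u} \<in> \<beta>" "{LP n, RP v} \<in> \<beta>" "u \<noteq> v"
  shows "{RP u, RP v} \<in> gen n T {a, b} \<odot> \<beta>"
  by (rule mult_RRL[OF assms(1) _ assms(2,3)]) (use gen_RR in simp)

end

lemma brauer_subset_eq:
  assumes "\<alpha> \<in> brauer n" "\<beta> \<in> brauer n" "\<beta> \<subseteq> \<alpha>" shows "\<alpha> = \<beta>"
proof (rule brauer_eqI[OF assms(1,2)])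
  fix x assume "x \<in> pins n"
  then obtain y where "{x, y} \<in> \<beta>" using brauer_ex[OF assms(2)] by blast
  then show "\<exists>y. {x, y} \<in> \<alpha> \<and> {x, y} \<in> \<beta>" using assms(3) by blast
qed

lemma gen_absorb:
  assumes p: "deep_pair n a b" and r: "deep_pair n m c" and c: "lev n c = 0"
  shows "gen n T {a, b} \<odot> gen n T {m, c} = gen n T {a, b}"
proof (rule brauer_subset_eq)
  show "gen n T {a, b} \<odot> gen n T {m, c} \<in> brauer n"
    by (intro brauer_mult_closed gen_brauer p r)
  show "gen n T {a, b} \<in> brauer n" by (rule gen_brauer[OF p])
  have n: "2 \<le> n" by (rule deep_pair_ge[OF p])
  have c_in: "c \<in> {1..n}" "m \<in> {1..n}" "c \<noteq> m" using r unfolding deep_pair_def by auto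
  have top: "{c, bar n c} = {n - 1, n}"
    using std_bar[OF c_in(1)] c n by (simp add: std_def)
  show "gen n T {a, b} \<subseteq> gen n T {a, b} \<odot> gen n T {m, c}"
  proof
    fix B assume "B \<in> gen n T {a, b}"
    from gen_block[OF p this] show "B \<in> gen n T {a, b} \<odot> gen n T {m, c}"
    proof (elim disjE exE conjE)
      assume "B = {LP a, LP b}"
      then show ?thesis using gen_mult_pair[OF p] by simp
    next
      assume "B = {RP (n - 1), RP n}"
      then show ?thesis using mult_RR[of "n - 1" n] gen_RR[OF r, of "n - 1" n T] n by simp
    next
      fix x assume x: "x \<in> {1..n} - {a, b}" "B = {LP x, RP (phi n T {a, b} x)}"
      let ?z = "phi n T {a, b} x"
      have z: "?z \<in> {1..n - 2}" using phi_range[OF p, of x T] x(1) by simp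
      then have z': "?z \<in> {1..n}" by auto
      have lz: "0 < lev n ?z" using lev_pos_iff[OF z'] z by simp
      have zc: "?z \<noteq> c" using lz c by auto
      have LRx: "{LP x, RP ?z} \<in> gen n T {a, b}" using gen_LR[OF p] x(1) by simp
      show ?thesis
      proof (cases "?z = m")
        case False
        have "phi n T {m, c} ?z = ?z" using phi_below[OF r] False zc lz c by simp
        then have "{LP ?z, RP ?z} \<in> gen n T {m, c}" using gen_LR[OF r] z' False zc by simp
        then show ?thesis using mult_LR[OF LRx] x(2) by blast
      next
        case True
        have bc: "bar n c \<noteq> m"
        proof
          assume "bar n c = m"
          then have "lev n ?z = lev n c" using True lev_bar[of n c] by simp
          then show False using lz c by simp
        qed
        have "{LP m, LP c} \<in> gen n T {m, c}" using gen_LL[OF r] by simp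
        moreover have "{RP c, RP (bar n c)} \<in> gen n T {a, b}" using gen_RR[OF p] top by simp
        moreover have "bar n c \<noteq> c" using bar_neq[OF c_in(1)] c n by simp
        then have "{LP (bar n c), RP m} \<in> gen n T {m, c}"
          using gen_LR[OF r, of "bar n c" m T] phi_partner[OF r bc] bc c_in(1)
          by (simp del: atLeastAtMost_iff)
        ultimately show ?thesis using mult_LRLR[OF LRx, of c "gen n T {m, c}" "bar n c" m] x(2) True by simp
      qed
    qed
  qed
qed

text \<open>Both products have the left pairs \<open>{a, b}\<close> and \<open>{c, d}\<close> and
  the standard right pairs of levels 0 and 1. On the other strands they are the two composites
  compared in \<open>phi_commute\<close>.\<close>

lemma gen_commute:
  assumes T: "valid n T" and p: "deep_pair n a b" and q: "deep_pair n c d" and disj: "{a, b} \<inter> {c, d} = {}"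
  shows "gen n T {a, b} \<odot> gen n T (phi n T {a, b} ` {c, d}) = gen n T {c, d} \<odot> gen n T (phi n T {c, d} ` {a, b})"
proof -
  \<comment> \<open>Stated for arbitrary pairs so that it serves both products, the second time with
    the two pairs exchanged.\<close>
  have blocks: "{LP a, LP b} \<in> \<gamma>" "{LP c, LP d} \<in> \<gamma>" "{RP (n - 1), RP n} \<in> \<gamma>" "\<gamma> \<in> brauer n"
    "\<And>y. y \<in> {1..n} \<Longrightarrow> lev n y = 1 \<Longrightarrow> {RP y, RP (bar n y)} \<in> \<gamma>"
    "\<And>x. x \<in> {1..n} - {a, b} - {c, d} \<Longrightarrow>
      {LP x, RP (phi n T (phi n T {a, b} ` {c, d}) (phi n T {a, b} x))} \<in> \<gamma>"
    "\<And>y. y \<in> {1..n} \<Longrightarrow> 1 < lev n y \<Longrightarrow> \<exists>x. x \<in> {1..n} - {a, b} - {c, d} \<and>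
      y = phi n T (phi n T {a, b} ` {c, d}) (phi n T {a, b} x)"
    if p: "deep_pair n a b" and q: "deep_pair n c d" and disj: "{a, b} \<inter> {c, d} = {}"
      and \<gamma>: "\<gamma> = gen n T {a, b} \<odot> gen n T (phi n T {a, b} ` {c, d})" for a b c d \<gamma>
  proof -
    let ?f = "phi n T {a, b}"
    have n: "2 \<le> n" by (rule deep_pair_ge[OF p])
    have cd: "c \<in> {1..n} - {a, b}" "d \<in> {1..n} - {a, b}" "c \<noteq> d" using q disj unfolding deep_pair_def by auto
    have inj: "u = v" if "?f u = ?f v" "u \<in> {1..n} - {a, b}" "v \<in> {1..n} - {a, b}" for u v
      by (rule phi_inj[OF p _ _ _ _ that(1)]) (use that in simp_all)
    have range: "?f u \<in> {1..n - 2}" if "u \<in> {1..n} - {a, b}" for u using phi_range[OF p, of u T] that by simp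
    have "card {?f c, ?f d} = 2" using inj cd by (metis card_2_iff)
    moreover have "{?f c, ?f d} \<subseteq> {1..n}" using range[OF cd(1)] range[OF cd(2)] by auto
    ultimately obtain e g where q': "{?f c, ?f d} = {e, g}" "deep_pair n e g" by (rule deep_pair_ex)
    have eg: "?f ` {c, d} = {e, g}" using q'(1) by simp
    have eg_sub: "{e, g} \<subseteq> {1..n - 2}"
      unfolding q'(1)[symmetric] using range[OF cd(1)] range[OF cd(2)] by simp
    have g_in: "g \<in> {1..n}" "g \<in> {1..n - 2}" using eg_sub by auto
    have lev_g: "0 < lev n g" using lev_pos_iff[OF g_in(1)] g_in(2) by simp
    have n4: "1 < n div 2" using deep_pair_half[OF q'(2)] lev_g by simp
    note gq = gen_brauer[OF q'(2), of T] and gp = gen_brauer[OF p, of T]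
    show "\<gamma> \<in> brauer n" unfolding \<gamma> eg by (rule brauer_mult_closed[OF gp gq])
    show "{LP a, LP b} \<in> \<gamma>" unfolding \<gamma> by (rule gen_mult_pair[OF p])
    show "{LP c, LP d} \<in> \<gamma>" unfolding \<gamma> eg
      by (rule gen_mult_LL[OF p _ cd]) (use gen_LL[OF q'(2)] q'(1) in simp)
    show "{RP (n - 1), RP n} \<in> \<gamma>" unfolding \<gamma> eg
      by (rule mult_RR) (use gen_RR[OF q'(2), of "n - 1" n T] n in simp_all)
    have topin: "n \<in> {1..n}" "n - 1 \<in> {1..n}" "lev n n = 0" "bar n n = n - 1"
      using n bar_upper[of 0 n] lev_upper[of 0 n] by auto
    have l0: "lev n n < lev n g" using lev_g topin(3) by simp
    have eg0: "n \<notin> {e, g}" "n - 1 \<notin> {e, g}"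
      using eg_sub n by auto
    \<comment> \<open>The right pair \<open>{n - 1, n}\<close> of the first factor is carried by the
      second factor to the standard pair of level 1.\<close>
    let ?u = "phi n T {e, g} n"
    have u: "lev n ?u = 1" "?u \<in> {1..n}" "phi n T {e, g} (n - 1) = bar n ?u"
      using phi_above[OF q'(2) topin(1) l0, of T] topin(3,4) by auto
    have "bar n ?u \<noteq> ?u" using bar_neq[OF u(2)] u(1) n4 by simp
    then have ru: "{RP (bar n ?u), RP ?u} \<in> \<gamma>" unfolding \<gamma> eg
      by (intro gen_mult_RR[OF p]) (use gen_LR[OF q'(2)] topin eg0 u(3) in simp_all)
    fix y
    show "{RP y, RP (bar n y)} \<in> \<gamma>" if "y \<in> {1..n}" "lev n y = 1"
    proof -
      have "y = ?u \<or> y = bar n ?u" using lev_eq[OF u(2) that(1)] u(1) that(2) by simp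
      then show ?thesis using ru by (auto simp: insert_commute)
    qed
    show "{LP x, RP (phi n T (?f ` {c, d}) (?f x))} \<in> \<gamma>" if x: "x \<in> {1..n} - {a, b} - {c, d}" for x
    proof -
      have "?f x \<notin> {?f c, ?f d}" using inj[of x c] inj[of x d] x cd by auto
      then have "?f x \<notin> {e, g}" unfolding q'(1) .
      moreover have "?f x \<in> {1..n}" using range[of x] x by auto
      ultimately have "?f x \<in> {1..n} - {e, g}" by blast
      then show ?thesis unfolding \<gamma> eg
        by (intro gen_mult_LR[OF p]) (use gen_LR[OF q'(2)] x in simp_all)
    qed
    show "\<exists>x. x \<in> {1..n} - {a, b} - {c, d} \<and> y = phi n T (?f ` {c, d}) (?f x)"
      if y: "y \<in> {1..n}" "1 < lev n y"
    proof -
      have "y \<in> {1..n - 2}" using lev_pos_iff[OF y(1)] y by simp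
      then obtain z where z: "z \<in> {1..n} - {e, g}" "y = phi n T {e, g} z"
        using phi_image[OF q'(2), of T] by (metis imageE)
      have "z \<noteq> n" using z(2) y(2) u(1) by auto
      moreover have "z \<noteq> n - 1" using z(2) y(2) u(1,3) by auto
      ultimately have "z \<in> {1..n - 2}" using top_range[of z n] z(1) by auto
      then obtain x where x: "x \<in> {1..n} - {a, b}" "z = ?f x"
        using phi_image[OF p, of T] by (metis imageE)
      have "?f x \<notin> {?f c, ?f d}" using z(1) x(2) unfolding q'(1) by simp
      then have "x \<notin> {c, d}" by auto
      then show ?thesis using x z(2) eg by (intro exI[of _ x]) simp
    qed
  qed
  let ?\<gamma> = "gen n T {a, b} \<odot> gen n T (phi n T {a, b} ` {c, d})"
  let ?\<delta> = "gen n T {c, d} \<odot> gen n T (phi n T {c, d} ` {a, b})"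
  have disj': "{c, d} \<inter> {a, b} = {}" using disj by blast
  note B = blocks[OF p q disj refl] and C = blocks[OF q p disj' refl]
  have eq: "phi n T (phi n T {a, b} ` {c, d}) (phi n T {a, b} x) = phi n T (phi n T {c, d} ` {a, b}) (phi n T {c, d} x)"
    if "x \<in> {1..n} - {a, b} - {c, d}" for x
    using phi_commute[OF T p q disj] that by simp
  have D: "{LP x, RP (phi n T (phi n T {a, b} ` {c, d}) (phi n T {a, b} x))} \<in> ?\<delta>"
    if x: "x \<in> {1..n} - {a, b} - {c, d}" for x
  proof -
    have "x \<in> {1..n} - {c, d} - {a, b}" using x by blast
    from C(6)[OF this] show ?thesis unfolding eq[OF x] .
  qed
  show "?\<gamma> = ?\<delta>"
  proof (rule brauer_eqI[OF B(4) C(4)])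
    fix x assume x: "x \<in> pins n"
    show "\<exists>y. {x, y} \<in> ?\<gamma> \<and> {x, y} \<in> ?\<delta>"
    proof (cases x)
      case (LP u)
      consider "u = a" | "u = b" | "u = c" | "u = d" | "u \<in> {1..n} - {a, b} - {c, d}"
        using x LP by auto
      then show ?thesis
      proof cases
        case 1 then show ?thesis unfolding LP using B(1) C(2) by (intro exI[of _ "LP b"]) simp
      next
        case 2 then show ?thesis unfolding LP using B(1) C(2) by (intro exI[of _ "LP a"]) (simp add: insert_commute)
      next
        case 3 then show ?thesis unfolding LP using B(2) C(1) by (intro exI[of _ "LP d"]) simp
      next
        case 4 then show ?thesis unfolding LP using B(2) C(1) by (intro exI[of _ "LP c"]) (simp add: insert_commute)
      next
        case 5 then show ?thesis unfolding LP using B(6)[OF 5] D[OF 5] by blast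
      qed
    next
      case (RP u)
      then have u: "u \<in> {1..n}" using x by simp
      consider "lev n u = 0" | "lev n u = 1" | "1 < lev n u" by linarith
      then show ?thesis
      proof cases
        case 1
        have "u = n - 1 \<or> u = n" using lev_pos_iff[OF u] 1 u by auto
        then show ?thesis unfolding RP using B(3) C(3)
          by (auto intro: exI[of _ "RP n"] exI[of _ "RP (n - 1)"] simp: insert_commute)
      next
        case 2 then show ?thesis unfolding RP using B(5)[OF u 2] C(5)[OF u 2] by blast
      next
        case 3
        then obtain v where "v \<in> {1..n} - {a, b} - {c, d}"
          "u = phi n T (phi n T {a, b} ` {c, d}) (phi n T {a, b} v)" using B(7)[OF u] by blast
        then show ?thesis unfolding RP using B(6)[of v] D[of v] by (intro exI[of _ "LP v"]) (simp add: insert_commute)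
      qed
    qed
  qed
qed

section \<open>Words in the generators and their independence of the order\<close>

lemma matching_image:
  assumes K: "matching n K" and inj: "inj_on f (\<Union>K)" and sub: "f ` \<Union>K \<subseteq> {1..n}"
  shows "matching n ((`) f ` K)" "card ((`) f ` K) = card K"
proof -
  have inj': "inj_on ((`) f) K" using inj by (rule inj_on_image)
  then show "card ((`) f ` K) = card K" by (rule card_image)
  have "card q = 2 \<and> q \<subseteq> {1..n}" if q: "q \<in> (`) f ` K" for q
  proof -
    obtain p where p: "p \<in> K" "q = f ` p" using q by blast
    then have "inj_on f p" using inj by (meson Union_upper inj_on_subset)
    then have "card q = 2" using p K unfolding matching_def by (simp add: card_image)
    moreover have "q \<subseteq> {1..n}" using p sub by (meson Union_upper image_mono subset_trans)
    ultimately show ?thesis by simp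
  qed
  moreover have "disjoint ((`) f ` K)"
  proof (rule disjointI)
    fix q r assume qr: "q \<in> (`) f ` K" "r \<in> (`) f ` K" "q \<noteq> r"
    then obtain p s where ps: "p \<in> K" "s \<in> K" "q = f ` p" "r = f ` s" by (elim imageE)
    then have "p \<inter> s = {}" using matching_disjoint[OF K ps(1,2)] qr(3) by auto
    then show "q \<inter> r = {}" using ps inj inj_on_image_Int[of f "\<Union>K" p s] by (simp add: Union_upper)
  qed
  ultimately show "matching n ((`) f ` K)" unfolding matching_def by blast
qed

lemma matching_deep_pair:
  assumes "matching n L" "p \<in> L" obtains a b where "p = {a, b}" "deep_pair n a b"
  using assms deep_pair_ex[of p n] unfolding matching_def by blast

lemma phi_pairs:
  assumes "matching n L" "p \<in> L"
  shows "matching n ((`) (phi n T p) ` (L - {p}))" "card ((`) (phi n T p) ` (L - {p})) = card L - 1"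
    "\<Union>((`) (phi n T p) ` (L - {p})) \<subseteq> {1..n - 2}"
    "inj_on (phi n T p) ({1..n} - p)" "\<Union>(L - {p}) \<subseteq> {1..n} - p"
proof -
  obtain a b where p: "p = {a, b}" "deep_pair n a b" by (rule matching_deep_pair[OF assms])
  show inj: "inj_on (phi n T p) ({1..n} - p)"
  proof (rule inj_onI)
    fix x y assume xy: "x \<in> {1..n} - p" "y \<in> {1..n} - p" "phi n T p x = phi n T p y"
    show "x = y" by (rule phi_inj[OF p(2) _ _ _ _ xy(3)[unfolded p(1)]]) (use xy(1,2) p(1) in simp_all)
  qed
  show U: "\<Union>(L - {p}) \<subseteq> {1..n} - p"
  proof
    fix x assume "x \<in> \<Union>(L - {p})"
    then obtain q where q: "q \<in> L" "q \<noteq> p" "x \<in> q" by blast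
    then show "x \<in> {1..n} - p" using matching_disjoint[OF assms(1) q(1) assms(2) q(2)] Union_matching[OF assms(1)] by blast
  qed
  have K: "matching n (L - {p})" by (rule matching_subset[OF assms(1)]) simp
  have im: "phi n T p ` ({1..n} - p) = {1..n - 2}" using phi_image[OF p(2)] p(1) by simp
  have U': "phi n T p ` \<Union>(L - {p}) \<subseteq> {1..n - 2}" using image_mono[OF U] im by metis
  then show "\<Union>((`) (phi n T p) ` (L - {p})) \<subseteq> {1..n - 2}" by (simp only: image_Union)
  have U'': "phi n T p ` \<Union>(L - {p}) \<subseteq> {1..n}" using U' by (rule subset_trans) auto
  show "matching n ((`) (phi n T p) ` (L - {p}))"
    by (rule matching_image(1)[OF K inj_on_subset[OF inj U] U''])
  show "card ((`) (phi n T p) ` (L - {p})) = card L - 1"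
    using matching_image(2)[OF K inj_on_subset[OF inj U] U''] assms(2) finite_matching[OF assms(1)] by simp
qed

text \<open>A point outside \<open>L\<close> is sent by the injective map \<open>phi\<close> outside
  the left pairs of \<open>\<beta>\<close>, so its strand passes through the product and no further
  left pair arises.\<close>

lemma lft_gen_mult:
  assumes L: "matching n L" "p \<in> L" and \<beta>: "\<beta> \<in> brauer n" "lft \<beta> = (`) (phi n T p) ` (L - {p})"
  shows "lft (gen n T p \<odot> \<beta>) = L" "gen n T p \<odot> \<beta> \<in> brauer n"
proof -
  obtain a b where p: "p = {a, b}" "deep_pair n a b" by (rule matching_deep_pair[OF L])
  let ?\<gamma> = "gen n T p \<odot> \<beta>"
  note U = phi_pairs(5)[OF L] and inj = phi_pairs(4)[OF L, of T]
  show \<gamma>: "?\<gamma> \<in> brauer n" unfolding p by (rule brauer_mult_closed[OF gen_brauer[OF p(2)] \<beta>(1)])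
  have sub: "L \<subseteq> lft ?\<gamma>"
  proof
    fix q assume q: "q \<in> L"
    show "q \<in> lft ?\<gamma>"
    proof (cases "q = p")
      case True then show ?thesis using gen_mult_pair[OF p(2)] p(1) by (simp add: pair_lft)
    next
      case False
      obtain c d where cd: "q = {c, d}" "c \<noteq> d" using matching_pair[OF L(1) q] by metis
      have in_c: "c \<in> {1..n} - {a, b}" "d \<in> {1..n} - {a, b}" using U q False cd p(1) by blast+
      have "phi n T p ` q \<in> lft \<beta>" unfolding \<beta>(2) using q False by simp
      then have "{LP (phi n T {a, b} c), LP (phi n T {a, b} d)} \<in> \<beta>"
        unfolding cd p(1) by (simp add: lft_def)
      from gen_mult_LL[OF p(2) this in_c cd(2)] show ?thesis unfolding cd p(1) by (simp add: pair_lft)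
    qed
  qed
  show "lft ?\<gamma> = L"
  proof
    show "lft ?\<gamma> \<subseteq> L"
    proof
      fix q assume q: "q \<in> lft ?\<gamma>"
      show "q \<in> L"
      proof (rule ccontr)
        assume nq: "q \<notin> L"
        obtain x y where xy: "q = {x, y}" "x \<in> {1..n}" using matching_pair[OF matching_lft[OF \<gamma>] q] by metis
        have notin: "x \<notin> r" if "r \<in> L" for r
          using matching_disjoint[OF matching_lft[OF \<gamma>] q subsetD[OF sub that]] nq that xy(1) by blast
        have x: "x \<in> {1..n} - p" using notin[OF L(2)] xy(2) by simp
        have "phi n T p x \<notin> \<Union>(lft \<beta>)"
        proof
          assume "phi n T p x \<in> \<Union>(lft \<beta>)"
          then obtain r z where r: "r \<in> L" "r \<noteq> p" "z \<in> r" "phi n T p x = phi n T p z" unfolding \<beta>(2) by blast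
          then have "z \<in> {1..n} - p" using U by blast
          then have "x = z" using inj_onD[OF inj r(4) x] by simp
          then show False using notin[OF r(1)] r(3) by simp
        qed
        moreover have "phi n T p x \<in> {1..n}" using phi_range[OF p(2), of x T] x p(1) by auto
        ultimately obtain u where "{LP (phi n T p x), RP u} \<in> \<beta>" using left_partner(2)[OF \<beta>(1)] by blast
        then have "{LP x, RP u} \<in> ?\<gamma>" using gen_mult_LR[OF p(2)] x p(1) by simp
        moreover have "{LP x, LP y} \<in> ?\<gamma>" using q xy(1) by (simp add: pair_lft)
        ultimately show False using brauer_unique[OF \<gamma>] by blast
      qed
    qed
  qed (rule sub)
qed

text \<open>
  The element with left pairs \<open>L\<close> is a product of \<open>card L\<close> elements of corank 2, obtained by removing the
  pairs of \<open>L\<close> one after the other; by the commutation rule the order does not matter.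
\<close>

inductive rep :: "nat \<Rightarrow> nat set set \<Rightarrow> nat set set \<Rightarrow> pin set set \<Rightarrow> bool" for n T where
  rep_empty: "rep n T {} (perm_brauer n id)"
| rep_insert: "matching n L \<Longrightarrow> p \<in> L \<Longrightarrow> rep n T ((`) (phi n T p) ` (L - {p})) \<beta> \<Longrightarrow>
    rep n T L (gen n T p \<odot> \<beta>)"

lemma perm_id: "perm_brauer n id \<in> brauer n" "lft (perm_brauer n id) = {}"
proof -
  show I: "perm_brauer n id \<in> brauer n" by (intro perm_brauer_in_brauer permutes_id)
  have "{LP x, LP y} \<notin> perm_brauer n id" for x y unfolding perm_brauer_def by (auto simp: doubleton_eq_iff)
  then show "lft (perm_brauer n id) = {}"
    using matching_pair[OF matching_lft[OF I]] pair_lft by (metis all_not_in_conv)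
qed

lemma rep_facts:
  assumes "rep n T L \<gamma>" shows "matching n L" "\<gamma> \<in> brauer n" "lft \<gamma> = L"
proof -
  have "matching n L \<and> \<gamma> \<in> brauer n \<and> lft \<gamma> = L"
    using assms
  proof induction
    case rep_empty then show ?case using perm_id by simp
  next
    case (rep_insert L p \<beta>)
    then have "\<beta> \<in> brauer n" "lft \<beta> = (`) (phi n T p) ` (L - {p})" by simp_all
    then show ?case using lft_gen_mult[OF rep_insert.hyps(1,2)] rep_insert.hyps(1) by simp
  qed
  then show "matching n L" "\<gamma> \<in> brauer n" "lft \<gamma> = L" by auto
qed

lemma rep_ex: "matching n L \<Longrightarrow> \<exists>\<gamma>. rep n T L \<gamma>"
proof (induction "card L" arbitrary: L)
  case 0
  then have "L = {}" using finite_matching by simp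
  then show ?case using rep_empty by blast
next
  case (Suc k)
  then obtain p where p: "p \<in> L" by fastforce
  have "k = card ((`) (phi n T p) ` (L - {p}))" using phi_pairs(2)[OF Suc.prems p] Suc.hyps(2) by simp
  then obtain \<beta> where "rep n T ((`) (phi n T p) ` (L - {p})) \<beta>"
    using Suc.hyps(1)[OF _ phi_pairs(1)[OF Suc.prems p]] by blast
  then show ?case using rep_insert[OF Suc.prems p] by blast
qed

text \<open>A diamond argument. If the two words begin with different pairs \<open>p\<close> and
  \<open>q\<close>, the other pair survives in each remainder and can be removed next; both ways
  then arrive at the same matching and share a tail \<open>\<delta>\<close>. The two pairs of
  leading factors agree by \<open>gen_commute\<close>.\<close>

lemma rep_unique:
  assumes T: "valid n T"
  shows "rep n T L \<gamma> \<Longrightarrow> rep n T L \<gamma>' \<Longrightarrow> \<gamma> = \<gamma>'"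
proof (induction "card L" arbitrary: L \<gamma> \<gamma>' rule: less_induct)
  case less
  show ?case
    using less.prems(1)
  proof cases
    case rep_empty
    then show ?thesis using less.prems(2) by (auto elim: rep.cases)
  next
    case 1: (rep_insert p \<beta>)
    then have fin: "finite L" "card L \<noteq> 0" using finite_matching[OF 1(2)] by auto
    show ?thesis using less.prems(2)
    proof cases
      case rep_empty then show ?thesis using 1(3) by simp
    next
      case 2: (rep_insert q \<beta>')
      note L = 1(2)
      let ?f = "phi n T p" and ?g = "phi n T q"
      have cp: "card ((`) ?f ` (L - {p})) < card L" using phi_pairs(2)[OF L 1(3), of T] fin(2) by linarith
      have cq: "card ((`) ?g ` (L - {q})) < card L" using phi_pairs(2)[OF L 2(3), of T] fin(2) by linarith
      show ?thesis
      proof (cases "p = q")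
        case True
        then have "\<beta> = \<beta>'" using less.hyps[OF cp 1(4)] 2(4) by simp
        then show ?thesis using 1(1) 2(1) True by simp
      next
        case False
        obtain a b where p: "p = {a, b}" "deep_pair n a b" by (rule matching_deep_pair[OF L 1(3)])
        obtain c d where q: "q = {c, d}" "deep_pair n c d" by (rule matching_deep_pair[OF L 2(3)])
        have disj: "p \<inter> q = {}" using matching_disjoint[OF L 1(3) 2(3) False] .
        let ?q = "?f ` q" and ?p = "?g ` p"
        let ?K = "(`) ?f ` (L - {p})" and ?K' = "(`) ?g ` (L - {q})"
        have K: "matching n ?K" "?q \<in> ?K" using phi_pairs(1)[OF L 1(3)] 2(3) False by auto
        have K': "matching n ?K'" "?p \<in> ?K'" using phi_pairs(1)[OF L 2(3)] 1(3) False by auto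
        have rem: "?K - {?q} = (`) ?f ` (L - {p, q})"
        proof -
          have "inj_on ((`) ?f) (L - {p})"
            using inj_on_image[OF inj_on_subset[OF phi_pairs(4,5)[OF L 1(3)]]] .
          then have "(`) ?f ` (L - {p} - {q}) = ?K - (`) ?f ` {q}"
            by (rule inj_on_image_set_diff) (use 2(3) False in auto)
          moreover have "L - {p} - {q} = L - {p, q}" by blast
          ultimately show ?thesis by simp
        qed
        have rem': "?K' - {?p} = (`) ?g ` (L - {p, q})"
        proof -
          have "inj_on ((`) ?g) (L - {q})"
            using inj_on_image[OF inj_on_subset[OF phi_pairs(4,5)[OF L 2(3)]]] .
          then have "(`) ?g ` (L - {q} - {p}) = ?K' - (`) ?g ` {p}"
            by (rule inj_on_image_set_diff) (use 1(3) False in auto)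
          moreover have "L - {q} - {p} = L - {p, q}" by blast
          ultimately show ?thesis by simp
        qed
        have same: "phi n T ?q ` (?f ` r) = phi n T ?p ` (?g ` r)" if r: "r \<in> L - {p, q}" for r
        proof -
          have "phi n T ?q (?f x) = phi n T ?p (?g x)" if "x \<in> r" for x
          proof -
            have "x \<in> {1..n}" using r that Union_matching[OF L] by blast
            moreover have "x \<notin> p" using matching_disjoint[OF L _ 1(3), of r] r that by blast
            moreover have "x \<notin> q" using matching_disjoint[OF L _ 2(3), of r] r that by blast
            ultimately show ?thesis using phi_commute[OF T p(2) q(2)] disj unfolding p(1) q(1) by blast
          qed
          then show ?thesis unfolding image_image by (intro image_cong) simp_all
        qed
        \<comment> \<open>The remaining pairs are moved by the two composites of \<open>phi\<close>,
          which agree on points outside \<open>p\<close> and \<open>q\<close>.\<close>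
        have J: "(`) (phi n T ?q) ` (?K - {?q}) = (`) (phi n T ?p) ` (?K' - {?p})"
          unfolding rem rem' image_image[of "(`) (phi n T ?q)"] image_image[of "(`) (phi n T ?p)"]
          by (rule image_cong[OF refl same])
        obtain \<delta> where \<delta>: "rep n T ((`) (phi n T ?q) ` (?K - {?q})) \<delta>"
          using rep_ex[OF phi_pairs(1)[OF K]] by blast
        have "\<beta> = gen n T ?q \<odot> \<delta>" by (rule less.hyps[OF cp 1(4) rep_insert[OF K \<delta>]])
        moreover have "\<beta>' = gen n T ?p \<odot> \<delta>"
          by (rule less.hyps[OF cq 2(4) rep_insert[OF K' \<delta>[unfolded J]]])
        moreover have "gen n T p \<odot> gen n T ?q = gen n T q \<odot> gen n T ?p"
          using gen_commute[OF T p(2) q(2)] disj unfolding p(1) q(1) by blast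
        ultimately show ?thesis unfolding 1(1) 2(1) by (simp add: brauer_mult_assoc[symmetric])
      qed
    qed
  qed
qed

text \<open>If \<open>K\<close> avoids \<open>n - 1\<close> and \<open>n\<close>, pull it back along
  the bijection \<open>phi\<close> and add \<open>{a, b}\<close>. Otherwise some pair of
  \<open>K\<close> meets the top; by \<open>rep_unique\<close> its generator may be put first, where
  it is absorbed by \<open>gen_absorb\<close>, and a shorter word is left.\<close>

lemma rep_gen_mult:
  assumes T: "valid n T" and q: "deep_pair n a b"
  shows "rep n T K \<beta> \<Longrightarrow> \<exists>L. rep n T L (gen n T {a, b} \<odot> \<beta>)"
proof (induction "card K" arbitrary: K \<beta> rule: less_induct)
  case less
  note K = rep_facts(1)[OF less.prems]
  let ?f = "phi n T {a, b}" and ?S = "{1..n} - {a, b}"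
  show ?case
  proof (cases "\<Union>K \<subseteq> {1..n - 2}")
    case True
    let ?g = "inv_into ?S ?f"
    note im = phi_image[OF q, of T]
    have fg: "?f (?g y) = y" if "y \<in> \<Union>K" for y
      using that True im by (intro f_inv_into_f) auto
    have gS: "?g y \<in> ?S" if "y \<in> \<Union>K" for y
      using that True im by (intro inv_into_into) auto
    have inj: "inj_on ?g (\<Union>K)" by (rule inj_on_inverseI[of _ ?f]) (rule fg)
    let ?L = "(`) ?g ` K"
    have sub: "?g ` \<Union>K \<subseteq> {1..n}" using gS by blast
    have UL: "\<Union>?L \<subseteq> ?S" unfolding image_Union[symmetric] by (intro image_subsetI gS)
    have "card {a, b} = 2" "{a, b} \<subseteq> {1..n}" using q unfolding deep_pair_def by auto
    moreover have disj: "{a, b} \<inter> \<Union>?L = {}" using UL by auto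
    ultimately have L: "matching n (insert {a, b} ?L)"
      by (rule matching_insert[OF matching_image(1)[OF K inj sub]])
    have "{a, b} \<notin> ?L"
    proof
      assume "{a, b} \<in> ?L"
      then have "a \<in> \<Union>?L" by (rule UnionI) simp
      then show False using disj by simp
    qed
    then have "insert {a, b} ?L - {{a, b}} = ?L" by simp
    moreover have "(`) ?f ` ?L = K"
    proof -
      have "?f ` (?g ` r) = r" if "r \<in> K" for r
      proof -
        have "\<And>y. y \<in> r \<Longrightarrow> ?f (?g y) = y" using fg that by blast
        then show ?thesis by (simp add: image_image)
      qed
      then show ?thesis by (simp add: image_image)
    qed
    ultimately have "rep n T (insert {a, b} ?L) (gen n T {a, b} \<odot> \<beta>)"
      using less.prems by (intro rep_insert[OF L]) simp_all
    then show ?thesis by blast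
  next
    case False
    then obtain r x where r: "r \<in> K" "x \<in> r" "x \<notin> {1..n - 2}" by blast
    obtain m c where mc: "r = {m, c}" "deep_pair n m c" by (rule matching_deep_pair[OF K r(1)])
    have x: "x \<in> {1..n}" using r Union_matching[OF K] by blast
    have "lev n x = 0" using lev_pos_iff[OF x] r(3) x by auto
    then have c: "lev n c = 0" using mc r(2) unfolding deep_pair_def by auto
    let ?K' = "(`) (phi n T r) ` (K - {r})"
    obtain \<beta>' where \<beta>': "rep n T ?K' \<beta>'" using rep_ex[OF phi_pairs(1)[OF K r(1)]] by blast
    have "\<beta> = gen n T r \<odot> \<beta>'" by (rule rep_unique[OF T less.prems rep_insert[OF K r(1) \<beta>']])
    then have "gen n T {a, b} \<odot> \<beta> = gen n T {a, b} \<odot> \<beta>'"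
      using gen_absorb[OF q mc(2) c, of T] mc(1) by (simp add: brauer_mult_assoc[symmetric])
    moreover have "card ?K' < card K"
    proof -
      have "0 < card K" using r(1) finite_matching[OF K] by (auto simp: card_gt_0_iff)
      then show ?thesis using phi_pairs(2)[OF K r(1), of T] by linarith
    qed
    ultimately show ?thesis using less.hyps[OF _ \<beta>'] by simp
  qed
qed

definition section_of :: "nat \<Rightarrow> nat set set \<Rightarrow> pin set set set" where
  "section_of n T = {\<gamma>. \<exists>L. rep n T L \<gamma>}"

lemma section_of_cross_section:
  assumes T: "valid n T" shows "section_of n T \<in> R_cross_sections n"
proof (rule cross_sectionI)
  show "\<alpha> \<in> brauer n" if "\<alpha> \<in> section_of n T" for \<alpha>
    using that rep_facts(2) unfolding section_of_def by blast
  show "\<exists>\<alpha>. \<alpha> \<in> section_of n T \<and> lft \<alpha> = L" if "matching n L" for L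
    using rep_ex[OF that] rep_facts(3) unfolding section_of_def by blast
  show "\<alpha> = \<beta>" if "\<alpha> \<in> section_of n T" "\<beta> \<in> section_of n T" "lft \<alpha> = lft \<beta>" for \<alpha> \<beta>
    using that rep_facts(3) rep_unique[OF T] unfolding section_of_def mem_Collect_eq by metis
  have "\<exists>M. rep n T M (\<alpha> \<odot> \<beta>)" if "rep n T L \<alpha>" "rep n T K \<beta>" for L K \<alpha> \<beta>
    using that(1)
  proof induction
    case rep_empty
    show ?case using that(2) perm_id_mult(1)[OF rep_facts(2)[OF that(2)]] by auto
  next
    case (rep_insert L p \<alpha>)
    obtain a b where p: "p = {a, b}" "deep_pair n a b" by (rule matching_deep_pair[OF rep_insert.hyps(1,2)])
    obtain M where "rep n T M (\<alpha> \<odot> \<beta>)" using rep_insert.IH by blast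
    from rep_gen_mult[OF T p(2) this] show ?case unfolding p(1) by (simp add: brauer_mult_assoc)
  qed
  then show "\<alpha> \<odot> \<beta> \<in> section_of n T" if "\<alpha> \<in> section_of n T" "\<beta> \<in> section_of n T" for \<alpha> \<beta>
    using that unfolding section_of_def by blast
qed

lemma gen_in_section:
  assumes "deep_pair n a b" shows "gen n T {a, b} \<in> section_of n T" "lft (gen n T {a, b}) = {{a, b}}"
proof -
  have L: "matching n {{a, b}}" using assms unfolding matching_singleton deep_pair_def by simp
  have "rep n T {{a, b}} (gen n T {a, b} \<odot> perm_brauer n id)"
    by (rule rep_insert[OF L]) (simp_all add: rep_empty)
  then have r: "rep n T {{a, b}} (gen n T {a, b})" by (simp add: perm_id_mult(2)[OF gen_brauer[OF assms]])
  then show "gen n T {a, b} \<in> section_of n T" unfolding section_of_def by blast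
  show "lft (gen n T {a, b}) = {{a, b}}" using rep_facts(3)[OF r] .
qed

section \<open>Right pairs of the constructed cross-section\<close>

text \<open>While all pairs of \<open>K\<close> are deeper than the level \<open>u\<close>, each
  generator moves the two points of that level down together by one level. The hypothesis survives
  with \<open>Suc u\<close>: pairs not yet deeper than the removed one move down as well.\<close>

lemma rep_descend:
  assumes "rep n T K \<beta>" "\<forall>z\<in>\<Union>K. u < lev n z" "x \<in> {1..n}" "lev n x = u"
  shows "\<exists>y\<in>{1..n}. {LP x, RP y} \<in> \<beta> \<and> {LP (bar n x), RP (bar n y)} \<in> \<beta> \<and> lev n y = u + card K"
  using assms
proof (induction arbitrary: u x)
  case rep_empty
  have "bar n x \<in> {1..n}" using rep_empty(2) bar_in by blast
  then show ?case using rep_empty by (intro bexI[of _ x]) (simp_all only: perm_brauer_iff id_apply card.empty add_0_right)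
next
  case (rep_insert L p \<beta>)
  note L = rep_insert.hyps(1,2)
  obtain a b where p: "p = {a, b}" "deep_pair n a b" by (rule matching_deep_pair[OF L])
  have ub: "u < lev n b" using rep_insert.prems(1) L(2) p(1) by blast
  let ?f = "phi n T p"
  have f: "?f x \<in> {1..n}" "lev n (?f x) = Suc u" "?f (bar n x) = bar n (?f x)"
    using phi_above[OF p(2) rep_insert.prems(2), of T] rep_insert.prems(3) ub p(1) by auto
  have "Suc u < lev n w" if w: "w \<in> \<Union>((`) ?f ` (L - {p}))" for w
  proof -
    obtain z where z: "z \<in> \<Union>(L - {p})" "w = ?f z" using w by blast
    have zn: "z \<in> {1..n}" "z \<notin> {a, b}" using phi_pairs(5)[OF L] z(1) p(1) by auto
    have uz: "u < lev n z" using rep_insert.prems(1) z(1) by blast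
    show ?thesis
      by (cases rule: phi_cases[OF p(2) zn, where T = T])
        (use phi_above(2)[OF p(2) zn(1), of T] uz ub z(2) p(1) in auto)
  qed
  then obtain y where y: "y \<in> {1..n}" "{LP (?f x), RP y} \<in> \<beta>" "{LP (?f (bar n x)), RP (bar n y)} \<in> \<beta>"
    "lev n y = Suc u + card ((`) ?f ` (L - {p}))"
    using rep_insert.IH[OF _ f(1,2)] f(3) by force
  have "0 < card L" using L(2) finite_matching[OF L(1)] by (auto simp: card_gt_0_iff)
  then have "lev n y = u + card L" using y(4) phi_pairs(2)[OF L] by simp
  moreover have ux: "x \<notin> {a, b}" "bar n x \<notin> {a, b}"
    using rep_insert.prems(3) ub p(2) lev_bar[of n x] unfolding deep_pair_def by fastforce+
  moreover have "bar n x \<in> {1..n}" using rep_insert.prems(2) bar_in by blast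
  ultimately show ?case using gen_mult_LR[OF p(2), of T x y \<beta>] gen_mult_LR[OF p(2), of T "bar n x" "bar n y" \<beta>]
      y rep_insert.prems(2) unfolding p(1) by (intro bexI[of _ y]) simp_all
qed

text \<open>The right pairs of \<open>\<beta>\<close> persist, and the right pair
  \<open>{n - 1, n}\<close> of the first generator descends through \<open>\<beta>\<close> to the
  next free level, \<open>card L - 1\<close>.\<close>

lemma rep_right_pairs:
  assumes "rep n T L \<gamma>" "y \<in> {1..n}" "lev n y < card L"
  shows "{RP y, RP (bar n y)} \<in> \<gamma>"
  using assms
proof (induction)
  case rep_empty then show ?case by simp
next
  case (rep_insert L p \<beta>)
  note L = rep_insert.hyps(1,2)
  obtain a b where p: "p = {a, b}" "deep_pair n a b" by (rule matching_deep_pair[OF L])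
  let ?K = "(`) (phi n T p) ` (L - {p})"
  have c: "card ?K = card L - 1" by (rule phi_pairs(2)[OF L])
  have "card L \<le> n div 2" using card_matching_le[OF L(1)] by linarith
  then have yb: "bar n y \<noteq> y" using bar_neq[OF rep_insert.prems(1)] rep_insert.prems(2) by simp
  show ?case
  proof (cases "lev n y < card ?K")
    case True
    then have "{RP y, RP (bar n y)} \<in> \<beta>" using rep_insert.IH rep_insert.prems(1) by blast
    then show ?thesis using mult_RR yb by metis
  next
    case False
    have n: "2 \<le> n" by (rule deep_pair_ge[OF p(2)])
    then have top: "n \<in> {1..n}" "lev n n = 0" "bar n n = n - 1"
      using bar_upper[of 0 n] lev_upper[of 0 n] by auto
    have "0 < lev n z" if "z \<in> \<Union>?K" for z
    proof -
      have "z \<in> {1..n - 2}" using that phi_pairs(3)[OF L] by blast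
      then show ?thesis using lev_pos_iff[of z n] by auto
    qed
    then obtain v where v: "v \<in> {1..n}" "{LP n, RP v} \<in> \<beta>" "{LP (n - 1), RP (bar n v)} \<in> \<beta>" "lev n v = card ?K"
      using rep_descend[OF rep_insert.hyps(3) _ top(1,2)] top(3) by auto
    have "lev n y = lev n v" using False v(4) c rep_insert.prems(2) by simp
    then have vy: "v = y \<or> v = bar n y" using lev_eq[OF rep_insert.prems(1) v(1)] by simp
    then have "bar n v \<noteq> v" using yb by auto
    then have "{RP (bar n v), RP v} \<in> gen n T p \<odot> \<beta>"
      using gen_mult_RR[OF p(2) v(3,2)] unfolding p(1) by simp
    then show ?thesis using vy by (auto simp: insert_commute)
  qed
qed

section \<open>Right pairs in an arbitrary cross-section\<close>

lemma lft_eqI: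
  assumes "\<gamma> \<in> brauer n" "L \<subseteq> lft \<gamma>"
    and "\<And>x. x \<in> {1..n} \<Longrightarrow> x \<notin> \<Union>L \<Longrightarrow> \<exists>y. {LP x, RP y} \<in> \<gamma>"
  shows "lft \<gamma> = L"
proof
  show "lft \<gamma> \<subseteq> L"
  proof
    fix q assume q: "q \<in> lft \<gamma>"
    obtain x y where xy: "q = {x, y}" "x \<noteq> y" "x \<in> {1..n}" "y \<in> {1..n}"
      by (rule matching_pair[OF matching_lft[OF assms(1)] q])
    have "x \<in> \<Union>(lft \<gamma>)" using q xy(1) by blast
    then have "\<nexists>z. {LP x, RP z} \<in> \<gamma>" using left_partner(2)[OF assms(1) xy(3)] by blast
    then obtain r where r: "r \<in> L" "x \<in> r" using assms(3)[OF xy(3)] by blast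
    then have "q = r"
      using matching_disjoint[OF matching_lft[OF assms(1)] q, of r] assms(2) xy(1) by auto
    then show "q \<in> L" using r(1) by simp
  qed
qed (rule assms(2))

lemma rgt_mult: "\<beta> \<in> brauer n \<Longrightarrow> rgt \<beta> \<subseteq> rgt (\<alpha> \<odot> \<beta>)"
proof
  fix p assume b: "\<beta> \<in> brauer n" and p: "p \<in> rgt \<beta>"
  obtain x y where xy: "p = {x, y}" "x \<noteq> y" "x \<in> {1..n}" "y \<in> {1..n}"
    by (rule matching_pair[OF matching_rgt[OF b] p])
  then show "p \<in> rgt (\<alpha> \<odot> \<beta>)" using p mult_RR[of x y \<beta> \<alpha>] by (simp add: pair_rgt)
qed

lemma lft_mult: "\<alpha> \<in> brauer n \<Longrightarrow> lft \<alpha> \<subseteq> lft (\<alpha> \<odot> \<beta>)"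
proof
  fix p assume b: "\<alpha> \<in> brauer n" and p: "p \<in> lft \<alpha>"
  obtain x y where xy: "p = {x, y}" "x \<noteq> y" "x \<in> {1..n}" "y \<in> {1..n}"
    by (rule matching_pair[OF matching_lft[OF b] p])
  then show "p \<in> lft (\<alpha> \<odot> \<beta>)" using p mult_LL[of x y \<alpha> \<beta>] by (simp add: pair_lft)
qed

text \<open>If no through strand of \<open>\<alpha>\<close> is turned back by \<open>\<beta>\<close>, then \<open>\<alpha> \<odot> \<beta>\<close> and \<open>\<alpha>\<close> lie in
  the same \<open>\<R>\<close>-class, so they coincide in a cross-section.\<close>

lemma absorb:
  assumes "\<Lambda> \<in> R_cross_sections n" "\<alpha> \<in> \<Lambda>" "\<beta> \<in> \<Lambda>"
    and "\<And>x m. {LP x, RP m} \<in> \<alpha> \<Longrightarrow> \<exists>y. {LP x, RP y} \<in> \<alpha> \<odot> \<beta>"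
  shows "\<alpha> \<odot> \<beta> = \<alpha>" "rgt \<beta> \<subseteq> rgt \<alpha>"
proof -
  have b: "\<alpha> \<in> brauer n" "\<alpha> \<odot> \<beta> \<in> brauer n" "\<beta> \<in> brauer n"
    using assms cross_section_brauer cross_section_mult by blast+
  have "lft (\<alpha> \<odot> \<beta>) = lft \<alpha>"
  proof (rule lft_eqI[OF b(2) lft_mult[OF b(1)]])
    fix x assume "x \<in> {1..n}" "x \<notin> \<Union>(lft \<alpha>)"
    then obtain m where "{LP x, RP m} \<in> \<alpha>" using left_partner(2)[OF b(1)] by blast
    then show "\<exists>y. {LP x, RP y} \<in> \<alpha> \<odot> \<beta>" by (rule assms(4))
  qed
  then show eq: "\<alpha> \<odot> \<beta> = \<alpha>"
    by (rule cross_section_unique[OF assms(1) cross_section_mult[OF assms(1-3)] assms(2)])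
  show "rgt \<beta> \<subseteq> rgt \<alpha>" using rgt_mult[OF b(3), of \<alpha>] eq by simp
qed

lemma through_pins:
  assumes "\<alpha> \<in> brauer n" "{LP x, RP m} \<in> \<alpha>"
  shows "x \<in> {1..n}" "m \<in> {1..n}" "x \<notin> \<Union>(lft \<alpha>)" "m \<notin> \<Union>(rgt \<alpha>)"
proof -
  show xm: "x \<in> {1..n}" "m \<in> {1..n}" using brauer_pins[OF assms] by simp_all
  show "x \<notin> \<Union>(lft \<alpha>)" using left_partner(2)[OF assms(1) xm(1)] assms(2) by blast
  show "m \<notin> \<Union>(rgt \<alpha>)" using right_partner[OF assms(1) xm(2)] assms(2) by blast
qed

lemma absorb_subset:
  assumes "\<Lambda> \<in> R_cross_sections n" "\<alpha> \<in> \<Lambda>" "\<beta> \<in> \<Lambda>" "lft \<beta> \<subseteq> rgt \<alpha>"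
  shows "\<alpha> \<odot> \<beta> = \<alpha>" "rgt \<beta> \<subseteq> rgt \<alpha>"
proof -
  have "\<exists>y. {LP x, RP y} \<in> \<alpha> \<odot> \<beta>" if xm: "{LP x, RP m} \<in> \<alpha>" for x m
  proof -
    have b: "\<alpha> \<in> brauer n" "\<beta> \<in> brauer n" using assms(1-3) cross_section_brauer by blast+
    have "m \<notin> \<Union>(lft \<beta>)" using through_pins(4)[OF b(1) xm] assms(4) by blast
    then obtain y where "{LP m, RP y} \<in> \<beta>" using left_partner(2)[OF b(2) through_pins(2)[OF b(1) xm]] by blast
    then show ?thesis using mult_LR[OF xm] by blast
  qed
  then show "\<alpha> \<odot> \<beta> = \<alpha>" "rgt \<beta> \<subseteq> rgt \<alpha>" using absorb[OF assms(1-3)] by blast+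
qed

text \<open>The pair \<open>p = {b, b'}\<close> is replaced on the left of \<open>\<beta>\<close> by
  \<open>{b, c}\<close>. A strand of \<open>\<alpha>\<close> arriving at \<open>c\<close> moves to
  \<open>b\<close>, then along \<open>p\<close> to \<open>b'\<close>, and passes through
  \<open>\<beta>\<close> there. Thus \<open>\<alpha>\<close> absorbs \<open>\<beta>\<close>, and
  equal ranks turn the inclusion of right pairs into equality.\<close>

lemma rgt_exchange:
  assumes \<Lambda>: "\<Lambda> \<in> R_cross_sections n" "\<alpha> \<in> \<Lambda>" "\<beta> \<in> \<Lambda>"
    and R: "rgt \<alpha> = insert p R" "p \<notin> R" and bc: "b \<in> p" "c \<notin> p" "{b, c} \<notin> R"
    and \<beta>: "lft \<beta> = insert {b, c} R"
  shows "rgt \<beta> = rgt \<alpha>"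
proof -
  have B: "\<alpha> \<in> brauer n" "\<beta> \<in> brauer n" using \<Lambda> cross_section_brauer by blast+
  note M = matching_rgt[OF B(1)] and N = matching_lft[OF B(2)]
  have "p \<in> rgt \<alpha>" using R(1) by simp
  then obtain x y where xy: "p = {x, y}" "x \<noteq> y" "x \<in> {1..n}" "y \<in> {1..n}"
    by (rule matching_pair[OF M])
  have "\<exists>b'. p = {b, b'} \<and> b \<noteq> b' \<and> b' \<in> {1..n}"
  proof (cases "b = x")
    case True then show ?thesis using xy by (intro exI[of _ y]) simp
  next
    case False
    then have "b = y" using bc(1) xy(1) by simp
    then show ?thesis using xy by (intro exI[of _ x]) (simp add: insert_commute)
  qed
  then obtain b' where b': "p = {b, b'}" "b \<noteq> b'" "b' \<in> {1..n}" by blast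
  have "b' \<notin> \<Union>(lft \<beta>)"
  proof
    assume "b' \<in> \<Union>(lft \<beta>)"
    then obtain r where r: "r \<in> R" "b' \<in> r" using \<beta> b' bc(2) by auto
    then have "r \<noteq> p" using R(2) by blast
    then show False using matching_disjoint[OF M, of r p] r R(1) b'(1) by blast
  qed
  then obtain y where y: "{LP b', RP y} \<in> \<beta>" using left_partner(2)[OF B(2) b'(3)] by blast
  have "\<exists>y. {LP x, RP y} \<in> \<alpha> \<odot> \<beta>" if xm: "{LP x, RP m} \<in> \<alpha>" for x m
  proof (cases "m = c")
    case True
    have "{LP c, LP b} \<in> \<beta>" using \<beta> pair_lft[of c b \<beta>] by (simp add: insert_commute)
    moreover have "{RP b, RP b'} \<in> \<alpha>" using R(1) b'(1) pair_rgt[of b b' \<alpha>] by simp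
    ultimately show ?thesis using mult_LRLR[OF xm _ _ y] True by blast
  next
    case False
    have "m \<notin> \<Union>(rgt \<alpha>)" by (rule through_pins(4)[OF B(1) xm])
    then have "m \<notin> \<Union>(lft \<beta>)" using False R(1) bc(1) \<beta> by auto
    then obtain z where "{LP m, RP z} \<in> \<beta>"
      using left_partner(2)[OF B(2) through_pins(2)[OF B(1) xm]] by blast
    then show ?thesis using mult_LR[OF xm] by blast
  qed
  then have "rgt \<beta> \<subseteq> rgt \<alpha>" using absorb(2)[OF \<Lambda>] by blast
  moreover have "card (rgt \<beta>) = card (rgt \<alpha>)"
  proof -
    have "finite R" using finite_matching[OF M] R(1) by simp
    then show ?thesis using card_rgt_eq[OF B(2)] \<beta> bc(3) R by simp
  qed
  ultimately show ?thesis using finite_matching[OF M] card_subset_eq by blast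
qed

text \<open>By induction the right pairs of \<open>\<alpha>\<close> and \<open>\<alpha>'\<close>
  consist of the same \<open>k\<close> pairs and one more pair each, \<open>p\<close> and
  \<open>p'\<close>. If these differ, an element with the common pairs and one pair joining
  \<open>p\<close> to \<open>p'\<close> on its left has the right pairs of both, by
  \<open>rgt_exchange\<close>.\<close>

lemma rgt_unique:
  assumes \<Lambda>: "\<Lambda> \<in> R_cross_sections n"
  shows "\<alpha> \<in> \<Lambda> \<Longrightarrow> \<alpha>' \<in> \<Lambda> \<Longrightarrow> card (lft \<alpha>) = k \<Longrightarrow> card (lft \<alpha>') = k \<Longrightarrow> rgt \<alpha> = rgt \<alpha>'"
proof (induction k arbitrary: \<alpha> \<alpha>')
  case 0
  have "rgt \<beta> = {}" if "\<beta> \<in> \<Lambda>" "card (lft \<beta>) = 0" for \<beta>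
    using card_rgt_eq[OF cross_section_brauer[OF \<Lambda> that(1)]] that(2)
      finite_matching[OF matching_rgt[OF cross_section_brauer[OF \<Lambda> that(1)]]] by simp
  then show ?case using "0.prems" by simp
next
  case (Suc k)
  have below: "\<exists>p \<gamma>. \<gamma> \<in> \<Lambda> \<and> card (lft \<gamma>) = k \<and> rgt \<beta> = insert p (rgt \<gamma>) \<and> p \<notin> rgt \<gamma>"
    if \<beta>: "\<beta> \<in> \<Lambda>" "card (lft \<beta>) = Suc k" for \<beta>
  proof -
    have B: "\<beta> \<in> brauer n" by (rule cross_section_brauer[OF \<Lambda> \<beta>(1)])
    have c: "card (rgt \<beta>) = Suc k" using card_rgt_eq[OF B] \<beta>(2) by simp
    then have "k \<le> card (rgt \<beta>)" by simp
    \<comment> \<open>An element with \<open>k\<close> of the right pairs of \<open>\<beta>\<close>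
      as its left pairs is absorbed by \<open>\<beta>\<close>, so its right pairs lie among those of
      \<open>\<beta>\<close>.\<close>
    then obtain K where K: "K \<subseteq> rgt \<beta>" "card K = k" by (meson obtain_subset_with_card_n)
    obtain \<gamma> where g: "\<gamma> \<in> \<Lambda>" "lft \<gamma> = K" "\<gamma> \<in> brauer n"
      by (rule cross_section_ex[OF \<Lambda> matching_subset[OF matching_rgt[OF B] K(1)]])
    have sub: "rgt \<gamma> \<subseteq> rgt \<beta>" using absorb_subset(2)[OF \<Lambda> \<beta>(1) g(1)] g(2) K(1) by simp
    have cg: "card (rgt \<gamma>) = k" using card_rgt_eq[OF g(3)] g(2) K(2) by simp
    have "card (rgt \<beta> - rgt \<gamma>) = 1"
      using card_Diff_subset[OF finite_matching[OF matching_rgt[OF g(3)]] sub] c cg by simp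
    then obtain p where "rgt \<beta> - rgt \<gamma> = {p}" by (rule card_1_singletonE)
    then have "rgt \<beta> = insert p (rgt \<gamma>)" "p \<notin> rgt \<gamma>" using sub by blast+
    then show ?thesis using g(1,2) K(2) by blast
  qed
  obtain p \<gamma> where g: "\<gamma> \<in> \<Lambda>" "card (lft \<gamma>) = k" "rgt \<alpha> = insert p (rgt \<gamma>)" "p \<notin> rgt \<gamma>"
    using below[OF Suc.prems(1,3)] by blast
  obtain p' \<gamma>' where g': "\<gamma>' \<in> \<Lambda>" "card (lft \<gamma>') = k" "rgt \<alpha>' = insert p' (rgt \<gamma>')" "p' \<notin> rgt \<gamma>'"
    using below[OF Suc.prems(2,4)] by blast
  have R: "rgt \<gamma>' = rgt \<gamma>" by (rule Suc.IH[OF g'(1) g(1) g'(2) g(2)])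
  have B: "\<alpha> \<in> brauer n" "\<alpha>' \<in> brauer n" using Suc.prems(1,2) cross_section_brauer[OF \<Lambda>] by blast+
  note M = matching_rgt[OF B(1)] and M' = matching_rgt[OF B(2)]
  show ?case
  proof (cases "p = p'")
    case True then show ?thesis using g(3) g'(3) R by simp
  next
    case False
    have pp: "card p = 2" "card p' = 2" "p \<subseteq> {1..n}" "p' \<subseteq> {1..n}"
      using M M' g(3) g'(3) unfolding matching_def by auto
    then have fin: "finite p" "finite p'" using finite_subset by blast+
    have "\<not> p \<subseteq> p'" "\<not> p' \<subseteq> p" using False pp card_subset_eq fin by metis+
    then obtain b c where bc: "b \<in> p" "b \<notin> p'" "c \<in> p'" "c \<notin> p" by blast
    have bR: "b \<notin> \<Union>(rgt \<gamma>)" using matching_disjoint[OF M, of p] g(3,4) bc(1) by blast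
    have cR: "c \<notin> \<Union>(rgt \<gamma>)" using matching_disjoint[OF M', of p'] g'(3,4) R bc(3) by blast
    have bcR: "{b, c} \<notin> rgt \<gamma>" "{c, b} \<notin> rgt \<gamma>" using bR by blast+
    have "matching n (insert {b, c} (rgt \<gamma>))"
    proof (rule matching_insert[OF matching_rgt[OF cross_section_brauer[OF \<Lambda> g(1)]]])
      have "b \<noteq> c" using bc by blast
      then show "card {b, c} = 2" by simp
      show "{b, c} \<subseteq> {1..n}" using bc pp by blast
      show "{b, c} \<inter> \<Union>(rgt \<gamma>) = {}" using bR cR by blast
    qed
    then obtain \<beta> where \<beta>: "\<beta> \<in> \<Lambda>" "lft \<beta> = insert {b, c} (rgt \<gamma>)" "\<beta> \<in> brauer n"
      by (rule cross_section_ex[OF \<Lambda>])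
    have "rgt \<beta> = rgt \<alpha>"
      by (rule rgt_exchange[OF \<Lambda> Suc.prems(1) \<beta>(1) g(3,4) bc(1,4) bcR(1) \<beta>(2)])
    moreover have "rgt \<beta> = rgt \<alpha>'"
      using rgt_exchange[OF \<Lambda> Suc.prems(2) \<beta>(1) g'(3,4) bc(3,2)] bcR(2) \<beta>(2) R by (simp add: insert_commute)
    ultimately show ?thesis by simp
  qed
qed

text \<open>\<open>\<beta>\<close> absorbs an element whose left pairs are right pairs of
  \<open>\<beta>\<close>; chosen of the size of \<open>\<alpha>\<close>, it has the right pairs of
  \<open>\<alpha>\<close>.\<close>

lemma rgt_mono:
  assumes \<Lambda>: "\<Lambda> \<in> R_cross_sections n" and "\<alpha> \<in> \<Lambda>" "\<beta> \<in> \<Lambda>" "card (lft \<alpha>) \<le> card (lft \<beta>)"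
  shows "rgt \<alpha> \<subseteq> rgt \<beta>"
proof -
  have B: "\<beta> \<in> brauer n" by (rule cross_section_brauer[OF \<Lambda> assms(3)])
  have "card (lft \<alpha>) \<le> card (rgt \<beta>)" using card_rgt_eq[OF B] assms(4) by simp
  then obtain K where K: "K \<subseteq> rgt \<beta>" "card K = card (lft \<alpha>)" by (meson obtain_subset_with_card_n)
  obtain \<gamma> where g: "\<gamma> \<in> \<Lambda>" "lft \<gamma> = K" "\<gamma> \<in> brauer n"
    by (rule cross_section_ex[OF \<Lambda> matching_subset[OF matching_rgt[OF B] K(1)]])
  have "rgt \<gamma> = rgt \<alpha>" using rgt_unique[OF \<Lambda> g(1) assms(2)] g(2) K(2) by simp
  then show ?thesis using absorb_subset(2)[OF \<Lambda> assms(3) g(1)] g(2) K(1) by simp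
qed

section \<open>Standard pairs and conjugation to a canonical cross-section\<close>

lemma std_pair: "l < n div 2 \<Longrightarrow> card (std n l) = 2 \<and> std n l \<subseteq> {1..n}"
  using std_eq[of l n] by (auto simp: std_def)

lemma std_disjoint:
  assumes "l < n div 2" "k < n div 2" "l \<noteq> k" shows "std n l \<inter> std n k = {}"
  using assms(3) unfolding disjoint_iff std_eq[OF assms(1)] std_eq[OF assms(2)] by simp

lemma std_inj: "inj_on (std n) {..<n div 2}"
proof (rule inj_onI)
  fix k l assume kl: "k \<in> {..<n div 2}" "l \<in> {..<n div 2}" "std n k = std n l"
  then show "k = l" using std_disjoint[of k n l] by (auto simp: std_def)
qed

lemma std_matching:
  assumes "k \<le> n div 2"
  shows "matching n (std n ` {..<k})" "card (std n ` {..<k}) = k"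
    "\<Union>(std n ` {..<k}) = {x \<in> {1..n}. lev n x < k}"
proof -
  have less: "l < n div 2" if "l < k" for l using that assms by simp
  have "inj_on (std n) {..<k}" using inj_on_subset[OF std_inj] assms by (auto simp: subset_iff)
  then show "card (std n ` {..<k}) = k" by (simp add: card_image)
  show "matching n (std n ` {..<k})"
    unfolding matching_def
  proof (intro conjI disjointI)
    show "\<forall>p\<in>std n ` {..<k}. card p = 2 \<and> p \<subseteq> {1..n}" using std_pair[OF less] by simp
    fix p q assume "p \<in> std n ` {..<k}" "q \<in> std n ` {..<k}" "p \<noteq> q"
    then obtain i j where "i < k" "j < k" "p = std n i" "q = std n j" "i \<noteq> j" by auto
    then show "p \<inter> q = {}" using std_disjoint[OF less less] by simp
  qed
  show "\<Union>(std n ` {..<k}) = {x \<in> {1..n}. lev n x < k}"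
  proof (rule Set.set_eqI)
    fix x
    have "(\<exists>l. l < k \<and> x \<in> std n l) \<longleftrightarrow> (\<exists>l. l < k \<and> (x \<in> {1..n} \<and> lev n x = l))"
      by (rule ex_cong1, rule conj_cong[OF refl], rule std_eq[OF less])
    then show "x \<in> \<Union>(std n ` {..<k}) \<longleftrightarrow> x \<in> {x \<in> {1..n}. lev n x < k}"
      unfolding UN_iff mem_Collect_eq Bex_def lessThan_iff by auto
  qed
qed

lemma canonical_cross: "canonical n \<Lambda> \<Longrightarrow> \<Lambda> \<in> R_cross_sections n"
  unfolding canonical_def by simp

text \<open>The definition of \<open>canonical\<close> numbers the pairs from below and
  \<open>std\<close> from the top, whence the substitution \<open>l = k - m\<close>. An element with
  \<open>k\<close> left pairs has exactly \<open>k\<close> right pairs, so containing the standard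
  ones means having no others.\<close>

lemma canonical_iff:
  "canonical n \<Lambda> \<longleftrightarrow> \<Lambda> \<in> R_cross_sections n \<and> (\<forall>\<alpha>\<in>\<Lambda>. rgt \<alpha> = std n ` {..<card (lft \<alpha>)})"
proof -
  have eq: "(\<forall>k. corank n \<alpha> = 2 * k \<longrightarrow>
        (\<forall>m\<in>{1..k}. {RP (n - 2 * k + 2 * m - 1), RP (n - 2 * k + 2 * m)} \<in> \<alpha>)) \<longleftrightarrow>
      rgt \<alpha> = std n ` {..<card (lft \<alpha>)}" if B: "\<alpha> \<in> brauer n" for \<alpha>
  proof -
    let ?k = "card (lft \<alpha>)"
    have k: "2 * ?k \<le> n" by (rule card_matching_le[OF matching_lft[OF B]])
    then have k': "?k \<le> n div 2" by simp
    have pairs: "{RP (n - 2 * ?k + 2 * (?k - l) - 1), RP (n - 2 * ?k + 2 * (?k - l))} = RP ` std n l" if "l < ?k" for l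
    proof -
      have "n - 2 * ?k + 2 * (?k - l) = n - 2 * l" using that k by simp
      then show ?thesis by (simp add: std_def)
    qed
    have "(\<forall>m\<in>{1..?k}. {RP (n - 2 * ?k + 2 * m - 1), RP (n - 2 * ?k + 2 * m)} \<in> \<alpha>) \<longleftrightarrow>
        (\<forall>l<?k. std n l \<in> rgt \<alpha>)"
    proof
      assume l: "\<forall>m\<in>{1..?k}. {RP (n - 2 * ?k + 2 * m - 1), RP (n - 2 * ?k + 2 * m)} \<in> \<alpha>"
      show "\<forall>l<?k. std n l \<in> rgt \<alpha>"
      proof (intro allI impI)
        fix l assume lk: "l < ?k"
        then have "?k - l \<in> {1..?k}" by simp
        then have "RP ` std n l \<in> \<alpha>" unfolding pairs[OF lk, symmetric] by (rule bspec[OF l])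
        then show "std n l \<in> rgt \<alpha>" unfolding rgt_def by simp
      qed
    next
      assume l: "\<forall>l<?k. std n l \<in> rgt \<alpha>"
      show "\<forall>m\<in>{1..?k}. {RP (n - 2 * ?k + 2 * m - 1), RP (n - 2 * ?k + 2 * m)} \<in> \<alpha>"
      proof
        fix m assume m: "m \<in> {1..?k}"
        then have lk: "?k - m < ?k" "?k - (?k - m) = m" by auto
        have "RP ` std n (?k - m) \<in> \<alpha>" using l lk(1) unfolding rgt_def by simp
        then show "{RP (n - 2 * ?k + 2 * m - 1), RP (n - 2 * ?k + 2 * m)} \<in> \<alpha>"
          unfolding pairs[OF lk(1), symmetric] lk(2) .
      qed
    qed
    moreover have "(\<forall>l<?k. std n l \<in> rgt \<alpha>) \<longleftrightarrow> rgt \<alpha> = std n ` {..<?k}"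
    proof
      assume "\<forall>l<?k. std n l \<in> rgt \<alpha>"
      then have "std n ` {..<?k} \<subseteq> rgt \<alpha>" by blast
      then have "std n ` {..<?k} = rgt \<alpha>"
        using finite_matching[OF matching_rgt[OF B]] std_matching(2)[OF k'] card_rgt_eq[OF B]
        by (intro card_subset_eq) simp_all
      then show "rgt \<alpha> = std n ` {..<?k}" by simp
    qed simp
    ultimately show ?thesis unfolding corank_eq[OF B] by auto
  qed
  show ?thesis
  proof (cases "\<Lambda> \<in> R_cross_sections n")
    case True
    have "(\<forall>\<alpha>\<in>\<Lambda>. \<forall>k. corank n \<alpha> = 2 * k \<longrightarrow>
        (\<forall>m\<in>{1..k}. {RP (n - 2 * k + 2 * m - 1), RP (n - 2 * k + 2 * m)} \<in> \<alpha>)) \<longleftrightarrow>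
      (\<forall>\<alpha>\<in>\<Lambda>. rgt \<alpha> = std n ` {..<card (lft \<alpha>)})"
      by (rule ball_cong[OF refl eq[OF cross_section_brauer[OF True]]])
    then show ?thesis unfolding canonical_def by simp
  next
    case False then show ?thesis unfolding canonical_def by simp
  qed
qed

lemma canonical_section_of:
  assumes "valid n T" shows "canonical n (section_of n T)"
  unfolding canonical_iff
proof (intro conjI ballI)
  show c: "section_of n T \<in> R_cross_sections n" by (rule section_of_cross_section[OF assms])
  fix \<alpha> assume a: "\<alpha> \<in> section_of n T"
  then obtain L where L: "rep n T L \<alpha>" unfolding section_of_def by blast
  note B = rep_facts(2)[OF L] and lft = rep_facts(3)[OF L]
  let ?k = "card (lft \<alpha>)"
  have k': "?k \<le> n div 2" using card_matching_le[OF matching_lft[OF B]] by simp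
  have "std n ` {..<?k} \<subseteq> rgt \<alpha>"
  proof
    fix p assume "p \<in> std n ` {..<?k}"
    then obtain l where l: "p = std n l" "l < ?k" by blast
    then have ln: "Suc (2 * l) < n" using k' by linarith
    have "{RP (n - 2 * l), RP (bar n (n - 2 * l))} \<in> \<alpha>"
      using rep_right_pairs[OF L, of "n - 2 * l"] lev_upper[OF ln] ln l(2) lft by simp
    then show "p \<in> rgt \<alpha>" unfolding l(1) rgt_def std_def bar_upper[OF ln] by (simp add: insert_commute)
  qed
  then have "std n ` {..<?k} = rgt \<alpha>"
    using finite_matching[OF matching_rgt[OF B]] std_matching(2)[OF k'] card_rgt_eq[OF B]
    by (intro card_subset_eq) simp_all
  then show "rgt \<alpha> = std n ` {..<?k}" by simp
qed

lemma conj_canonical_iff: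
  assumes "\<sigma> permutes {1..n}" "\<Theta> \<in> R_cross_sections n"
  shows "canonical n (conj_elem n \<sigma> ` \<Theta>) \<longleftrightarrow> (\<forall>\<alpha>\<in>\<Theta>. (`) \<sigma> ` rgt \<alpha> = std n ` {..<card (lft \<alpha>)})"
proof -
  have "rgt (conj_elem n \<sigma> \<alpha>) = (`) \<sigma> ` rgt \<alpha>" "card (lft (conj_elem n \<sigma> \<alpha>)) = card (lft \<alpha>)" if "\<alpha> \<in> \<Theta>" for \<alpha>
  proof -
    have B: "\<alpha> \<in> brauer n" by (rule cross_section_brauer[OF assms(2) that])
    show "rgt (conj_elem n \<sigma> \<alpha>) = (`) \<sigma> ` rgt \<alpha>" by (rule conj_elem_lft(2)[OF assms(1) B])
    have "inj ((`) \<sigma>)" by (simp add: inj_def inj_image_eq_iff[OF permutes_inj[OF assms(1)]])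
    then show "card (lft (conj_elem n \<sigma> \<alpha>)) = card (lft \<alpha>)"
      unfolding conj_elem_lft(1)[OF assms(1) B] by (intro card_image) (erule inj_on_subset[OF _ subset_UNIV])
  qed
  then show ?thesis unfolding canonical_iff using conj_elem_cross_section[OF assms] by simp
qed

text \<open>The sets of right pairs grow by one pair \<open>{u k, v k}\<close> at each rank. The
  permutation \<open>f\<close> takes the standard pair of level \<open>k\<close> to the pair added
  at that step, and its inverse conjugates the chain to the standard one.\<close>

lemma ex_canonical:
  assumes \<Theta>: "\<Theta> \<in> R_cross_sections n"
  shows "\<exists>\<sigma>. \<sigma> permutes {1..n} \<and> canonical n (conj_elem n \<sigma> ` \<Theta>)"
proof -
  let ?h = "n div 2"
  have "\<exists>\<alpha>. \<alpha> \<in> \<Theta> \<and> card (lft \<alpha>) = k" if "k \<le> ?h" for k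
    using cross_section_ex[OF \<Theta> std_matching(1)[OF that]] std_matching(2)[OF that] by metis
  then obtain e where e: "\<And>k. k \<le> ?h \<Longrightarrow> e k \<in> \<Theta> \<and> card (lft (e k)) = k" by metis
  define R where "R k = rgt (e k)" for k
  have eB: "e k \<in> brauer n" if "k \<le> ?h" for k using e[OF that] cross_section_brauer[OF \<Theta>] by blast
  have RM: "matching n (R k)" "card (R k) = k" if "k \<le> ?h" for k
    using matching_rgt[OF eB[OF that]] card_rgt_eq[OF eB[OF that]] e[OF that] unfolding R_def by simp_all
  have mono: "R k \<subseteq> R l" if "k \<le> l" "l \<le> ?h" for k l
    using rgt_mono[OF \<Theta>] e[of k] e[of l] that unfolding R_def by simp
  have "\<exists>u v. R (Suc k) - R k = {{u, v}} \<and> u \<noteq> v \<and> u \<in> {1..n} \<and> v \<in> {1..n}" if k: "k < ?h" for k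
  proof -
    have "card (R (Suc k) - R k) = 1"
      using card_Diff_subset[OF finite_matching[OF RM(1)] mono[of k "Suc k"]] RM(2)[of k] RM(2)[of "Suc k"] k by simp
    then obtain p where p: "R (Suc k) - R k = {p}" by (rule card_1_singletonE)
    then have "p \<in> R (Suc k)" by blast
    then obtain u v where "p = {u, v}" "u \<noteq> v" "u \<in> {1..n}" "v \<in> {1..n}"
      using matching_pair[OF RM(1), of "Suc k" p] k by auto
    then show ?thesis using p by blast
  qed
  then obtain u v where uv: "\<And>k. k < ?h \<Longrightarrow> R (Suc k) - R k = {{u k, v k}}"
    "\<And>k. k < ?h \<Longrightarrow> u k \<noteq> v k" "\<And>k. k < ?h \<Longrightarrow> u k \<in> {1..n}" "\<And>k. k < ?h \<Longrightarrow> v k \<in> {1..n}"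
    by metis
  have R_eq: "R k = (\<lambda>l. {u l, v l}) ` {..<k}" if "k \<le> ?h" for k
    using that
  proof (induction k)
    case 0 then show ?case using RM[of 0] finite_matching[OF RM(1)[of 0]] by simp
  next
    case (Suc k)
    have "R (Suc k) = insert {u k, v k} (R k)" using uv(1)[of k] mono[of k "Suc k"] Suc.prems by auto
    then show ?case using Suc by (simp add: lessThan_Suc)
  qed
  have in_R': "{u l, v l} \<in> R k" if "l < k" "k \<le> ?h" for k l
    unfolding R_eq[OF that(2)] using that(1) by (intro image_eqI[OF refl]) simp
  have in_R: "{u l, v l} \<in> R ?h" if "l < ?h" for l using in_R'[OF that] by simp
  have notin_R: "{u l, v l} \<notin> R l" if "l < ?h" for l using uv(1)[OF that] by blast
  have Q_disj: "{u k, v k} \<inter> {u l, v l} = {}" if kl: "k < ?h" "l < ?h" "k \<noteq> l" for k l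
  proof -
    have "{u k, v k} \<noteq> {u l, v l}"
    proof
      assume eq: "{u k, v k} = {u l, v l}"
      have "\<not> k < l" using notin_R[OF kl(2)] in_R'[of k l] kl(2) eq by auto
      moreover have "\<not> l < k" using notin_R[OF kl(1)] in_R'[of l k] kl(1) eq by auto
      ultimately show False using kl(3) by simp
    qed
    then show ?thesis using matching_disjoint[OF RM(1)[of ?h] in_R[OF kl(1)] in_R[OF kl(2)]] by simp
  qed
  \<comment> \<open>For odd \<open>n\<close> the right pairs of maximal rank miss a point, the image
    of the unpaired point 1; for even \<open>n\<close> the value of \<open>w\<close> is
    arbitrary.\<close>
  have "\<exists>w. odd n \<longrightarrow> w \<in> {1..n} - \<Union>(R ?h)"
  proof (cases "odd n")
    case True
    then have "card ({1..n} - \<Union>(R ?h)) \<noteq> 0"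
      using card_Compl_matching[OF RM(1)[of ?h]] RM(2)[of ?h] by (auto elim!: oddE)
    then show ?thesis by (metis card.empty ex_in_conv)
  qed simp
  then obtain w where w: "odd n \<Longrightarrow> w \<in> {1..n} - \<Union>(R ?h)" by blast
  \<comment> \<open>The points \<open>n - 2 * l\<close>, those with \<open>n - x\<close> even, go to
    \<open>v l\<close>, and their partners to \<open>u l\<close>.\<close>
  define f where "f x = (if x \<notin> {1..n} then x else if lev n x = ?h then w
    else if even (n - x) then v (lev n x) else u (lev n x))" for x
  have half_odd: "odd n" if "x \<in> {1..n}" "lev n x = ?h" for x
    using that(1) by (cases rule: bar_cases) (use that(2) in presburger)+
  have f_std: "f x \<in> {u (lev n x), v (lev n x)}" if "x \<in> {1..n}" "lev n x < ?h" for x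
    using that unfolding f_def by simp
  have f_bar: "f (bar n x) \<noteq> f x" if x: "x \<in> {1..n}" "lev n x < ?h" for x
  proof -
    have "even (n - bar n x) \<longleftrightarrow> odd (n - x)"
      using x(1) by (cases rule: bar_cases) (use x(2) in auto)
    moreover have "bar n x \<in> {1..n}" using x(1) bar_in by blast
    ultimately show ?thesis using x uv(2)[of "lev n x"] uv(2)[of "lev n x", symmetric] unfolding f_def by simp
  qed
  have f_half: "f x \<in> {1..n} - \<Union>(R ?h)" if "x \<in> {1..n}" "lev n x = ?h" for x
    using w[OF half_odd[OF that]] that unfolding f_def by simp
  have f_R: "f x \<in> \<Union>(R ?h)" if "x \<in> {1..n}" "lev n x < ?h" for x
    using f_std[OF that] in_R[OF that(2)] by blast
  have f_in: "f x \<in> {1..n}" if x: "x \<in> {1..n}" for x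
  proof (cases "lev n x = ?h")
    case True then show ?thesis using f_half[OF x] by simp
  next
    case False
    then have "lev n x < ?h" using lev_le[OF x] by simp
    then show ?thesis using f_R[OF x] Union_matching[OF RM(1)[of ?h]] by blast
  qed
  have inj: "x = y" if xy: "x \<in> {1..n}" "y \<in> {1..n}" "f x = f y" for x y
  proof -
    consider "lev n x = ?h" "lev n y = ?h" | "lev n x = ?h" "lev n y < ?h" | "lev n x < ?h" "lev n y = ?h"
      | "lev n x < ?h" "lev n y < ?h" using lev_le[OF xy(1)] lev_le[OF xy(2)] by linarith
    then have "lev n x = lev n y"
    proof cases
      case 2 then show ?thesis using f_half[OF xy(1)] f_R[OF xy(2)] xy(3) by simp
    next
      case 3 then show ?thesis using f_half[OF xy(2)] f_R[OF xy(1)] xy(3) by simp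
    next
      case 4
      then show ?thesis using f_std[OF xy(1)] f_std[OF xy(2)] Q_disj[OF 4] xy(3) by (metis disjoint_iff)
    qed simp
    then consider "y = x" | "y = bar n x" using lev_eq[OF xy(1,2)] by blast
    then show ?thesis
    proof cases
      case 2
      show ?thesis
      proof (cases "lev n x = ?h")
        case True then show ?thesis using lev_eq_half[OF xy(1)] 2 by simp
      next
        case False
        then have "lev n x < ?h" using lev_le[OF xy(1)] by simp
        then show ?thesis using f_bar[OF xy(1)] 2 xy(3) by simp
      qed
    qed simp
  qed
  have "inj_on f {1..n}" using inj by (intro inj_onI)
  moreover have "f ` {1..n} = {1..n}"
    using calculation f_in by (intro card_subset_eq) (auto simp: card_image)
  ultimately have "f permutes {1..n}" by (intro bij_imp_permutes) (auto simp: bij_betw_def f_def)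
  have f_image: "f ` std n l = {u l, v l}" if l: "l < ?h" for l
  proof -
    have ln: "Suc (2 * l) < n" using l by linarith
    then have "n - 2 * l \<in> {1..n}" "n - Suc (2 * l) \<in> {1..n}" "even (n - (n - 2 * l))" "odd (n - (n - Suc (2 * l)))" by auto
    then have "f (n - 2 * l) = v l" "f (n - Suc (2 * l)) = u l"
      unfolding f_def using lev_upper[OF ln] lev_lower[OF ln] l by simp_all
    then show ?thesis unfolding std_def by simp
  qed
  let ?\<sigma> = "inv' f"
  have \<sigma>: "?\<sigma> permutes {1..n}" by (rule permutes_inv[OF \<open>f permutes {1..n}\<close>])
  have "(`) ?\<sigma> ` rgt \<alpha> = std n ` {..<card (lft \<alpha>)}" if a: "\<alpha> \<in> \<Theta>" for \<alpha>
  proof -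
    let ?k = "card (lft \<alpha>)"
    have k: "?k \<le> ?h" using card_matching_le[OF matching_lft[OF cross_section_brauer[OF \<Theta> a]]] by simp
    have "rgt \<alpha> = R ?k" unfolding R_def using rgt_unique[OF \<Theta> a] e[OF k] by simp
    also have "\<dots> = (\<lambda>l. f ` std n l) ` {..<?k}" unfolding R_eq[OF k] using f_image k by (intro image_cong) auto
    finally have "(`) ?\<sigma> ` rgt \<alpha> = (\<lambda>l. ?\<sigma> ` f ` std n l) ` {..<?k}" by (simp only: image_image)
    also have "\<dots> = std n ` {..<?k}"
      by (simp add: image_comp permutes_inv_o[OF \<open>f permutes {1..n}\<close>])
    finally show ?thesis .
  qed
  then show ?thesis using conj_canonical_iff[OF \<sigma> \<Theta>] \<sigma> by blast
qed

lemma brauer_LR_unique: "\<alpha> \<in> brauer n \<Longrightarrow> {LP x, RP y} \<in> \<alpha> \<Longrightarrow> {LP x, RP z} \<in> \<alpha> \<Longrightarrow> z = y"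
  using brauer_unique[of \<alpha> n "LP x" "RP y" "RP z"] by simp

section \<open>Generators of a canonical cross-section\<close>

locale canonical_section =
  fixes n :: nat and \<Lambda> :: "pin set set set"
  assumes canonical: "canonical n \<Lambda>"
begin

lemma cross: "\<Lambda> \<in> R_cross_sections n"
  by (rule canonical_cross[OF canonical])

lemmas brauer = cross_section_brauer[OF cross]
  and mult = cross_section_mult[OF cross]
  and unique = cross_section_unique[OF cross]

lemma rgt_std: "\<alpha> \<in> \<Lambda> \<Longrightarrow> rgt \<alpha> = std n ` {..<card (lft \<alpha>)}"
  using canonical unfolding canonical_iff by simp

definition elt :: "nat set set \<Rightarrow> pin set set" where
  "elt L = (THE \<alpha>. \<alpha> \<in> \<Lambda> \<and> lft \<alpha> = L)"

lemma elt:
  assumes "matching n L" shows "elt L \<in> \<Lambda>" "lft (elt L) = L" "elt L \<in> brauer n"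
    "rgt (elt L) = std n ` {..<card L}"
proof -
  have "elt L \<in> \<Lambda> \<and> lft (elt L) = L"
    unfolding elt_def by (rule theI'[OF cross_section_ex1[OF cross assms]])
  then show 1: "elt L \<in> \<Lambda>" "lft (elt L) = L" by simp_all
  then show "elt L \<in> brauer n" "rgt (elt L) = std n ` {..<card L}"
    using brauer[OF 1(1)] rgt_std[OF 1(1)] by simp_all
qed

text \<open>Left and right pairs of this element coincide, so it absorbs itself and is idempotent;
  its through strands then form an injective idempotent map, that is, the identity.\<close>

lemma elt_std_below:
  assumes "k \<le> n div 2" "x \<in> {1..n}" "k \<le> lev n x"
  shows "{LP x, RP x} \<in> elt (std n ` {..<k})"
proof -
  let ?e = "elt (std n ` {..<k})"
  note M = std_matching[OF assms(1)]
  note e = elt[OF M(1)]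
  have ee: "?e \<odot> ?e = ?e"
    by (rule absorb_subset(1)[OF cross e(1) e(1)]) (simp add: e(2,4) M(2))
  have through: "\<exists>z. {LP y, RP z} \<in> ?e" if "y \<in> {1..n}" "k \<le> lev n y" for y
    using left_partner(2)[OF e(3) that(1)] that(2) unfolding e(2) M(3) by simp
  obtain y where y: "{LP x, RP y} \<in> ?e" using through[OF assms(2,3)] by blast
  have "y \<notin> \<Union>(std n ` {..<k})" using through_pins(4)[OF e(3) y] unfolding e(4) M(2) .
  then have yk: "k \<le> lev n y" using through_pins(2)[OF e(3) y] unfolding M(3) by simp
  obtain z where z: "{LP y, RP z} \<in> ?e" using through[OF through_pins(2)[OF e(3) y] yk] by blast
  have "{LP x, RP z} \<in> ?e" using mult_LR[OF y z] unfolding ee .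
  then have "z = y" by (rule brauer_LR_unique[OF e(3) y])
  then have "x = y" using brauer_unique'[OF e(3) y, of "LP y"] z by simp
  then show ?thesis using y by simp
qed

text \<open>The strand map of the generator with left pair \<open>p\<close>, to be compared with
  \<open>phi\<close>; it is meaningful only on points outside \<open>p\<close>.\<close>

definition fp :: "nat set \<Rightarrow> nat \<Rightarrow> nat" where
  "fp p x = (THE y. {LP x, RP y} \<in> elt {p})"

context
  fixes a b assumes ab: "deep_pair n a b"
begin

lemma pair_matching: "matching n {{a, b}}"
  using ab unfolding matching_singleton deep_pair_def by simp

lemmas pair_elt = elt[OF pair_matching]

lemma n_ge: "1 \<le> n div 2"
  using deep_pair_ge[OF ab] by simp

lemma pair_rgt_eq: "rgt (elt {{a, b}}) = {std n 0}"
  using pair_elt(4) by (simp add: lessThan_Suc)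

lemma fp_iff: "{LP x, RP y} \<in> elt {{a, b}} \<longleftrightarrow> x \<in> {1..n} \<and> x \<notin> {a, b} \<and> y = fp {a, b} x"
proof -
  have f: "fp {a, b} x = z" if "{LP x, RP z} \<in> elt {{a, b}}" for z
    unfolding fp_def by (rule the_equality) (rule that, rule brauer_LR_unique[OF pair_elt(3) that])
  show ?thesis
  proof
    assume xy: "{LP x, RP y} \<in> elt {{a, b}}"
    then show "x \<in> {1..n} \<and> x \<notin> {a, b} \<and> y = fp {a, b} x"
      using through_pins(1,3)[OF pair_elt(3) xy] f[OF xy] unfolding pair_elt(2) by simp
  next
    assume x: "x \<in> {1..n} \<and> x \<notin> {a, b} \<and> y = fp {a, b} x"
    then obtain z where "{LP x, RP z} \<in> elt {{a, b}}"
      using left_partner(2)[OF pair_elt(3), of x] unfolding pair_elt(2) by auto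
    then show "{LP x, RP y} \<in> elt {{a, b}}" using f x by simp
  qed
qed

lemma pair_LL: "{LP a, LP b} \<in> elt {{a, b}}"
  using pair_lft[of a b "elt {{a, b}}"] pair_elt(2) by simp

lemma fp_range:
  assumes "x \<in> {1..n}" "x \<notin> {a, b}" shows "fp {a, b} x \<in> {1..n}" "0 < lev n (fp {a, b} x)"
proof -
  have xf: "{LP x, RP (fp {a, b} x)} \<in> elt {{a, b}}" using assms fp_iff by simp
  show "fp {a, b} x \<in> {1..n}" by (rule through_pins(2)[OF pair_elt(3) xf])
  then show "0 < lev n (fp {a, b} x)"
    using through_pins(4)[OF pair_elt(3) xf] std_eq[of 0 n "fp {a, b} x"] n_ge unfolding pair_rgt_eq by auto
qed

lemma fp_inj:
  assumes "x \<in> {1..n}" "x \<notin> {a, b}" "y \<in> {1..n}" "y \<notin> {a, b}" "fp {a, b} x = fp {a, b} y"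
  shows "x = y"
proof -
  have "{LP x, RP (fp {a, b} x)} \<in> elt {{a, b}}" "{LP y, RP (fp {a, b} x)} \<in> elt {{a, b}}"
    using assms fp_iff by simp_all
  then show ?thesis using brauer_unique'[OF pair_elt(3)] by blast
qed

text \<open>The strands of the left factor are the identity on points deeper than \<open>b\<close>.
  Of these only one ending in \<open>a\<close> could be turned back, but it runs on through
  \<open>b\<close> and \<open>bar n b\<close> and then passes.\<close>

lemma elt_std_absorb: "elt (std n ` {..<Suc (lev n b)}) \<odot> elt {{a, b}} = elt (std n ` {..<Suc (lev n b)})"
proof -
  let ?k = "Suc (lev n b)"
  have k: "?k \<le> n div 2" using deep_pair_half[OF ab] by simp
  note M = std_matching[OF k] and e = elt[OF std_matching(1)[OF k]]
  show ?thesis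
  proof (rule absorb(1)[OF cross e(1) pair_elt(1)])
    fix x m assume xm: "{LP x, RP m} \<in> elt (std n ` {..<?k})"
    have x: "x \<in> {1..n}" "?k \<le> lev n x"
      using through_pins(1,3)[OF e(3) xm] unfolding e(2) M(3) by auto
    then have "{LP x, RP x} \<in> elt (std n ` {..<?k})" using elt_std_below[OF k] by simp
    then have "m = x" using brauer_LR_unique[OF e(3) _ xm] by metis
    have xb: "x \<noteq> b" using x(2) by auto
    show "\<exists>y. {LP x, RP y} \<in> elt (std n ` {..<?k}) \<odot> elt {{a, b}}"
    proof (cases "x = a")
      case False
      then have "{LP x, RP (fp {a, b} x)} \<in> elt {{a, b}}" using x(1) xb fp_iff by simp
      then show ?thesis using mult_LR[OF xm[unfolded \<open>m = x\<close>]] by blast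
    next
      case True
      have bb: "bar n b \<noteq> a" using x(2) True lev_bar[of n b] by auto
      have b_in: "b \<in> {1..n}" using ab unfolding deep_pair_def by simp
      have bar_b: "bar n b \<noteq> b" using bar_neq[OF b_in] deep_pair_half[OF ab] by simp
      have "{LP (bar n b), RP (fp {a, b} (bar n b))} \<in> elt {{a, b}}"
        using fp_iff bb bar_b b_in by (simp del: atLeastAtMost_iff)
      moreover have "{RP b, RP (bar n b)} \<in> elt (std n ` {..<?k})"
      proof -
        have "{b, bar n b} \<in> rgt (elt (std n ` {..<?k}))"
          unfolding e(4) M(2) std_bar[OF b_in deep_pair_half[OF ab]] by simp
        then show ?thesis by (simp add: pair_rgt)
      qed
      moreover have aa: "{LP a, RP a} \<in> elt (std n ` {..<?k})" using xm \<open>m = x\<close> True by simp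
      ultimately show ?thesis using mult_LRLR[OF aa pair_LL] True by blast
    qed
  qed
qed

text \<open>The left factor of \<open>elt_std_absorb\<close> is the identity at \<open>x\<close>, so
  the product sends \<open>x\<close> to its image under the generator. As the product equals the
  left factor, this image is \<open>x\<close>.\<close>

lemma fp_below:
  assumes "x \<in> {1..n}" "x \<notin> {a, b}" "lev n b < lev n x"
  shows "fp {a, b} x = x"
proof -
  let ?k = "Suc (lev n b)"
  have k: "?k \<le> n div 2" using deep_pair_half[OF ab] by simp
  note e = elt[OF std_matching(1)[OF k]]
  have xx: "{LP x, RP x} \<in> elt (std n ` {..<?k})" by (rule elt_std_below[OF k assms(1)]) (use assms(3) in simp)
  have "{LP x, RP (fp {a, b} x)} \<in> elt {{a, b}}" using assms fp_iff by simp
  from mult_LR[OF xx this] have "{LP x, RP (fp {a, b} x)} \<in> elt (std n ` {..<?k})" unfolding elt_std_absorb .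
  then show ?thesis by (rule brauer_LR_unique[OF e(3) xx])
qed

text \<open>In the product of \<open>elt_std_absorb\<close> the strand of \<open>a\<close> makes the
  detour through \<open>b\<close> and \<open>bar n b\<close>. The product being the left factor, it
  ends in \<open>a\<close>.\<close>

lemma fp_partner:
  assumes "bar n b \<noteq> a" shows "fp {a, b} (bar n b) = a"
proof -
  let ?k = "Suc (lev n b)"
  have k: "?k \<le> n div 2" using deep_pair_half[OF ab] by simp
  note e = elt[OF std_matching(1)[OF k]] and M = std_matching[OF k]
  have b_in: "b \<in> {1..n}" "a \<in> {1..n}" using ab unfolding deep_pair_def by simp_all
  have bar_b: "bar n b \<noteq> b" using bar_neq[OF b_in(1)] deep_pair_half[OF ab] by simp
  have "lev n b < lev n a" using ab by (cases rule: deep_pair_cases) (use assms in auto)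
  then have aa: "{LP a, RP a} \<in> elt (std n ` {..<?k})" by (intro elt_std_below[OF k b_in(2)]) simp
  have "{LP (bar n b), RP (fp {a, b} (bar n b))} \<in> elt {{a, b}}"
    using fp_iff assms bar_b b_in by (simp del: atLeastAtMost_iff)
  moreover have "{RP b, RP (bar n b)} \<in> elt (std n ` {..<?k})"
  proof -
    have "{b, bar n b} \<in> rgt (elt (std n ` {..<?k}))"
      unfolding e(4) M(2) std_bar[OF b_in(1) deep_pair_half[OF ab]] by simp
    then show ?thesis by (simp add: pair_rgt)
  qed
  ultimately have "{LP a, RP (fp {a, b} (bar n b))} \<in> elt (std n ` {..<?k})"
    using mult_LRLR[OF aa pair_LL] elt_std_absorb by metis
  then show ?thesis by (rule brauer_LR_unique[OF e(3) aa])
qed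

lemma lft_std_mult:
  assumes k: "k \<le> lev n b"
  shows "lft (elt (std n ` {..<k}) \<odot> elt {{a, b}}) = insert {a, b} (std n ` {..<k})"
proof -
  have k': "k \<le> n div 2" using deep_pair_half[OF ab] k by simp
  note M = std_matching[OF k'] and e = elt[OF std_matching(1)[OF k']]
  have ab': "a \<in> {1..n}" "b \<in> {1..n}" "a \<noteq> b" "lev n b \<le> lev n a" using ab unfolding deep_pair_def by simp_all
  let ?\<gamma> = "elt (std n ` {..<k}) \<odot> elt {{a, b}}"
  have diag: "{LP x, RP x} \<in> elt (std n ` {..<k})" if "x \<in> {1..n}" "k \<le> lev n x" for x
    by (rule elt_std_below[OF k' that])
  show ?thesis
  proof (rule lft_eqI)
    show "?\<gamma> \<in> brauer n" by (rule brauer_mult_closed[OF e(3) pair_elt(3)])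
    have "std n ` {..<k} \<subseteq> lft ?\<gamma>" using lft_mult[OF e(3), of "elt {{a, b}}"] unfolding e(2) .
    moreover have "{LP a, LP b} \<in> ?\<gamma>"
      by (rule mult_LLR[OF diag pair_LL diag ab'(3)]) (use ab' k in simp_all)
    ultimately show "insert {a, b} (std n ` {..<k}) \<subseteq> lft ?\<gamma>" by (simp add: pair_lft)
    fix x assume x: "x \<in> {1..n}" "x \<notin> \<Union>(insert {a, b} (std n ` {..<k}))"
    then have "x \<notin> {a, b}" "x \<notin> \<Union>(std n ` {..<k})" by auto
    then have "k \<le> lev n x" using x(1) unfolding M(3) by simp
    moreover have "{LP x, RP (fp {a, b} x)} \<in> elt {{a, b}}" using fp_iff x(1) \<open>x \<notin> {a, b}\<close> by simp
    ultimately show "\<exists>y. {LP x, RP y} \<in> ?\<gamma>" using mult_LR[OF diag[OF x(1)]] by blast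
  qed
qed

text \<open>Multiplying by the element with the standard pairs of levels at most
  \<open>lev n x\<close> on both sides makes the image of \<open>{x, bar n x}\<close> a right pair,
  so by canonicity a standard pair of level at most \<open>Suc (lev n x)\<close>. Level 0 is
  excluded by the right pair of the generator, and the levels between are already images of higher
  pairs.\<close>

lemma fp_std:
  assumes "x \<in> {1..n}" "lev n x < lev n b"
  shows "{fp {a, b} x, fp {a, b} (bar n x)} = std n (Suc (lev n x))"
  using assms
proof (induction "lev n x" arbitrary: x rule: less_induct)
  case less
  let ?l = "lev n x" and ?k = "Suc (lev n x)" and ?f = "fp {a, b}"
  have half: "lev n b < n div 2" by (rule deep_pair_half[OF ab])
  have k: "?k \<le> n div 2" "?k \<le> lev n b" using half less.prems(2) by auto
  note M = std_matching[OF k(1)] and e = elt[OF std_matching(1)[OF k(1)]]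
  have out: "y \<notin> {a, b}" if "lev n y < lev n b" for y using that ab unfolding deep_pair_def by auto
  have bx: "bar n x \<in> {1..n}" "bar n x \<noteq> x" using less.prems bar_neq[of x n] half by (auto simp del: atLeastAtMost_iff)
  have bx_out: "bar n x \<notin> {a, b}" using out[of "bar n x"] less.prems(2) by simp
  note x_out = out[OF less.prems(2)]
  let ?\<gamma> = "elt (std n ` {..<?k}) \<odot> elt {{a, b}}"
  have g: "?\<gamma> \<in> \<Lambda>" by (rule mult[OF e(1) pair_elt(1)])
  have "{a, b} \<notin> std n ` {..<?k}"
  proof
    assume "{a, b} \<in> std n ` {..<?k}"
    then have "b \<in> \<Union>(std n ` {..<?k})" by blast
    then show False unfolding M(3) using k(2) by simp
  qed
  then have "card (lft ?\<gamma>) = Suc ?k"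
    unfolding lft_std_mult[OF k(2)] using M(2) by simp
  then have rg: "rgt ?\<gamma> = std n ` {..<Suc ?k}" using rgt_std[OF g] by simp
  have fneq: "?f x \<noteq> ?f (bar n x)" using fp_inj[OF less.prems(1) x_out bx(1) bx_out] bx(2) by metis
  have "{x, bar n x} \<in> rgt (elt (std n ` {..<?k}))"
    unfolding e(4) M(2) using std_bar[OF less.prems(1)] k(1) by simp
  then have "{RP x, RP (bar n x)} \<in> elt (std n ` {..<?k})" by (simp add: pair_rgt)
  moreover have "{LP x, RP (?f x)} \<in> elt {{a, b}}" "{LP (bar n x), RP (?f (bar n x))} \<in> elt {{a, b}}"
    using fp_iff less.prems(1) bx(1) x_out bx_out by blast+
  ultimately have "{RP (?f x), RP (?f (bar n x))} \<in> ?\<gamma>" using mult_RRL[OF _ _ _ fneq] by blast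
  then have "{?f x, ?f (bar n x)} \<in> std n ` {..<Suc ?k}" using rg pair_rgt by metis
  then obtain l where l: "l < Suc ?k" "{?f x, ?f (bar n x)} = std n l" by blast
  have l': "l < n div 2" using l(1) k half by linarith
  have fl: "lev n (?f x) = l" using std_eq[OF l', of "?f x"] l(2) by blast
  have "l \<noteq> 0" using fp_range(2)[OF less.prems(1) x_out] fl by simp
  have "l = ?k"
  proof (rule ccontr)
    assume "l \<noteq> ?k"
    then obtain j where j: "l = Suc j" "j < ?l" using l(1) \<open>l \<noteq> 0\<close> by (cases l) auto
    have jn: "Suc (2 * j) < n" using j l' by linarith
    let ?y = "n - 2 * j"
    have y: "?y \<in> {1..n}" "lev n ?y = j" using lev_upper[OF jn] jn by auto
    have yb: "lev n ?y < lev n b" using y(2) j(2) less.prems(2) by simp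
    have "{?f ?y, ?f (bar n ?y)} = std n l" using less.hyps[of ?y] y j yb by simp
    then have "?f x \<in> {?f ?y, ?f (bar n ?y)}" using l(2) by auto
    moreover have by_in: "bar n ?y \<in> {1..n}" using y(1) bar_in by blast
    moreover have "?y \<notin> {a, b}" "bar n ?y \<notin> {a, b}" using out[OF yb] out[of "bar n ?y"] yb by simp_all
    ultimately have "x = ?y \<or> x = bar n ?y"
      using fp_inj[OF less.prems(1) x_out y(1)] fp_inj[OF less.prems(1) x_out by_in] by auto
    then show False using y(2) j(2) lev_bar[of n ?y] by auto
  qed
  then show ?case using l(2) by simp
qed

lemma fp_above:
  assumes "x \<in> {1..n}" "lev n x < lev n b"
  shows "lev n (fp {a, b} x) = Suc (lev n x)" "fp {a, b} (bar n x) = bar n (fp {a, b} x)" "x \<notin> {a, b}"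
proof -
  have half: "Suc (lev n x) < n div 2" using deep_pair_half[OF ab] assms(2) by simp
  have out: "y \<notin> {a, b}" if "lev n y < lev n b" for y using that ab unfolding deep_pair_def by auto
  show x_out: "x \<notin> {a, b}" by (rule out[OF assms(2)])
  have f: "fp {a, b} x \<in> std n (Suc (lev n x))" "fp {a, b} (bar n x) \<in> std n (Suc (lev n x))"
    using fp_std[OF assms] by blast+
  then show l: "lev n (fp {a, b} x) = Suc (lev n x)" using std_eq[OF half] by blast
  have "bar n x \<in> {1..n}" "bar n x \<noteq> x" using assms bar_neq[of x n] half by (auto simp del: atLeastAtMost_iff)
  then have "fp {a, b} x \<noteq> fp {a, b} (bar n x)"
    using fp_inj[OF assms(1) x_out, of "bar n x"] out[of "bar n x"] assms(2) by auto
  then show "fp {a, b} (bar n x) = bar n (fp {a, b} x)"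
    using lev_eq[of "fp {a, b} x" n "fp {a, b} (bar n x)"] f std_eq[OF half] by metis
qed

lemma fp_image_pair:
  assumes "deep_pair n c d" "{a, b} \<inter> {c, d} = {}"
  obtains c' d' where "deep_pair n c' d'" "{fp {a, b} c, fp {a, b} d} = {c', d'}" "0 < lev n d'"
proof -
  have cd: "c \<in> {1..n}" "d \<in> {1..n}" "c \<noteq> d" "c \<notin> {a, b}" "d \<notin> {a, b}" using assms unfolding deep_pair_def by auto
  have "fp {a, b} c \<noteq> fp {a, b} d" using fp_inj[OF cd(1,4,2,5)] cd(3) by blast
  then have "card {fp {a, b} c, fp {a, b} d} = 2" by simp
  moreover have "{fp {a, b} c, fp {a, b} d} \<subseteq> {1..n}" using fp_range(1) cd by blast
  ultimately obtain c' d' where c: "{fp {a, b} c, fp {a, b} d} = {c', d'}" "deep_pair n c' d'" by (rule deep_pair_ex)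
  then have "d' = fp {a, b} c \<or> d' = fp {a, b} d" by auto
  then have "0 < lev n d'" using fp_range(2) cd by blast
  then show ?thesis using that c by blast
qed

lemma lft_pair_mult:
  assumes q: "deep_pair n c d" and disj: "{a, b} \<inter> {c, d} = {}"
  shows "lft (elt {{a, b}} \<odot> elt {{fp {a, b} c, fp {a, b} d}}) = {{a, b}, {c, d}}"
    "\<And>x. x \<in> {1..n} \<Longrightarrow> x \<notin> {a, b} \<Longrightarrow> x \<notin> {c, d} \<Longrightarrow>
      {LP x, RP (fp {fp {a, b} c, fp {a, b} d} (fp {a, b} x))} \<in> elt {{a, b}} \<odot> elt {{fp {a, b} c, fp {a, b} d}}"
    "elt {{a, b}} \<odot> elt {{fp {a, b} c, fp {a, b} d}} \<in> \<Lambda>"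
proof -
  obtain c' d' where c': "deep_pair n c' d'" "{fp {a, b} c, fp {a, b} d} = {c', d'}"
    by (rule fp_image_pair[OF q disj])
  have cd: "c \<in> {1..n}" "d \<in> {1..n}" "c \<noteq> d" "c \<notin> {a, b}" "d \<notin> {a, b}" using q disj unfolding deep_pair_def by auto
  note q' = canonical_section.pair_elt[OF canonical_section_axioms c'(1)]
  let ?\<gamma> = "elt {{a, b}} \<odot> elt {{fp {a, b} c, fp {a, b} d}}"
  show "?\<gamma> \<in> \<Lambda>" unfolding c'(2) by (rule mult[OF pair_elt(1) q'(1)])
  show LR: "{LP x, RP (fp {fp {a, b} c, fp {a, b} d} (fp {a, b} x))} \<in> ?\<gamma>"
    if x: "x \<in> {1..n}" "x \<notin> {a, b}" "x \<notin> {c, d}" for x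
  proof -
    have "fp {a, b} x \<notin> {fp {a, b} c, fp {a, b} d}"
      using fp_inj[OF x(1,2) cd(1,4)] fp_inj[OF x(1,2) cd(2,5)] x(3) by auto
    then have "{LP (fp {a, b} x), RP (fp {c', d'} (fp {a, b} x))} \<in> elt {{c', d'}}"
      using canonical_section.fp_iff[OF canonical_section_axioms c'(1)] fp_range(1)[OF x(1,2)] unfolding c'(2) by simp
    moreover have "{LP x, RP (fp {a, b} x)} \<in> elt {{a, b}}" using fp_iff x by simp
    ultimately show ?thesis unfolding c'(2) using mult_LR by blast
  qed
  show "lft ?\<gamma> = {{a, b}, {c, d}}"
  proof (rule lft_eqI)
    show B: "?\<gamma> \<in> brauer n" unfolding c'(2) by (rule brauer_mult_closed[OF pair_elt(3) q'(3)])
    have "{LP a, LP b} \<in> ?\<gamma>" by (rule mult_LL[OF pair_LL]) (use ab in \<open>simp add: deep_pair_def\<close>)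
    moreover have "{LP c, LP d} \<in> ?\<gamma>"
    proof (rule mult_LLR[OF _ _ _ cd(3)])
      show "{LP c, RP (fp {a, b} c)} \<in> elt {{a, b}}" "{LP d, RP (fp {a, b} d)} \<in> elt {{a, b}}"
        using fp_iff cd by simp_all
      have "{c', d'} \<in> lft (elt {{c', d'}})" using q'(2) by simp
      then show "{LP (fp {a, b} c), LP (fp {a, b} d)} \<in> elt {{fp {a, b} c, fp {a, b} d}}"
        unfolding c'(2)[symmetric] pair_lft .
    qed
    ultimately show "{{a, b}, {c, d}} \<subseteq> lft ?\<gamma>" by (simp add: pair_lft)
    fix x assume "x \<in> {1..n}" "x \<notin> \<Union>{{a, b}, {c, d}}"
    then show "\<exists>y. {LP x, RP y} \<in> ?\<gamma>" using LR[of x] by auto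
  qed
qed

end

text \<open>Both products have the left pairs \<open>{a, b}\<close> and \<open>{c, d}\<close>, so
  they are the same element of the cross-section.\<close>

lemma fp_commute:
  assumes p: "deep_pair n a b" and q: "deep_pair n c d" and disj: "{a, b} \<inter> {c, d} = {}"
    and x: "x \<in> {1..n}" "x \<notin> {a, b}" "x \<notin> {c, d}"
  shows "fp {fp {a, b} c, fp {a, b} d} (fp {a, b} x) = fp {fp {c, d} a, fp {c, d} b} (fp {c, d} x)"
proof -
  have disj': "{c, d} \<inter> {a, b} = {}" using disj by blast
  note A = lft_pair_mult[OF p q disj] and B = lft_pair_mult[OF q p disj']
  have "elt {{a, b}} \<odot> elt {{fp {a, b} c, fp {a, b} d}} = elt {{c, d}} \<odot> elt {{fp {c, d} a, fp {c, d} b}}"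
    by (rule unique[OF A(3) B(3)]) (simp add: A(1) B(1) insert_commute)
  then show ?thesis
    using A(2)[OF x] B(2)[OF x(1,3,2)] brauer_LR_unique[OF brauer[OF A(3)]] by metis
qed

end

text \<open>
  Conjugation by products of \<open>(n - 2 l - 1, n - 2 l)\<close> keeps a cross-section canonical; it is used to
  untwist the element whose left pair is the deepest standard pair, level by level.
\<close>

definition normal :: "nat \<Rightarrow> pin set set set \<Rightarrow> bool" where
  "normal n \<Lambda> \<longleftrightarrow> canonical n \<Lambda> \<and> (\<forall>\<alpha>\<in>\<Lambda>. lft \<alpha> = {std n (n div 2 - 1)} \<longrightarrow>
     (\<forall>x\<in>{1..n}. lev n x < n div 2 - 1 \<longrightarrow> {LP x, RP (x - 2)} \<in> \<alpha>))"

section \<open>Signs of a normalised cross-section\<close>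

lemma deep_std: "b \<in> {1..n} \<Longrightarrow> lev n b < n div 2 \<Longrightarrow> deep_pair n (bar n b) b"
  unfolding deep_pair_def using bar_neq[of b n] by (simp del: atLeastAtMost_iff)

lemma bar_shift_neq: "x \<in> {1..n} \<Longrightarrow> Suc (lev n x) < n div 2 \<Longrightarrow> bar n (x - 2) \<noteq> x - 2"
  using bar_neq[OF shift(1)] shift(2) by metis

lemma upper_in: "Suc (2 * k) < n \<Longrightarrow> n - 2 * k \<in> {1..n}"
  by auto

lemma top_facts:
  assumes "1 \<le> n div 2"
  shows "n \<in> {1..n}" "lev n n = 0" "bar n n = n - 1"
  using assms bar_upper[of 0 n] lev_upper[of 0 n] by auto

lemma top_shift_facts:
  assumes "1 < n div 2"
  shows "n - 2 \<in> {1..n}" "lev n (n - 2) = 1" "bar n (n - 2) = n - 3" "n - 3 \<noteq> n - 2"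
  using assms bar_upper[of 1 n] lev_upper[of 1 n] by (auto simp: numeral_3_eq_3)

locale normal_section = canonical_section +
  assumes normal: "normal n \<Lambda>"
begin

text \<open>The sign is read off from the image of \<open>n\<close>, which is \<open>n - 2\<close>
  without and \<open>n - 3\<close> with a twist; by \<open>fp_sign\<close> this value decides all
  levels.\<close>

definition tw :: "nat set set" where
  "tw = {p \<in> mixed n. fp p n = n - 3}"

lemma fp_last:
  assumes b: "b \<in> {1..n}" "lev n b = n div 2 - 1" and x: "x \<in> {1..n}" "lev n x < n div 2 - 1"
  shows "fp {bar n b, b} x = x - 2"
proof -
  have half: "lev n b < n div 2" using b(2) x(2) by simp
  note d = deep_std[OF b(1) half]
  have "{bar n b, b} = std n (n div 2 - 1)" using std_bar[OF b(1) half] b(2) by (simp add: insert_commute)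
  then have "lft (elt {{bar n b, b}}) = {std n (n div 2 - 1)}" using pair_elt(2)[OF d] by simp
  then have "{LP x, RP (x - 2)} \<in> elt {{bar n b, b}}"
    using normal pair_elt(1)[OF d] x unfolding normal_def by blast
  then show ?thesis using fp_iff[OF d] by simp
qed

text \<open>Induction upwards from the deepest standard pair, that of \<open>c\<close>, whose
  generator is a plain shift by normality. It is compared with the generator of
  \<open>{bar n b, b}\<close> through \<open>fp_commute\<close>.\<close>

lemma fp_std_pair:
  assumes "b \<in> {1..n}" "lev n b < n div 2" "x \<in> {1..n}" "lev n x < lev n b"
  shows "fp {bar n b, b} x = x - 2"
  using assms
proof (induction "n div 2 - lev n b" arbitrary: b x rule: less_induct)
  case less
  let ?h = "n div 2"
  show ?case
  proof (cases "lev n b = ?h - 1")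
    case True then show ?thesis using fp_last less.prems by simp
  next
    case False
    then have lb: "Suc (lev n b) < ?h" using less.prems(2) by simp
    define c where "c = n - 2 * (?h - 1)"
    have "Suc (2 * (?h - 1)) < n" using lb by linarith
    then have c: "c \<in> {1..n}" "lev n c = ?h - 1" using lev_upper upper_in unfolding c_def by blast+
    have bc: "lev n b < lev n c" "lev n c < ?h" using c(2) lb by auto
    note q = deep_std[OF less.prems(1,2)] and p = deep_std[OF c(1) bc(2)]
    have disj: "{bar n c, c} \<inter> {bar n b, b} = {}"
      using bc(1) lev_bar[of n b] lev_bar[of n c] by (auto simp: bar_eq_iff)
    have x_out: "x \<notin> {bar n c, c}" "x \<notin> {bar n b, b}"
      using less.prems(4) bc(1) lev_bar[of n b] lev_bar[of n c] by auto
    have b_in: "bar n b \<in> {1..n}" "lev n (bar n b) = lev n b" using less.prems(1) bar_in by auto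
    have last: "fp {bar n c, c} y = y - 2" if "y \<in> {1..n}" "lev n y < ?h - 1" for y
      by (rule fp_last[OF c that])
    note sb = shift[OF less.prems(1) lb]
    have "Suc (lev n x) < ?h" using less.prems(4) lb by simp
    note sx = shift[OF less.prems(3) this]
    have lx: "lev n (x - 2) < lev n (b - 2)" using sx(2) sb(2) less.prems(4) by simp
    \<comment> \<open>The shift carries \<open>{bar n b, b}\<close> to the standard pair one level
      deeper, where the induction hypothesis is available.\<close>
    have "fp {fp {bar n c, c} (bar n b), fp {bar n c, c} b} (fp {bar n c, c} x) = fp {bar n (b - 2), b - 2} (x - 2)"
      using last[OF b_in(1)] last[OF less.prems(1)] last[OF less.prems(3)] b_in(2) lb less.prems(4) sb(3) by simp
    also have "\<dots> = x - 2 - 2"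
      by (rule less.hyps) (use sb(1,2) sx(1) lx lb in simp_all)
    also have "fp {fp {bar n c, c} (bar n b), fp {bar n c, c} b} (fp {bar n c, c} x) =
        fp {fp {bar n b, b} (bar n c), fp {bar n b, b} c} (fp {bar n b, b} x)"
      by (rule fp_commute[OF p q disj less.prems(3) x_out])
    also have "fp {bar n b, b} (bar n c) = bar n c"
      by (rule fp_below[OF q]) (use disj bc c(1) in \<open>simp_all del: atLeastAtMost_iff\<close>)
    also have "fp {bar n b, b} c = c"
      by (rule fp_below[OF q c(1)]) (use disj bc in simp_all)
    finally have eq: "fp {bar n c, c} (fp {bar n b, b} x) = x - 2 - 2" .
    note fx = fp_above[OF q less.prems(3,4)] fp_range[OF q less.prems(3) x_out(2)]
    have lfx: "lev n (fp {bar n b, b} x) < ?h - 1" using fx(1) less.prems(4) lb by simp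
    \<comment> \<open>The generator of \<open>c\<close> acts on this image as subtraction of 2,
      which is cancelled because both points are at least 3.\<close>
    have "fp {bar n b, b} x - 2 = x - 2 - 2" using last[OF fx(4) lfx] eq by simp
    moreover have "3 \<le> fp {bar n b, b} x" by (rule shift(4)[OF fx(4)]) (use lfx in simp)
    ultimately show ?thesis using sx(4) by linarith
  qed
qed

context
  fixes a b assumes ab: "deep_pair n a b"
begin

text \<open>This makes the twist independent of the level. The generator of the standard pair of
  \<open>x - 2\<close> sends \<open>x\<close> to \<open>x - 2\<close> and fixes \<open>a\<close> and
  \<open>b\<close>; in the other order the image of that standard pair is again standard, so its
  generator is a plain shift, and \<open>fp_commute\<close> compares the two.\<close>

lemma fp_shift:
  assumes "x \<in> {1..n}" "Suc (lev n x) < lev n b"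
  shows "fp {a, b} (x - 2) = fp {a, b} x - 2"
proof -
  have half: "lev n b < n div 2" by (rule deep_pair_half[OF ab])
  have h: "Suc (lev n x) < n div 2" using half assms(2) by simp
  note s = shift[OF assms(1) h]
  let ?d = "x - 2"
  have d: "?d \<in> {1..n}" "lev n ?d < n div 2" "lev n ?d < lev n b" using s(1,2) h assms(2) by simp_all
  note q = deep_std[OF d(1,2)]
  have ab': "a \<in> {1..n}" "b \<in> {1..n}" "lev n b \<le> lev n a" using ab unfolding deep_pair_def by simp_all
  have disj: "{a, b} \<inter> {bar n ?d, ?d} = {}" using d(3) ab'(3) lev_bar[of n ?d] by auto
  have "lev n x \<noteq> lev n ?d" using s(2) by simp
  then have "x \<noteq> ?d" "x \<noteq> bar n ?d" using lev_bar[of n ?d] by metis+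
  then have x_out: "x \<notin> {a, b}" "x \<notin> {bar n ?d, ?d}" using assms(2) ab'(3) by auto
  have xb: "lev n x < lev n b" using assms(2) by simp
  have d_out: "?d \<notin> {a, b}" using disj by auto
  note fx = fp_above[OF ab assms(1) xb] fp_range[OF ab assms(1) x_out(1)]
  note fd = fp_above[OF ab d(1,3)] fp_range[OF ab d(1) d_out]
  have fd_h: "lev n (fp {a, b} ?d) < n div 2" using fd(1) d(3) half by simp
  have "fp {fp {a, b} (bar n ?d), fp {a, b} ?d} (fp {a, b} x) = fp {bar n (fp {a, b} ?d), fp {a, b} ?d} (fp {a, b} x)"
    using fd(2) by simp
  also have "\<dots> = fp {a, b} x - 2"
    by (rule fp_std_pair[OF fd(4) fd_h fx(4)]) (use fx(1) fd(1) s(2) in simp)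
  finally have "fp {a, b} x - 2 = fp {fp {bar n ?d, ?d} a, fp {bar n ?d, ?d} b} (fp {bar n ?d, ?d} x)"
    using fp_commute[OF ab q disj assms(1) x_out] by simp
  also have "fp {bar n ?d, ?d} a = a"
    by (rule fp_below[OF q ab'(1)]) (use disj d(3) ab'(3) in auto)
  also have "fp {bar n ?d, ?d} b = b"
    by (rule fp_below[OF q ab'(2)]) (use disj d(3) in auto)
  also have "fp {bar n ?d, ?d} x = x - 2"
    by (rule fp_std_pair[OF d(1,2) assms(1)]) (use s(2) in simp)
  finally show ?thesis by simp
qed

lemma fp_sign:
  assumes "x \<in> {1..n}" "lev n x < lev n b"
  shows "fp {a, b} x = (if fp {a, b} n = n - 3 then bar n (x - 2) else x - 2)"
  using assms
proof (induction "lev n x" arbitrary: x)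
  case 0
  have half: "1 < n div 2" using deep_pair_half[OF ab] 0 by simp
  note t = top_facts[of n] top_shift_facts[OF half]
  have t1: "n \<in> {1..n}" "lev n n = 0" "bar n n = n - 1" using top_facts[of n] half by simp_all
  have nb: "lev n n < lev n b" using t1(2) 0 by simp
  note f = fp_above[OF ab t1(1) nb] and r = fp_range[OF ab t1(1) fp_above(3)[OF ab t1(1) nb]]
  have fn: "fp {a, b} n = n - 2 \<or> fp {a, b} n = n - 3"
    using lev_eq[OF t(4) r(1)] t(5,6) f(1) t1(2) by auto
  have "x = n \<or> x = n - 1" using lev_eq[OF t1(1) 0(2)] 0(1) t1(2,3) by simp
  then show ?case
  proof
    assume "x = n"
    then show ?thesis using fn t(6,7) by auto
  next
    assume "x = n - 1"
    then have xn: "x = bar n n" using t1(3) by simp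
    have "Suc (lev n n) < n div 2" using half t1(2) by simp
    then have sh: "bar n (n - 2) = x - 2" using shift(3)[OF t1(1)] t1(3) \<open>x = n - 1\<close> by simp
    then have "bar n (x - 2) = n - 2" by (metis bar_bar)
    moreover have "fp {a, b} x = bar n (fp {a, b} n)" using f(2) xn by simp
    ultimately show ?thesis using fn t(6,7) sh by (metis bar_bar)
  qed
next
  case (Suc l)
  have half: "lev n b < n div 2" by (rule deep_pair_half[OF ab])
  let ?x = "x + 2"
  have x2: "?x \<in> {1..n}" "lev n ?x = l" using Suc.hyps(2) Suc.prems(1) unfolding lev_def by auto
  have h: "Suc (lev n ?x) < lev n b" using x2(2) Suc.hyps(2) Suc.prems(2) by simp
  have sh: "bar n (?x - 2) = bar n ?x - 2" "Suc (lev n ?x) < n div 2"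
    using shift(3)[OF x2(1)] h half by auto
  have sx: "bar n (x - 2) = bar n x - 2" using shift(3)[OF Suc.prems(1)] Suc.prems(2) half by simp
  have "fp {a, b} x = fp {a, b} ?x - 2" using fp_shift[OF x2(1) h] by simp
  also have "fp {a, b} ?x = (if fp {a, b} n = n - 3 then bar n x else x)"
    using Suc.hyps(1)[of ?x] x2 h by simp
  finally show ?case using sx by simp
qed

lemma tw_sign:
  assumes "0 < lev n b" shows "{a, b} \<in> tw \<longleftrightarrow> fp {a, b} n = n - 3"
proof
  assume "fp {a, b} n = n - 3"
  moreover have "{a, b} \<in> mixed n"
  proof (rule ccontr)
    assume "{a, b} \<notin> mixed n"
    then have "lev n a = lev n b" using ab assms unfolding pair_mixed deep_pair_def by auto
    then have "a = bar n b" using lev_eq[of b n a] ab unfolding deep_pair_def by auto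
    moreover have b: "b \<in> {1..n}" "lev n b < n div 2" using ab deep_pair_half[OF ab] unfolding deep_pair_def by simp_all
    have "1 < n div 2" using b(2) assms by simp
    moreover have "fp {bar n b, b} n = n - 2"
      by (rule fp_std_pair[OF b]) (use top_facts[of n] b(2) assms in simp_all)
    ultimately show False using top_shift_facts(4)[of n] \<open>fp {a, b} n = n - 3\<close> by simp
  qed
  ultimately show "{a, b} \<in> tw" unfolding tw_def by simp
qed (simp add: tw_def)

lemma fp_phi:
  assumes "x \<in> {1..n}" "x \<notin> {a, b}" shows "fp {a, b} x = phi n tw {a, b} x"
proof (cases rule: phi_cases[OF ab assms, where T = tw])
  case 1
  then show ?thesis
    unfolding fp_sign[OF assms(1) 1] phi_above(1)[OF ab assms(1) 1] using tw_sign by simp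
next
  case 2
  then show ?thesis using fp_partner[OF ab] assms(2) by simp
next
  case 3
  then show ?thesis using fp_below[OF ab assms] by simp
qed

lemma elt_gen: "elt {{a, b}} = gen n tw {a, b}"
proof (rule brauer_subset_eq[OF pair_elt(3)[OF ab] gen_brauer[OF ab]], rule subsetI)
  fix B assume "B \<in> gen n tw {a, b}"
  from gen_block[OF ab this] show "B \<in> elt {{a, b}}"
  proof (elim disjE exE conjE)
    assume "B = {LP a, LP b}" then show ?thesis using pair_LL[OF ab] by simp
  next
    assume "B = {RP (n - 1), RP n}"
    moreover have "{n - 1, n} \<in> rgt (elt {{a, b}})" using pair_rgt_eq[OF ab] by (simp add: std_def)
    ultimately show ?thesis by (simp add: pair_rgt)
  next
    fix x assume x: "x \<in> {1..n} - {a, b}" "B = {LP x, RP (phi n tw {a, b} x)}"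
    then have "{LP x, RP (fp {a, b} x)} \<in> elt {{a, b}}" using fp_iff[OF ab] by simp
    then show ?thesis using x fp_phi[of x] by simp
  qed
qed

end

text \<open>Both closure conditions are \<open>fp_commute\<close> evaluated at \<open>n\<close>,
  where the images display the signs.\<close>

lemma valid_tw: "valid n tw"
  unfolding valid_def
proof (intro conjI allI impI)
  show "tw \<subseteq> mixed n" unfolding tw_def by blast
next
  fix a b c
  assume *: "{a, b} \<in> mixed n \<and> {c, bar n b} \<in> mixed n \<and> lev n b < lev n a \<and> lev n b < lev n c \<and> a \<noteq> c"
  then have in_n: "a \<in> {1..n}" "b \<in> {1..n}" "c \<in> {1..n}" and pos: "0 < lev n b"
    and lt: "lev n b < lev n a" "lev n b < lev n c" and ac: "a \<noteq> c"
    unfolding pair_mixed by auto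
  have bar_in': "bar n b \<in> {1..n}" using in_n(2) bar_in by blast
  have p: "deep_pair n a b" and q: "deep_pair n c (bar n b)"
    unfolding deep_pair_def using in_n bar_in' lt by auto
  have half: "lev n b < n div 2" by (rule deep_pair_half[OF p])
  have bb: "bar n b \<noteq> b" by (rule bar_neq[OF in_n(2) half])
  have disj: "{a, b} \<inter> {c, bar n b} = {}" using lt ac bb lev_bar[of n b] by auto
  have t: "n \<in> {1..n}" "lev n n = 0" using top_facts[of n] half by auto
  have nb: "lev n n < lev n b" "lev n n < lev n (bar n b)" using t(2) pos by simp_all
  note f = fp_above[OF p t(1) nb(1)] and g = fp_above[OF q t(1) nb(2)]
  have 1: "fp {a, b} c = c" by (rule fp_below[OF p in_n(3)]) (use lt ac in auto)
  have 2: "fp {a, b} (bar n b) = a" by (rule fp_partner[OF p]) (use disj in auto)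
  have 3: "fp {c, bar n b} a = a" by (rule fp_below[OF q in_n(1)]) (use disj lt in auto)
  have 4: "fp {c, bar n b} b = c" using fp_partner[OF q] disj by auto
  have "fp {c, a} (fp {a, b} n) = fp {a, c} (fp {c, bar n b} n)"
    using fp_commute[OF p q disj t(1) f(3) g(3)] 1 2 3 4 by simp
  \<comment> \<open>In both orders the second generator belongs to \<open>{a, c}\<close>; its strand
    map is injective and can be cancelled.\<close>
  then have eq: "fp {a, c} (fp {a, b} n) = fp {a, c} (fp {c, bar n b} n)" by (simp add: insert_commute)
  obtain c' d' where cd: "{a, c} = {c', d'}" "deep_pair n c' d'"
    using deep_pair_ex[of "{a, c}" n] ac in_n by (auto simp del: atLeastAtMost_iff)
  have "fp {a, b} n = fp {c, bar n b} n"
  proof (rule fp_inj[OF cd(2)])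
    show "fp {a, b} n \<in> {1..n}" by (rule fp_range(1)[OF p t(1) f(3)])
    show "fp {c, bar n b} n \<in> {1..n}" by (rule fp_range(1)[OF q t(1) g(3)])
    show "fp {a, b} n \<notin> {c', d'}" unfolding cd(1)[symmetric] using f(1) t(2) lt pos by auto
    show "fp {c, bar n b} n \<notin> {c', d'}" unfolding cd(1)[symmetric] using g(1) t(2) lt pos by auto
    show "fp {c', d'} (fp {a, b} n) = fp {c', d'} (fp {c, bar n b} n)" using eq unfolding cd(1) .
  qed
  then show "{a, b} \<in> tw \<longleftrightarrow> {c, bar n b} \<in> tw"
    using tw_sign[OF p] tw_sign[OF q] pos by simp
next
  fix a b c d
  assume *: "deep_pair n a b \<and> {c, d} \<in> mixed n \<and> lev n d < lev n c \<and> lev n d < lev n b \<and> {a, b} \<inter> {c, d} = {}"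
  then have p: "deep_pair n a b" and cd: "c \<in> {1..n}" "d \<in> {1..n}" "0 < lev n d" "lev n d < lev n c"
    and lt: "lev n d < lev n b" and disj: "{a, b} \<inter> {c, d} = {}"
    unfolding pair_mixed by auto
  have q: "deep_pair n c d" unfolding deep_pair_def using cd by auto
  have out: "c \<notin> {a, b}" "d \<notin> {a, b}" using disj by auto
  have ab: "a \<in> {1..n}" "b \<in> {1..n}" "lev n b \<le> lev n a" using p unfolding deep_pair_def by simp_all
  let ?c = "fp {a, b} c" and ?d = "fp {a, b} d"
  note fd = fp_above[OF p cd(2) lt] fp_range[OF p cd(2) out(2)]
  have "lev n ?d < lev n ?c"
  proof (cases rule: phi_cases[OF p cd(1) out(1), where T = tw])
    case 1 then show ?thesis using fp_above(1)[OF p cd(1) 1] fd(1) cd(4) by simp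
  next
    case 2
    have "?c = a" using 2(3) fp_phi[OF p cd(1) out(1)] by simp
    then show ?thesis using 2(2) fd(1) lt by simp
  next
    case 3
    have "?c = c" using 3(2) fp_phi[OF p cd(1) out(1)] by simp
    then show ?thesis using 3(1) fd(1) lt by simp
  qed
  then have q': "deep_pair n ?c ?d" unfolding deep_pair_def using fd(4) fp_range(1)[OF p cd(1) out(1)] by auto
  have half: "lev n b < n div 2" by (rule deep_pair_half[OF p])
  have t: "n \<in> {1..n}" "lev n n = 0" using top_facts[of n] half by auto
  have nd: "lev n n < lev n d" "lev n n < lev n b" using t(2) cd(3) lt by simp_all
  note fn = fp_above[OF p t(1) nd(2)] fp_range[OF p t(1) fp_above(3)[OF p t(1) nd(2)]]
  note gn = fp_above[OF q t(1) nd(1)] fp_range[OF q t(1) fp_above(3)[OF q t(1) nd(1)]]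
  have a': "fp {c, d} a = a" by (rule fp_below[OF q ab(1)]) (use disj lt ab(3) in auto)
  have b': "fp {c, d} b = b" by (rule fp_below[OF q ab(2)]) (use disj lt in auto)
  have eq: "fp {?c, ?d} (fp {a, b} n) = fp {a, b} (fp {c, d} n)"
    using fp_commute[OF p q disj t(1) fn(3) gn(3)] a' b' by simp
  have l: "lev n (fp {a, b} n) < lev n ?d" "lev n (fp {c, d} n) < lev n b"
    using fn(1) gn(1) t(2) fd(1) cd(3) lt by simp_all
  have sgn: "fp {a, b} n = (if fp {a, b} n = n - 3 then bar n (n - 2) else n - 2)"
    "fp {c, d} n = (if fp {c, d} n = n - 3 then bar n (n - 2) else n - 2)"
    using fp_sign[OF p t(1) nd(2)] fp_sign[OF q t(1) nd(1)] by blast+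
  have h2: "Suc (lev n (n - 2)) < n div 2" "n - 2 \<in> {1..n}" "1 < n div 2"
    using half lt cd(3) top_shift_facts[of n] by auto
  note s4 = shift[OF h2(2,1)] and b4 = bar_shift_neq[OF h2(2,1)]
  have bs: "bar n (n - 2) - 2 = bar n (n - 2 - 2)" using s4(3) by simp
  have L: "fp {?c, ?d} (fp {a, b} n) = (if fp {?c, ?d} n = n - 3 then bar n (fp {a, b} n - 2) else fp {a, b} n - 2)"
    by (rule fp_sign[OF q' fn(4) l(1)])
  have R: "fp {a, b} (fp {c, d} n) = (if fp {a, b} n = n - 3 then bar n (fp {c, d} n - 2) else fp {c, d} n - 2)"
    by (rule fp_sign[OF p gn(4) l(2)])
  have sub: "fp {a, b} n - 2 = (if fp {a, b} n = n - 3 then bar n (n - 2 - 2) else n - 2 - 2)"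
    "fp {c, d} n - 2 = (if fp {c, d} n = n - 3 then bar n (n - 2 - 2) else n - 2 - 2)"
    using sgn bs by (metis (full_types))+
  \<comment> \<open>Up to twists both sides of \<open>eq\<close> are \<open>n - 2 - 2\<close>. The
    twist of \<open>{a, b}\<close> occurs on both and cancels, which leaves that of the image pair
    against that of \<open>{c, d}\<close>.\<close>
  have "fp {?c, ?d} n = n - 3 \<longleftrightarrow> fp {c, d} n = n - 3"
    using eq b4 b4[symmetric] unfolding L R sub by (auto split: if_splits)
  moreover have "{?c, ?d} = {phi n tw {a, b} c, phi n tw {a, b} d}"
    using fp_phi[OF p cd(1) out(1)] fp_phi[OF p cd(2) out(2)] by simp
  ultimately show "{phi n tw {a, b} c, phi n tw {a, b} d} \<in> tw \<longleftrightarrow> {c, d} \<in> tw"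
    using tw_sign[OF q'] tw_sign[OF q] cd(3) fd(1) by simp
qed

lemma id_in: "perm_brauer n id \<in> \<Lambda>"
proof -
  note e = elt[OF matching_empty]
  have "perm_brauer n id = elt {}"
  proof (rule brauer_subset_eq[OF e(3) perm_id(1), symmetric], rule subsetI)
    fix B assume "B \<in> perm_brauer n id"
    then obtain x where x: "x \<in> {1..n}" "B = {LP x, RP x}" unfolding perm_brauer_def by auto
    then show "B \<in> elt {}" using elt_std_below[of 0 x] by simp
  qed
  then show ?thesis using e(1) by simp
qed

text \<open>The elements of \<open>section_of\<close> are products of generators, so they lie in
  \<open>\<Lambda>\<close>; of two cross-sections neither can contain the other properly.\<close>

lemma eq_section: "\<Lambda> = section_of n tw"
proof -
  have "\<gamma> \<in> \<Lambda>" if "rep n tw L \<gamma>" for L \<gamma>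
    using that
  proof induction
    case rep_empty show ?case by (rule id_in)
  next
    case (rep_insert L p \<beta>)
    obtain a b where p: "p = {a, b}" "deep_pair n a b" by (rule matching_deep_pair[OF rep_insert.hyps(1,2)])
    then show ?case using mult[OF pair_elt(1)[OF p(2)] rep_insert.IH] elt_gen[OF p(2)] by simp
  qed
  then have sub: "section_of n tw \<subseteq> \<Lambda>" unfolding section_of_def by blast
  note c = section_of_cross_section[OF valid_tw]
  have "\<alpha> \<in> section_of n tw" if a: "\<alpha> \<in> \<Lambda>" for \<alpha>
  proof -
    obtain \<beta> where b: "\<beta> \<in> section_of n tw" "lft \<beta> = lft \<alpha>" "\<beta> \<in> brauer n"
      by (rule cross_section_ex[OF c matching_lft[OF brauer[OF a]]])
    then have "\<alpha> = \<beta>" using unique[OF a] sub by blast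
    then show ?thesis using b(1) by simp
  qed
  then show ?thesis using sub by blast
qed

end

section \<open>Normalised cross-sections and valid sign sets correspond\<close>

lemma normal_section_of:
  assumes "valid n T" shows "normal n (section_of n T)"
  unfolding normal_def
proof (intro conjI ballI impI)
  show c: "canonical n (section_of n T)" by (rule canonical_section_of[OF assms])
  fix \<alpha> x assume a: "\<alpha> \<in> section_of n T" "lft \<alpha> = {std n (n div 2 - 1)}"
    and x: "x \<in> {1..n}" "lev n x < n div 2 - 1"
  define b where "b = n - 2 * (n div 2 - 1)"
  have "Suc (2 * (n div 2 - 1)) < n" using x(2) by linarith
  then have b: "b \<in> {1..n}" "lev n b = n div 2 - 1" using lev_upper upper_in unfolding b_def by blast+
  have half: "lev n b < n div 2" using b(2) x(2) by simp
  note d = deep_std[OF b(1) half]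
  have "{bar n b, b} = std n (n div 2 - 1)" using std_bar[OF b(1) half] b(2) by (simp add: insert_commute)
  then have "\<alpha> = gen n T {bar n b, b}"
    using cross_section_unique[OF section_of_cross_section[OF assms] a(1) gen_in_section(1)[OF d]]
      gen_in_section(2)[OF d] a(2) by simp
  moreover have "{bar n b, b} \<notin> T"
  proof -
    have "{bar n b, b} \<notin> mixed n" unfolding pair_mixed by simp
    then show ?thesis using assms unfolding valid_def by blast
  qed
  moreover have xb: "lev n x < lev n b" using x(2) b(2) by simp
  moreover have "x \<notin> {bar n b, b}" using xb lev_bar[of n b] by auto
  ultimately show "{LP x, RP (x - 2)} \<in> \<alpha>"
    using gen_LR[OF d, of x "x - 2" T] phi_above(1)[OF d x(1) xb, of T] x(1) by simp
qed

lemma normal_iff: "normal n \<Lambda> \<longleftrightarrow> (\<exists>T. valid n T \<and> \<Lambda> = section_of n T)"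
proof
  assume n: "normal n \<Lambda>"
  then interpret normal_section n \<Lambda> by unfold_locales (simp_all add: normal_def)
  show "\<exists>T. valid n T \<and> \<Lambda> = section_of n T" using valid_tw eq_section by blast
qed (use normal_section_of in blast)

text \<open>For \<open>lev n b > 0\<close> the top pair is shifted, so one strand reveals the sign.
  This separates different sign sets and shows how conjugation acts on them.\<close>

lemma gen_sign:
  assumes "deep_pair n a b" "0 < lev n b"
  shows "{LP n, RP (n - 3)} \<in> gen n T {a, b} \<longleftrightarrow> {a, b} \<in> T"
    "{LP (n - 1), RP (n - 2)} \<in> gen n T {a, b} \<longleftrightarrow> {a, b} \<in> T"
    "{LP n, RP (n - 2)} \<in> gen n T {a, b} \<longleftrightarrow> {a, b} \<notin> T"
proof -
  have half: "1 < n div 2" using deep_pair_half[OF assms(1)] assms(2) by simp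
  have t: "n \<in> {1..n}" "lev n n = 0" "bar n n = n - 1" using top_facts[of n] half by auto
  note s = top_shift_facts[OF half]
  have nb: "lev n n < lev n b" using t(2) assms(2) by simp
  note f = phi_above[OF assms(1) t(1) nb, of T]
  have out: "n \<notin> {a, b}" "n - 1 \<notin> {a, b}" "n - 1 \<in> {1..n}"
    using t nb lev_bar[of n n] assms(1) half unfolding deep_pair_def by (auto simp del: lev_bar)
  have "phi n T {a, b} n = (if {a, b} \<in> T then n - 3 else n - 2)" using f(1) s(3) by simp
  moreover have "phi n T {a, b} (n - 1) = bar n (phi n T {a, b} n)" using f(4) t(3) by simp
  moreover have "bar n (n - 3) = n - 2" using s(3) by (metis bar_bar)
  ultimately show "{LP n, RP (n - 3)} \<in> gen n T {a, b} \<longleftrightarrow> {a, b} \<in> T"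
    "{LP (n - 1), RP (n - 2)} \<in> gen n T {a, b} \<longleftrightarrow> {a, b} \<in> T"
    "{LP n, RP (n - 2)} \<in> gen n T {a, b} \<longleftrightarrow> {a, b} \<notin> T"
    using gen_LR[OF assms(1), of _ _ T] out t(1) s(3,4) s(4)[symmetric] by (auto split: if_splits)
qed

lemma mixed_deep:
  assumes "p \<in> mixed n" obtains a b where "p = {a, b}" "deep_pair n a b" "0 < lev n b" "lev n b < lev n a"
proof -
  obtain a b where "p = {a, b}" "a \<in> {1..n}" "b \<in> {1..n}" "lev n b < lev n a" "0 < lev n b"
    using assms unfolding mixed_def by blast
  then show ?thesis using that[of a b] unfolding deep_pair_def by auto
qed

lemma section_of_inj:
  assumes "valid n T" "valid n T'" "section_of n T = section_of n T'" shows "T = T'"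
proof -
  have sub: "S \<subseteq> mixed n" if "valid n S" for S using that unfolding valid_def by blast
  have "p \<in> T \<longleftrightarrow> p \<in> T'" if mixed: "p \<in> mixed n" for p
  proof -
    obtain a b where p: "p = {a, b}" "deep_pair n a b" "0 < lev n b" "lev n b < lev n a"
      using mixed by (rule mixed_deep)
    have "gen n T p = gen n T' p"
      using cross_section_unique[OF section_of_cross_section[OF assms(1)] gen_in_section(1)[OF p(2)]]
        gen_in_section[OF p(2)] assms(3) p(1) by metis
    then show ?thesis using gen_sign(1)[OF p(2,3)] p(1) by metis
  qed
  then show ?thesis using sub assms(1,2) by blast
qed

section \<open>Rigidity and the classification of valid sign sets\<close>

text \<open>\<open>F\<close> is a set of levels: the product of the transpositions of the standard
  pairs on the levels in \<open>F\<close>. All levels together give \<open>bar n\<close>.\<close>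

definition flip :: "nat \<Rightarrow> nat set \<Rightarrow> nat \<Rightarrow> nat" where
  "flip n F x = (if lev n x \<in> F then bar n x else x)"

lemma flip_flip [simp]: "flip n F (flip n F x) = x"
  by (simp add: flip_def)

lemma lev_flip [simp]: "lev n (flip n F x) = lev n x"
  by (simp add: flip_def)

lemma flip_bar: "flip n F (bar n x) = bar n (flip n F x)"
  by (simp add: flip_def)

lemma flip_UNIV: "flip n UNIV = bar n"
  by (simp add: flip_def fun_eq_iff)

lemma flip_in: "flip n F x \<in> {1..n} \<longleftrightarrow> x \<in> {1..n}"
  unfolding flip_def using bar_in[of n x] by (simp del: atLeastAtMost_iff)

lemma flip_permutes: "flip n F permutes {1..n}"
proof (rule bij_imp_permutes)
  show "bij_betw (flip n F) {1..n} {1..n}"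
    by (rule bij_betw_byWitness[where f' = "flip n F"]) (use flip_in in \<open>auto simp del: atLeastAtMost_iff\<close>)
  show "flip n F x = x" if "x \<notin> {1..n}" for x
    using that by (simp add: flip_def bar_def)
qed

lemma bar_permutes: "bar n permutes {1..n}"
  using flip_permutes[of n UNIV] unfolding flip_UNIV .

lemma bar_comp: "bar n \<circ> bar n = id"
  by (simp add: fun_eq_iff)

lemma image_std:
  assumes "\<sigma> permutes {1..n}" "\<And>x. x \<in> {1..n} \<Longrightarrow> lev n (\<sigma> x) = lev n x" "l < n div 2"
  shows "\<sigma> ` std n l = std n l"
proof (rule card_subset_eq)
  show "finite (std n l)" by (simp add: std_def)
  show "\<sigma> ` std n l \<subseteq> std n l"
    using assms(2) permutes_in_image[OF assms(1)] std_eq[OF assms(3)] by (intro image_subsetI) metis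
  show "card (\<sigma> ` std n l) = card (std n l)"
    by (rule card_image) (rule inj_on_subset[OF permutes_inj[OF assms(1)] subset_UNIV])
qed

text \<open>The first \<open>k\<close> standard pairs cover exactly the points of level less than
  \<open>k\<close>. A conjugating permutation has to preserve these sets for all \<open>k\<close>,
  and conversely a permutation preserving levels maps each standard pair to itself.\<close>

lemma conj_canonical_lev:
  assumes \<sigma>: "\<sigma> permutes {1..n}" and can: "canonical n \<Lambda>"
  shows "canonical n (conj_elem n \<sigma> ` \<Lambda>) \<longleftrightarrow> (\<forall>x\<in>{1..n}. lev n (\<sigma> x) = lev n x)"
proof
  interpret canonical_section n \<Lambda> using can by unfold_locales
  note inj = permutes_inj[OF \<sigma>]
  {
    assume c: "canonical n (conj_elem n \<sigma> ` \<Lambda>)"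
    have mem: "x \<in> {1..n} \<and> lev n x < k \<longleftrightarrow> \<sigma> x \<in> {1..n} \<and> lev n (\<sigma> x) < k" if k: "k \<le> n div 2" for k x
    proof -
      note M = std_matching[OF k] and e = elt[OF std_matching(1)[OF k]]
      have "(`) \<sigma> ` rgt (elt (std n ` {..<k})) = std n ` {..<card (lft (elt (std n ` {..<k})))}"
        using c e(1) unfolding conj_canonical_iff[OF \<sigma> cross] by blast
      then have "\<Union>((`) \<sigma> ` (std n ` {..<k})) = \<Union>(std n ` {..<k})"
        unfolding e(2,4) M(2) by simp
      then have "\<sigma> ` \<Union>(std n ` {..<k}) = \<Union>(std n ` {..<k})" by (simp only: image_Union)
      then have A: "\<sigma> ` {x \<in> {1..n}. lev n x < k} = {x \<in> {1..n}. lev n x < k}" unfolding M(3) .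
      have "\<sigma> x \<in> \<sigma> ` {x \<in> {1..n}. lev n x < k} \<longleftrightarrow> x \<in> {x \<in> {1..n}. lev n x < k}"
        by (rule inj_image_mem_iff[OF inj])
      then show ?thesis unfolding A by simp
    qed
    show "\<forall>x\<in>{1..n}. lev n (\<sigma> x) = lev n x"
    proof
      fix x assume x: "x \<in> {1..n}"
      have sx: "\<sigma> x \<in> {1..n}" using x permutes_in_image[OF \<sigma>] by simp
      show "lev n (\<sigma> x) = lev n x"
      proof (cases "lev n x < n div 2")
        case True
        then show ?thesis using mem[of "lev n x" x] mem[of "Suc (lev n x)" x] x sx by auto
      next
        case False
        then have "lev n x = n div 2" using lev_le[OF x] by simp
        then show ?thesis using mem[of "n div 2" x] x sx lev_le[OF sx] by auto
      qed
    qed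
  }
  assume l: "\<forall>x\<in>{1..n}. lev n (\<sigma> x) = lev n x"
  show "canonical n (conj_elem n \<sigma> ` \<Lambda>)"
    unfolding conj_canonical_iff[OF \<sigma> cross]
  proof
    fix \<alpha> assume a: "\<alpha> \<in> \<Lambda>"
    have "card (lft \<alpha>) \<le> n div 2" using card_matching_le[OF matching_lft[OF brauer[OF a]]] by simp
    then have "(`) \<sigma> ` std n ` {..<card (lft \<alpha>)} = std n ` {..<card (lft \<alpha>)}"
      unfolding image_image using image_std[OF \<sigma>] l by (intro image_cong) auto
    then show "(`) \<sigma> ` rgt \<alpha> = std n ` {..<card (lft \<alpha>)}" unfolding rgt_std[OF a] .
  qed
qed

lemma conj_canonical_flip: "canonical n \<Lambda> \<Longrightarrow> canonical n (conj_elem n (flip n F) ` \<Lambda>)"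
  using conj_canonical_lev[OF flip_permutes] by simp

text \<open>With at most one standard pair there is nothing to untwist. Otherwise the orbit of
  \<open>n\<close> under the generator of the deepest pair meets each level once, and flipping
  suitable levels turns this orbit into \<open>n\<close>, \<open>n - 2\<close>, \<open>n - 4\<close>
  and so on.\<close>

lemma ex_normal_flip:
  assumes can: "canonical n \<Lambda>" shows "\<exists>F. normal n (conj_elem n (flip n F) ` \<Lambda>)"
proof (cases "n div 2 \<le> 1")
  case True
  then show ?thesis using conj_canonical_flip[OF can] unfolding normal_def by auto
next
  case False
  interpret canonical_section n \<Lambda> using can by unfold_locales
  let ?h = "n div 2"
  define c where "c = n - 2 * (?h - 1)"
  have "Suc (2 * (?h - 1)) < n" using False by linarith
  then have c: "c \<in> {1..n}" "lev n c = ?h - 1" using lev_upper upper_in unfolding c_def by blast+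
  have ch: "lev n c < ?h" using c(2) False by simp
  note d = deep_std[OF c(1) ch]
  let ?p = "{bar n c, c}"
  have p: "?p = std n (?h - 1)" using std_bar[OF c(1) ch] c(2) by (simp add: insert_commute)
  \<comment> \<open>The generator moves down one level at a time, so \<open>z l\<close> is a point
    of level \<open>l\<close>.\<close>
  define z where "z l = (fp ?p ^^ l) n" for l
  have zS: "z (Suc l) = fp ?p (z l)" for l unfolding z_def by simp
  have top: "n \<in> {1..n}" "lev n n = 0" using top_facts[of n] False by auto
  have z: "z l \<in> {1..n} \<and> lev n (z l) = l" if "l \<le> ?h - 1" for l
    using that
  proof (induction l)
    case 0 then show ?case using top unfolding z_def by simp
  next
    case (Suc l)
    then have zl: "z l \<in> {1..n}" "lev n (z l) = l" "lev n (z l) < lev n c" using c(2) by auto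
    note f = fp_above[OF d zl(1,3)] and r = fp_range[OF d zl(1) fp_above(3)[OF d zl(1,3)]]
    show ?case unfolding zS using f(1) r(1) zl(2) by simp
  qed
  \<comment> \<open>The levels on which the orbit leaves the points \<open>n - 2 * l\<close>; the
    flip carries these points to the orbit.\<close>
  define F where "F = {l. z l \<noteq> n - 2 * l}"
  let ?g = "flip n F"
  have up: "n - 2 * l \<in> {1..n}" "lev n (n - 2 * l) = l" if "l \<le> ?h - 1" for l
  proof -
    have "Suc (2 * l) < n" using that False by linarith
    then show "n - 2 * l \<in> {1..n}" "lev n (n - 2 * l) = l" using upper_in lev_upper by blast+
  qed
  have g: "?g (n - 2 * l) = z l" if "l \<le> ?h - 1" for l
    using lev_eq[OF up(1)[OF that], of "z l"] z[OF that] up(2)[OF that] unfolding flip_def F_def by auto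
  have step: "?g (x - 2) = fp ?p (?g x)" if x: "x \<in> {1..n}" "lev n x < ?h - 1" for x
  proof -
    let ?l = "lev n x" and ?y = "n - 2 * lev n x"
    have l: "?l \<le> ?h - 1" "Suc ?l \<le> ?h - 1" "Suc ?l < ?h" using x(2) by auto
    note y = up[OF l(1)]
    have y2: "?g (?y - 2) = fp ?p (?g ?y)"
      using g[OF l(1)] g[OF l(2)] zS[of ?l] by simp
    have "x = ?y \<or> x = bar n ?y" using lev_eq[OF y(1) x(1)] y(2) by simp
    then show ?thesis
    proof
      assume "x = ?y" then show ?thesis using y2 by simp
    next
      assume xb: "x = bar n ?y"
      have "x - 2 = bar n (?y - 2)" using shift(3)[OF y(1)] y(2) l(3) xb by simp
      then have "?g (x - 2) = bar n (fp ?p (?g ?y))" using y2 by (simp add: flip_bar)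
      also have "\<dots> = fp ?p (bar n (?g ?y))"
        by (rule fp_above(2)[OF d, symmetric]) (use flip_in y x(2) c(2) in \<open>simp_all del: atLeastAtMost_iff\<close>)
      finally have "?g (x - 2) = fp ?p (bar n (?g ?y))" .
      moreover have "?g x = bar n (?g ?y)" using flip_bar[of n F ?y] unfolding xb[symmetric] .
      ultimately show ?thesis by simp
    qed
  qed
  have "normal n (conj_elem n ?g ` \<Lambda>)"
    unfolding normal_def
  proof (intro conjI ballI impI)
    show c': "canonical n (conj_elem n ?g ` \<Lambda>)" by (rule conj_canonical_flip[OF can])
    fix \<alpha> x assume a: "\<alpha> \<in> conj_elem n ?g ` \<Lambda>" "lft \<alpha> = {std n (?h - 1)}"
      and x: "x \<in> {1..n}" "lev n x < ?h - 1"
    have "lft (conj_elem n ?g (elt {?p})) = {std n (?h - 1)}"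
      using conj_elem_lft(1)[OF flip_permutes pair_elt(3)[OF d]] pair_elt(2)[OF d] p
        image_std[OF flip_permutes, of n F "?h - 1"] False by simp
    then have "\<alpha> = conj_elem n ?g (elt {?p})"
      using cross_section_unique[OF canonical_cross[OF c'] a(1)] a(2) pair_elt(1)[OF d] by simp
    moreover have "{LP (?g x), RP (?g (x - 2))} \<in> elt {?p}"
    proof -
      have "?g x \<in> {1..n}" using x(1) flip_in by blast
      moreover have "?g x \<notin> ?p"
        using x(2) c(2) lev_flip[of n F x] lev_bar[of n c] by (metis insertE less_irrefl singletonD)
      ultimately show ?thesis using fp_iff[OF d] step[OF x] by blast
    qed
    then have "{relabel ?g (LP (?g x)), relabel ?g (RP (?g (x - 2)))} \<in> conj_elem n ?g (elt {?p})"
      by (rule iffD2[OF conj_elem_iff[OF flip_permutes pair_elt(3)[OF d]]])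
    ultimately show "{LP x, RP (x - 2)} \<in> \<alpha>" by simp
  qed
  then show ?thesis by blast
qed

text \<open>Compatibility with the shift transports the image of \<open>n\<close> to all points
  \<open>n - 2 * l\<close>, because the flips of no level and of all levels commute with it.
  Injectivity settles the partners, and a point alone on its level is fixed.\<close>

lemma lev_preserving_determined:
  assumes \<sigma>: "\<sigma> permutes {1..n}" and lev: "\<And>x. x \<in> {1..n} \<Longrightarrow> lev n (\<sigma> x) = lev n x"
    and shifts: "\<And>x. x \<in> {1..n} \<Longrightarrow> Suc (lev n x) < n div 2 \<Longrightarrow> \<sigma> (x - 2) = \<sigma> x - 2"
    and top: "n \<in> {1..n} \<Longrightarrow> \<sigma> n = flip n S n" and S: "S = {} \<or> S = UNIV"
  shows "\<sigma> = flip n S"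
proof
  fix x
  let ?s = "flip n S"
  have upper: "\<sigma> (n - 2 * l) = ?s (n - 2 * l)" if "l < n div 2" for l
    using that
  proof (induction l)
    case 0 then show ?case using top by simp
  next
    case (Suc l)
    have ln: "Suc (2 * l) < n" using Suc.prems by linarith
    let ?y = "n - 2 * l"
    have y: "?y \<in> {1..n}" "Suc (lev n ?y) < n div 2" using upper_in[OF ln] lev_upper[OF ln] Suc.prems by auto
    have "\<sigma> (?y - 2) = ?s ?y - 2" using shifts[OF y] Suc by simp
    also have "\<dots> = ?s (?y - 2)" using S shift(3)[OF y] by (auto simp: flip_def)
    finally show ?case by (simp add: numeral_2_eq_2)
  qed
  show "\<sigma> x = ?s x"
  proof (cases "x \<in> {1..n}")
    case False
    then show ?thesis using permutes_not_in[OF \<sigma> False] permutes_not_in[OF flip_permutes False] by simp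
  next
    case x: True
    then have sx: "\<sigma> x \<in> {1..n}" using permutes_in_image[OF \<sigma>] by simp
    show ?thesis
    proof (cases "lev n x < n div 2")
      case False
      then have l: "lev n x = n div 2" using lev_le[OF x] by simp
      then have "bar n x = x" using lev_eq_half[OF x] by simp
      moreover have "\<sigma> x = x" using lev_eq[OF x sx] lev[OF x] calculation by simp
      ultimately show ?thesis by (simp add: flip_def)
    next
      case True
      let ?y = "n - 2 * lev n x"
      have ln: "Suc (2 * lev n x) < n" using True by linarith
      have y: "?y \<in> {1..n}" "lev n ?y = lev n x" using upper_in[OF ln] lev_upper[OF ln] by auto
      have sy: "\<sigma> ?y \<in> {1..n}" using permutes_in_image[OF \<sigma>] y(1) by simp
      have "x = ?y \<or> x = bar n ?y" using lev_eq[OF y(1) x] y(2) by simp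
      then show ?thesis
      proof
        assume "x = ?y" then show ?thesis using upper[OF True] by simp
      next
        assume xb: "x = bar n ?y"
        have "?y \<noteq> x" using bar_neq[OF y(1)] y(2) True xb by auto
        then have "\<sigma> x \<noteq> \<sigma> ?y" using permutes_inj[OF \<sigma>] by (metis injD)
        then have "\<sigma> x = bar n (\<sigma> ?y)" using lev_eq[OF sy sx] lev[OF x] lev[OF y(1)] y(2) by simp
        moreover have "?s x = bar n (?s ?y)" using flip_bar[of n S ?y] unfolding xb[symmetric] .
        ultimately show ?thesis using upper[OF True] by simp
      qed
    qed
  qed
qed

text \<open>In both cross-sections the generator of the deepest standard pair is the shift by 2, and
  \<open>\<sigma>\<close> carries one to the other since it preserves levels. So
  \<open>\<sigma>\<close> commutes with the shift and is determined by the image of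
  \<open>n\<close>.\<close>

lemma normal_rigid:
  assumes \<sigma>: "\<sigma> permutes {1..n}" and N: "normal n \<Lambda>" "normal n (conj_elem n \<sigma> ` \<Lambda>)"
  shows "\<sigma> = id \<or> \<sigma> = bar n"
proof -
  have can: "canonical n \<Lambda>" "canonical n (conj_elem n \<sigma> ` \<Lambda>)" using N unfolding normal_def by auto
  interpret canonical_section n \<Lambda> using can(1) by unfold_locales
  have lev: "lev n (\<sigma> x) = lev n x" if "x \<in> {1..n}" for x
    using conj_canonical_lev[OF \<sigma> can(1)] can(2) that by blast
  let ?h = "n div 2"
  have shifts: "\<sigma> (x - 2) = \<sigma> x - 2" if x: "x \<in> {1..n}" "Suc (lev n x) < ?h" for x
  proof -
    have h: "?h - 1 < ?h" "1 \<le> ?h" using x(2) by auto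
    define e where "e = elt {std n (?h - 1)}"
    have "matching n {std n (?h - 1)}" unfolding matching_singleton using std_pair[OF h(1)] by simp
    note e = elt[OF this, folded e_def]
    have "lft (conj_elem n \<sigma> e) = {std n (?h - 1)}"
      using conj_elem_lft(1)[OF \<sigma> e(3)] e(2) image_std[OF \<sigma> lev h(1)] by simp
    moreover have "\<sigma> x \<in> {1..n}" using permutes_in_image[OF \<sigma>] x(1) by simp
    moreover have "lev n (\<sigma> x) < ?h - 1" using lev[OF x(1)] x(2) by simp
    ultimately have "{LP (\<sigma> x), RP (\<sigma> x - 2)} \<in> conj_elem n \<sigma> e"
      using N(2) e(1) unfolding normal_def by blast
    moreover have "lev n x < ?h - 1" using x(2) by simp
    then have "{LP x, RP (x - 2)} \<in> e"
      using N(1) e(1,2) x(1) unfolding normal_def by blast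
    then have "{relabel \<sigma> (LP x), relabel \<sigma> (RP (x - 2))} \<in> conj_elem n \<sigma> e"
      by (rule iffD2[OF conj_elem_iff[OF \<sigma> e(3)]])
    then have "{LP (\<sigma> x), RP (\<sigma> (x - 2))} \<in> conj_elem n \<sigma> e" by simp
    ultimately show ?thesis by (rule brauer_LR_unique[OF conj_elem_brauer[OF \<sigma> e(3)]])
  qed
  have flip0: "flip n {} = id" by (simp add: flip_def fun_eq_iff)
  have "\<sigma> n = flip n {} n \<or> \<sigma> n = flip n UNIV n" if n: "n \<in> {1..n}"
    using lev_eq[OF n _ lev[OF n, symmetric]] permutes_in_image[OF \<sigma>, of n] n by (simp add: flip_def)
  then consider "n \<in> {1..n} \<Longrightarrow> \<sigma> n = flip n {} n" | "n \<in> {1..n} \<Longrightarrow> \<sigma> n = flip n UNIV n" by blast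
  then show ?thesis
  proof cases
    case 1
    have "\<sigma> = flip n {}" by (rule lev_preserving_determined[OF \<sigma> lev shifts 1]) auto
    then show ?thesis unfolding flip0 by simp
  next
    case 2
    have "\<sigma> = flip n UNIV" by (rule lev_preserving_determined[OF \<sigma> lev shifts 2]) auto
    then show ?thesis unfolding flip_UNIV by simp
  qed
qed

text \<open>\<open>bar n\<close> maps each standard pair to itself and commutes with the shift, so
  the generator of the deepest standard pair stays untwisted.\<close>

lemma normal_bar:
  assumes N: "normal n \<Lambda>" shows "normal n (conj_elem n (bar n) ` \<Lambda>)"
  unfolding normal_def
proof (intro conjI ballI impI)
  have can: "canonical n \<Lambda>" using N unfolding normal_def by auto
  show c: "canonical n (conj_elem n (bar n) ` \<Lambda>)"
    using conj_canonical_flip[OF can, of UNIV] unfolding flip_UNIV .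
  fix \<alpha> x assume a: "\<alpha> \<in> conj_elem n (bar n) ` \<Lambda>" "lft \<alpha> = {std n (n div 2 - 1)}"
    and x: "x \<in> {1..n}" "lev n x < n div 2 - 1"
  obtain \<beta> where b: "\<beta> \<in> \<Lambda>" "\<alpha> = conj_elem n (bar n) \<beta>" using a(1) by blast
  have B: "\<beta> \<in> brauer n" by (rule cross_section_brauer[OF canonical_cross[OF can] b(1)])
  have "conj_elem n (bar n) \<alpha> = \<beta>"
    using b(2) conj_elem_comp[OF bar_permutes bar_permutes] conj_elem_id[OF B] bar_comp by simp
  then have "lft \<beta> = (`) (bar n) ` lft \<alpha>"
    using conj_elem_lft(1)[OF bar_permutes conj_elem_brauer[OF bar_permutes B]] b(2) by simp
  also have "\<dots> = {std n (n div 2 - 1)}"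
    using a(2) image_std[OF bar_permutes, of n "n div 2 - 1"] x(2) by simp
  finally have lb: "lft \<beta> = {std n (n div 2 - 1)}" .
  have bx: "bar n x \<in> {1..n}" "lev n (bar n x) < n div 2 - 1" using x bar_in by auto
  have "{LP (bar n x), RP (bar n x - 2)} \<in> \<beta>" using N b(1) lb bx unfolding normal_def by blast
  then have "{relabel (bar n) (LP (bar n x)), relabel (bar n) (RP (bar n x - 2))} \<in> conj_elem n (bar n) \<beta>"
    by (rule iffD2[OF conj_elem_iff[OF bar_permutes B]])
  moreover have "bar n (bar n x - 2) = x - 2"
    using shift(3)[OF bx(1)] bx(2) by simp
  ultimately show "{LP x, RP (x - 2)} \<in> \<alpha>" using b(2) by simp
qed

lemma transpose_flip:
  assumes "Suc (2 * k) < n" "k \<notin> F"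
  shows "Transposition.transpose (n - Suc (2 * k)) (n - 2 * k) \<circ> flip n F = flip n (insert k F)"
proof
  fix x
  have h: "k < n div 2" using assms(1) by linarith
  have nb: "n - Suc (2 * k) \<noteq> n - 2 * k" using assms(1) by simp
  show "(Transposition.transpose (n - Suc (2 * k)) (n - 2 * k) \<circ> flip n F) x = flip n (insert k F) x"
  proof (cases "x \<in> std n k")
    case True
    then have "lev n x = k" using std_eq[OF h] by simp
    moreover have "x = n - 2 * k \<or> x = n - Suc (2 * k)" using True by (auto simp: std_def)
    ultimately show ?thesis
      using assms bar_upper[OF assms(1)] bar_lower[OF assms(1)] by (auto simp: flip_def)
  next
    case out: False
    have fx: "flip n F x \<notin> std n k" using out flip_in[of n F x] lev_flip[of n F x] unfolding std_eq[OF h] by simp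
    then have "flip n F x \<noteq> n - 2 * k" "flip n F x \<noteq> n - Suc (2 * k)" by (auto simp: std_def)
    then have "(Transposition.transpose (n - Suc (2 * k)) (n - 2 * k) \<circ> flip n F) x = flip n F x"
      by (simp add: transpose_def)
    moreover have "flip n F x = flip n (insert k F) x"
    proof (cases "x \<in> {1..n}")
      case True
      then have "lev n x \<noteq> k" using out std_eq[OF h] by simp
      then show ?thesis by (simp add: flip_def)
    next
      case False
      then show ?thesis using permutes_not_in[OF flip_permutes False] by simp
    qed
    ultimately show ?thesis by simp
  qed
qed

text \<open>\<open>A_pairs n\<close> contains the standard pairs of positive level and the separate
  transposition supplies level 0. Since the pairs are disjoint, folding the transpositions collects
  their levels in a \<open>flip\<close>.\<close>

lemma special_perm_eq:
  assumes "2 \<le> n" shows "special_perm n = bar n"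
proof -
  let ?pr = "\<lambda>k. (n - Suc (2 * k), n - 2 * k)"
  let ?f = "\<lambda>(i, j) p. Transposition.transpose i j \<circ> p"
  let ?S = "?pr ` {k. Suc (2 * k) < n}"
  interpret comp_fun_commute_on ?S ?f
  proof
    fix x y assume "x \<in> ?S" "y \<in> ?S"
    then obtain k l where kl: "Suc (2 * k) < n" "Suc (2 * l) < n" "x = ?pr k" "y = ?pr l" by blast
    show "?f y \<circ> ?f x = ?f x \<circ> ?f y"
    proof (cases "k = l")
      case False
      have "std n k \<inter> std n l = {}" by (rule std_disjoint) (use kl False in linarith)+
      then have "Transposition.transpose (n - Suc (2 * l)) (n - 2 * l) (Transposition.transpose (n - Suc (2 * k)) (n - 2 * k) z) =
        Transposition.transpose (n - Suc (2 * k)) (n - 2 * k) (Transposition.transpose (n - Suc (2 * l)) (n - 2 * l) z)" for z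
        unfolding std_def transpose_def by auto
      then show ?thesis unfolding kl by (simp add: fun_eq_iff)
    qed (use kl in simp)
  qed
  have inj: "inj_on ?pr {k. Suc (2 * k) < n}" by (rule inj_onI) auto
  have fold: "Finite_Set.fold ?f id (?pr ` K) = flip n K" if "finite K" "K \<subseteq> {k. Suc (2 * k) < n}" for K
    using that
  proof (induction K)
    case empty
    show ?case by (simp add: flip_def fun_eq_iff)
  next
    case (insert k K)
    have "?pr k \<notin> ?pr ` K" using inj_on_image_mem_iff[OF inj, of k K] insert by simp
    then have "Finite_Set.fold ?f id (?pr ` insert k K) = ?f (?pr k) (Finite_Set.fold ?f id (?pr ` K))"
      unfolding image_insert using insert by (intro fold_insert) auto
    also have "Finite_Set.fold ?f id (?pr ` K) = flip n K" by (rule insert.IH) (use insert.prems in simp)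
    also have "?f (?pr k) (flip n K) = flip n (insert k K)"
      unfolding prod.case by (rule transpose_flip) (use insert.prems insert.hyps in simp_all)
    finally show ?case .
  qed
  let ?K = "{k. 1 \<le> k \<and> Suc (2 * k) < n}"
  have A: "A_pairs n = ?pr ` ?K" unfolding A_pairs_def by (auto simp: image_iff)
  have "finite ?K" by (rule finite_subset[of _ "{..n}"]) auto
  then have "Finite_Set.fold ?f id (?pr ` ?K) = flip n ?K" by (rule fold) auto
  then have "special_perm n = Transposition.transpose (n - Suc (2 * 0)) (n - 2 * 0) \<circ> flip n ?K"
    unfolding special_perm_def A by simp
  also have "\<dots> = flip n (insert 0 ?K)" using assms by (intro transpose_flip) auto
  also have "\<dots> = bar n"
  proof
    fix x show "flip n (insert 0 ?K) x = bar n x"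
    proof (cases "x \<in> {1..n}")
      case False
      then show ?thesis using permutes_not_in[OF flip_permutes False] permutes_not_in[OF bar_permutes False] by simp
    next
      case True
      show ?thesis
      proof (cases "lev n x < n div 2")
        case l: True
        then have "Suc (2 * lev n x) < n" by linarith
        then show ?thesis by (auto simp: flip_def)
      next
        case False
        then have "bar n x = x" using lev_eq_half[OF True] lev_le[OF True] by simp
        then show ?thesis by (simp add: flip_def)
      qed
    qed
  qed
  finally show ?thesis .
qed

section \<open>Classification of the valid sign sets\<close>

lemma half_less: "l < n div 2 \<Longrightarrow> Suc (2 * l) < n"
  by linarith

lemma mixed_small: "n \<le> 4 \<Longrightarrow> mixed n = {}"
proof -
  assume n: "n \<le> 4"
  have False if mixed: "p \<in> mixed n" for p
  proof -
    obtain a b where p: "p = {a, b}" "deep_pair n a b" "0 < lev n b" "lev n b < lev n a"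
      using mixed by (rule mixed_deep)
    have "lev n a \<le> n div 2" "a \<in> {1..n}" using p(2) lev_le unfolding deep_pair_def by auto
    then have "1 < lev n a" "1 \<le> a" using p by auto
    then show False using n unfolding lev_def by auto
  qed
  then show ?thesis by blast
qed

lemma valid_small: "n \<le> 4 \<Longrightarrow> valid n T \<longleftrightarrow> T = {}"
  using mixed_small[of n] unfolding valid_def by auto

lemma valid_empty: "valid n {}"
  unfolding valid_def by simp

lemma valid_subset: "valid n T \<Longrightarrow> T \<subseteq> mixed n"
  unfolding valid_def by simp

text \<open>The first condition compares two members of \<open>mixed n\<close>; for the second it
  suffices that the image of a mixed pair is mixed, its points staying on different positive
  levels.\<close>

lemma valid_mixed: "valid n (mixed n)"
  unfolding valid_def
proof (intro conjI allI impI subset_refl)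
  fix a b c d
  assume *: "deep_pair n a b \<and> {c, d} \<in> mixed n \<and> lev n d < lev n c \<and> lev n d < lev n b \<and> {a, b} \<inter> {c, d} = {}"
  then have p: "deep_pair n a b" and cd: "c \<in> {1..n}" "d \<in> {1..n}" "lev n d < lev n c" "0 < lev n d" "{c, d} \<in> mixed n"
    and lt: "lev n d < lev n b" and disj: "{a, b} \<inter> {c, d} = {}"
    unfolding pair_mixed by auto
  have out: "c \<notin> {a, b}" "d \<notin> {a, b}" using disj by auto
  let ?f = "phi n (mixed n) {a, b}"
  note d = phi_above[OF p cd(2) lt, of "mixed n"]
  have c: "?f c \<in> {1..n}" using phi_range[OF p cd(1) out(1), of "mixed n"] by auto
  have "lev n (?f d) < lev n (?f c)"
  proof (cases rule: phi_cases[OF p cd(1) out(1), where T = "mixed n"])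
    case 1 then show ?thesis using phi_above(2)[OF p cd(1) 1, of "mixed n"] d(2) cd(3) by simp
  next
    case 2 then show ?thesis using d(2) lt by simp
  next
    case 3 then show ?thesis using d(2) lt by simp
  qed
  then have "{?f c, ?f d} \<in> mixed n" unfolding pair_mixed using c d(2,3) by (simp del: atLeastAtMost_iff)
  then show "{?f c, ?f d} \<in> mixed n \<longleftrightarrow> {c, d} \<in> mixed n" using cd(5) by simp
qed simp

lemma valid_bar_pair:
  assumes "valid n T" "{a, b} \<in> mixed n" "lev n b < lev n a" "bar n a \<noteq> a"
  shows "{bar n a, bar n b} \<in> T \<longleftrightarrow> {a, b} \<in> T"
proof -
  have "{bar n a, bar n b} \<in> mixed n" using assms(2) bar_in unfolding pair_mixed by auto
  then show ?thesis using assms unfolding valid_def by (metis lev_bar)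
qed

text \<open>The first closure condition replaces the deeper point by another one and at the same
  time applies \<open>bar n\<close> to the other point. Applied twice, by way of a third deep point,
  it changes the deeper point alone. The bounds provide three points deeper than \<open>b\<close>,
  so two given ones can always be avoided.\<close>

lemma valid_same:
  assumes T: "valid n T" and ab: "{a, b} \<in> mixed n" "lev n b < lev n a"
    and cd: "{c, d} \<in> mixed n" "lev n d = lev n b" "lev n b < lev n c"
    and three: "lev n b + 1 < n div 2" "odd n \<or> lev n b + 2 < n div 2"
  shows "{a, b} \<in> T \<longleftrightarrow> {c, d} \<in> T"
proof -
  have in_n: "a \<in> {1..n}" "b \<in> {1..n}" "c \<in> {1..n}" "d \<in> {1..n}" "0 < lev n b" using ab(1) cd(1) unfolding pair_mixed by auto
  have bb: "bar n b \<in> {1..n}" using in_n bar_in by blast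
  have C2: "{x, y} \<in> T \<longleftrightarrow> {z, bar n y} \<in> T"
    if "x \<in> {1..n}" "z \<in> {1..n}" "y \<in> {1..n}" "lev n y = lev n b" "lev n b < lev n x" "lev n b < lev n z" "x \<noteq> z" for x y z
  proof -
    have "{x, y} \<in> mixed n" "{z, bar n y} \<in> mixed n"
      unfolding pair_mixed using that in_n(5) bar_in[of n y] by (simp_all del: atLeastAtMost_iff)
    then show ?thesis using T that unfolding valid_def by metis
  qed
  \<comment> \<open>A point at least two levels below \<open>b\<close>: the unpaired point 1 for odd
    \<open>n\<close>, a point of a further standard pair otherwise. It differs from both points one
    level below \<open>b\<close>.\<close>
  define e where "e = (if odd n then 1 else n - 2 * (lev n b + 2))"
  have e: "e \<in> {1..n}" "lev n b + 2 \<le> lev n e"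
  proof -
    have "e \<in> {1..n} \<and> lev n b + 2 \<le> lev n e"
    proof (cases "odd n")
      case True
      then have "lev n 1 = n div 2" unfolding lev_def by (auto elim: oddE)
      then show ?thesis using True three(1) unfolding e_def by simp
    next
      case False
      then have "lev n b + 2 < n div 2" using three(2) by simp
      then have "Suc (2 * (lev n b + 2)) < n" by (rule half_less)
      then show ?thesis using False upper_in[of "lev n b + 2" n] lev_upper[of "lev n b + 2" n] unfolding e_def by simp
    qed
    then show "e \<in> {1..n}" "lev n b + 2 \<le> lev n e" by simp_all
  qed
  have "Suc (2 * (lev n b + 1)) < n" using three(1) by (rule half_less)
  then obtain f where f: "f \<in> {1..n}" "lev n f = lev n b + 1" using upper_in lev_upper by blast
  have fb: "bar n f \<in> {1..n}" "lev n (bar n f) = lev n b + 1" "bar n f \<noteq> f"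
    using f bar_in bar_neq[OF f(1)] three(1) by auto
  have avoid: "\<exists>g. g \<in> {1..n} \<and> lev n b < lev n g \<and> g \<noteq> x \<and> g \<noteq> y" for x y
  proof -
    have "e \<noteq> f" "e \<noteq> bar n f" using e(2) f(2) fb(2) by auto
    then consider "e \<noteq> x \<and> e \<noteq> y" | "f \<noteq> x \<and> f \<noteq> y" | "bar n f \<noteq> x \<and> bar n f \<noteq> y"
      using fb(3) by metis
    then show ?thesis
    proof cases
      case 1 then show ?thesis using e by (intro exI[of _ e]) auto
    next
      case 2 then show ?thesis using f by (intro exI[of _ f]) auto
    next
      case 3 then show ?thesis using fb by (intro exI[of _ "bar n f"]) (simp del: atLeastAtMost_iff)
    qed
  qed
  have move: "{x, y} \<in> T \<longleftrightarrow> {z, y} \<in> T"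
    if xz: "x \<in> {1..n}" "z \<in> {1..n}" "y \<in> {1..n}" "lev n y = lev n b" "lev n b < lev n x" "lev n b < lev n z" for x y z
  proof -
    obtain g where g: "g \<in> {1..n}" "lev n b < lev n g" "g \<noteq> x" "g \<noteq> z" using avoid by blast
    have y': "bar n y \<in> {1..n}" "lev n (bar n y) = lev n b" using xz bar_in by auto
    have "{x, y} \<in> T \<longleftrightarrow> {g, bar n y} \<in> T" using C2[OF xz(1) g(1) xz(3,4,5) g(2)] g(3) by simp
    also have "\<dots> \<longleftrightarrow> {z, bar n (bar n y)} \<in> T" using C2[OF g(1) xz(2) y' g(2) xz(6) g(4)] .
    finally show ?thesis by simp
  qed
  have "d = b \<or> d = bar n b" using lev_eq[OF in_n(2,4)] cd(2) by simp
  then show ?thesis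
  proof
    assume "d = b" then show ?thesis using move[OF in_n(1,3,2)] ab(2) cd(3) by simp
  next
    assume db: "d = bar n b"
    obtain g where g: "g \<in> {1..n}" "lev n b < lev n g" "g \<noteq> a" using avoid by blast
    have "{a, b} \<in> T \<longleftrightarrow> {g, d} \<in> T" using C2[OF in_n(1) g(1) in_n(2) refl ab(2) g(2)] g(3) db by simp
    also have "\<dots> \<longleftrightarrow> {c, d} \<in> T" using move[OF g(1) in_n(3,4) cd(2) g(2) cd(3)] .
    finally show ?thesis .
  qed
qed

text \<open>Commuting \<open>\<alpha>\<^sub>p\<close> with \<open>\<alpha>\<^sub>q\<close> for \<open>q = {bar b, d}\<close>, where \<open>p = {a, b}\<close> itself sends \<open>bar b\<close>
  to \<open>a\<close> and \<open>d\<close> to \<open>b\<close>, ties the sign of \<open>p\<close> to that of a pair one level higher.\<close>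

lemma valid_climb:
  assumes T: "valid n T" and ab: "{a, b} \<in> mixed n" "lev n b < lev n a" "1 < lev n b"
  shows "\<exists>d. {bar n b, d} \<in> mixed n \<and> Suc (lev n d) = lev n b \<and> ({bar n b, d} \<in> T \<longleftrightarrow> {a, b} \<in> T)"
proof -
  have in_n: "a \<in> {1..n}" "b \<in> {1..n}" using ab(1) unfolding pair_mixed by auto
  have p: "deep_pair n a b" unfolding deep_pair_def using in_n ab(2) by auto
  have half: "lev n b < n div 2" by (rule deep_pair_half[OF p])
  define e where "e = n - 2 * (lev n b - 1)"
  have "Suc (2 * (lev n b - 1)) < n" using half by linarith
  then have e: "e \<in> {1..n}" "lev n e = lev n b - 1" using upper_in lev_upper unfolding e_def by blast+
  have lt: "lev n e < lev n b" using e(2) ab(3) by simp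
  let ?f = "phi n T {a, b}"
  note fe = phi_above[OF p e(1) lt, of T]
  have "?f e = b \<or> ?f e = bar n b" using lev_eq[OF in_n(2) fe(3)] fe(2) e(2) ab(3) by simp
  then have "\<exists>d. d \<in> {1..n} \<and> lev n d = lev n e \<and> ?f d = b"
  proof
    assume "?f e = b" then show ?thesis using e by (intro exI[of _ e]) simp
  next
    assume "?f e = bar n b"
    then show ?thesis using fe(4) e(1) bar_in[of n e]
      by (intro exI[of _ "bar n e"]) (simp del: atLeastAtMost_iff)
  qed
  then obtain d where d: "d \<in> {1..n}" "lev n d = lev n e" "?f d = b" by blast
  have bb: "bar n b \<in> {1..n}" "bar n b \<noteq> a" "bar n b \<noteq> b"
    using in_n bar_in bar_neq[OF in_n(2) half] ab(2) lev_bar[of n b] by auto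
  have fb: "?f (bar n b) = a" by (rule phi_partner[OF p bb(2)])
  have q: "{bar n b, d} \<in> mixed n"
    unfolding pair_mixed using bb(1) d e(2) ab(3) by (simp del: atLeastAtMost_iff)
  have disj: "{a, b} \<inter> {bar n b, d} = {}" using bb(2,3) d(2) lt ab(2) by auto
  have "{?f (bar n b), ?f d} \<in> T \<longleftrightarrow> {bar n b, d} \<in> T"
    using T p q disj d(2) lt unfolding valid_def by (metis lev_bar)
  then have "{bar n b, d} \<in> T \<longleftrightarrow> {a, b} \<in> T" unfolding fb d(3) by simp
  then show ?thesis using q d(2) e(2) ab(3) by (intro exI[of _ d]) simp
qed

text \<open>Repeated use of \<open>valid_climb\<close> links each mixed pair to one with a point on
  level 1 and a deeper point, and \<open>valid_same\<close> links all of those to each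
  other.\<close>

lemma valid_large:
  assumes n: "7 \<le> n" shows "valid n T \<longleftrightarrow> T = {} \<or> T = mixed n"
proof
  assume T: "valid n T"
  have down: "\<exists>c d. {c, d} \<in> mixed n \<and> lev n d = 1 \<and> 1 < lev n c \<and> ({c, d} \<in> T \<longleftrightarrow> {a, b} \<in> T)"
    if "{a, b} \<in> mixed n" "lev n b < lev n a" for a b
    using that
  proof (induction "lev n b" arbitrary: a b rule: less_induct)
    case less
    have pos: "0 < lev n b" using less.prems(1) unfolding pair_mixed by simp
    show ?case
    proof (cases "lev n b = 1")
      case True then show ?thesis using less.prems by (intro exI[of _ a] exI[of _ b]) simp
    next
      case False
      then have "1 < lev n b" using pos by simp
      from valid_climb[OF T less.prems this]
      obtain d where d: "{bar n b, d} \<in> mixed n" "Suc (lev n d) = lev n b"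
        "{bar n b, d} \<in> T \<longleftrightarrow> {a, b} \<in> T" by blast
      have "lev n d < lev n b" "lev n d < lev n (bar n b)" using d(2) by simp_all
      from less.hyps[OF this(1) d(1) this(2)] show ?thesis unfolding d(3) .
    qed
  qed
  \<comment> \<open>Here \<open>n \<ge> 7\<close> enters: below level 1 at least three points are
    needed. In degree 6 there are only the points 1 and 2.\<close>
  have three: "1 + 1 < n div 2" "odd n \<or> 1 + 2 < n div 2" using n by presburger+
  have same: "p \<in> T \<longleftrightarrow> q \<in> T" if pq: "p \<in> mixed n" "q \<in> mixed n" for p q
  proof -
    obtain a b where p: "p = {a, b}" "deep_pair n a b" "0 < lev n b" "lev n b < lev n a" by (rule mixed_deep[OF pq(1)])
    obtain c d where q: "q = {c, d}" "deep_pair n c d" "0 < lev n d" "lev n d < lev n c" by (rule mixed_deep[OF pq(2)])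
    obtain a' b' where p': "{a', b'} \<in> mixed n" "lev n b' = 1" "1 < lev n a'" "{a', b'} \<in> T \<longleftrightarrow> p \<in> T"
      using down[of a b] p pq(1) by auto
    obtain c' d' where q': "{c', d'} \<in> mixed n" "lev n d' = 1" "1 < lev n c'" "{c', d'} \<in> T \<longleftrightarrow> q \<in> T"
      using down[of c d] q pq(2) by auto
    have "{a', b'} \<in> T \<longleftrightarrow> {c', d'} \<in> T"
      by (rule valid_same[OF T p'(1) _ q'(1)]) (use p'(2,3) q'(2,3) three in simp_all)
    then show ?thesis using p'(4) q'(4) by simp
  qed
  have "T \<subseteq> mixed n" by (rule valid_subset[OF T])
  then show "T = {} \<or> T = mixed n" using same by blast
qed (use valid_empty valid_mixed in blast)

lemma mixed_ne: "7 \<le> n \<Longrightarrow> mixed n \<noteq> {}"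
proof -
  assume n: "7 \<le> n"
  have "lev n (n - 2) = 1" "lev n (n - 4) = 2" using n unfolding lev_def by auto
  moreover have "n - 2 \<in> {1..n}" "n - 4 \<in> {1..n}" using n by auto
  ultimately have "{n - 4, n - 2} \<in> mixed n" unfolding pair_mixed by (simp del: atLeastAtMost_iff)
  then show ?thesis by blast
qed

lemma lev_five: "lev 5 1 = 2" "lev 5 (Suc 0) = 2" "lev 5 2 = 1" "lev 5 3 = 1" "lev 5 4 = 0" "lev 5 5 = 0"
  and bar_five: "bar 5 1 = 1" "bar 5 (Suc 0) = Suc 0" "bar 5 2 = 3" "bar 5 3 = 2" "bar 5 4 = 5" "bar 5 5 = 4"
  by (simp_all add: lev_def bar_def)

lemma lev_six: "lev 6 1 = 2" "lev 6 (Suc 0) = 2" "lev 6 2 = 2" "lev 6 3 = 1" "lev 6 4 = 1" "lev 6 5 = 0" "lev 6 6 = 0"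
  and bar_six: "bar 6 1 = 2" "bar 6 (Suc 0) = 2" "bar 6 2 = 1" "bar 6 3 = 4" "bar 6 4 = 3" "bar 6 5 = 6" "bar 6 6 = 5"
  by (simp_all add: lev_def bar_def)

lemma five_cases: "x \<in> {1..5::nat} \<Longrightarrow> x = 1 \<or> x = 2 \<or> x = 3 \<or> x = 4 \<or> x = 5"
  by auto

lemma six_cases: "x \<in> {1..6::nat} \<Longrightarrow> x = 1 \<or> x = 2 \<or> x = 3 \<or> x = 4 \<or> x = 5 \<or> x = 6"
  by auto

lemma deep_five:
  assumes "a \<in> {1..5}" "b \<in> {1..5}" "lev 5 b < lev 5 a" "0 < lev 5 b"
  shows "a = 1 \<and> (b = 2 \<or> b = 3)"
  using five_cases[OF assms(1)] five_cases[OF assms(2)] assms(3,4) by (auto simp: lev_five)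

lemma deep_six:
  assumes "a \<in> {1..6}" "b \<in> {1..6}" "lev 6 b < lev 6 a" "0 < lev 6 b"
  shows "(a = 1 \<or> a = 2) \<and> (b = 3 \<or> b = 4)"
  using six_cases[OF assms(1)] six_cases[OF assms(2)] assms(3,4) by (auto simp: lev_six)

lemma mixed_five: "mixed 5 = {{1, 2}, {1, 3}}"
proof
  show "mixed 5 \<subseteq> {{1, 2}, {1, 3}}"
  proof
    fix p assume "p \<in> mixed 5"
    then obtain a b where p: "p = {a, b}" "deep_pair 5 a b" "0 < lev 5 b" "lev 5 b < lev 5 a" by (rule mixed_deep)
    then have "a = 1 \<and> (b = 2 \<or> b = 3)" by (intro deep_five) (simp_all add: deep_pair_def)
    then show "p \<in> {{1, 2}, {1, 3}}" using p(1) by (elim conjE disjE) simp_all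
  qed
  show "{{1, 2}, {1, 3}} \<subseteq> mixed 5" by (simp add: pair_mixed lev_five)
qed

lemma mixed_six: "mixed 6 = {{1, 3}, {2, 3}, {1, 4}, {2, 4}}"
proof
  show "mixed 6 \<subseteq> {{1, 3}, {2, 3}, {1, 4}, {2, 4}}"
  proof
    fix p assume "p \<in> mixed 6"
    then obtain a b where p: "p = {a, b}" "deep_pair 6 a b" "0 < lev 6 b" "lev 6 b < lev 6 a" by (rule mixed_deep)
    then have "(a = 1 \<or> a = 2) \<and> (b = 3 \<or> b = 4)" by (intro deep_six) (simp_all add: deep_pair_def)
    then show "p \<in> {{1, 3}, {2, 3}, {1, 4}, {2, 4}}" using p(1) by (elim conjE disjE) simp_all
  qed
  show "{{1, 3}, {2, 3}, {1, 4}, {2, 4}} \<subseteq> mixed 6" by (simp add: pair_mixed lev_six)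
qed

text \<open>Both closure conditions are void: 1 is the only point deeper than level 1, so the first
  would require \<open>a = c\<close>, and the second needs two positive levels below
  \<open>5 div 2\<close>.\<close>

lemma valid_five: "valid 5 T \<longleftrightarrow> T \<subseteq> {{1, 2}, {1, 3}}"
proof
  assume "valid 5 T" then show "T \<subseteq> {{1, 2}, {1, 3}}" using valid_subset mixed_five by blast
next
  assume T: "T \<subseteq> {{1, 2}, {1, 3}}"
  show "valid 5 T"
    unfolding valid_def
  proof (intro conjI allI impI)
    show "T \<subseteq> mixed 5" using T mixed_five by simp
  next
    fix a b c
    assume "{a, b} \<in> mixed 5 \<and> {c, bar 5 b} \<in> mixed 5 \<and> lev 5 b < lev 5 a \<and> lev 5 b < lev 5 c \<and> a \<noteq> c"
    then have *: "a \<in> {1..5}" "b \<in> {1..5}" "c \<in> {1..5}" "lev 5 b < lev 5 a" "lev 5 b < lev 5 c" "a \<noteq> c" "0 < lev 5 b"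
      unfolding pair_mixed by auto
    have False using deep_five[OF *(1,2,4,7)] deep_five[OF *(3,2,5,7)] *(6) by simp
    then show "{a, b} \<in> T \<longleftrightarrow> {c, bar 5 b} \<in> T" ..
  next
    fix a b c d
    assume *: "deep_pair 5 a b \<and> {c, d} \<in> mixed 5 \<and> lev 5 d < lev 5 c \<and> lev 5 d < lev 5 b \<and> {a, b} \<inter> {c, d} = {}"
    then have p: "deep_pair 5 a b" and cd: "0 < lev 5 d" "lev 5 d < lev 5 b" unfolding pair_mixed by auto
    have "lev 5 b < 5 div 2" by (rule deep_pair_half[OF p])
    then have False using cd by simp
    then show "{phi 5 T {a, b} c, phi 5 T {a, b} d} \<in> T \<longleftrightarrow> {c, d} \<in> T" ..
  qed
qed

lemma paired_subsets:
  assumes "p \<noteq> q" "p \<noteq> r" "s \<noteq> q" "s \<noteq> r"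
  shows "T \<in> {{}, {p, s}, {q, r}, {p, q, r, s}} \<longleftrightarrow>
      T \<subseteq> {p, q, r, s} \<and> (p \<in> T \<longleftrightarrow> s \<in> T) \<and> (q \<in> T \<longleftrightarrow> r \<in> T)"
    and "card {{}, {p, s}, {q, r}, {p, q, r, s}} = 4"
proof -
  have p: "p \<notin> {q, r}" and q: "q \<notin> {p, s}" "r \<notin> {p, s}" and s: "s \<notin> {q, r}" using assms by auto
  show "T \<in> {{}, {p, s}, {q, r}, {p, q, r, s}} \<longleftrightarrow>
      T \<subseteq> {p, q, r, s} \<and> (p \<in> T \<longleftrightarrow> s \<in> T) \<and> (q \<in> T \<longleftrightarrow> r \<in> T)" (is "?L \<longleftrightarrow> ?R")
  proof
    assume ?L
    then consider "T = {}" | "T = {p, s}" | "T = {q, r}" | "T = {p, q, r, s}" by blast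
    then show ?R by cases (use p q s in simp_all)
  next
    assume R: ?R
    consider "p \<in> T" "q \<in> T" | "p \<in> T" "q \<notin> T" | "p \<notin> T" "q \<in> T" | "p \<notin> T" "q \<notin> T" by blast
    then show ?L
    proof cases
      case 1 then have "T = {p, q, r, s}" using R by blast
      then show ?thesis by simp
    next
      case 2 then have "T = {p, s}" using R by blast
      then show ?thesis by simp
    next
      case 3 then have "T = {q, r}" using R by blast
      then show ?thesis by simp
    next
      case 4 then have "T = {}" using R by blast
      then show ?thesis by simp
    qed
  qed
  have "{p, s} \<noteq> {q, r}" using p by (metis insertI1)
  moreover have "{p, s} \<noteq> {p, q, r, s}" using q(1) by (metis insertCI)
  moreover have "{q, r} \<noteq> {p, q, r, s}" using p by (metis insertI1)
  ultimately show "card {{}, {p, s}, {q, r}, {p, q, r, s}} = 4" by simp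
qed

lemma six_pairs_distinct:
  "{1, 3} \<noteq> {2, 3 :: nat}" "{1, 3} \<noteq> {1, 4 :: nat}" "{2, 4} \<noteq> {2, 3 :: nat}" "{2, 4} \<noteq> {1, 4 :: nat}"
  by (simp_all add: doubleton_eq_iff)

text \<open>With only 1 and 2 below level 1, the first condition ties \<open>{1, 3}\<close> to
  \<open>{2, 4}\<close> and \<open>{2, 3}\<close> to \<open>{1, 4}\<close>. The second is void, as
  \<open>{a, b}\<close> would have to be \<open>{1, 2}\<close> and would meet
  \<open>{c, d}\<close>.\<close>

lemma valid_six: "valid 6 T \<longleftrightarrow> T \<in> {{}, {{1, 3}, {2, 4}}, {{2, 3}, {1, 4}}, {{1, 3}, {2, 3}, {1, 4}, {2, 4}}}"
proof -
  have "T \<in> {{}, {{1, 3}, {2, 4}}, {{2, 3}, {1, 4}}, {{1, 3}, {2, 3}, {1, 4}, {2, 4}}} \<longleftrightarrow>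
      T \<subseteq> mixed 6 \<and> ({1, 3} \<in> T \<longleftrightarrow> {2, 4} \<in> T) \<and> ({2, 3} \<in> T \<longleftrightarrow> {1, 4} \<in> T)"
    unfolding mixed_six by (rule paired_subsets(1)[OF six_pairs_distinct])
  moreover have "valid 6 T \<longleftrightarrow> T \<subseteq> mixed 6 \<and> ({1, 3} \<in> T \<longleftrightarrow> {2, 4} \<in> T) \<and> ({2, 3} \<in> T \<longleftrightarrow> {1, 4} \<in> T)"
  proof
    assume v: "valid 6 T"
    have m: "{1, 3} \<in> mixed 6" "{2, 3} \<in> mixed 6" unfolding mixed_six by simp_all
    show "T \<subseteq> mixed 6 \<and> ({1, 3} \<in> T \<longleftrightarrow> {2, 4} \<in> T) \<and> ({2, 3} \<in> T \<longleftrightarrow> {1, 4} \<in> T)"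
      using valid_subset[OF v] valid_bar_pair[OF v m(1)] valid_bar_pair[OF v m(2)] by (simp add: lev_six bar_six)
  next
    assume T: "T \<subseteq> mixed 6 \<and> ({1, 3} \<in> T \<longleftrightarrow> {2, 4} \<in> T) \<and> ({2, 3} \<in> T \<longleftrightarrow> {1, 4} \<in> T)"
    show "valid 6 T"
      unfolding valid_def
    proof (intro conjI allI impI)
      show "T \<subseteq> mixed 6" using T by simp
    next
      fix a b c
      assume "{a, b} \<in> mixed 6 \<and> {c, bar 6 b} \<in> mixed 6 \<and> lev 6 b < lev 6 a \<and> lev 6 b < lev 6 c \<and> a \<noteq> c"
      then have *: "a \<in> {1..6}" "b \<in> {1..6}" "c \<in> {1..6}" "lev 6 b < lev 6 a" "lev 6 b < lev 6 c" "a \<noteq> c" "0 < lev 6 b"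
        unfolding pair_mixed by auto
      have "(a = 1 \<and> c = 2 \<or> a = 2 \<and> c = 1) \<and> (b = 3 \<or> b = 4)"
        using deep_six[OF *(1,2,4,7)] deep_six[OF *(3,2,5,7)] *(6) by auto
      then show "{a, b} \<in> T \<longleftrightarrow> {c, bar 6 b} \<in> T"
        using T by (elim conjE disjE) (simp_all add: bar_six)
    next
      fix a b c d
      assume *: "deep_pair 6 a b \<and> {c, d} \<in> mixed 6 \<and> lev 6 d < lev 6 c \<and> lev 6 d < lev 6 b \<and> {a, b} \<inter> {c, d} = {}"
      then have p: "deep_pair 6 a b" and cd: "0 < lev 6 d" "lev 6 d < lev 6 b" "c \<in> {1..6}" "d \<in> {1..6}" "lev 6 d < lev 6 c"
        and disj: "{a, b} \<inter> {c, d} = {}" unfolding pair_mixed by auto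
      have ab: "a \<in> {1..6}" "b \<in> {1..6}" "a \<noteq> b" "lev 6 b \<le> lev 6 a" using p unfolding deep_pair_def by auto
      have "a = 1 \<or> a = 2" "b = 1 \<or> b = 2"
        using six_cases[OF ab(1)] six_cases[OF ab(2)] cd(1,2) ab(4) by (auto simp: lev_six)
      moreover have "c = 1 \<or> c = 2" using deep_six[OF cd(3,4,5,1)] by simp
      ultimately have False using disj ab(3) by auto
      then show "{phi 6 T {a, b} c, phi 6 T {a, b} d} \<in> T \<longleftrightarrow> {c, d} \<in> T" ..
    qed
  qed
  ultimately show ?thesis by simp
qed

lemma card_valid:
  "card {T. valid n T} = (if n \<le> 4 then 1 else if n \<le> 6 then 4 else 2)"
proof -
  consider "n \<le> 4" | "n = 5" | "n = 6" | "7 \<le> n" by linarith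
  then show ?thesis
  proof cases
    case 1 then show ?thesis using valid_small[of n] by simp
  next
    case 2
    have "{T. valid n T} = Pow {{1, 2}, {1, 3}}" unfolding 2 valid_five by auto
    then show ?thesis using 2 by (simp add: card_Pow doubleton_eq_iff)
  next
    case 3
    have eq: "{T. valid n T} = {{}, {{1, 3}, {2, 4}}, {{2, 3}, {1, 4}}, {{1, 3}, {2, 3}, {1, 4}, {2, 4}}}" unfolding 3 valid_six by (rule Collect_mem_eq)
    show ?thesis unfolding eq using 3 paired_subsets(2)[OF six_pairs_distinct] by simp
  next
    case 4
    have "{T. valid n T} = {{}, mixed n}" using valid_large[OF 4] by auto
    then show ?thesis using 4 mixed_ne[OF 4] by (simp add: card_insert_if)
  qed
qed

section \<open>Parameters of regular and alternating cross-sections\<close>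

lemma alpha_eq:
  assumes "\<Lambda> \<in> R_cross_sections n" "\<alpha> \<in> \<Lambda>" "lft \<alpha> = {{i, j}}" shows "alpha n \<Lambda> i j = \<alpha>"
  unfolding alpha_def
proof (rule the_equality)
  show "\<alpha> \<in> \<Lambda> \<and> corank n \<alpha> = 2 \<and> {LP i, LP j} \<in> \<alpha>"
    using assms(2,3) corank_eq[OF cross_section_brauer[OF assms(1,2)]] pair_lft[of i j \<alpha>] by simp
  fix \<beta> assume b: "\<beta> \<in> \<Lambda> \<and> corank n \<beta> = 2 \<and> {LP i, LP j} \<in> \<beta>"
  then have "card (lft \<beta>) = 1" using corank_eq[OF cross_section_brauer[OF assms(1)], of \<beta>] by simp
  moreover have "{i, j} \<in> lft \<beta>" using b pair_lft by simp
  ultimately have "lft \<beta> = {{i, j}}" by (metis card_1_singletonE singletonD)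
  then show "\<beta> = \<alpha>" using cross_section_unique[OF assms(1)] b assms(2,3) by simp
qed

lemma deep_pair_less: "1 \<le> i \<Longrightarrow> i < j \<Longrightarrow> j \<le> n \<Longrightarrow> deep_pair n i j"
  unfolding deep_pair_def lev_def by (auto intro!: div_le_mono)

lemma (in canonical_section) alpha_elt:
  assumes "deep_pair n i j" shows "alpha n \<Lambda> i j = elt {{i, j}}"
  by (rule alpha_eq[OF cross pair_elt(1,2)[OF assms]])

lemma transpose_12_neq: "Transposition.transpose 1 2 \<noteq> (id :: nat \<Rightarrow> nat)"
  by (metis id_apply numeral_One numeral_eq_iff semiring_norm(85) transpose_apply_first)

text \<open>The point tested is the upper one of level \<open>l - 1\<close>. In a canonical
  cross-section its image lies on level \<open>l\<close>, so it is one of the two values tested and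
  the default branch is not reached.\<close>

lemma (in canonical_section) alpha_sup_eq:
  assumes "1 \<le> i" "i < j" "j \<le> n" "1 \<le> l" "l \<le> (n - j) div 2"
  shows "alpha_sup n \<Lambda> i j l = (if fp {i, j} (n - 2 * (l - 1)) = n - 2 * l then id else Transposition.transpose 1 2)"
proof -
  have d: "deep_pair n i j" by (rule deep_pair_less[OF assms(1-3)])
  obtain k where k: "l = Suc k" using assms(4) by (cases l) auto
  let ?x = "n - 2 * k"
  have kj: "Suc k \<le> lev n j" using assms(5) k unfolding lev_def by simp
  then have half: "Suc k < n div 2" using deep_pair_half[OF d] by simp
  then have kn: "Suc (2 * k) < n" by linarith
  have x: "?x \<in> {1..n}" "lev n ?x = k" by (rule upper_in[OF kn], rule lev_upper[OF kn])
  have xj: "lev n ?x < lev n j" using x(2) kj by simp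
  note f = fp_above[OF d x(1) xj] fp_range[OF d x(1) fp_above(3)[OF d x(1) xj]]
  have kn2: "Suc (2 * Suc k) < n" using half by (rule half_less)
  have l: "n - 2 * l + 2 = ?x" "n - 2 * (l - 1) = ?x" using kn2 k by simp_all
  have "fp {i, j} ?x = n - 2 * l \<or> fp {i, j} ?x = n - 2 * l - 1"
    using lev_eq[OF upper_in[OF kn2] f(4)] lev_upper[OF kn2] bar_upper[OF kn2] f(1) x(2) k by auto
  moreover have mem: "{LP ?x, RP y} \<in> elt {{i, j}} \<longleftrightarrow> y = fp {i, j} ?x" for y
    using fp_iff[OF d, of ?x y] x(1) f(3) by blast
  have "alpha_sup n \<Lambda> i j l = (if n - 2 * l = fp {i, j} ?x then id
      else if n - 2 * l - 1 = fp {i, j} ?x then Transposition.transpose 1 2 else undefined)"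
    unfolding alpha_sup_def alpha_elt[OF d] l(1) mem ..
  ultimately show ?thesis unfolding l(2) by (elim disjE) simp_all
qed

text \<open>A normalised cross-section twists all levels alike, so the parameter does not depend on
  \<open>l\<close>.\<close>

lemma section_alpha_sup:
  assumes T: "valid n T" and ij: "1 \<le> i" "i < j" "j \<le> n" "1 \<le> l" "l \<le> (n - j) div 2"
  shows "alpha_sup n (section_of n T) i j l = (if {i, j} \<in> T then Transposition.transpose 1 2 else id)"
proof -
  interpret canonical_section n "section_of n T" by unfold_locales (rule canonical_section_of[OF T])
  have d: "deep_pair n i j" by (rule deep_pair_less[OF ij(1-3)])
  obtain k where k: "l = Suc k" using ij(4) by (cases l) auto
  let ?x = "n - 2 * k"
  have kj: "Suc k \<le> lev n j" using ij(5) k unfolding lev_def by simp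
  then have half: "Suc k < n div 2" using deep_pair_half[OF d] by simp
  then have kn: "Suc (2 * k) < n" by linarith
  have x: "?x \<in> {1..n}" "lev n ?x = k" by (rule upper_in[OF kn], rule lev_upper[OF kn])
  have xj: "lev n ?x < lev n j" using x(2) kj by simp
  have "elt {{i, j}} = gen n T {i, j}"
    by (rule unique[OF pair_elt(1)[OF d] gen_in_section(1)[OF d]]) (simp add: pair_elt(2)[OF d] gen_in_section(2)[OF d])
  moreover have "{LP ?x, RP (fp {i, j} ?x)} \<in> elt {{i, j}}"
    using fp_iff[OF d] x(1) fp_above(3)[OF d x(1) xj] by blast
  ultimately have "fp {i, j} ?x = phi n T {i, j} ?x" using gen_LR[OF d] by simp
  also have "\<dots> = (if {i, j} \<in> T then bar n (?x - 2) else ?x - 2)" by (rule phi_above(1)[OF d x(1) xj])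
  finally have "fp {i, j} ?x = ?x - 2 \<longleftrightarrow> {i, j} \<notin> T"
    using bar_shift_neq[OF x(1)] half x(2) by auto
  moreover have "?x - 2 = n - 2 * l" "n - 2 * (l - 1) = ?x" using k by auto
  ultimately show ?thesis unfolding alpha_sup_eq[OF ij] by simp
qed

lemma admissible_imp: "admissible n i j l \<Longrightarrow> 1 \<le> i \<and> i < j \<and> j \<le> n \<and> 1 \<le> l \<and> l \<le> (n - j) div 2"
  unfolding admissible_def by auto

text \<open>Admissibility puts \<open>j\<close> on a positive level. Outside \<open>mixed n\<close>
  there remain then only the standard pairs, so the alternating choice amounts to the sign set
  \<open>mixed n\<close>.\<close>

lemma A_pairs_mixed:
  assumes "admissible n i j l" shows "(i, j) \<in> A_pairs n \<longleftrightarrow> {i, j} \<notin> mixed n"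
proof -
  have ij: "1 \<le> i" "i < j" "j \<le> n" "1 \<le> (n - j) div 2" using assms unfolding admissible_def by auto
  have lj: "0 < lev n j" using ij(4) unfolding lev_def by simp
  have in_n: "i \<in> {1..n}" "j \<in> {1..n}" using ij by auto
  have d: "deep_pair n i j" by (rule deep_pair_less[OF ij(1-3)])
  then have le: "lev n j \<le> lev n i" unfolding deep_pair_def by simp
  have "{i, j} \<notin> mixed n \<longleftrightarrow> lev n i = lev n j" unfolding pair_mixed using in_n lj le by auto
  moreover have "(i, j) \<in> A_pairs n \<longleftrightarrow> lev n i = lev n j"
  proof
    assume "(i, j) \<in> A_pairs n"
    then obtain k where "i = n - Suc (2 * k)" "j = n - 2 * k" "Suc (2 * k) < n" unfolding A_pairs_def by auto
    then show "lev n i = lev n j" by (simp add: lev_lower lev_upper)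
  next
    assume "lev n i = lev n j"
    then have i: "i = bar n j" using lev_eq[OF in_n(2,1)] ij(2) by auto
    show "(i, j) \<in> A_pairs n"
      using in_n(2)
    proof (cases rule: bar_cases)
      case single then show ?thesis using i ij(2) by simp
    next
      case (upper k)
      then show ?thesis unfolding A_pairs_def mem_Collect_eq using i lj by (intro exI[of _ k]) simp
    next
      case (lower k) then show ?thesis using i ij(2) by simp
    qed
  qed
  ultimately show ?thesis by simp
qed

lemma regular_section: "regular_canonical n (section_of n {})"
  unfolding regular_canonical_def
proof (intro conjI allI impI)
  show "canonical n (section_of n {})" by (rule canonical_section_of[OF valid_empty])
  fix i j l assume "admissible n i j l"
  then show "alpha_sup n (section_of n {}) i j l = id"
    using section_alpha_sup[OF valid_empty] admissible_imp by simp
qed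

lemma alternating_section: "alternating_canonical n (section_of n (mixed n))"
  unfolding alternating_canonical_def
proof (intro conjI allI impI)
  show "canonical n (section_of n (mixed n))" by (rule canonical_section_of[OF valid_mixed])
  fix i j l assume a: "admissible n i j l"
  show "alpha_sup n (section_of n (mixed n)) i j l = (if (i, j) \<in> A_pairs n then id else Transposition.transpose 1 2)"
    unfolding A_pairs_mixed[OF a] using section_alpha_sup[OF valid_mixed] admissible_imp[OF a] by simp
qed

text \<open>Normality concerns only the deepest standard pair. The parameters describe its upper
  points, and compatibility with \<open>bar n\<close> gives the lower ones.\<close>

lemma normal_of_alpha_sup:
  assumes can: "canonical n \<Lambda>"
    and A: "\<And>i j l. admissible n i j l \<Longrightarrow> (i, j) \<in> A_pairs n \<Longrightarrow> alpha_sup n \<Lambda> i j l = id"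
  shows "normal n \<Lambda>"
  unfolding normal_def
proof (intro conjI ballI impI)
  interpret canonical_section n \<Lambda> by unfold_locales (rule can)
  show "canonical n \<Lambda>" by (rule can)
  let ?h = "n div 2"
  fix \<alpha> x assume a: "\<alpha> \<in> \<Lambda>" "lft \<alpha> = {std n (?h - 1)}" and x: "x \<in> {1..n}" "lev n x < ?h - 1"
  define k where "k = ?h - 1"
  have kn: "Suc (2 * k) < n" unfolding k_def using x(2) by linarith
  let ?i = "n - Suc (2 * k)" and ?j = "n - 2 * k"
  have ij: "1 \<le> ?i" "?i < ?j" "?j \<le> n" using kn by auto
  have d: "deep_pair n ?i ?j" by (rule deep_pair_less[OF ij])
  have lj: "lev n ?j = k" by (rule lev_upper[OF kn])
  have "elt {{?i, ?j}} = \<alpha>"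
    by (rule unique[OF pair_elt(1)[OF d] a(1)]) (subst pair_elt(2)[OF d], subst a(2), simp add: std_def k_def)
  have up: "fp {?i, ?j} (n - 2 * m) = n - 2 * m - 2" if m: "m < k" for m
  proof -
    have l: "1 \<le> Suc m" "Suc m \<le> (n - ?j) div 2" using m kn by auto
    have "?j < n - 1" using m kn by auto
    then have adm: "admissible n ?i ?j (Suc m)" unfolding admissible_def using ij l by simp
    \<comment> \<open>\<open>k\<close> is the level of the deepest standard pair, and
      \<open>m < k\<close> makes it positive.\<close>
    have "(?i, ?j) \<in> A_pairs n"
      unfolding A_pairs_def mem_Collect_eq using m kn by (intro exI[of _ k]) simp
    from A[OF adm this] show ?thesis
      unfolding alpha_sup_eq[OF ij l] using transpose_12_neq by (simp split: if_splits)
  qed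
  have xk: "lev n x < k" using x(2) unfolding k_def .
  let ?y = "n - 2 * lev n x"
  have yn: "Suc (2 * lev n x) < n" using xk kn by linarith
  have y: "?y \<in> {1..n}" "lev n ?y = lev n x" by (rule upper_in[OF yn], rule lev_upper[OF yn])
  have yj: "lev n ?y < lev n ?j" using y(2) lj xk by simp
  have fy: "fp {?i, ?j} ?y = ?y - 2" by (rule up[OF xk])
  have "x = ?y \<or> x = bar n ?y" using lev_eq[OF y(1) x(1)] y(2) by simp
  then have "fp {?i, ?j} x = x - 2"
  proof
    assume "x = ?y" then show ?thesis using fy by simp
  next
    assume xb: "x = bar n ?y"
    have "Suc (lev n ?y) < ?h" using y(2) x(2) by simp
    then have "bar n (?y - 2) = x - 2" using shift(3)[OF y(1)] xb by simp
    moreover have "fp {?i, ?j} (bar n ?y) = bar n (fp {?i, ?j} ?y)" by (rule fp_above(2)[OF d y(1) yj])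
    ultimately show ?thesis using fy unfolding xb[symmetric] by simp
  qed
  moreover have xj: "lev n x < lev n ?j" using yj y(2) by simp
  ultimately show "{LP x, RP (x - 2)} \<in> \<alpha>"
    using fp_iff[OF d, of x "x - 2"] x(1) fp_above(3)[OF d x(1) xj] \<open>elt {{?i, ?j}} = \<alpha>\<close> by metis
qed

lemma mixed_admissible:
  assumes "p \<in> mixed n" obtains i j where "p = {i, j}" "admissible n i j 1"
proof -
  obtain a b where p: "p = {a, b}" "deep_pair n a b" "0 < lev n b" "lev n b < lev n a"
    using assms by (rule mixed_deep)
  have "a < b" using lev_less_imp[OF p(4)] .
  moreover have "1 \<le> (n - b) div 2" using p(3) unfolding lev_def by simp
  moreover have "1 \<le> a" using p(2) unfolding deep_pair_def by simp
  ultimately have "admissible n a b 1" unfolding admissible_def by auto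
  then show ?thesis using that p(1) by blast
qed

lemma regular_unique: "{\<Theta>. regular_canonical n \<Theta>} = {section_of n {}}"
proof -
  have "\<Theta> = section_of n {}" if r: "regular_canonical n \<Theta>" for \<Theta>
  proof -
    have "normal n \<Theta>" by (rule normal_of_alpha_sup) (use r in \<open>simp_all add: regular_canonical_def\<close>)
    then obtain T where T: "valid n T" "\<Theta> = section_of n T" unfolding normal_iff by blast
    have "p \<notin> T" if p: "p \<in> mixed n" for p
    proof -
      obtain i j where ij: "p = {i, j}" "admissible n i j 1" using p by (rule mixed_admissible)
      then have "alpha_sup n \<Theta> i j 1 = id" using r unfolding regular_canonical_def by blast
      then show ?thesis
        unfolding T(2) using section_alpha_sup[OF T(1)] admissible_imp[OF ij(2)] transpose_12_neq ij(1)
        by (simp split: if_splits)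
    qed
    then have "T = {}" using valid_subset[OF T(1)] by blast
    then show ?thesis using T(2) by simp
  qed
  then show ?thesis using regular_section by blast
qed

lemma alternating_unique: "{\<Theta>. alternating_canonical n \<Theta>} = {section_of n (mixed n)}"
proof -
  have "\<Theta> = section_of n (mixed n)" if r: "alternating_canonical n \<Theta>" for \<Theta>
  proof -
    have "normal n \<Theta>" by (rule normal_of_alpha_sup) (use r in \<open>simp_all add: alternating_canonical_def\<close>)
    then obtain T where T: "valid n T" "\<Theta> = section_of n T" unfolding normal_iff by blast
    have "p \<in> T" if p: "p \<in> mixed n" for p
    proof -
      obtain i j where ij: "p = {i, j}" "admissible n i j 1" using p by (rule mixed_admissible)
      then have "alpha_sup n \<Theta> i j 1 = Transposition.transpose 1 2"
        using r A_pairs_mixed[OF ij(2)] p unfolding alternating_canonical_def by simp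
      then show ?thesis
        unfolding T(2) using section_alpha_sup[OF T(1)] admissible_imp[OF ij(2)] transpose_12_neq[symmetric] ij(1)
        by (simp split: if_splits)
    qed
    then have "T = mixed n" using valid_subset[OF T(1)] by blast
    then show ?thesis using T(2) by simp
  qed
  then show ?thesis using alternating_section by blast
qed

section \<open>Counting conjugates of normalised cross-sections\<close>

lemma section_in: "valid n T \<Longrightarrow> section_of n T \<in> R_cross_sections n"
  by (rule section_of_cross_section)

lemma normal_cross: "normal n \<Lambda> \<Longrightarrow> \<Lambda> \<in> R_cross_sections n"
  unfolding normal_def using canonical_cross by blast

lemma conj_action_inv:
  assumes "\<sigma> permutes {1..n}" "\<Theta> \<in> R_cross_sections n"
  shows "conj_action n (inv' \<sigma>) (conj_action n \<sigma> \<Theta>) = \<Theta>" "conj_action n \<sigma> (conj_action n (inv' \<sigma>) \<Theta>) = \<Theta>"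
  using assms permutes_inv[OF assms(1)] permutes_inv_o[OF assms(1)]
  by (simp_all add: conj_action_comp conj_action_id)

lemma canonical_conj_section:
  assumes can: "canonical n \<Lambda>"
  obtains F T where "valid n T" "\<Lambda> = conj_action n (flip n F) (section_of n T)"
proof -
  note c = canonical_cross[OF can]
  obtain F where "normal n (conj_elem n (flip n F) ` \<Lambda>)" using ex_normal_flip[OF can] by blast
  then obtain T where T: "valid n T" "conj_elem n (flip n F) ` \<Lambda> = section_of n T" unfolding normal_iff by blast
  have "flip n F \<circ> flip n F = id" by (simp add: fun_eq_iff)
  then have "conj_action n (flip n F) (conj_action n (flip n F) \<Lambda>) = \<Lambda>"
    using conj_action_comp[OF flip_permutes flip_permutes c] conj_action_id[OF c] by simp
  moreover have "conj_action n (flip n F) \<Lambda> = section_of n T" using T(2) conj_action_eq[OF c] by simp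
  ultimately show ?thesis using that T(1) by metis
qed

lemma ex_conj_section:
  assumes \<Theta>: "\<Theta> \<in> R_cross_sections n"
  obtains \<sigma> T where "\<sigma> permutes {1..n}" "valid n T" "\<Theta> = conj_action n \<sigma> (section_of n T)"
proof -
  obtain \<tau> where \<tau>: "\<tau> permutes {1..n}" "canonical n (conj_elem n \<tau> ` \<Theta>)" using ex_canonical[OF \<Theta>] by blast
  obtain F T where F: "valid n T" "conj_elem n \<tau> ` \<Theta> = conj_action n (flip n F) (section_of n T)"
    by (rule canonical_conj_section[OF \<tau>(2)])
  note iv = permutes_inv[OF \<tau>(1)]
  have "\<Theta> = conj_action n (inv' \<tau>) (conj_action n \<tau> \<Theta>)" using conj_action_inv(1)[OF \<tau>(1) \<Theta>] by simp
  also have "\<dots> = conj_action n (inv' \<tau>) (conj_action n (flip n F) (section_of n T))"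
    using F(2) conj_action_eq[OF \<Theta>] by simp
  also have "\<dots> = conj_action n (inv' \<tau> \<circ> flip n F) (section_of n T)"
    by (rule conj_action_comp[OF iv flip_permutes section_in[OF F(1)]])
  finally show ?thesis using that permutes_compose[OF flip_permutes iv] F(1) by blast
qed

text \<open>The quotient \<open>inv' \<tau> \<circ> \<sigma>\<close> carries one normalised
  cross-section to another, so \<open>normal_rigid\<close> leaves two possibilities.\<close>

lemma conj_normal_eq:
  assumes N: "normal n \<Lambda>" "normal n \<Lambda>'" and \<sigma>: "\<sigma> permutes {1..n}" "\<tau> permutes {1..n}"
    and eq: "conj_action n \<sigma> \<Lambda> = conj_action n \<tau> \<Lambda>'"
  shows "\<tau> = \<sigma> \<and> \<Lambda>' = \<Lambda> \<or> \<tau> = \<sigma> \<circ> bar n \<and> \<Lambda>' = conj_action n (bar n) \<Lambda>"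
proof -
  note c = normal_cross[OF N(1)] normal_cross[OF N(2)] and iv = permutes_inv[OF \<sigma>(2)]
  let ?\<rho> = "inv' \<tau> \<circ> \<sigma>"
  have \<rho>: "?\<rho> permutes {1..n}" by (rule permutes_compose[OF \<sigma>(1) iv])
  have "conj_action n ?\<rho> \<Lambda> = conj_action n (inv' \<tau>) (conj_action n \<tau> \<Lambda>')"
    using conj_action_comp[OF iv \<sigma>(1) c(1)] eq by simp
  then have L': "\<Lambda>' = conj_action n ?\<rho> \<Lambda>" using conj_action_inv(1)[OF \<sigma>(2) c(2)] by simp
  then have "normal n (conj_elem n ?\<rho> ` \<Lambda>)" using N(2) conj_action_eq[OF c(1)] by simp
  from normal_rigid[OF \<rho> N(1) this] have "?\<rho> = id \<or> ?\<rho> = bar n" .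
  moreover have \<sigma>\<tau>: "\<sigma> = \<tau> \<circ> ?\<rho>" using permutes_inv_o(1)[OF \<sigma>(2)] by (simp add: comp_assoc[symmetric])
  ultimately show ?thesis
  proof (elim disjE)
    assume r: "?\<rho> = id"
    then show ?thesis using \<sigma>\<tau> L' conj_action_id[OF c(1)] by simp
  next
    assume r: "?\<rho> = bar n"
    have "\<sigma> \<circ> bar n = \<tau> \<circ> (bar n \<circ> bar n)" using \<sigma>\<tau> r by (simp add: comp_assoc)
    then have "\<tau> = \<sigma> \<circ> bar n" unfolding bar_comp by simp
    then show ?thesis using L' r by simp
  qed
qed

lemma finite_cross_sections: "finite (R_cross_sections n)"
proof -
  have "brauer n \<subseteq> Pow (Pow (pins n))" unfolding brauer_def partition_on_def by blast
  then have "finite (brauer n)" by (rule finite_subset) (simp only: finite_Pow_iff finite_pins)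
  moreover have "R_cross_sections n \<subseteq> Pow (brauer n)" using cross_section_brauer by blast
  ultimately show ?thesis by (meson finite_Pow_iff finite_subset)
qed

lemma bar_neq_id: "2 \<le> n \<Longrightarrow> bar n \<noteq> id"
proof -
  assume "2 \<le> n"
  then have "bar n n \<noteq> n" using bar_upper[of 0 n] by simp
  then show ?thesis by auto
qed

lemma conj_bar_normal: "normal n \<Lambda> \<Longrightarrow> normal n (conj_action n (bar n) \<Lambda>)"
  using normal_bar conj_action_eq[OF normal_cross] by simp

text \<open>Double counting of pairs of a permutation and a normalised cross-section. Every fibre of
  the conjugation map consists of \<open>(\<sigma>, \<Lambda>)\<close> and of the pair obtained by
  composing \<open>\<sigma>\<close> with \<open>bar n\<close> and conjugating
  \<open>\<Lambda>\<close> by \<open>bar n\<close>; they differ because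
  \<open>bar n \<noteq> id\<close> for \<open>n \<ge> 2\<close>.\<close>

lemma card_cross_sections:
  assumes n: "2 \<le> n" shows "2 * card (R_cross_sections n) = fact n * card {T. valid n T}"
proof -
  let ?S = "{\<sigma>. \<sigma> permutes {1..n}}" and ?N = "{\<Lambda>. normal n \<Lambda>}"
  let ?F = "\<lambda>(\<sigma>, \<Lambda>). conj_action n \<sigma> \<Lambda>"
  have N: "?N = section_of n ` {T. valid n T}" using normal_iff by blast
  have "inj_on (section_of n) {T. valid n T}" using section_of_inj by (intro inj_onI) simp
  then have cN: "card ?N = card {T. valid n T}" unfolding N by (rule card_image)
  have fin: "finite ?N" by (rule finite_subset[OF _ finite_cross_sections[of n]]) (use normal_cross in blast)
  have finS: "finite ?S" by (simp add: finite_permutations)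
  have image: "?F ` (?S \<times> ?N) = R_cross_sections n"
  proof
    show "?F ` (?S \<times> ?N) \<subseteq> R_cross_sections n" using conj_action_closed normal_cross by auto
    show "R_cross_sections n \<subseteq> ?F ` (?S \<times> ?N)"
    proof
      fix \<Theta> assume "\<Theta> \<in> R_cross_sections n"
      then obtain \<sigma> T where s: "\<sigma> permutes {1..n}" "valid n T" "\<Theta> = conj_action n \<sigma> (section_of n T)"
        by (rule ex_conj_section)
      then have "(\<sigma>, section_of n T) \<in> ?S \<times> ?N" using normal_section_of by simp
      then show "\<Theta> \<in> ?F ` (?S \<times> ?N)" by (rule rev_image_eqI) (simp add: s(3))
    qed
  qed
  have fibre: "card {z \<in> ?S \<times> ?N. ?F z = \<Theta>} = 2" if \<Theta>: "\<Theta> \<in> R_cross_sections n" for \<Theta>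
  proof -
    obtain \<sigma> \<Lambda> where s: "\<sigma> permutes {1..n}" "normal n \<Lambda>" "\<Theta> = conj_action n \<sigma> \<Lambda>"
      using \<Theta> unfolding image[symmetric] by auto
    let ?\<sigma> = "\<sigma> \<circ> bar n" and ?\<Lambda> = "conj_action n (bar n) \<Lambda>"
    note c = normal_cross[OF s(2)]
    have s': "?\<sigma> permutes {1..n}" by (rule permutes_compose[OF bar_permutes s(1)])
    have "conj_action n ?\<sigma> ?\<Lambda> = conj_action n (?\<sigma> \<circ> bar n) \<Lambda>" by (rule conj_action_comp[OF s' bar_permutes c])
    also have "?\<sigma> \<circ> bar n = \<sigma>" by (simp add: comp_assoc bar_comp)
    finally have eq: "conj_action n ?\<sigma> ?\<Lambda> = \<Theta>" unfolding s(3)[symmetric] .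
    have "{z \<in> ?S \<times> ?N. ?F z = \<Theta>} = {(\<sigma>, \<Lambda>), (?\<sigma>, ?\<Lambda>)}"
    proof
      show "{(\<sigma>, \<Lambda>), (?\<sigma>, ?\<Lambda>)} \<subseteq> {z \<in> ?S \<times> ?N. ?F z = \<Theta>}"
      proof -
        have "(\<sigma>, \<Lambda>) \<in> ?S \<times> ?N" "(?\<sigma>, ?\<Lambda>) \<in> ?S \<times> ?N" using s s' conj_bar_normal[OF s(2)] by simp_all
        moreover have "?F (\<sigma>, \<Lambda>) = \<Theta>" "?F (?\<sigma>, ?\<Lambda>) = \<Theta>" unfolding prod.case by (rule s(3)[symmetric], rule eq)
        ultimately show ?thesis by blast
      qed
      show "{z \<in> ?S \<times> ?N. ?F z = \<Theta>} \<subseteq> {(\<sigma>, \<Lambda>), (?\<sigma>, ?\<Lambda>)}"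
      proof
        fix z assume "z \<in> {z \<in> ?S \<times> ?N. ?F z = \<Theta>}"
        then obtain \<tau> \<Lambda>' where z: "z = (\<tau>, \<Lambda>')" "\<tau> permutes {1..n}" "normal n \<Lambda>'" "conj_action n \<tau> \<Lambda>' = \<Theta>"
          by auto
        have "conj_action n \<sigma> \<Lambda> = conj_action n \<tau> \<Lambda>'" using z(4) s(3) by simp
        from conj_normal_eq[OF s(2) z(3) s(1) z(2) this] show "z \<in> {(\<sigma>, \<Lambda>), (?\<sigma>, ?\<Lambda>)}" using z(1) by auto
      qed
    qed
    moreover have "\<sigma> \<noteq> ?\<sigma>"
    proof
      assume "\<sigma> = ?\<sigma>"
      then have "inv' \<sigma> \<circ> \<sigma> = inv' \<sigma> \<circ> \<sigma> \<circ> bar n" by (simp add: comp_assoc)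
      then show False using permutes_inv_o(2)[OF s(1)] bar_neq_id[OF n] by simp
    qed
    ultimately show ?thesis by simp
  qed
  have "card (?S \<times> ?N) = (\<Sum>z\<in>?S \<times> ?N. 1)" by simp
  also have "\<dots> = (\<Sum>\<Theta>\<in>?F ` (?S \<times> ?N). \<Sum>z\<in>{z \<in> ?S \<times> ?N. ?F z = \<Theta>}. 1)"
    by (rule sum.image_gen) (use fin finS in simp)
  also have "\<dots> = (\<Sum>\<Theta>\<in>R_cross_sections n. 2)"
    unfolding image by (rule sum.cong[OF refl]) (use fibre in simp)
  finally have "card ?S * card ?N = 2 * card (R_cross_sections n)"
    by (simp add: card_cartesian_product)
  moreover have "card ?S = fact n" by (simp add: card_permutations)
  ultimately show ?thesis using cN by simp
qed

section \<open>Stabilizers\<close>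

lemma gen_sign4:
  assumes "deep_pair n a b" "0 < lev n b"
  shows "{LP (n - 1), RP (n - 3)} \<in> gen n T {a, b} \<longleftrightarrow> {a, b} \<notin> T"
proof -
  have half: "1 < n div 2" using deep_pair_half[OF assms(1)] assms(2) by simp
  have t: "n \<in> {1..n}" "lev n n = 0" "bar n n = n - 1" using top_facts[of n] half by auto
  note s = top_shift_facts[OF half]
  have nb: "lev n n < lev n b" using t(2) assms(2) by simp
  note f = phi_above[OF assms(1) t(1) nb, of T]
  have out: "n - 1 \<notin> {a, b}" "n - 1 \<in> {1..n}"
    using t nb lev_bar[of n n] assms(1) half unfolding deep_pair_def by (auto simp del: lev_bar)
  have "phi n T {a, b} n = (if {a, b} \<in> T then n - 3 else n - 2)" using f(1) s(3) by simp
  moreover have "phi n T {a, b} (n - 1) = bar n (phi n T {a, b} n)" using f(4) t(3) by simp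
  moreover have "bar n (n - 3) = n - 2" using s(3) by (metis bar_bar)
  ultimately show ?thesis
    using gen_LR[OF assms(1), of _ _ T] out s(3,4) s(4)[symmetric] by (auto split: if_splits)
qed

lemma conj_flip_gen:
  assumes T: "valid n T" and d: "deep_pair n a b" and i: "flip n F ` {a, b} = {i, j}"
  shows "conj_elem n (flip n F) (gen n T {a, b}) \<in> conj_action n (flip n F) (section_of n T)"
    "lft (conj_elem n (flip n F) (gen n T {a, b})) = {{i, j}}"
    "alpha n (conj_action n (flip n F) (section_of n T)) i j = conj_elem n (flip n F) (gen n T {a, b})"
proof -
  note c = section_in[OF T]
  show m: "conj_elem n (flip n F) (gen n T {a, b}) \<in> conj_action n (flip n F) (section_of n T)"
    unfolding conj_action_eq[OF c] by (rule imageI[OF gen_in_section(1)[OF d]])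
  show l: "lft (conj_elem n (flip n F) (gen n T {a, b})) = {{i, j}}"
    unfolding conj_elem_lft(1)[OF flip_permutes gen_brauer[OF d]] gen_in_section(2)[OF d] using i by simp
  show "alpha n (conj_action n (flip n F) (section_of n T)) i j = conj_elem n (flip n F) (gen n T {a, b})"
    by (rule alpha_eq[OF conj_action_closed[OF flip_permutes c] m l])
qed

lemma conj_flip_mem:
  assumes "deep_pair n a b"
  shows "{LP (flip n F x), RP (flip n F y)} \<in> conj_elem n (flip n F) (gen n T {a, b}) \<longleftrightarrow> {LP x, RP y} \<in> gen n T {a, b}"
  using conj_elem_iff[OF flip_permutes gen_brauer[OF assms], of F "LP x" "RP y"] by simp

definition bar_invariant :: "nat \<Rightarrow> nat set set \<Rightarrow> bool" where
  "bar_invariant n T \<longleftrightarrow> (\<forall>a b. {a, b} \<in> mixed n \<longrightarrow> ({a, b} \<in> T \<longleftrightarrow> {bar n a, bar n b} \<in> T))"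

text \<open>Conjugation by \<open>bar n\<close> applies \<open>bar n\<close> to the pairs of the
  sign set. It preserves twists: a strand from \<open>n - 1\<close> to \<open>n - 2\<close> becomes
  one from \<open>n\<close> to \<open>n - 3\<close>, and both indicate a twist.\<close>

lemma conj_bar_section:
  assumes T: "valid n T"
  shows "conj_action n (bar n) (section_of n T) = section_of n T \<longleftrightarrow> bar_invariant n T"
proof -
  note c = section_in[OF T]
  obtain T' where T': "valid n T'" "conj_action n (bar n) (section_of n T) = section_of n T'"
    using conj_bar_normal[OF normal_section_of[OF T]] unfolding normal_iff by blast
  have sign: "{a, b} \<in> T' \<longleftrightarrow> {bar n a, bar n b} \<in> T" if m: "{a, b} \<in> mixed n" for a b
  proof -
    have sign': "{x, y} \<in> T' \<longleftrightarrow> {bar n x, bar n y} \<in> T" if xy: "deep_pair n x y" "0 < lev n y" for x y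
    proof -
      have d: "deep_pair n (bar n x) (bar n y)" using xy(1) bar_in unfolding deep_pair_def by (auto simp: bar_eq_iff)
      have half: "1 < n div 2" using deep_pair_half[OF xy(1)] xy(2) by simp
      have "flip n UNIV ` {bar n x, bar n y} = {x, y}" unfolding flip_UNIV by simp
      note g = conj_flip_gen[OF T d this]
      have "conj_elem n (bar n) (gen n T {bar n x, bar n y}) = gen n T' {x, y}"
        by (rule cross_section_unique[OF section_in[OF T'(1)] _ gen_in_section(1)[OF xy(1)]])
          (use g(1,2) T'(2) gen_in_section(2)[OF xy(1)] in \<open>simp_all add: flip_UNIV\<close>)
      moreover have "{LP (flip n UNIV (n - 1)), RP (flip n UNIV (n - 2))} \<in> conj_elem n (flip n UNIV) (gen n T {bar n x, bar n y})
          \<longleftrightarrow> {LP (n - 1), RP (n - 2)} \<in> gen n T {bar n x, bar n y}" by (rule conj_flip_mem[OF d])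
      moreover have "flip n UNIV (n - 1) = n" "flip n UNIV (n - 2) = n - 3"
        using top_facts(3)[of n] top_shift_facts(3)[OF half] half unfolding flip_UNIV
        by (metis bar_bar less_imp_le, simp)
      ultimately show ?thesis
        using gen_sign(1)[OF xy, of T'] gen_sign(2)[OF d, of T] xy(2) unfolding flip_UNIV by simp
    qed
    have in_n: "a \<in> {1..n}" "b \<in> {1..n}" "0 < lev n a" "0 < lev n b" "lev n a \<noteq> lev n b" using m unfolding pair_mixed by auto
    show ?thesis
    proof (cases "lev n b < lev n a")
      case True
      then show ?thesis using sign'[of a b] in_n unfolding deep_pair_def by auto
    next
      case False
      then have "{b, a} \<in> T' \<longleftrightarrow> {bar n b, bar n a} \<in> T" using sign'[of b a] in_n unfolding deep_pair_def by auto
      then show ?thesis by (simp add: insert_commute)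
    qed
  qed
  show ?thesis
  proof
    assume "conj_action n (bar n) (section_of n T) = section_of n T"
    then have "T' = T" using section_of_inj[OF T'(1) T] T'(2) by simp
    then show "bar_invariant n T" unfolding bar_invariant_def using sign by blast
  next
    assume inv: "bar_invariant n T"
    have "p \<in> T' \<longleftrightarrow> p \<in> T" if p: "p \<in> mixed n" for p
    proof -
      obtain a b where "p = {a, b}" using p unfolding mixed_def by blast
      then show ?thesis using sign inv p unfolding bar_invariant_def by blast
    qed
    then have "T' = T" using valid_subset[OF T] valid_subset[OF T'(1)] by blast
    then show "conj_action n (bar n) (section_of n T) = section_of n T" using T'(2) by simp
  qed
qed

text \<open>Without mixed pairs, or with an empty or full sign set, this is immediate. In degree 6
  no point is fixed by \<open>bar n\<close>, so the first closure condition relates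
  \<open>{a, b}\<close> to its image.\<close>

lemma bar_invariant_valid:
  assumes T: "valid n T" and n: "n \<noteq> 5" shows "bar_invariant n T"
  unfolding bar_invariant_def
proof (intro allI impI)
  fix a b assume m: "{a, b} \<in> mixed n"
  then have in_n: "a \<in> {1..n}" "b \<in> {1..n}" "0 < lev n a" "0 < lev n b" "lev n a \<noteq> lev n b" unfolding pair_mixed by auto
  have mb: "{bar n a, bar n b} \<in> mixed n" unfolding pair_mixed using in_n bar_in by auto
  consider "n \<le> 4" | "n = 6" | "7 \<le> n" using n by linarith
  then show "{a, b} \<in> T \<longleftrightarrow> {bar n a, bar n b} \<in> T"
  proof cases
    case 1 then show ?thesis using m mixed_small by blast
  next
    case 3 then show ?thesis using valid_large T m mb by blast
  next
    case 2
    have ne: "bar n x \<noteq> x" if "x \<in> {1..n}" for x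
      using six_cases[of x] that unfolding 2 by (auto simp: bar_six)
    show ?thesis
    proof (cases "lev n b < lev n a")
      case True then show ?thesis using valid_bar_pair[OF T m True] ne[OF in_n(1)] by simp
    next
      case False
      then have lt: "lev n a < lev n b" using in_n(5) by simp
      have "{b, a} \<in> mixed n" using m by (simp add: insert_commute)
      from valid_bar_pair[OF T this lt] show ?thesis using ne[OF in_n(2)] by (simp add: insert_commute)
    qed
  qed
qed

text \<open>\<open>bar 5\<close> fixes the deeper point 1 and exchanges 2 and 3, so invariance is a
  condition on two signs that validity leaves independent.\<close>

lemma bar_invariant_five:
  assumes T: "valid 5 T" shows "bar_invariant 5 T \<longleftrightarrow> ({1, 2} \<in> T \<longleftrightarrow> {1, 3} \<in> T)"
proof
  assume "bar_invariant 5 T"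
  moreover have "{1, 2} \<in> mixed 5" unfolding mixed_five by simp
  ultimately have "{1, 2} \<in> T \<longleftrightarrow> {bar 5 1, bar 5 2} \<in> T" unfolding bar_invariant_def by blast
  then show "{1, 2} \<in> T \<longleftrightarrow> {1, 3} \<in> T" unfolding bar_five .
next
  assume eq: "{1, 2} \<in> T \<longleftrightarrow> {1, 3} \<in> T"
  show "bar_invariant 5 T"
    unfolding bar_invariant_def
  proof (intro allI impI)
    fix a b assume "{a, b} \<in> mixed 5"
    then have "(a = 1 \<and> b = 2) \<or> (a = 2 \<and> b = 1) \<or> (a = 1 \<and> b = 3) \<or> (a = 3 \<and> b = 1)"
      unfolding mixed_five by (auto simp: doubleton_eq_iff)
    then show "{a, b} \<in> T \<longleftrightarrow> {bar 5 a, bar 5 b} \<in> T"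
      using eq by (elim disjE conjE) (simp_all add: bar_five insert_commute)
  qed
qed

text \<open>Flips commute with \<open>bar n\<close>, so the flip leading to a normalised
  cross-section does not change the stabilizer; rigidity excludes all permutations other than
  \<open>id\<close> and \<open>bar n\<close>.\<close>

lemma stabilizer_canonical:
  assumes n: "2 \<le> n" and can: "canonical n \<Lambda>"
    and T: "valid n T" "\<Lambda> = conj_action n (flip n F) (section_of n T)"
  shows "stabilizer (sym_group n) (conj_action n) \<Lambda> = (if bar_invariant n T then {id, bar n} else {id})"
proof -
  note c = section_in[OF T(1)] and N = normal_section_of[OF T(1)]
  let ?f = "flip n F"
  have ff: "?f \<circ> ?f = id" by (simp add: fun_eq_iff)
  have fb: "?f \<circ> bar n = bar n \<circ> ?f" by (simp add: fun_eq_iff flip_bar)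
  have bar: "conj_action n (bar n) \<Lambda> = \<Lambda> \<longleftrightarrow> bar_invariant n T"
  proof -
    have "conj_action n (bar n) \<Lambda> = conj_action n ?f (conj_action n (bar n) (section_of n T))"
      unfolding T(2) using conj_action_comp[OF bar_permutes flip_permutes c] conj_action_comp[OF flip_permutes bar_permutes c] fb
      by simp
    moreover have "conj_action n ?f X = conj_action n ?f Y \<longleftrightarrow> X = Y"
      if "X \<in> R_cross_sections n" "Y \<in> R_cross_sections n" for X Y
      using conj_action_inv(1)[OF flip_permutes that(1)] conj_action_inv(1)[OF flip_permutes that(2)] by metis
    ultimately show ?thesis
      using conj_bar_section[OF T(1)] conj_action_closed[OF bar_permutes c] c unfolding T(2) by metis
  qed
  have only: "g = id \<or> g = bar n" if g: "g permutes {1..n}" "conj_action n g \<Lambda> = \<Lambda>" for g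
  proof -
    have gf: "g \<circ> ?f permutes {1..n}" by (rule permutes_compose[OF flip_permutes g(1)])
    have "conj_action n (g \<circ> ?f) (section_of n T) = conj_action n ?f (section_of n T)"
      using conj_action_comp[OF g(1) flip_permutes c] g(2) unfolding T(2) by simp
    from conj_normal_eq[OF N N gf flip_permutes this]
    have "?f = g \<circ> ?f \<or> ?f = (g \<circ> ?f) \<circ> bar n" by blast
    then show ?thesis
    proof
      assume "?f = g \<circ> ?f"
      then have "?f \<circ> ?f = g \<circ> (?f \<circ> ?f)" by (metis comp_assoc)
      then show ?thesis unfolding ff by simp
    next
      assume e: "?f = (g \<circ> ?f) \<circ> bar n"
      have "id = ?f \<circ> ?f" using ff by simp
      also have "\<dots> = ((g \<circ> ?f) \<circ> bar n) \<circ> ?f" using e by simp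
      also have "\<dots> = g \<circ> (?f \<circ> ?f) \<circ> bar n" by (simp add: comp_assoc fb[symmetric])
      finally have "id = g \<circ> bar n" unfolding ff by simp
      then have "id \<circ> bar n = g \<circ> (bar n \<circ> bar n)" by (metis comp_assoc)
      then show ?thesis unfolding bar_comp by simp
    qed
  qed
  show ?thesis
    unfolding stabilizer_def carrier_sym_group
    using only bar bar_permutes[of n] permutes_id[of "{1..n}"] conj_action_id[OF canonical_cross[OF can]]
    by auto
qed

text \<open>Flipping level 0 or level 1 reverses both parameters, and flipping level 1 also
  exchanges \<open>{1, 2}\<close> and \<open>{1, 3}\<close>. Whether the two parameters agree is
  therefore independent of \<open>F\<close>.\<close>

lemma alpha_sup_five:
  assumes can: "canonical 5 \<Lambda>" and T: "valid 5 T" "\<Lambda> = conj_action 5 (flip 5 F) (section_of 5 T)"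
  shows "alpha_sup 5 \<Lambda> 1 2 1 = alpha_sup 5 \<Lambda> 1 3 1 \<longleftrightarrow> ({1, 2} \<in> T \<longleftrightarrow> {1, 3} \<in> T)"
    "1 \<notin> F \<Longrightarrow> alpha_sup 5 \<Lambda> 1 2 1 = id \<longleftrightarrow> ({1, 2} \<in> T \<longleftrightarrow> 0 \<in> F)"
proof -
  interpret canonical_section 5 \<Lambda> by unfold_locales (rule can)
  let ?f = "flip 5 F"
  have sup: "alpha_sup 5 \<Lambda> 1 y 1 = (if {LP 5, RP 3} \<in> alpha 5 \<Lambda> 1 y then id else Transposition.transpose 1 2)"
    if y: "y = 2 \<or> y = 3" for y
  proof -
    have d: "deep_pair 5 1 y" using y by (intro deep_pair_less) auto
    have "{LP 5, RP 3} \<in> alpha 5 \<Lambda> 1 y \<longleftrightarrow> fp {1, y} 5 = 3"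
      unfolding alpha_elt[OF d] fp_iff[OF d] using y by auto
    then show ?thesis using alpha_sup_eq[of 1 y 1] y by auto
  qed
  have mem: "{LP 5, RP 3} \<in> alpha 5 \<Lambda> 1 y \<longleftrightarrow> (({1, ?f y} \<notin> T) \<longleftrightarrow> (0 \<in> F \<longleftrightarrow> 1 \<in> F))"
    if y: "y = 2 \<or> y = 3" for y
  proof -
    have fy: "?f y = 2 \<or> ?f y = 3" using y by (auto simp: flip_def lev_five bar_five)
    have d: "deep_pair 5 1 (?f y)" using fy by (intro deep_pair_less) auto
    have pos: "0 < lev 5 (?f y)" using y by (auto simp: lev_five)
    have im: "?f ` {1, ?f y} = {1, y}" by (simp add: flip_def[of _ _ 1] flip_def[of _ _ "Suc 0"] bar_five)
    have al: "alpha 5 \<Lambda> 1 y = conj_elem 5 ?f (gen 5 T {1, ?f y})"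
      unfolding T(2) by (rule conj_flip_gen(3)[OF T(1) d im])
    have "{LP 5, RP 3} \<in> alpha 5 \<Lambda> 1 y \<longleftrightarrow> {LP (?f 5), RP (?f 3)} \<in> gen 5 T {1, ?f y}"
      using conj_flip_mem[OF d, of F "?f 5" "?f 3" T] unfolding al by simp
    moreover have "?f 5 = (if 0 \<in> F then 4 else 5)" "?f 3 = (if 1 \<in> F then 2 else 3)"
      by (simp_all add: flip_def lev_five bar_five)
    ultimately show ?thesis
      using gen_sign[OF d pos, of T] gen_sign4[OF d pos, of T] by simp
  qed
  have f23: "?f 2 = (if 1 \<in> F then 3 else 2)" "?f 3 = (if 1 \<in> F then 2 else 3)"
    by (simp_all add: flip_def lev_five bar_five)
  show "alpha_sup 5 \<Lambda> 1 2 1 = alpha_sup 5 \<Lambda> 1 3 1 \<longleftrightarrow> ({1, 2} \<in> T \<longleftrightarrow> {1, 3} \<in> T)"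
    using sup[of 2] sup[of 3] mem[of 2] mem[of 3] f23 transpose_12_neq transpose_12_neq[symmetric]
    by (auto split: if_splits)
  show "1 \<notin> F \<Longrightarrow> alpha_sup 5 \<Lambda> 1 2 1 = id \<longleftrightarrow> ({1, 2} \<in> T \<longleftrightarrow> 0 \<in> F)"
    using sup[of 2] mem[of 2] f23 transpose_12_neq by (auto split: if_splits)
qed

text \<open>In degree 1 the symmetric group is trivial. In degree 5 the condition on the parameters
  expresses invariance under \<open>bar 5\<close>, which holds in all other degrees from 2
  on.\<close>

lemma stabilizer_eq:
  assumes n: "1 \<le> n" and can: "canonical n \<Lambda>"
  shows "stabilizer (sym_group n) (conj_action n) \<Lambda> =
    (if n = 1 \<or> (n = 5 \<and> alpha_sup n \<Lambda> 1 2 1 \<noteq> alpha_sup n \<Lambda> 1 3 1)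
     then {id} else {id, special_perm n})"
proof (cases "n = 1")
  case True
  have "\<sigma> permutes {1..n} \<longleftrightarrow> \<sigma> = id" for \<sigma> :: "nat \<Rightarrow> nat" using True by simp
  then show ?thesis
    unfolding stabilizer_def carrier_sym_group
    using True conj_action_id[OF canonical_cross[OF can]] by auto
next
  case False
  then have n2: "2 \<le> n" using n by simp
  obtain F T where T: "valid n T" "\<Lambda> = conj_action n (flip n F) (section_of n T)"
    by (rule canonical_conj_section[OF can])
  note st = stabilizer_canonical[OF n2 can T]
  show ?thesis
  proof (cases "n = 5")
    case True
    have "bar_invariant 5 T \<longleftrightarrow> alpha_sup 5 \<Lambda> 1 2 1 = alpha_sup 5 \<Lambda> 1 3 1"
      using alpha_sup_five(1)[of \<Lambda> T F] bar_invariant_five[of T] can T unfolding True by blast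
    then show ?thesis unfolding st special_perm_eq[OF n2] using True by simp
  next
    case n5: False
    then show ?thesis unfolding st special_perm_eq[OF n2] using bar_invariant_valid[OF T(1)] False by simp
  qed
qed

section \<open>Orbits and the individual degrees\<close>

lemma orbit_eq: "conj_orbit n \<Lambda> = {conj_action n \<sigma> \<Lambda> |\<sigma>. \<sigma> permutes {1..n}}"
  unfolding orbit_def carrier_sym_group ..

lemma card_conj_orbit:
  assumes n: "2 \<le> n" "n \<noteq> 5" and can: "canonical n \<Lambda>"
  shows "2 * card (conj_orbit n \<Lambda>) = fact n"
proof -
  have "stabilizer (sym_group n) (conj_action n) \<Lambda> = {id, bar n}"
    using stabilizer_eq[OF _ can] special_perm_eq[OF n(1)] n by simp
  then have "card (stabilizer (sym_group n) (conj_action n) \<Lambda>) = 2" using bar_neq_id[OF n(1)] by simp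
  then show ?thesis
    using group_action.orbit_stabilizer_theorem[OF conj_group_action canonical_cross[OF can]]
    by (simp add: order_def sym_group_card_carrier)
qed

lemma section_small:
  assumes n: "n \<le> 3"
  shows "section_of n {} = insert (perm_brauer n id) {gen n {} {i, j} |i j. 1 \<le> i \<and> i < j \<and> j \<le> n}"
proof -
  note c = section_in[OF valid_empty[of n]]
  have idc: "perm_brauer n id \<in> section_of n {}" unfolding section_of_def using rep_empty by blast
  show ?thesis
  proof
    show "insert (perm_brauer n id) {gen n {} {i, j} |i j. 1 \<le> i \<and> i < j \<and> j \<le> n} \<subseteq> section_of n {}"
      using idc gen_in_section(1)[OF deep_pair_less] by auto
    show "section_of n {} \<subseteq> insert (perm_brauer n id) {gen n {} {i, j} |i j. 1 \<le> i \<and> i < j \<and> j \<le> n}"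
    proof
      fix \<gamma> assume g: "\<gamma> \<in> section_of n {}"
      note M = matching_lft[OF cross_section_brauer[OF c g]]
      have "card (lft \<gamma>) \<le> 1" using card_matching_le[OF M] n by simp
      then consider "lft \<gamma> = {}" | p where "lft \<gamma> = {p}"
        using finite_matching[OF M] by (metis card_0_eq card_1_singletonE le_neq_implies_less less_one)
      then show "\<gamma> \<in> insert (perm_brauer n id) {gen n {} {i, j} |i j. 1 \<le> i \<and> i < j \<and> j \<le> n}"
      proof cases
        case 1
        then have "\<gamma> = perm_brauer n id" using cross_section_unique[OF c g idc] perm_id(2) by simp
        then show ?thesis by simp
      next
        case (2 p)
        then have p: "p \<in> lft \<gamma>" by simp
        obtain a b where ab: "p = {a, b}" "a \<noteq> b" "a \<in> {1..n}" "b \<in> {1..n}" by (rule matching_pair[OF M p])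
        then obtain i j where ij: "p = {i, j}" "1 \<le> i" "i < j" "j \<le> n"
        proof (cases "a < b")
          case True then show ?thesis using that[of a b] ab by simp
        next
          case False then show ?thesis using that[of b a] ab by (simp add: insert_commute)
        qed
        note d = deep_pair_less[OF ij(2-4)]
        have "\<gamma> = gen n {} {i, j}"
          using cross_section_unique[OF c g gen_in_section(1)[OF d]] gen_in_section(2)[OF d] 2 ij(1) by simp
        then show ?thesis using ij by blast
      qed
    qed
  qed
qed

lemma section_alpha:
  assumes "valid n T" "1 \<le> i" "i < j" "j \<le> n"
  shows "alpha n (section_of n T) i j = gen n T {i, j}"
  using alpha_eq[OF section_in[OF assms(1)]] gen_in_section[OF deep_pair_less[OF assms(2-4)]] by simp

lemma cross_sections_one: "R_cross_sections 1 = {{perm_brauer 1 id}}"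
proof -
  have uniq: "\<alpha> = perm_brauer 1 id" if a: "\<alpha> \<in> brauer 1" for \<alpha>
  proof (rule brauer_subset_eq[OF a perm_id(1)], rule subsetI)
    fix B assume "B \<in> perm_brauer 1 id"
    then have B: "B = {LP 1, RP 1}" unfolding perm_brauer_def by auto
    obtain y where y: "{LP 1, y} \<in> \<alpha>" using brauer_ex[OF a, of "LP 1"] by auto
    have "y \<in> pins 1" "y \<noteq> LP 1" using brauer_pins[OF a y] brauer_neq[OF a y] by auto
    then have "y = RP 1" by (cases y) simp_all
    then show "B \<in> \<alpha>" using y B by simp
  qed
  have "\<Lambda> = {perm_brauer 1 id}" if L: "\<Lambda> \<in> R_cross_sections 1" for \<Lambda>
  proof -
    obtain \<alpha> where "\<alpha> \<in> \<Lambda>" "lft \<alpha> = {}" "\<alpha> \<in> brauer 1" by (rule cross_section_ex[OF L matching_empty])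
    then show ?thesis using uniq cross_section_brauer[OF L] by blast
  qed
  note all = this
  have "{perm_brauer 1 id} \<in> R_cross_sections 1"
    using section_in[OF valid_empty[of 1]] all[OF section_in[OF valid_empty[of 1]]] by simp
  then have "{{perm_brauer 1 id}} \<subseteq> R_cross_sections 1" by simp
  moreover have "R_cross_sections 1 \<subseteq> {{perm_brauer 1 id}}"
  proof
    fix \<Lambda> assume "\<Lambda> \<in> R_cross_sections 1"
    from all[OF this] show "\<Lambda> \<in> {{perm_brauer 1 id}}" by simp
  qed
  ultimately show ?thesis by (rule equalityI[rotated])
qed

lemma cross_sections_two:
  "\<exists>\<Lambda>. R_cross_sections 2 = {\<Lambda>} \<and> canonical 2 \<Lambda> \<and> \<Lambda> = {alpha 2 \<Lambda> 1 2, perm_brauer 2 id}"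
proof -
  let ?L = "section_of 2 {}"
  have "card (R_cross_sections 2) = 1" using card_cross_sections[of 2] card_valid[of 2] by simp
  then have "R_cross_sections 2 = {?L}" using section_in[OF valid_empty[of 2]] by (metis card_1_singletonE singletonD)
  moreover have "?L = {alpha 2 ?L 1 2, perm_brauer 2 id}"
  proof -
    have "1 \<le> i \<and> i < j \<and> j \<le> 2 \<longleftrightarrow> i = 1 \<and> j = 2" for i j :: nat by auto
    then have "?L = {perm_brauer 2 id, gen 2 {} {1, 2}}" unfolding section_small[of 2, simplified] by auto
    then show ?thesis using section_alpha[OF valid_empty, of 1 2 2] by auto
  qed
  ultimately show ?thesis using canonical_section_of[OF valid_empty[of 2]] by blast
qed

lemma conj_transpose:
  fixes i j :: nat
  assumes "\<Lambda> \<in> R_cross_sections n"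
  shows "(\<lambda>\<alpha>. perm_brauer n (Transposition.transpose i j) \<odot> \<alpha> \<odot> perm_brauer n (Transposition.transpose i j)) ` \<Lambda> =
    conj_action n (Transposition.transpose i j) \<Lambda>"
  unfolding conj_action_eq[OF assms] conj_elem_def by simp

lemma cross_sections_three:
  "\<exists>\<Lambda>. {\<Theta>. canonical 3 \<Theta>} = {\<Lambda>} \<and>
    \<Lambda> = {alpha 3 \<Lambda> 1 2, alpha 3 \<Lambda> 2 3, alpha 3 \<Lambda> 1 3, perm_brauer 3 id} \<and>
    (\<forall>\<alpha>\<in>\<Lambda>. \<alpha> \<odot> \<alpha> = \<alpha>) \<and> card (R_cross_sections 3) = 3 \<and>
    R_cross_sections 3 =
      {\<Lambda>,
       (\<lambda>\<alpha>. perm_brauer 3 (Transposition.transpose 1 2) \<odot> \<alpha> \<odot> perm_brauer 3 (Transposition.transpose 1 2)) ` \<Lambda>,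
       (\<lambda>\<alpha>. perm_brauer 3 (Transposition.transpose 1 3) \<odot> \<alpha> \<odot> perm_brauer 3 (Transposition.transpose 1 3)) ` \<Lambda>}"
proof (intro exI conjI)
  let ?L = "section_of 3 {}" and ?s = "Transposition.transpose 1 (2 :: nat)" and ?t = "Transposition.transpose 1 (3 :: nat)"
  note L = section_in[OF valid_empty[of 3]] and can = canonical_section_of[OF valid_empty[of 3]]
  have "\<Theta> = ?L" if "canonical 3 \<Theta>" for \<Theta>
  proof -
    have "normal 3 \<Theta>" unfolding normal_def using that by simp
    then obtain T where "valid 3 T" "\<Theta> = section_of 3 T" unfolding normal_iff by blast
    then show ?thesis using valid_small[of 3 T] by simp
  qed
  then show "{\<Theta>. canonical 3 \<Theta>} = {?L}" using can by blast
  have "1 \<le> i \<and> i < j \<and> j \<le> 3 \<longleftrightarrow> i = 1 \<and> j = 2 \<or> i = 2 \<and> j = 3 \<or> i = 1 \<and> j = 3" for i j :: nat by auto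
  then have eq: "?L = {gen 3 {} {1, 2}, gen 3 {} {2, 3}, gen 3 {} {1, 3}, perm_brauer 3 id}"
    unfolding section_small[of 3, simplified] by auto
  have "alpha 3 ?L 1 2 = gen 3 {} {1, 2}" "alpha 3 ?L 2 3 = gen 3 {} {2, 3}" "alpha 3 ?L 1 3 = gen 3 {} {1, 3}"
    by (rule section_alpha[OF valid_empty]; simp)+
  then show "?L = {alpha 3 ?L 1 2, alpha 3 ?L 2 3, alpha 3 ?L 1 3, perm_brauer 3 id}" using eq by simp
  show "\<forall>\<alpha>\<in>?L. \<alpha> \<odot> \<alpha> = \<alpha>"
  proof
    fix \<alpha> assume "\<alpha> \<in> ?L"
    then consider "\<alpha> = perm_brauer 3 id" | i j where "1 \<le> i" "i < j" "j \<le> 3" "\<alpha> = gen 3 {} {i, j}"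
      unfolding section_small[of 3, simplified] by auto
    then show "\<alpha> \<odot> \<alpha> = \<alpha>"
    proof cases
      case 1 then show ?thesis using perm_id_mult(1)[OF perm_id(1)] by simp
    next
      case (2 i j)
      note d = deep_pair_less[OF 2(1-3)]
      \<comment> \<open>Every pair in degree 3 meets the top standard pair, so each generator
        absorbs itself.\<close>
      have "lev 3 j = 0" using 2 unfolding lev_def by auto
      then show ?thesis using gen_absorb[OF d d] 2(4) by simp
    qed
  qed
  show c: "card (R_cross_sections 3) = 3" using card_cross_sections[of 3] card_valid[of 3] by (simp add: fact_numeral)
  have s: "?s permutes {1..3}" "?t permutes {1..3}" by (rule permutes_swap_id; simp)+
  note conj = conj_transpose[OF L, of 1 2] conj_transpose[OF L, of 1 3]
  have stab: "g = id \<or> g = bar 3" if g: "g permutes {1..3}" "conj_action 3 g ?L = ?L" for g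
  proof -
    have "g \<in> stabilizer (sym_group 3) (conj_action 3) ?L" unfolding stabilizer_def carrier_sym_group using g by simp
    then show ?thesis using stabilizer_eq[OF _ can] special_perm_eq[of 3] by simp
  qed
  \<comment> \<open>A stabilizing permutation fixes 1, whereas the two transpositions and their
    quotient move it; this separates the three conjugates.\<close>
  have bar1: "bar 3 1 = 1" by (simp add: bar_def)
  have fix1: "g 1 = 1" if "g permutes {1..3}" "conj_action 3 g ?L = ?L" for g using stab[OF that] bar1 by auto
  have ne1: "conj_action 3 ?s ?L \<noteq> ?L" using fix1[OF s(1)] by auto
  have ne2: "conj_action 3 ?t ?L \<noteq> ?L" using fix1[OF s(2)] by auto
  have ne3: "conj_action 3 ?s ?L \<noteq> conj_action 3 ?t ?L"
  proof
    assume "conj_action 3 ?s ?L = conj_action 3 ?t ?L"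
    then have "conj_action 3 (inv' ?t) (conj_action 3 ?s ?L) = ?L" using conj_action_inv(1)[OF s(2) L] by simp
    then have "conj_action 3 (inv' ?t \<circ> ?s) ?L = ?L" using conj_action_comp[OF permutes_inv[OF s(2)] s(1) L] by simp
    from fix1[OF permutes_compose[OF s(1) permutes_inv[OF s(2)]] this] show False by simp
  qed
  have sub: "{?L, conj_action 3 ?s ?L, conj_action 3 ?t ?L} \<subseteq> R_cross_sections 3"
    using L conj_action_closed[OF s(1) L] conj_action_closed[OF s(2) L] by simp
  have card3: "card {a, b, c} = 3" if "a \<noteq> b" "a \<noteq> c" "b \<noteq> c" for a b c :: "pin set set set"
    using that by simp
  have "card {?L, conj_action 3 ?s ?L, conj_action 3 ?t ?L} = 3"
    by (rule card3[OF ne1[symmetric] ne2[symmetric] ne3])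
  from card_subset_eq[OF finite_cross_sections sub trans[OF this c[symmetric]], symmetric] show "R_cross_sections 3 =
      {?L,
       (\<lambda>\<alpha>. perm_brauer 3 ?s \<odot> \<alpha> \<odot> perm_brauer 3 ?s) ` ?L,
       (\<lambda>\<alpha>. perm_brauer 3 ?t \<odot> \<alpha> \<odot> perm_brauer 3 ?t) ` ?L}"
    unfolding conj .
qed

lemma cross_sections_four:
  "card (R_cross_sections 4) = 12 \<and> (\<exists>\<Lambda>. {\<Theta>. regular_canonical 4 \<Theta>} = {\<Lambda>} \<and>
    (\<forall>\<Theta>\<in>R_cross_sections 4. \<Theta> \<in> conj_orbit 4 \<Lambda>))"
proof (intro conjI exI ballI)
  show "card (R_cross_sections 4) = 12" using card_cross_sections[of 4] card_valid[of 4] by (simp add: fact_numeral)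
  show "{\<Theta>. regular_canonical 4 \<Theta>} = {section_of 4 {}}" by (rule regular_unique)
  fix \<Theta> assume "\<Theta> \<in> R_cross_sections 4"
  then obtain \<sigma> T where "\<sigma> permutes {1..4}" "valid 4 T" "\<Theta> = conj_action 4 \<sigma> (section_of 4 T)"
    by (rule ex_conj_section)
  then show "\<Theta> \<in> conj_orbit 4 (section_of 4 {})" unfolding orbit_eq using valid_small[of 4 T] by auto
qed

lemma cross_sections_five:
  "card (R_cross_sections 5) = 2 * fact 5 \<and> (\<forall>\<Theta>\<in>R_cross_sections 5. \<exists>\<Lambda>. canonical 5 \<Lambda> \<and>
    alpha_sup 5 \<Lambda> 1 2 1 = id \<and> \<Theta> \<in> conj_orbit 5 \<Lambda>)"
proof (intro conjI ballI)
  show "card (R_cross_sections 5) = 2 * fact 5" using card_cross_sections[of 5] card_valid[of 5] by simp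
  fix \<Theta> assume "\<Theta> \<in> R_cross_sections 5"
  then obtain \<sigma> T where T: "\<sigma> permutes {1..5}" "valid 5 T" "\<Theta> = conj_action 5 \<sigma> (section_of 5 T)"
    by (rule ex_conj_section)
  note c = section_in[OF T(2)]
  \<comment> \<open>Flipping level 0 reverses the sign of \<open>{1, 2}\<close>, so it is flipped
    exactly when this pair is twisted.\<close>
  define F where "F = (if {1, 2} \<in> T then {0} else {} :: nat set)"
  let ?f = "flip 5 F"
  let ?L = "conj_action 5 ?f (section_of 5 T)"
  have can: "canonical 5 ?L"
    using conj_canonical_flip[OF canonical_section_of[OF T(2)], of F] unfolding conj_action_eq[OF c] .
  have "1 \<notin> F" "{1, 2} \<in> T \<longleftrightarrow> 0 \<in> F" unfolding F_def by auto
  then have "alpha_sup 5 ?L 1 2 1 = id" using alpha_sup_five(2)[OF can T(2) refl] by blast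
  moreover have "\<Theta> \<in> conj_orbit 5 ?L"
  proof -
    have p: "\<sigma> \<circ> ?f permutes {1..5}" by (rule permutes_compose[OF flip_permutes T(1)])
    have "conj_action 5 (\<sigma> \<circ> ?f) ?L = conj_action 5 ((\<sigma> \<circ> ?f) \<circ> ?f) (section_of 5 T)"
      by (rule conj_action_comp[OF p flip_permutes c])
    also have "(\<sigma> \<circ> ?f) \<circ> ?f = \<sigma>" by (simp add: fun_eq_iff)
    finally show ?thesis unfolding orbit_eq T(3) using p by blast
  qed
  ultimately show "\<exists>\<Lambda>. canonical 5 \<Lambda> \<and> alpha_sup 5 \<Lambda> 1 2 1 = id \<and> \<Theta> \<in> conj_orbit 5 \<Lambda>" using can by blast
qed

lemma cross_sections_six:
  "card (R_cross_sections 6) = 2 * fact 6 \<and> (\<forall>\<Theta>\<in>R_cross_sections 6. \<exists>\<Lambda>. canonical 6 \<Lambda> \<and>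
    alpha_sup 6 \<Lambda> 1 2 1 = id \<and> alpha_sup 6 \<Lambda> 1 2 2 = id \<and> \<Theta> \<in> conj_orbit 6 \<Lambda>)"
proof (intro conjI ballI)
  show "card (R_cross_sections 6) = 2 * fact 6" using card_cross_sections[of 6] card_valid[of 6] by simp
  fix \<Theta> assume "\<Theta> \<in> R_cross_sections 6"
  then obtain \<sigma> T where T: "\<sigma> permutes {1..6}" "valid 6 T" "\<Theta> = conj_action 6 \<sigma> (section_of 6 T)"
    by (rule ex_conj_section)
  \<comment> \<open>In degree 6 this is the deepest standard pair, so its parameters are trivial in
    every normalised cross-section.\<close>
  have "{1, 2} \<notin> mixed 6" unfolding pair_mixed by (simp add: lev_six)
  then have "{1, 2} \<notin> T" using valid_subset[OF T(2)] by blast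
  then have "alpha_sup 6 (section_of 6 T) 1 2 1 = id" "alpha_sup 6 (section_of 6 T) 1 2 2 = id"
    using section_alpha_sup[OF T(2), of 1 2 1] section_alpha_sup[OF T(2), of 1 2 2] by simp_all
  moreover have "\<Theta> \<in> conj_orbit 6 (section_of 6 T)" unfolding orbit_eq using T(1,3) by blast
  ultimately show "\<exists>\<Lambda>. canonical 6 \<Lambda> \<and> alpha_sup 6 \<Lambda> 1 2 1 = id \<and> alpha_sup 6 \<Lambda> 1 2 2 = id \<and> \<Theta> \<in> conj_orbit 6 \<Lambda>"
    using canonical_section_of[OF T(2)] by blast
qed

text \<open>Disjointness of the orbits comes from counting: each has half of \<open>fact n\<close>
  elements, and together they exhaust a set of \<open>fact n\<close> elements.\<close>

lemma cross_sections_large: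
  assumes n: "7 \<le> n"
  shows "card (R_cross_sections n) = fact n \<and>
    (\<exists>\<Lambda>\<^sub>r \<Lambda>\<^sub>a. {\<Theta>. regular_canonical n \<Theta>} = {\<Lambda>\<^sub>r} \<and> {\<Theta>. alternating_canonical n \<Theta>} = {\<Lambda>\<^sub>a} \<and>
       2 * card (conj_orbit n \<Lambda>\<^sub>r) = fact n \<and> 2 * card (conj_orbit n \<Lambda>\<^sub>a) = fact n \<and>
       conj_orbit n \<Lambda>\<^sub>r \<inter> conj_orbit n \<Lambda>\<^sub>a = {} \<and> conj_orbit n \<Lambda>\<^sub>r \<union> conj_orbit n \<Lambda>\<^sub>a = R_cross_sections n)"
proof -
  let ?R = "section_of n {}" and ?A = "section_of n (mixed n)"
  note R = section_in[OF valid_empty[of n]] and A = section_in[OF valid_mixed[of n]]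
  have n2: "2 \<le> n" "n \<noteq> 5" using n by auto
  have card: "card (R_cross_sections n) = fact n"
    using card_cross_sections[OF n2(1)] card_valid[of n] n by simp
  have oR: "2 * card (conj_orbit n ?R) = fact n"
    by (rule card_conj_orbit[OF n2 canonical_section_of[OF valid_empty]])
  have oA: "2 * card (conj_orbit n ?A) = fact n"
    by (rule card_conj_orbit[OF n2 canonical_section_of[OF valid_mixed]])
  have union: "conj_orbit n ?R \<union> conj_orbit n ?A = R_cross_sections n"
  proof
    show "conj_orbit n ?R \<union> conj_orbit n ?A \<subseteq> R_cross_sections n"
      unfolding orbit_eq using conj_action_closed R A by auto
    show "R_cross_sections n \<subseteq> conj_orbit n ?R \<union> conj_orbit n ?A"
    proof
      fix \<Theta> assume "\<Theta> \<in> R_cross_sections n"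
      then obtain \<sigma> T where T: "\<sigma> permutes {1..n}" "valid n T" "\<Theta> = conj_action n \<sigma> (section_of n T)"
        by (rule ex_conj_section)
      then have "T = {} \<or> T = mixed n" using valid_large[OF n] by blast
      then show "\<Theta> \<in> conj_orbit n ?R \<union> conj_orbit n ?A" unfolding orbit_eq using T(1,3) by blast
    qed
  qed
  have "finite (conj_orbit n ?R)" "finite (conj_orbit n ?A)"
    using finite_subset[OF _ finite_cross_sections[of n]] union by blast+
  then have "card (conj_orbit n ?R) + card (conj_orbit n ?A) =
      card (R_cross_sections n) + card (conj_orbit n ?R \<inter> conj_orbit n ?A)"
    using card_Un_Int[of "conj_orbit n ?R" "conj_orbit n ?A"] union by simp
  then have "card (conj_orbit n ?R \<inter> conj_orbit n ?A) = 0" using oR oA card by linarith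
  then have "conj_orbit n ?R \<inter> conj_orbit n ?A = {}" using \<open>finite (conj_orbit n ?R)\<close> by simp
  then show ?thesis using card oR oA union regular_unique[of n] alternating_unique[of n] by blast
qed

theorem theorem19:
  fixes n :: nat
  assumes "n \<ge> 1"
  shows
    "group_action (sym_group n) (R_cross_sections n) (conj_action n)
     \<and> (\<forall>\<Lambda>. canonical n \<Lambda> \<longrightarrow>
          stabilizer (sym_group n) (conj_action n) \<Lambda> =
            (if n = 1 \<or> (n = 5 \<and> alpha_sup n \<Lambda> 1 2 1 \<noteq> alpha_sup n \<Lambda> 1 3 1)
             then {id} else {id, special_perm n}))
     \<and> (n = 1 \<longrightarrow> R_cross_sections n = {{perm_brauer n id}})
     \<and> (n = 2 \<longrightarrow> (\<exists>\<Lambda>. R_cross_sections n = {\<Lambda>} \<and> canonical n \<Lambda> \<and>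
          \<Lambda> = {alpha n \<Lambda> 1 2, perm_brauer n id}))
     \<and> (n = 3 \<longrightarrow> (\<exists>\<Lambda>. {\<Theta>. canonical n \<Theta>} = {\<Lambda>} \<and>
          \<Lambda> = {alpha n \<Lambda> 1 2, alpha n \<Lambda> 2 3, alpha n \<Lambda> 1 3, perm_brauer n id} \<and>
          (\<forall>\<alpha>\<in>\<Lambda>. \<alpha> \<odot> \<alpha> = \<alpha>) \<and>
          card (R_cross_sections n) = 3 \<and>
          R_cross_sections n =
            {\<Lambda>,
             (\<lambda>\<alpha>. perm_brauer n (Transposition.transpose 1 2) \<odot> \<alpha>
                    \<odot> perm_brauer n (Transposition.transpose 1 2)) ` \<Lambda>,
             (\<lambda>\<alpha>. perm_brauer n (Transposition.transpose 1 3) \<odot> \<alpha>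
                    \<odot> perm_brauer n (Transposition.transpose 1 3)) ` \<Lambda>}))
     \<and> (n = 4 \<longrightarrow> card (R_cross_sections n) = 12 \<and>
          (\<exists>\<Lambda>. {\<Theta>. regular_canonical n \<Theta>} = {\<Lambda>} \<and>
            (\<forall>\<Theta>\<in>R_cross_sections n. \<Theta> \<in> conj_orbit n \<Lambda>)))
     \<and> (n = 5 \<longrightarrow> card (R_cross_sections n) = 2 * fact 5 \<and>
          (\<forall>\<Theta>\<in>R_cross_sections n. \<exists>\<Lambda>. canonical n \<Lambda> \<and> alpha_sup n \<Lambda> 1 2 1 = id \<and>
            \<Theta> \<in> conj_orbit n \<Lambda>))
     \<and> (n = 6 \<longrightarrow> card (R_cross_sections n) = 2 * fact 6 \<and>
          (\<forall>\<Theta>\<in>R_cross_sections n. \<exists>\<Lambda>. canonical n \<Lambda> \<and> alpha_sup n \<Lambda> 1 2 1 = id \<and>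
            alpha_sup n \<Lambda> 1 2 2 = id \<and> \<Theta> \<in> conj_orbit n \<Lambda>))
     \<and> (n \<ge> 7 \<longrightarrow> card (R_cross_sections n) = fact n \<and>
          (\<exists>\<Lambda>\<^sub>r \<Lambda>\<^sub>a. {\<Theta>. regular_canonical n \<Theta>} = {\<Lambda>\<^sub>r} \<and>
             {\<Theta>. alternating_canonical n \<Theta>} = {\<Lambda>\<^sub>a} \<and>
             2 * card (conj_orbit n \<Lambda>\<^sub>r) = fact n \<and>
             2 * card (conj_orbit n \<Lambda>\<^sub>a) = fact n \<and>
             conj_orbit n \<Lambda>\<^sub>r \<inter> conj_orbit n \<Lambda>\<^sub>a = {} \<and>
             conj_orbit n \<Lambda>\<^sub>r \<union> conj_orbit n \<Lambda>\<^sub>a = R_cross_sections n))"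
proof (intro conjI)
  show "\<forall>\<Lambda>. canonical n \<Lambda> \<longrightarrow>
      stabilizer (sym_group n) (conj_action n) \<Lambda> =
        (if n = 1 \<or> (n = 5 \<and> alpha_sup n \<Lambda> 1 2 1 \<noteq> alpha_sup n \<Lambda> 1 3 1)
         then {id} else {id, special_perm n})"
    by (intro allI impI stabilizer_eq[OF assms])
qed (rule conj_group_action |
  (rule impI, erule ssubst,
    rule cross_sections_one cross_sections_two cross_sections_three cross_sections_four
      cross_sections_five cross_sections_six) |
  (rule impI, erule cross_sections_large))+

end
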